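(* Let $Z\subseteq\mathbb{P}^2_{\mathbb{C}}$ be a nonempty finite set of points. If $D_0(\mathcal{A}_Z)$ has splitting type $(a_1,a_2)$ with $a_2-a_1\geq2$ (in particular, if $Z$ admits unexpected curves in some degree), then $D_0(\mathcal{A}_Z)$ has a generator in degree $a_1$; equivalently, $I^{\gg}(Z)$ has a generator in degree $a_1+1$.
   Context: Let $R=\mathbb{C}[X_0,X_1,X_2]$ and let $S=\mathbb{C}[Y_0,Y_1,Y_2]$ be the coordinate ring of the dual plane. $\mathcal{A}_Z$ is the line arrangement in the dual plane consisting of the lines $\{c_0Y_0+c_1Y_1+c_2Y_2=0\}$ for $(c_0:c_1:c_2)\in Z$. For a line arrangement $\mathcal{A}$, $D(\mathcal{A})$ is the $S$-module of $\mathbb{C}$-linear derivations $\theta:S\to S$ with $\theta(I(H))\subseteq I(H)$ for all $H\in\mathcal{A}$, graded so that $\deg\theta=\deg\theta(\ell)$ for linear forms $\ell$. $\theta_e=\sum_iY_i\,\partial/\partial Y_i$ and $D_0(\mathcal{A})=D(\mathcal{A})/S\theta_e$. For nonempty $\mathcal{A}$, the splitting type of $D_0(\mathcal{A})$ is the unique pair of integers $0\le a_1\leq a_2$ such that, for a general line $L$ in the dual plane, the restriction of the sheaf $\widetilde{D_0(\mathcal{A})}$ to $L$ is isomorphic to $\mathcal{O}_L(-a_1)\oplus\mathcal{O}_L(-a_2)$. $Z$ admits unexpected curves in degree $d$ if, for a general point $Q\in\mathbb{P}^2$, $\dim[I(Z)\cap I(Q)^{d-1}]_d>\max\{0,\dim[I(Z)]_d-\dim[R/I(Q)^{d-1}]_d\}$.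 The module $I^{\gg}(Z)$: let $M_0,M_1,M_2\in\mathbb{C}[X_0,X_1,X_2,A_0,A_1,A_2]$ be the signed maximal minors of $\begin{bmatrix} X_0 & X_1 & X_2 \\ A_0 & A_1 & A_2 \end{bmatrix}$: $M_i$ is the determinant of the $3\times3$ matrix whose first row is the $i$-th standard basis vector (indexed from $0$) and whose other rows are $(X_0,X_1,X_2)$ and $(A_0,A_1,A_2)$. Let $\mathfrak{m}^{\gg}$ be the $\mathbb{C}[M_0,M_1,M_2]$-submodule of $\mathbb{C}[X_0,X_1,X_2,A_0,A_1,A_2]$ generated by $X_0,X_1,X_2$, graded with $\deg M_i=\deg X_i=1$. Then $I^{\gg}(Z)=\big(I(Z)\cdot\mathbb{C}[X_0,X_1,X_2,A_0,A_1,A_2]\big)\cap\mathfrak{m}^{\gg}$, a graded $\mathbb{C}[M_0,M_1,M_2]$-module. *)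

theory Defs
  imports
    "HOL-Analysis.Analysis"
    "HOL-Library.Poly_Mapping"
    "HOL-Library.Function_Algebras"
    "HOL-Library.Numeral_Type"
begin

section \<open>Polynomials in three variables\<close>

text \<open>
  The variables are indexed by \<^typ>\<open>3\<close>, whose elements are \<open>0\<close>, \<open>1\<close>, \<open>2\<close>. Both \<open>R = \<complex>[X\<^sub>0, X\<^sub>1, X\<^sub>2]\<close> and
  \<open>S = \<complex>[Y\<^sub>0, Y\<^sub>1, Y\<^sub>2]\<close> are \<open>complex poly3\<close>. The ring \<open>\<complex>[X\<^sub>0, X\<^sub>1, X\<^sub>2, A\<^sub>0, A\<^sub>1, A\<^sub>2]\<close> is
  \<open>complex poly3 poly3\<close>: polynomials in the \<open>X\<^sub>i\<close> with coefficients in \<open>\<complex>[A\<^sub>0, A\<^sub>1, A\<^sub>2]\<close>.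
\<close>

type_synonym 'a poly3 = "(3 \<Rightarrow>\<^sub>0 nat) \<Rightarrow>\<^sub>0 'a"

definition const :: "'a::zero \<Rightarrow> 'a poly3" where
  "const c = Poly_Mapping.single 0 c"

definition var :: "3 \<Rightarrow> 'a::zero_neq_one poly3" where
  "var i = Poly_Mapping.single (Poly_Mapping.single i 1) 1"

text \<open>\<open>subst3 h x f\<close> replaces the \<open>i\<close>-th variable of \<open>f\<close> by \<open>x i\<close> and each coefficient \<open>c\<close> by \<open>h c\<close>.\<close>

definition subst3 :: "('a::zero \<Rightarrow> 'b::comm_ring_1) \<Rightarrow> (3 \<Rightarrow> 'b) \<Rightarrow> 'a poly3 \<Rightarrow> 'b" where
  "subst3 h x f = (\<Sum>m\<in>Poly_Mapping.keys f. h (Poly_Mapping.lookup f m) * (\<Prod>i\<in>UNIV. x i ^ Poly_Mapping.lookup m i))"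

definition eval3 :: "complex poly3 \<Rightarrow> complex ^ 3 \<Rightarrow> complex" where
  "eval3 f c = subst3 id (($) c) f"

text \<open>The homogeneous polynomials of degree \<open>d\<close>, including \<open>0\<close>; only \<open>0\<close> if \<open>d < 0\<close>.\<close>

definition forms :: "int \<Rightarrow> complex poly3 set" where
  "forms d = {f. \<forall>m\<in>Poly_Mapping.keys f. int (\<Sum>i\<in>UNIV. Poly_Mapping.lookup m i) = d}"

definition partial :: "3 \<Rightarrow> complex poly3 \<Rightarrow> complex poly3" where
  "partial i f = (\<Sum>m\<in>Poly_Mapping.keys f.
     Poly_Mapping.single (m - Poly_Mapping.single i 1) (of_nat (Poly_Mapping.lookup m i) * Poly_Mapping.lookup f m))"

abbreviation ideal_gen :: "'a::comm_ring_1 set \<Rightarrow> 'a set" where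
  "ideal_gen \<equiv> module.span (*)"

primrec ideal_power :: "'a::comm_ring_1 set \<Rightarrow> nat \<Rightarrow> 'a set" where
  "ideal_power J 0 = UNIV"
| "ideal_power J (Suc n) = ideal_gen {f * g | f g. f \<in> J \<and> g \<in> ideal_power J n}"


section \<open>The projective plane\<close>

text \<open>\<open>proj2\<close> serves both as the plane \<open>\<P>\<^sup>2\<close> containing \<open>Z\<close> and as the dual plane.\<close>

definition proportional :: "complex ^ 3 \<Rightarrow> complex ^ 3 \<Rightarrow> bool" where
  "proportional u v \<longleftrightarrow> u \<noteq> 0 \<and> v \<noteq> 0 \<and> (\<exists>k. k \<noteq> 0 \<and> v = k *s u)"

quotient_type proj2 = "complex ^ 3" / partial: proportional
proof (rule part_equivpI)
  show "\<exists>x. proportional x x"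
    by (intro exI[of _ "axis 1 1"]) (auto simp: proportional_def intro!: exI[of _ 1])
  show "symp proportional"
  proof (rule sympI)
    fix x y assume "proportional x y"
    then obtain k where "x \<noteq> 0" "y \<noteq> 0" "k \<noteq> 0" "y = k *s x"
      by (auto simp: proportional_def)
    then show "proportional y x"
      by (auto simp: proportional_def intro!: exI[of _ "inverse k"])
  qed
  show "transp proportional"
  proof (rule transpI)
    fix x y z assume "proportional x y" "proportional y z"
    then obtain k l where "x \<noteq> 0" "z \<noteq> 0" "k \<noteq> 0" "l \<noteq> 0" "z = (l * k) *s x"
      by (auto simp: proportional_def)
    then show "proportional x z"
      by (auto simp: proportional_def intro!: exI[of _ "l * k"])
  qed
qed

definition coords :: "proj2 \<Rightarrow> (complex ^ 3) set" where
  "coords p = {c. c \<noteq> 0 \<and> abs_proj2 c = p}"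

definition vanishing_ideal :: "proj2 set \<Rightarrow> complex poly3 set" where
  "vanishing_ideal V = {f. \<forall>p\<in>V. \<forall>c\<in>coords p. eval3 f c = 0}"

definition nonvanishing :: "complex poly3 \<Rightarrow> proj2 set" where
  "nonvanishing f = {p. \<forall>c\<in>coords p. eval3 f c \<noteq> 0}"

definition zariski :: "proj2 topology" where
  "zariski = topology_generated_by {nonvanishing f | f d. f \<in> forms d}"

text \<open>Lines of the dual plane are parametrised by \<open>\<P>\<^sup>2\<close>, so this also expresses ``for a general line''.\<close>

definition for_general :: "(proj2 \<Rightarrow> bool) \<Rightarrow> bool" where
  "for_general P \<longleftrightarrow> (\<exists>U. openin zariski U \<and> U \<noteq> {} \<and> (\<forall>p\<in>U. P p))"

text \<open>The line \<open>{c\<^sub>0 Y\<^sub>0 + c\<^sub>1 Y\<^sub>1 + c\<^sub>2 Y\<^sub>2 = 0}\<close> of the dual plane, where \<open>p = (c\<^sub>0 : c\<^sub>1 : c\<^sub>2)\<close>.\<close>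

definition dual_line :: "proj2 \<Rightarrow> proj2 set" where
  "dual_line p = {q. \<forall>c\<in>coords p. \<forall>y\<in>coords q. (\<Sum>i\<in>UNIV. c $ i * y $ i) = 0}"

definition arrangement :: "proj2 set \<Rightarrow> proj2 set set" where
  "arrangement Z = dual_line ` Z"


section \<open>Graded modules\<close>

text \<open>
  A graded module is given as a quotient \<open>M / N\<close>, where \<open>N \<subseteq> M\<close> are graded submodules of an ambient
  module: \<open>piece d\<close> is the set of homogeneous elements of degree \<open>d\<close> of \<open>M\<close>
  (\<open>M\<close> being generated by its homogeneous elements), and \<open>rels\<close> is \<open>N\<close>.
\<close>

record 'b gmodule =
  scale :: "complex poly3 \<Rightarrow> 'b \<Rightarrow> 'b"
  piece :: "int \<Rightarrow> 'b set"
  rels :: "'b set"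

text \<open>
  \<open>M / N\<close> has a (minimal) generator in degree \<open>d\<close>: some homogeneous element of degree \<open>d\<close> is not in
  the submodule generated by the homogeneous elements of smaller degree.
\<close>

definition has_generator_in_degree :: "'b::ab_group_add gmodule \<Rightarrow> int \<Rightarrow> bool" where
  "has_generator_in_degree M d \<longleftrightarrow>
     \<not> piece M d \<subseteq> module.span (scale M) (rels M \<union> (\<Union>e\<in>{..<d}. piece M e))"

definition polynomial_module :: "complex poly3 gmodule" where
  "polynomial_module = \<lparr>scale = (*), piece = forms, rels = {0}\<rparr>"

definition twist :: "int \<Rightarrow> 'b gmodule \<Rightarrow> 'b gmodule" where
  "twist k M = M\<lparr>piece := \<lambda>d. piece M (k + d)\<rparr>"

definition direct_sum :: "'b gmodule \<Rightarrow> 'c gmodule \<Rightarrow> ('b \<times> 'c) gmodule" where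
  "direct_sum M M' = \<lparr>scale = \<lambda>g (x, y). (scale M g x, scale M' g y),
     piece = \<lambda>d. piece M d \<times> piece M' d, rels = rels M \<times> rels M'\<rparr>"

text \<open>For \<open>M\<close> representing \<open>M\<^sub>0\<close>, this is \<open>M\<^sub>0 / I(L) M\<^sub>0\<close>.\<close>

definition restrict_to :: "proj2 set \<Rightarrow> 'b::ab_group_add gmodule \<Rightarrow> 'b gmodule" where
  "restrict_to L M = M\<lparr>rels := module.span (scale M)
     (rels M \<union> {scale M g x | g x d. g \<in> vanishing_ideal L \<and> x \<in> piece M d})\<rparr>"


section \<open>Associated sheaves\<close>

text \<open>
  The sheaf associated with \<open>M\<close>, on the variety of closed points. The element \<open>x / f\<close>
  of the homogeneous localisation of \<open>M\<close> at \<open>p\<close> (with \<open>x\<close>, \<open>f\<close> homogeneous of equal degree and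
  \<open>f(p) \<noteq> 0\<close>) is the set \<open>fraction M p x f\<close> of all pairs \<open>(y, g)\<close> with \<open>y / g = x / f\<close>.
\<close>

definition fraction ::
    "'b::ab_group_add gmodule \<Rightarrow> proj2 \<Rightarrow> 'b \<Rightarrow> complex poly3 \<Rightarrow> ('b \<times> complex poly3) set" where
  "fraction M p x f = {(y, g).
     (\<exists>d. y \<in> piece M d \<and> g \<in> forms d) \<and> p \<in> nonvanishing g \<and>
     (\<exists>h e. h \<in> forms e \<and> p \<in> nonvanishing h \<and>
        scale M h (scale M g x - scale M f y) \<in> rels M)}"

definition fraction_add ::
    "'b::ab_group_add gmodule \<Rightarrow> proj2 \<Rightarrow> ('b \<times> complex poly3) set \<Rightarrow> ('b \<times> complex poly3) set
      \<Rightarrow> ('b \<times> complex poly3) set" where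
  "fraction_add M p X Y =
     (\<Union>(x, f)\<in>X. \<Union>(y, g)\<in>Y. fraction M p (scale M g x + scale M f y) (f * g))"

definition fraction_scale ::
    "'b::ab_group_add gmodule \<Rightarrow> proj2 \<Rightarrow> (complex poly3 \<times> complex poly3) set
      \<Rightarrow> ('b \<times> complex poly3) set \<Rightarrow> ('b \<times> complex poly3) set" where
  "fraction_scale M p A X = (\<Union>(a, f)\<in>A. \<Union>(x, g)\<in>X. fraction M p (scale M a x) (f * g))"

type_synonym 'b sect = "proj2 \<Rightarrow> ('b \<times> complex poly3) set"

definition restr :: "proj2 set \<Rightarrow> 'b sect \<Rightarrow> 'b sect" where
  "restr V s = (\<lambda>p. if p \<in> V then s p else {})"

text \<open>
  For a closed subset \<open>L\<close> of the plane and a module \<open>M\<close> annihilated by \<open>I(L)\<close> (as \<open>restrict_to L\<close>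
  produces), these are the sections over an open subset \<open>U\<close> of \<open>L = Proj (S / I(L))\<close> of the sheaf
  associated with the \<open>S / I(L)\<close>-module \<open>M\<close>: the functions that are locally a fraction.
\<close>

definition sections :: "proj2 set \<Rightarrow> 'b::ab_group_add gmodule \<Rightarrow> proj2 set \<Rightarrow> 'b sect set" where
  "sections L M U = {s. (\<forall>p. p \<notin> U \<longrightarrow> s p = {}) \<and>
     (\<forall>p\<in>U. \<exists>V x f d. openin (subtopology zariski L) V \<and> p \<in> V \<and> V \<subseteq> U \<and>
        x \<in> piece M d \<and> f \<in> forms d \<and>
        (\<forall>q\<in>V. q \<in> nonvanishing f \<and> s q = fraction M q x f))}"

text \<open>
  Isomorphism of the sheaves of \<open>\<O>\<^sub>L\<close>-modules associated with \<open>M\<close> and \<open>M'\<close>: bijections between the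
  sections over each open set, linear over \<open>\<O>\<^sub>L\<close> and compatible with restriction.
\<close>

definition sheaves_isomorphic ::
    "proj2 set \<Rightarrow> 'b::ab_group_add gmodule \<Rightarrow> 'c::ab_group_add gmodule \<Rightarrow> bool" where
  "sheaves_isomorphic L M M' \<longleftrightarrow>
     (\<exists>\<phi> :: proj2 set \<Rightarrow> 'b sect \<Rightarrow> 'c sect.
        (\<forall>U. openin (subtopology zariski L) U \<longrightarrow>
           bij_betw (\<phi> U) (sections L M U) (sections L M' U) \<and>
           (\<forall>s\<in>sections L M U. \<forall>t\<in>sections L M U.
              \<phi> U (\<lambda>p. fraction_add M p (s p) (t p)) = (\<lambda>p. fraction_add M' p (\<phi> U s p) (\<phi> U t p))) \<and>
           (\<forall>r\<in>sections L (restrict_to L polynomial_module) U. \<forall>s\<in>sections L M U.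
              \<phi> U (\<lambda>p. fraction_scale M p (r p) (s p)) = (\<lambda>p. fraction_scale M' p (r p) (\<phi> U s p)))) \<and>
        (\<forall>U V. openin (subtopology zariski L) U \<and> openin (subtopology zariski L) V \<and> V \<subseteq> U \<longrightarrow>
           (\<forall>s\<in>sections L M U. \<phi> V (restr V s) = restr V (\<phi> U s))))"

text \<open>
  The restriction to \<open>L\<close> of the sheaf associated with \<open>M\<close> is the sheaf associated with \<open>M / I(L) M\<close>,
  and \<open>\<O>\<^sub>L(k)\<close> is associated with \<open>(S / I(L))(k)\<close>.
\<close>

definition splitting_type :: "'b::ab_group_add gmodule \<Rightarrow> int \<Rightarrow> int \<Rightarrow> bool" where
  "splitting_type M a\<^sub>1 a\<^sub>2 \<longleftrightarrow> 0 \<le> a\<^sub>1 \<and> a\<^sub>1 \<le> a\<^sub>2 \<and>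
     for_general (\<lambda>p. let L = dual_line p in
       sheaves_isomorphic L (restrict_to L M)
         (restrict_to L (direct_sum (twist (- a\<^sub>1) polynomial_module) (twist (- a\<^sub>2) polynomial_module))))"


section \<open>Derivations\<close>

definition derivations :: "(complex poly3 \<Rightarrow> complex poly3) set" where
  "derivations = {\<theta>. (\<forall>f g. \<theta> (f + g) = \<theta> f + \<theta> g) \<and> (\<forall>c f. \<theta> (const c * f) = const c * \<theta> f) \<and>
     (\<forall>f g. \<theta> (f * g) = f * \<theta> g + g * \<theta> f)}"

definition D_module :: "proj2 set set \<Rightarrow> (complex poly3 \<Rightarrow> complex poly3) set" where
  "D_module A = {\<theta> \<in> derivations. \<forall>H\<in>A. \<theta> ` vanishing_ideal H \<subseteq> vanishing_ideal H}"

definition euler_derivation :: "complex poly3 \<Rightarrow> complex poly3" where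
  "euler_derivation f = (\<Sum>i\<in>UNIV. var i * partial i f)"

definition D0_module :: "proj2 set set \<Rightarrow> (complex poly3 \<Rightarrow> complex poly3) gmodule" where
  "D0_module A = \<lparr>scale = \<lambda>g \<theta> f. g * \<theta> f,
     piece = \<lambda>d. {\<theta> \<in> D_module A. \<forall>l\<in>forms 1. \<theta> l \<in> forms d},
     rels = {\<lambda>f. g * euler_derivation f | g. True}\<rparr>"


section \<open>Unexpected curves\<close>

abbreviation poly_scale :: "complex \<Rightarrow> complex poly3 \<Rightarrow> complex poly3" where
  "poly_scale c f \<equiv> const c * f"

definition dim_degree :: "complex poly3 set \<Rightarrow> nat \<Rightarrow> nat" where
  "dim_degree J d = vector_space.dim poly_scale (J \<inter> forms (int d))"

text \<open>\<open>dim [R / J]\<^sub>d\<close>: the least number of forms of degree \<open>d\<close> whose classes span \<open>[R / J]\<^sub>d\<close>.\<close>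

definition dim_degree_quotient :: "complex poly3 set \<Rightarrow> nat \<Rightarrow> nat" where
  "dim_degree_quotient J d = (LEAST n. \<exists>B. B \<subseteq> forms (int d) \<and> finite B \<and> card B = n \<and>
     forms (int d) \<subseteq> module.span poly_scale (B \<union> (J \<inter> forms (int d))))"

definition admits_unexpected_curves :: "proj2 set \<Rightarrow> nat \<Rightarrow> bool" where
  "admits_unexpected_curves Z d \<longleftrightarrow> d \<ge> 1 \<and>
     for_general (\<lambda>Q. let J = ideal_power (vanishing_ideal {Q}) (d - 1) in
       int (dim_degree (vanishing_ideal Z \<inter> J) d)
         > max 0 (int (dim_degree (vanishing_ideal Z) d) - int (dim_degree_quotient J d)))"


section \<open>The module \<open>I\<^sup>\<ggreater>(Z)\<close>\<close>

definition X_var :: "3 \<Rightarrow> complex poly3 poly3" where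
  "X_var i = var i"

definition A_var :: "3 \<Rightarrow> complex poly3 poly3" where
  "A_var i = const (var i)"

definition M_minor :: "3 \<Rightarrow> complex poly3 poly3" where
  "M_minor i = det (\<chi> r. if r = 0 then axis i 1 else if r = 1 then \<chi> j. X_var j else \<chi> j. A_var j)"

definition subst_X :: "complex poly3 \<Rightarrow> complex poly3 poly3" where
  "subst_X = subst3 (\<lambda>c. const (const c)) X_var"

definition subst_M :: "complex poly3 \<Rightarrow> complex poly3 poly3" where
  "subst_M = subst3 (\<lambda>c. const (const c)) M_minor"

text \<open>
  \<open>\<complex>[M\<^sub>0, M\<^sub>1, M\<^sub>2]\<close> is the range of \<open>subst_M\<close>, and scaling by it is written as scaling by the
  polynomial that is substituted into. The form \<open>\<Sum>i. f\<^sub>i(M) X\<^sub>i\<close> has degree \<open>d\<close> when the \<open>f\<^sub>i\<close> have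
  degree \<open>d - 1\<close>, because \<open>deg M\<^sub>i = deg X\<^sub>i = 1\<close>.
\<close>

definition M_scale :: "complex poly3 \<Rightarrow> complex poly3 poly3 \<Rightarrow> complex poly3 poly3" where
  "M_scale g x = subst_M g * x"

definition m_gg :: "complex poly3 poly3 set" where
  "m_gg = module.span M_scale (range X_var)"

definition m_gg_piece :: "int \<Rightarrow> complex poly3 poly3 set" where
  "m_gg_piece d = {\<Sum>i\<in>UNIV. M_scale (f i) (X_var i) | f. \<forall>i. f i \<in> forms (d - 1)}"

definition I_gg :: "proj2 set \<Rightarrow> complex poly3 poly3 set" where
  "I_gg Z = ideal_gen (subst_X ` vanishing_ideal Z) \<inter> m_gg"

definition I_gg_module :: "proj2 set \<Rightarrow> complex poly3 poly3 gmodule" where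
  "I_gg_module Z = \<lparr>scale = M_scale, piece = \<lambda>d. I_gg Z \<inter> m_gg_piece d, rels = {0}\<rparr>"

end

theory Submission
  imports Defs
    "HOL-Computational_Algebra.Polynomial_Factorial"
    "HOL-Computational_Algebra.Field_as_Ring"
    "HOL-Computational_Algebra.Fundamental_Theorem_Algebra"
begin

text \<open>
  Parametrise a general line \<open>L\<close> of the dual plane. Evaluating derivations along \<open>L\<close> turns the restricted
  sheaf into a lattice of pairs of univariate polynomials, with one linear condition for each point of \<open>Z\<close>. The
  pairs with degree bounds \<open>k + 1\<close> and \<open>k\<close> are the sections of its \<open>k\<close>-th twist and correspond to pairs with
  degree bounds \<open>k - a\<^sub>1\<close> and \<open>k - a\<^sub>2\<close>. Counting dimensions for large \<open>k\<close> gives \<open>\<bar>Z\<bar> = a\<^sub>1 + a\<^sub>2 + 1\<close>.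
  A curve of degree \<open>d\<close> through \<open>Z\<close> that is \<open>d - 1\<close> times singular at the point dual to \<open>L\<close> is a section of the
  twist by \<open>d - 1\<close>, so that unexpected curves can occur only if \<open>a\<^sub>2 - a\<^sub>1 \<ge> 2\<close>.

  Now let \<open>a\<^sub>2 - a\<^sub>1 \<ge> 2\<close>. The nonzero sections of the twist by \<open>a\<^sub>1\<close> can be chosen to vary polynomially with
  \<open>L\<close>. Such a family assigns to each line through a point of the dual plane a direction at this point. The
  Wronskian that measures how the direction varies with the line has degree at most \<open>2 a\<^sub>1 + 2 < \<bar>Z\<bar>\<close> along \<open>L\<close>,
  but it vanishes where \<open>L\<close> meets the arrangement, since the directions there are tangent to the arrangement.
  Hence the direction depends on the point only, and the family descends to a derivation of degree \<open>a\<^sub>1\<close> (the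
  argument of Grauert and Muelich). A derivation of smaller degree vanishes on general lines modulo \<open>\<theta>\<^sub>e\<close>, so it
  is a multiple of \<open>\<theta>\<^sub>e\<close>.

  Finally, \<open>\<theta> \<mapsto> \<Sum>\<^sub>i \<theta>(Y\<^sub>i)(M) X\<^sub>i\<close> induces an isomorphism from \<open>D\<^sub>0\<close> to \<open>I\<^sup>\<ggreater>(Z)\<close> that raises degrees by one.
\<close>

section \<open>Polynomials in three variables\<close>

text \<open>The hypothesis gives only an abstract isomorphism of sheaves on each general line. What
  it certainly transports are the pairs of sections over the two standard open sets that are glued
  by the k-th power of the transition function, and all information about a1 and a2 enters through
  these spaces. The gap is exactly the room for the Wronskian: with |Z| = a1 + a2 + 1, the
  inequality 2 a1 + 2 < |Z| says a2 - a1 \<ge> 2. The isomorphisms on different lines are unrelated,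
  so they do not provide a family of sections. The family comes from linear algebra over the domain
  of polynomials in slope and intercept: without a nonzero solution, an elimination certificate
  would exclude sections on some general line. What descends to the plane is only a direction field,
  that is, a vector field up to a rational factor. Common factors must be removed, and lines that
  thereby lose invariance must be restored, before degrees on general lines bound the degree in the
  plane.\<close>

lemma UNIV_3_from_0: "(UNIV :: 3 set) = {0, 1, 2}"
proof -
  have "(3 :: 3) = 0" by simp
  then show ?thesis using UNIV_3 by (metis insert_commute)
qed

lemma sum_UNIV_3: "sum f (UNIV :: 3 set) = f 0 + f 1 + (f 2 :: 'a::comm_monoid_add)"
  unfolding UNIV_3_from_0 by (simp add: add.assoc)

lemma prod_UNIV_3: "prod f (UNIV :: 3 set) = f 0 * f 1 * (f 2 :: 'a::comm_monoid_mult)"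
  unfolding UNIV_3_from_0 by (simp add: mult.assoc)

lemma all_3: "(\<forall>i::3. P i) \<longleftrightarrow> P 0 \<and> P 1 \<and> P 2"
proof -
  have "(\<forall>i::3. P i) \<longleftrightarrow> (\<forall>i\<in>UNIV. P i)" by simp
  then show ?thesis unfolding UNIV_3_from_0 by simp
qed

lemma cases_3: obtains "(i::3) = 0" | "i = 1" | "i = 2"
  using all_3[of "\<lambda>i. i = 0 \<or> i = 1 \<or> i = 2"] by auto

locale ring_homomorphism =
  fixes h :: "'a::comm_ring_1 \<Rightarrow> 'b::comm_ring_1"
  assumes add: "h (x + y) = h x + h y"
    and mult: "h (x * y) = h x * h y"
    and one: "h 1 = 1"
begin

lemma zero: "h 0 = 0"
  using add[of 0 0] by simp

lemma uminus: "h (- x) = - h x"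
  using add[of x "- x"] zero by (simp add: eq_neg_iff_add_eq_0 add.commute)

lemma diff: "h (x - y) = h x - h y"
  using add[of x "- y"] uminus by simp

lemma sum: "h (sum f A) = (\<Sum>a\<in>A. h (f a))"
  by (induction A rule: infinite_finite_induct) (simp_all add: zero add)

lemma prod: "h (prod f A) = (\<Prod>a\<in>A. h (f a))"
  by (induction A rule: infinite_finite_induct) (simp_all add: one mult)

lemma power: "h (x ^ n) = h x ^ n"
  by (induction n) (simp_all add: one mult)

lemmas hom = add mult one zero uminus diff sum prod power

end

lemma ring_homomorphism_id: "ring_homomorphism id"
  by unfold_locales auto

lemma ring_homomorphism_comp:
  assumes "ring_homomorphism g" "ring_homomorphism h"
  shows "ring_homomorphism (\<lambda>x. g (h x))"
  by (intro ring_homomorphism.intro)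
    (simp_all add: assms[THEN ring_homomorphism.add] assms[THEN ring_homomorphism.mult] assms[THEN ring_homomorphism.one])

lemma poly_mapping_sum_single: "f = (\<Sum>m\<in>Poly_Mapping.keys f. Poly_Mapping.single m (Poly_Mapping.lookup f m))"
  by (rule poly_mapping_eqI) (auto simp: lookup_sum lookup_single when_def in_keys_iff)

lemma poly_mapping_single_induct [case_names zero add single]:
  fixes f :: "'a \<Rightarrow>\<^sub>0 'b::comm_monoid_add"
  assumes "P 0" "\<And>f g. P f \<Longrightarrow> P g \<Longrightarrow> P (f + g)" "\<And>m c. P (Poly_Mapping.single m c)"
  shows "P f"
proof -
  have "P (\<Sum>m\<in>A. Poly_Mapping.single m (Poly_Mapping.lookup f m))" if "finite A" for A
    using that by (induction A rule: finite_induct) (auto intro: assms)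
  from this[of "Poly_Mapping.keys f"] poly_mapping_sum_single[of f] show ?thesis by simp
qed

lemma const_add: "const (a + b) = const a + (const b :: 'a::comm_ring_1 poly3)"
  by (simp add: const_def single_add)

lemma const_mult: "const (a * b) = const a * (const b :: 'a::comm_ring_1 poly3)"
  by (simp add: const_def mult_single)

lemma const_1: "const 1 = (1 :: 'a::comm_ring_1 poly3)"
  by (simp add: const_def)

interpretation const: ring_homomorphism "const :: 'a::comm_ring_1 \<Rightarrow> 'a poly3"
  by unfold_locales (simp_all add: const_add const_mult const_1)

lemma single_conv_vars:
  "Poly_Mapping.single m c = const (c::'a::comm_ring_1) * (\<Prod>i\<in>UNIV. var i ^ Poly_Mapping.lookup m i)"
proof -
  have *: "(var i :: 'a poly3) ^ n = Poly_Mapping.single (Poly_Mapping.single i n) 1" for i n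
    by (induction n) (simp_all add: var_def mult_single single_add[symmetric])
  have "Poly_Mapping.single 0 (Poly_Mapping.lookup m 0) + Poly_Mapping.single 1 (Poly_Mapping.lookup m 1)
      + Poly_Mapping.single 2 (Poly_Mapping.lookup m 2) = m"
    by (rule poly_mapping_eqI, rule_tac i=k in cases_3) (auto simp: lookup_add lookup_single)
  then show ?thesis
    by (simp add: prod_UNIV_3 * mult_single const_def)
qed

lemma poly3_induct [case_names const var add mult]:
  fixes f :: "'a::comm_ring_1 poly3"
  assumes c: "\<And>c. P (const c)" and v: "\<And>i. P (var i)"
    and a: "\<And>f g. P f \<Longrightarrow> P g \<Longrightarrow> P (f + g)" and m: "\<And>f g. P f \<Longrightarrow> P g \<Longrightarrow> P (f * g)"
  shows "P f"
proof (induction f rule: poly_mapping_single_induct)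
  case zero
  then show ?case using c[of 0] by (simp add: const.zero)
next
  case (single k d)
  have "P (var i ^ n)" for i n
    by (induction n) (use c[of 1] v m in \<open>auto simp: const.one\<close>)
  then show ?case by (simp add: single_conv_vars prod_UNIV_3 m c)
qed (rule a)

lemma subst3_superset:
  assumes "h 0 = 0" "finite A" "Poly_Mapping.keys f \<subseteq> A"
  shows "subst3 h x f = (\<Sum>m\<in>A. h (Poly_Mapping.lookup f m) * (\<Prod>i\<in>UNIV. x i ^ Poly_Mapping.lookup m i))"
  unfolding subst3_def using assms by (intro sum.mono_neutral_left) (auto simp: in_keys_iff)

lemma subst3_single: "h 0 = 0 \<Longrightarrow>
  subst3 h x (Poly_Mapping.single m c) = h c * (\<Prod>i\<in>UNIV. x i ^ Poly_Mapping.lookup m i)"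
  by (subst subst3_superset[where A="{m}"]) auto

lemma ring_homomorphism_subst3:
  fixes h :: "'a::comm_ring_1 \<Rightarrow> 'b::comm_ring_1"
  assumes "ring_homomorphism h"
  shows "ring_homomorphism (subst3 h x)"
proof -
  interpret h: ring_homomorphism h by fact
  have add: "subst3 h x (f + g) = subst3 h x f + subst3 h x g" for f g
  proof -
    let ?A = "Poly_Mapping.keys f \<union> Poly_Mapping.keys g"
    have "Poly_Mapping.keys (f + g) \<subseteq> ?A" by (rule keys_add)
    then show ?thesis
      by (simp add: subst3_superset[where h = h and A = ?A, OF h.zero] lookup_add h.add distrib_right sum.distrib)
  qed
  have z: "subst3 h x 0 = 0" by (simp add: subst3_def)
  have "subst3 h x (f * g) = subst3 h x f * subst3 h x g" for f g
  proof (induction f rule: poly_mapping_single_induct)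
    case (single m c)
    show ?case
    proof (induction g rule: poly_mapping_single_induct)
      case (single n d)
      then show ?case
        by (simp add: mult_single subst3_single h.zero h.mult lookup_add power_add prod.distrib ac_simps)
    qed (simp_all add: z add distrib_left)
  qed (simp_all add: z add distrib_right)
  moreover have "subst3 h x 1 = 1"
    using subst3_single[of h x 0 1, OF h.zero] by (simp add: h.one)
  ultimately show ?thesis by (intro ring_homomorphism.intro add)
qed

lemma subst3_const: "ring_homomorphism h \<Longrightarrow> subst3 h x (const c) = h c"
  unfolding const_def by (simp add: subst3_single ring_homomorphism.zero)

lemma subst3_var: "ring_homomorphism h \<Longrightarrow> subst3 h x (var i) = x i"
  unfolding var_def
  by (rule_tac i=i in cases_3; simp add: subst3_single ring_homomorphism.zero ring_homomorphism.one prod_UNIV_3 lookup_single)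

text \<open>Identities between evaluations and substitutions are proved with this throughout:
  comparing constants and variables is enough.\<close>

lemma ring_homomorphism_ext:
  fixes g h :: "'a::comm_ring_1 poly3 \<Rightarrow> 'b::comm_ring_1"
  assumes "ring_homomorphism g" "ring_homomorphism h"
    and "\<And>c. g (const c) = h (const c)" "\<And>i. g (var i) = h (var i)"
  shows "g f = h f"
  by (induction f rule: poly3_induct)
    (simp_all add: assms ring_homomorphism.add ring_homomorphism.mult)

lemma ring_homomorphism_const: "ring_homomorphism (const :: 'a::comm_ring_1 \<Rightarrow> 'a poly3)" ..

interpretation eval3: ring_homomorphism "\<lambda>f. eval3 f c" for c
  unfolding eval3_def by (rule ring_homomorphism_subst3[OF ring_homomorphism_id])

lemma ring_homomorphism_eval3: "ring_homomorphism (\<lambda>f. eval3 f c)" ..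

lemma eval3_const [simp]: "eval3 (const a) c = a"
  by (simp add: eval3_def subst3_const ring_homomorphism_id)

lemma eval3_var [simp]: "eval3 (var i) c = c $ i"
  by (simp add: eval3_def subst3_var ring_homomorphism_id)

text \<open>Kronecker's substitution \<open>X\<^sub>i \<mapsto> t ^ N\<^sup>i\<close> separates the finitely many monomials of \<open>f\<close> when \<open>N\<close> is large.\<close>

lemma poly3_eq_0I:
  assumes "\<And>c. eval3 f c = 0"
  shows "f = 0"
proof (rule ccontr)
  assume "f \<noteq> 0"
  define K where "K = Poly_Mapping.keys f"
  have K: "finite K" "K \<noteq> {}" using \<open>f \<noteq> 0\<close> by (auto simp: K_def)
  define N where "N = Suc (\<Sum>m\<in>K. \<Sum>i\<in>UNIV. Poly_Mapping.lookup m i)"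
  have bound: "Poly_Mapping.lookup m i < N" if "m \<in> K" for m i
  proof -
    have "Poly_Mapping.lookup m i \<le> (\<Sum>i\<in>UNIV. Poly_Mapping.lookup m i)"
      by (rule member_le_sum) auto
    also have "\<dots> \<le> (\<Sum>m\<in>K. \<Sum>i\<in>UNIV. Poly_Mapping.lookup m i)"
      by (rule member_le_sum[OF that]) (use K in auto)
    finally show ?thesis by (simp add: N_def)
  qed
  \<comment> \<open>The power of t to which the monomial \<open>m\<close> is sent. The exponents of
    \<open>m\<close> are its digits in base \<open>N\<close>, since \<open>bound\<close> keeps them
    below \<open>N\<close>.\<close>
  define e where "e m = Poly_Mapping.lookup m 0 + N * (Poly_Mapping.lookup m 1 + N * Poly_Mapping.lookup m 2)" for m :: "3 \<Rightarrow>\<^sub>0 nat"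
  have digits: "a = a' \<and> b = b'" if "a + N * b = a' + N * b'" "a < N" "a' < N" for a b a' b'
  proof -
    have "(a + N * b) mod N = a" "(a + N * b) div N = b" "(a' + N * b') mod N = a'" "(a' + N * b') div N = b'"
      using that(2,3) by simp_all
    then show ?thesis using that(1) by metis
  qed
  have inj: "m = n" if "e m = e n" "m \<in> K" "n \<in> K" for m n
  proof -
    from digits[OF that(1)[unfolded e_def] bound[OF that(2)] bound[OF that(3)]]
    have 0: "Poly_Mapping.lookup m 0 = Poly_Mapping.lookup n 0"
      and "Poly_Mapping.lookup m 1 + N * Poly_Mapping.lookup m 2 = Poly_Mapping.lookup n 1 + N * Poly_Mapping.lookup n 2"
      by auto
    from digits[OF this(2) bound[OF that(2)] bound[OF that(3)]] 0
    have "\<forall>i. Poly_Mapping.lookup m i = Poly_Mapping.lookup n i"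
      by (simp add: all_3)
    then show ?thesis by (auto intro: poly_mapping_eqI)
  qed
  define p where "p = (\<Sum>m\<in>K. monom (Poly_Mapping.lookup f m) (e m))"
  have "poly p t = eval3 f (\<chi> i. if i = 0 then t else if i = 1 then t ^ N else t ^ (N * N))" for t
    by (simp add: p_def eval3_def subst3_def K_def poly_sum poly_monom e_def prod_UNIV_3 power_add
        power_mult[symmetric] algebra_simps)
  then have "poly p = poly 0"
    using assms by auto
  then have p: "p = 0" by (rule poly_eq_poly_eq_iff[THEN iffD1])
  obtain m where m: "m \<in> K" using K by auto
  have "0 = coeff p (e m)" using p by simp
  also have "\<dots> = (\<Sum>n\<in>K. if n = m then Poly_Mapping.lookup f n else 0)"
    unfolding p_def coeff_sum coeff_monom using inj m by (intro sum.cong) auto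
  also have "\<dots> = Poly_Mapping.lookup f m" using m K by simp
  finally show False using m by (simp add: K_def in_keys_iff)
qed

lemma poly3_eqI: "(\<And>c. eval3 f c = eval3 g c) \<Longrightarrow> f = g"
  using poly3_eq_0I[of "f - g"] by (simp add: eval3.diff)

lemma forms_0 [simp]: "0 \<in> forms d"
  by (simp add: forms_def)

lemma forms_add: "f \<in> forms d \<Longrightarrow> g \<in> forms d \<Longrightarrow> f + g \<in> forms d"
  using keys_add[of f g] by (auto simp: forms_def)

lemma forms_single: "int (\<Sum>i\<in>UNIV. Poly_Mapping.lookup m i) = d \<Longrightarrow> Poly_Mapping.single m c \<in> forms d"
  by (simp add: forms_def)

lemma forms_mult:
  assumes "f \<in> forms d" "g \<in> forms e"
  shows "f * g \<in> forms (d + e)"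
  unfolding forms_def
proof (intro CollectI ballI)
  fix m assume "m \<in> Poly_Mapping.keys (f * g)"
  then obtain a b where "m = a + b" "a \<in> Poly_Mapping.keys f" "b \<in> Poly_Mapping.keys g"
    using keys_mult[of f g] by blast
  moreover from this have "int (\<Sum>i\<in>UNIV. Poly_Mapping.lookup a i) = d" "int (\<Sum>i\<in>UNIV. Poly_Mapping.lookup b i) = e"
    using assms by (auto simp: forms_def simp del: of_nat_sum)
  ultimately show "int (\<Sum>i\<in>UNIV. Poly_Mapping.lookup m i) = d + e"
    by (simp add: lookup_add sum.distrib)
qed

lemma forms_const: "const c \<in> forms 0"
  unfolding const_def by (rule forms_single) simp

lemma forms_1: "1 \<in> forms 0"
  using forms_const[of 1] by (simp add: const_1)

lemma forms_const_mult: "f \<in> forms d \<Longrightarrow> const c * f \<in> forms d"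
  using forms_mult[OF forms_const, of f d c] by simp

lemma forms_uminus: "f \<in> forms d \<Longrightarrow> - f \<in> forms d"
  by (simp add: forms_def)

lemma forms_diff: "f \<in> forms d \<Longrightarrow> g \<in> forms d \<Longrightarrow> f - g \<in> forms d"
  using forms_add[of f d "- g"] forms_uminus by simp

lemma forms_var: "var i \<in> forms 1"
  unfolding var_def by (rule forms_single, rule_tac i=i in cases_3) (simp_all add: sum_UNIV_3 lookup_single)

lemma forms_sum: "(\<And>a. a \<in> A \<Longrightarrow> f a \<in> forms d) \<Longrightarrow> sum f A \<in> forms d"
  by (induction A rule: infinite_finite_induct) (auto intro: forms_add)

lemma forms_power: "f \<in> forms d \<Longrightarrow> f ^ n \<in> forms (int n * d)"
proof (induction n)
  case (Suc n)
  then show ?case using forms_mult[of f d "f ^ n" "int n * d"] by (simp add: algebra_simps)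
qed (simp add: forms_1)

lemma forms_power_linear: "f \<in> forms 1 \<Longrightarrow> f ^ n \<in> forms (int n)"
  using forms_power[of f 1 n] by simp

lemma forms_prod_linear:
  assumes "finite A" "\<And>a. a \<in> A \<Longrightarrow> f a \<in> forms 1"
  shows "prod f A \<in> forms (int (card A))"
  using assms
proof (induction A rule: finite_induct)
  case (insert a A)
  then show ?case using forms_mult[of "f a" 1 "prod f A" "int (card A)"] by simp
qed (simp add: forms_1)

lemma forms_neg: "d < 0 \<Longrightarrow> f \<in> forms d \<Longrightarrow> f = 0"
proof -
  assume d: "d < 0" and f: "f \<in> forms d"
  have "m \<notin> Poly_Mapping.keys f" for m
    using d f by (auto simp: forms_def simp del: of_nat_sum)
  then show "f = 0" by (metis all_not_in_conv keys_eq_empty)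
qed

lemma eval3_forms_scale:
  assumes "f \<in> forms (int d)"
  shows "eval3 f (t *s c) = t ^ d * eval3 f c"
  unfolding eval3_def subst3_def sum_distrib_left
proof (rule sum.cong[OF refl])
  fix m assume m: "m \<in> Poly_Mapping.keys f"
  then have "int (\<Sum>i\<in>UNIV. Poly_Mapping.lookup m i) = int d"
    using assms by (auto simp: forms_def simp del: of_nat_sum)
  then have "d = (\<Sum>i\<in>UNIV. Poly_Mapping.lookup m i)" by linarith
  then show "id (Poly_Mapping.lookup f m) * (\<Prod>i\<in>UNIV. (t *s c) $ i ^ Poly_Mapping.lookup m i) =
         t ^ d * (id (Poly_Mapping.lookup f m) * (\<Prod>i\<in>UNIV. c $ i ^ Poly_Mapping.lookup m i))"
    by (simp add: power_mult_distrib prod.distrib power_sum)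
qed

text \<open>Serves to see in \<open>forms_factor\<close> that the quotient of a form by a linear
  form can be taken homogeneous.\<close>

definition hom_component :: "int \<Rightarrow> complex poly3 \<Rightarrow> complex poly3" where
  "hom_component d f = (\<Sum>m\<in>Poly_Mapping.keys f. if int (\<Sum>i\<in>UNIV. Poly_Mapping.lookup m i) = d
     then Poly_Mapping.single m (Poly_Mapping.lookup f m) else 0)"

lemma lookup_hom_component: "Poly_Mapping.lookup (hom_component d f) m =
   (if int (\<Sum>i\<in>UNIV. Poly_Mapping.lookup m i) = d then Poly_Mapping.lookup f m else 0)"
proof -
  have "Poly_Mapping.lookup (hom_component d f) m = (\<Sum>n\<in>Poly_Mapping.keys f.
     if n = m then (if int (\<Sum>i\<in>UNIV. Poly_Mapping.lookup m i) = d then Poly_Mapping.lookup f m else 0) else 0)"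
    unfolding hom_component_def lookup_sum by (intro sum.cong) (auto simp: lookup_single when_def)
  also have "\<dots> = (if int (\<Sum>i\<in>UNIV. Poly_Mapping.lookup m i) = d then Poly_Mapping.lookup f m else 0)"
    by (simp add: in_keys_iff)
  finally show ?thesis .
qed

lemma hom_component_add: "hom_component d (f + g) = hom_component d f + hom_component d g"
  by (rule poly_mapping_eqI) (simp add: lookup_hom_component lookup_add)

lemma hom_component_forms: "hom_component d f \<in> forms d"
  by (auto simp: forms_def in_keys_iff lookup_hom_component simp del: of_nat_sum split: if_splits)

lemma hom_component_id: "f \<in> forms d \<Longrightarrow> hom_component d f = f"
proof (rule poly_mapping_eqI)
  fix m assume "f \<in> forms d"
  then show "Poly_Mapping.lookup (hom_component d f) m = Poly_Mapping.lookup f m"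
    by (cases "m \<in> Poly_Mapping.keys f") (auto simp: lookup_hom_component forms_def in_keys_iff)
qed

lemma hom_component_single: "hom_component d (Poly_Mapping.single m c) =
  (if int (\<Sum>i\<in>UNIV. Poly_Mapping.lookup m i) = d then Poly_Mapping.single m c else 0)"
  by (rule poly_mapping_eqI) (auto simp: lookup_hom_component lookup_single when_def)

lemma hom_component_var_mult: "hom_component d (var i * f) = var i * hom_component (d - 1) f"
proof (induction f rule: poly_mapping_single_induct)
  case zero
  then show ?case by (simp add: hom_component_def)
next
  case (add f g)
  then show ?case by (simp add: hom_component_add distrib_left)
next
  case (single m c)
  have "(\<Sum>j\<in>UNIV. Poly_Mapping.lookup (Poly_Mapping.single i 1 + m) j) = 1 + (\<Sum>j\<in>UNIV. Poly_Mapping.lookup m j)"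
    by (rule_tac i=i in cases_3) (simp_all add: sum_UNIV_3 lookup_add lookup_single)
  then show ?case by (simp add: var_def mult_single hom_component_single del: of_nat_sum)
qed

lemma hom_component_const_mult: "hom_component d (const c * f) = const c * hom_component d f"
proof (rule poly_mapping_eqI)
  have *: "Poly_Mapping.lookup (const c * g) m = c * Poly_Mapping.lookup g m" for g m
    by (simp add: const_def mult_map_scale_conv_mult[symmetric] Poly_Mapping.map.rep_eq when_def)
  show "Poly_Mapping.lookup (hom_component d (const c * f)) m = Poly_Mapping.lookup (const c * hom_component d f) m" for m
    by (simp add: lookup_hom_component *)
qed

subsection \<open>Linear forms\<close>

definition dot :: "complex ^ 3 \<Rightarrow> complex ^ 3 \<Rightarrow> complex" where
  "dot a b = (\<Sum>i\<in>UNIV. a $ i * b $ i)"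

lemma dot_3: "dot a b = a $ 0 * b $ 0 + a $ 1 * b $ 1 + a $ 2 * b $ 2"
  by (simp add: dot_def sum_UNIV_3)

lemma dot_commute: "dot a b = dot b a"
  by (simp add: dot_def mult.commute)

lemma dot_add: "dot a (b + c) = dot a b + dot a c"
  by (simp add: dot_def distrib_left sum.distrib)

lemma dot_diff: "dot a (b - c) = dot a b - dot a c"
  by (simp add: dot_def right_diff_distrib sum_subtractf)

lemma dot_scale: "dot a (k *s b) = k * dot a b"
  by (simp add: dot_def sum_distrib_left mult_ac)

lemma dot_axis: "dot a (axis j 1) = a $ j"
  by (simp add: dot_def axis_def if_distrib cong: if_cong)

lemma dot_diff_left: "dot (b - c) a = dot b a - dot c a"
  and dot_add_left: "dot (b + c) a = dot b a + dot c a"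
  and dot_scale_left: "dot (k *s b) a = k * dot b a"
  and dot_axis_left: "dot (axis j 1) a = a $ j"
  using dot_diff[of a b c] dot_add[of a b c] dot_scale[of a k b] dot_axis[of a j]
  by (simp_all add: dot_commute[of _ a])

lemmas dot_simps = dot_add dot_diff dot_scale dot_axis dot_add_left dot_diff_left dot_scale_left dot_axis_left

definition lin :: "complex ^ 3 \<Rightarrow> complex poly3" where
  "lin a = (\<Sum>i\<in>UNIV. const (a $ i) * var i)"

lemma eval3_lin [simp]: "eval3 (lin a) b = dot a b"
  by (simp add: lin_def dot_def eval3.sum eval3.mult)

lemma lin_forms: "lin a \<in> forms 1"
  unfolding lin_def by (intro forms_sum forms_const_mult forms_var)

lemma hom_component_lin_mult: "hom_component d (lin a * f) = lin a * hom_component (d - 1) f"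
  by (simp add: lin_def sum_UNIV_3 distrib_right hom_component_add mult.assoc
      hom_component_const_mult hom_component_var_mult)

lemma lin_eq_0_iff: "lin a = 0 \<longleftrightarrow> a = 0"
proof
  assume *: "lin a = 0"
  have "a $ i = 0" for i
    using arg_cong[OF *, of "\<lambda>f. eval3 f (axis i 1)"] by (simp add: eval3.zero dot_axis)
  then show "a = 0" by (simp add: vec_eq_iff)
qed (simp add: lin_def const.zero)

lemma forms_1_conv_lin: "f \<in> forms 1 \<Longrightarrow> \<exists>a. f = lin a"
proof (intro exI poly3_eqI)
  fix c assume f: "f \<in> forms 1"
  let ?a = "\<chi> i. Poly_Mapping.lookup f (Poly_Mapping.single i 1)"
  have "Poly_Mapping.keys f \<subseteq> range (\<lambda>i. Poly_Mapping.single i 1)"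
  proof
    fix m assume "m \<in> Poly_Mapping.keys f"
    with f have "int (\<Sum>i\<in>UNIV. Poly_Mapping.lookup m i) = 1"
      by (auto simp: forms_def simp del: of_nat_sum)
    then have "(\<Sum>i\<in>UNIV. Poly_Mapping.lookup m i) = 1" by linarith
    then have "Poly_Mapping.lookup m 0 + Poly_Mapping.lookup m 1 + Poly_Mapping.lookup m 2 = 1"
      by (simp add: sum_UNIV_3)
    then consider "Poly_Mapping.lookup m 0 = 1" "Poly_Mapping.lookup m 1 = 0" "Poly_Mapping.lookup m 2 = 0"
      | "Poly_Mapping.lookup m 0 = 0" "Poly_Mapping.lookup m 1 = 1" "Poly_Mapping.lookup m 2 = 0"
      | "Poly_Mapping.lookup m 0 = 0" "Poly_Mapping.lookup m 1 = 0" "Poly_Mapping.lookup m 2 = 1"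
      by linarith
    then have "\<exists>i. \<forall>j. Poly_Mapping.lookup m j = (if j = i then 1 else 0)"
    proof cases
      case 1 then show ?thesis unfolding all_3 by (intro exI[of _ 0]) simp
    next
      case 2 then show ?thesis unfolding all_3 by (intro exI[of _ 1]) simp
    next
      case 3 then show ?thesis unfolding all_3 by (intro exI[of _ 2]) simp
    qed
    then obtain i where "\<forall>j. Poly_Mapping.lookup m j = (if j = i then 1 else 0)" ..
    then have "m = Poly_Mapping.single i 1"
      by (intro poly_mapping_eqI) (auto simp: lookup_single when_def)
    then show "m \<in> range (\<lambda>i. Poly_Mapping.single i 1)" by blast
  qed
  then have "eval3 f c = (\<Sum>m\<in>range (\<lambda>i. Poly_Mapping.single i 1). Poly_Mapping.lookup f m * (\<Prod>i\<in>UNIV. c $ i ^ Poly_Mapping.lookup m i))"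
    unfolding eval3_def by (subst subst3_superset) auto
  also have "\<dots> = (\<Sum>i\<in>UNIV. Poly_Mapping.lookup f (Poly_Mapping.single i 1) * c $ i)"
  proof (subst sum.reindex)
    show "inj (\<lambda>i::3. Poly_Mapping.single i (1::nat))"
      by (rule injI) (metis keys_single one_neq_zero the_elem_eq)
  qed (simp add: sum_UNIV_3 prod_UNIV_3 lookup_single)
  finally show "eval3 f c = eval3 (lin ?a) c" by (simp add: dot_def)
qed

text \<open>Restriction of polynomials to the plane \<open>q \<sqdot> y = 0\<close>: one variable is eliminated by means of \<open>q\<close>,
  which changes \<open>f\<close> by a multiple of \<open>lin q\<close>.\<close>

lemma plane_elimination:
  assumes "q \<noteq> 0"
  obtains h :: "complex poly3 \<Rightarrow> complex poly3" and \<pi> where "ring_homomorphism h"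
    "\<And>f. lin q dvd f \<longleftrightarrow> h f = 0" "\<And>f c. eval3 (h f) c = eval3 f (\<pi> c)" "\<And>c. dot q (\<pi> c) = 0"
proof -
  obtain j where j: "q $ j \<noteq> 0" using assms(1) by (auto simp: vec_eq_iff)
  define x where "x i = (if i = j then var j - const (1 / q $ j) * lin q else var i)" for i
  define h where "h = subst3 const x"
  \<comment> \<open>The projection onto the plane along the \<open>j\<close>-th axis;
    \<open>h\<close> is the pullback of polynomials under it.\<close>
  define \<pi> where "\<pi> c = c - (dot q c / q $ j) *s axis j 1" for c
  have hom: "ring_homomorphism h"
    unfolding h_def by (rule ring_homomorphism_subst3[OF ring_homomorphism_const])
  interpret h: ring_homomorphism h by fact
  have dvd: "lin q dvd f - h f" for f
  proof (induction f rule: poly3_induct)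
    case (var i)
    then show ?case by (simp add: h_def subst3_var ring_homomorphism_const x_def)
  next
    case (add f g)
    then show ?case by (simp add: h.add add_diff_add)
  next
    case (mult f g)
    have "f * g - h f * h g = (f - h f) * g + h f * (g - h g)"
      by (simp add: algebra_simps)
    then show ?case using mult by (simp add: h.mult)
  qed (simp add: h_def subst3_const ring_homomorphism_const)
  have eval: "eval3 (h f) c = eval3 f (\<pi> c)" for f c
  proof (rule ring_homomorphism_ext)
    show "ring_homomorphism (\<lambda>f. eval3 (h f) c)"
      by (rule ring_homomorphism_comp[OF ring_homomorphism_eval3 hom])
  qed (auto intro: ring_homomorphism_eval3 simp: h_def subst3_const subst3_var ring_homomorphism_const
      \<pi>_def x_def eval3.diff eval3.mult axis_def)
  have \<pi>: "dot q (\<pi> c) = 0" for c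
    using j by (simp add: \<pi>_def dot_diff dot_scale dot_axis)
  have "lin q dvd f \<longleftrightarrow> h f = 0" for f
  proof
    assume "lin q dvd f"
    then obtain g where g: "f = lin q * g" by (rule dvdE)
    show "h f = 0"
      by (rule poly3_eq_0I) (simp add: eval g eval3.mult \<pi>)
  next
    assume "h f = 0"
    then show "lin q dvd f" using dvd[of f] by simp
  qed
  then show ?thesis using that hom eval \<pi> by blast
qed

text \<open>\<open>lin q\<close> is prime: its multiples are the kernel of a ring homomorphism into
  an integral domain.\<close>

lemma lin_dvd_mult_iff:
  assumes "q \<noteq> 0"
  shows "lin q dvd f * g \<longleftrightarrow> lin q dvd f \<or> lin q dvd g"
proof -
  obtain h :: "complex poly3 \<Rightarrow> complex poly3" and \<pi> where h: "ring_homomorphism h"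
    "\<And>f. lin q dvd f \<longleftrightarrow> h f = 0" "\<And>f c. eval3 (h f) c = eval3 f (\<pi> c)" "\<And>c. dot q (\<pi> c) = 0"
    by (rule plane_elimination[OF assms]) (rule that)
  show ?thesis by (simp add: h(2) ring_homomorphism.mult[OF h(1)])
qed

lemma eval3_dvd_lin: "lin q dvd f \<Longrightarrow> dot q y = 0 \<Longrightarrow> eval3 f y = 0"
  by (auto simp: eval3.mult elim!: dvdE)

lemma ex_plane_vector: "\<exists>y. y \<noteq> 0 \<and> dot q y = 0"
proof (cases "q $ 0 = 0")
  case True
  then show ?thesis by (intro exI[of _ "axis 0 1"]) (simp add: dot_axis)
next
  case False
  define y :: "complex ^ 3" where "y = (\<chi> i. if i = 0 then - q $ 1 else if i = 1 then q $ 0 else 0)"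
  have "y $ 1 \<noteq> 0" using False by (simp add: y_def)
  then have "y \<noteq> 0" by auto
  moreover have "dot q y = 0" by (simp add: dot_3 y_def)
  ultimately show ?thesis by blast
qed

lemma dvd_if_vanishes_on_plane:
  assumes "q \<noteq> 0" "\<And>y. dot q y = 0 \<Longrightarrow> y \<noteq> 0 \<Longrightarrow> eval3 f y = 0"
  shows "lin q dvd f"
proof -
  obtain h :: "complex poly3 \<Rightarrow> complex poly3" and \<pi> where h: "ring_homomorphism h" "\<And>f. lin q dvd f \<longleftrightarrow> h f = 0"
    "\<And>f c. eval3 (h f) c = eval3 f (\<pi> c)" "\<And>c. dot q (\<pi> c) = 0"
    by (rule plane_elimination[OF assms(1)]) (rule that)
  obtain y where y: "y \<noteq> 0" "dot q y = 0" using ex_plane_vector by blast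
  then obtain i where i: "y $ i \<noteq> 0" by (auto simp: vec_eq_iff)
  \<comment> \<open>The hypothesis says nothing about the origin, so \<open>f\<close> is multiplied
    by a variable. This variable does not vanish at the point \<open>y\<close> of the plane and is
    cancelled by primality.\<close>
  have "eval3 (h (f * var i)) c = 0" for c
    using assms(2)[of "\<pi> c"] h(4)[of c] by (cases "\<pi> c = 0") (simp_all add: h(3) eval3.mult)
  then have "lin q dvd f * var i" by (simp add: h(2) poly3_eq_0I)
  then have "lin q dvd f \<or> lin q dvd var i" by (simp add: lin_dvd_mult_iff assms)
  then show ?thesis using eval3_dvd_lin[of q "var i" y] y i by auto
qed

lemma forms_factor:
  assumes "lin q dvd f" "f \<in> forms d"
  obtains g where "f = lin q * g" "g \<in> forms (d - 1)"
proof -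
  from assms(1) obtain g where "f = lin q * g" by (rule dvdE)
  then have "f = lin q * hom_component (d - 1) g"
    using hom_component_lin_mult[of d q g] hom_component_id[OF assms(2)] by metis
  then show ?thesis using that hom_component_forms by blast
qed

section \<open>Points, lines and the Zariski topology\<close>

lemma Quotient_proj2': "proportional x x \<and> proportional y y \<and> abs_proj2 x = abs_proj2 y \<longleftrightarrow> proportional x y"
  using Quotient3_rel[OF Quotient3_proj2] by blast

lemma proportional_refl: "proportional c c \<longleftrightarrow> c \<noteq> 0"
  by (auto simp: proportional_def intro!: exI[of _ 1])

lemma abs_proj2_eq_iff:
  "c \<noteq> 0 \<Longrightarrow> d \<noteq> 0 \<Longrightarrow> abs_proj2 c = abs_proj2 d \<longleftrightarrow> (\<exists>k. k \<noteq> 0 \<and> d = k *s c)"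
  using Quotient_proj2'[of c d] by (simp add: proportional_refl) (simp add: proportional_def)

lemma rep_proj2_in_coords: "rep_proj2 p \<in> coords p"
  using Quotient3_abs_rep[OF Quotient3_proj2] Quotient3_rep_reflp[OF Quotient3_proj2]
  by (simp add: coords_def proportional_refl[symmetric])

lemma coords_nonzero: "c \<in> coords p \<Longrightarrow> c \<noteq> 0"
  by (simp add: coords_def)

lemma coords_conv:
  assumes "c \<in> coords p"
  shows "coords p = {k *s c | k. k \<noteq> 0}"
proof (intro equalityI subsetI)
  fix d assume "d \<in> coords p"
  then show "d \<in> {k *s c | k. k \<noteq> 0}"
    using assms abs_proj2_eq_iff[of c d] by (auto simp: coords_def)
next
  fix d assume "d \<in> {k *s c | k. k \<noteq> 0}"
  then obtain k where k: "k \<noteq> 0" "d = k *s c" by blast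
  then have "d \<noteq> 0" using assms by (simp add: coords_def)
  then show "d \<in> coords p"
    using assms abs_proj2_eq_iff[of c d] k by (auto simp: coords_def)
qed

lemma in_coords_abs: "c \<noteq> 0 \<Longrightarrow> c \<in> coords (abs_proj2 c)"
  by (simp add: coords_def)

lemma coords_eqD: "c \<in> coords p \<Longrightarrow> c \<in> coords q \<Longrightarrow> p = q"
  by (simp add: coords_def)

lemma nonvanishing_iff:
  assumes "f \<in> forms d" "c \<in> coords p"
  shows "p \<in> nonvanishing f \<longleftrightarrow> eval3 f c \<noteq> 0"
proof (cases "d < 0")
  case True
  then have "f = 0" using assms forms_neg by blast
  then show ?thesis using assms(2) by (auto simp: nonvanishing_def eval3.zero)
next
  case False
  then have "f \<in> forms (int (nat d))" using assms by simp
  then show ?thesis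
    using eval3_forms_scale[of f "nat d"] by (auto simp: nonvanishing_def coords_conv[OF assms(2)] intro: exI[of _ 1])
qed

lemma dual_line_conv:
  assumes "c \<in> coords p"
  shows "dual_line p = {q. \<forall>y\<in>coords q. dot c y = 0}"
  using assms unfolding dual_line_def coords_conv[OF assms]
  by (auto simp: dot_def sum_distrib_left[symmetric] mult.assoc)

lemma in_dual_line_iff:
  assumes "c \<in> coords p" "y \<in> coords q"
  shows "q \<in> dual_line p \<longleftrightarrow> dot c y = 0"
proof
  assume "q \<in> dual_line p"
  then show "dot c y = 0" using assms(2) by (simp add: dual_line_conv[OF assms(1)])
next
  assume "dot c y = 0"
  then show "q \<in> dual_line p"
    by (auto simp: dual_line_conv[OF assms(1)] coords_conv[OF assms(2)] dot_scale)
qed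

lemma vanishing_ideal_dual_line:
  assumes "c \<in> coords p"
  shows "f \<in> vanishing_ideal (dual_line p) \<longleftrightarrow> lin c dvd f"
proof
  assume f: "f \<in> vanishing_ideal (dual_line p)"
  show "lin c dvd f"
  proof (rule dvd_if_vanishes_on_plane)
    show "c \<noteq> 0" using assms coords_nonzero by blast
    fix y assume "dot c y = 0" "y \<noteq> 0"
    then have "abs_proj2 y \<in> dual_line p" using in_dual_line_iff[OF assms in_coords_abs] by blast
    then show "eval3 f y = 0" using f in_coords_abs[OF \<open>y \<noteq> 0\<close>] by (auto simp: vanishing_ideal_def)
  qed
next
  assume "lin c dvd f"
  then show "f \<in> vanishing_ideal (dual_line p)"
    unfolding vanishing_ideal_def using in_dual_line_iff[OF assms] eval3_dvd_lin by blast
qed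

lemma nonvanishing_mult: "nonvanishing f \<inter> nonvanishing g = nonvanishing (f * g)"
proof
  show "nonvanishing (f * g) \<subseteq> nonvanishing f \<inter> nonvanishing g"
    by (auto simp: nonvanishing_def eval3.mult)
qed (auto simp: nonvanishing_def eval3.mult)

lemma var_neq_0: "(var i :: complex poly3) \<noteq> 0"
  by (metis var_def lookup_single_eq lookup_zero zero_neq_one)

lemma nonvanishing_nonempty_iff: "f \<in> forms d \<Longrightarrow> nonvanishing f \<noteq> {} \<longleftrightarrow> f \<noteq> 0"
proof
  assume f: "f \<in> forms d" "f \<noteq> 0"
  then have "f * var 0 \<noteq> 0" by (simp add: var_neq_0)
  then obtain c where c: "eval3 (f * var 0) c \<noteq> 0" using poly3_eq_0I by blast
  then have "c \<noteq> 0" "eval3 f c \<noteq> 0" by (auto simp: eval3.mult)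
  then show "nonvanishing f \<noteq> {}" using nonvanishing_iff[OF f(1) in_coords_abs] by blast
next
  assume "nonvanishing f \<noteq> {}"
  then obtain p where "p \<in> nonvanishing f" by blast
  then show "f \<noteq> 0" using rep_proj2_in_coords[of p] by (auto simp: nonvanishing_def eval3.zero)
qed

lemma openin_zariski_nonvanishing: "f \<in> forms d \<Longrightarrow> openin zariski (nonvanishing f)"
  unfolding zariski_def by (rule topology_generated_by_Basis) blast

text \<open>The generating sets are closed under intersection, so they form a basis and not only a
  subbasis.\<close>

lemma zariski_basis:
  assumes "openin zariski U" "p \<in> U"
  obtains f d where "f \<in> forms d" "p \<in> nonvanishing f" "nonvanishing f \<subseteq> U"
proof -
  have "generate_topology_on {nonvanishing f | f d. f \<in> forms d} U"
    using assms(1) by (simp add: zariski_def openin_topology_generated_by_iff)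
  then have "p \<in> U \<longrightarrow> (\<exists>f d. f \<in> forms d \<and> p \<in> nonvanishing f \<and> nonvanishing f \<subseteq> U)"
  proof induction
    case (Int a b)
    show ?case
    proof
      assume "p \<in> a \<inter> b"
      then obtain f d g e where "f \<in> forms d" "p \<in> nonvanishing f" "nonvanishing f \<subseteq> a"
        "g \<in> forms e" "p \<in> nonvanishing g" "nonvanishing g \<subseteq> b" using Int by blast
      then show "\<exists>f d. f \<in> forms d \<and> p \<in> nonvanishing f \<and> nonvanishing f \<subseteq> a \<inter> b"
        by (intro exI[of _ "f * g"] exI[of _ "d + e"]) (auto simp: nonvanishing_mult[symmetric] intro: forms_mult)
    qed
  qed blast+
  then show ?thesis using assms(2) that by blast
qed

lemma for_general_nonvanishing:
  assumes "for_general P"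
  obtains f d where "f \<in> forms d" "f \<noteq> 0" "\<And>p. p \<in> nonvanishing f \<Longrightarrow> P p"
proof -
  obtain U where U: "openin zariski U" "U \<noteq> {}" "\<And>p. p \<in> U \<Longrightarrow> P p"
    using assms unfolding for_general_def by blast
  then obtain p where "p \<in> U" by blast
  from zariski_basis[OF U(1) this] obtain f d where "f \<in> forms d" "p \<in> nonvanishing f" "nonvanishing f \<subseteq> U"
    by metis
  then show ?thesis using that U(3) nonvanishing_nonempty_iff by blast
qed

section \<open>Derivations\<close>

lemma derivations_add: "\<theta> \<in> derivations \<Longrightarrow> \<theta> (f + g) = \<theta> f + \<theta> g"
  and derivations_const_mult: "\<theta> \<in> derivations \<Longrightarrow> \<theta> (const c * f) = const c * \<theta> f"
  and derivations_mult: "\<theta> \<in> derivations \<Longrightarrow> \<theta> (f * g) = f * \<theta> g + g * \<theta> f"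
  by (auto simp: derivations_def)

lemma derivations_const: 
  assumes "\<theta> \<in> derivations"
  shows "\<theta> (const c) = 0"
proof -
  have "\<theta> 1 = 0" using derivations_mult[OF assms, of 1 1] by simp
  then show ?thesis using derivations_const_mult[OF assms, of c 1] by simp
qed

lemma derivations_sum:
  assumes "\<theta> \<in> derivations"
  shows "\<theta> (sum f A) = (\<Sum>a\<in>A. \<theta> (f a))"
  using derivations_const[OF assms, of 0]
  by (induction A rule: infinite_finite_induct) (simp_all add: derivations_add[OF assms] const.zero)

lemma derivations_ext:
  assumes "\<theta> \<in> derivations" "\<eta> \<in> derivations" "\<And>i. \<theta> (var i) = \<eta> (var i)"
  shows "\<theta> = \<eta>"
proof
  fix f show "\<theta> f = \<eta> f"
    by (induction f rule: poly3_induct)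
      (use assms in \<open>simp_all add: derivations_const derivations_add derivations_mult\<close>)
qed

lemma partial_superset:
  assumes "finite A" "Poly_Mapping.keys f \<subseteq> A"
  shows "partial i f = (\<Sum>m\<in>A. Poly_Mapping.single (m - Poly_Mapping.single i 1)
    (of_nat (Poly_Mapping.lookup m i) * Poly_Mapping.lookup f m))"
  unfolding partial_def using assms by (intro sum.mono_neutral_left) (auto simp: in_keys_iff)

lemma partial_single: "partial i (Poly_Mapping.single m c) =
    Poly_Mapping.single (m - Poly_Mapping.single i 1) (of_nat (Poly_Mapping.lookup m i) * c)"
  by (subst partial_superset[where A="{m}"]) auto

lemma partial_add: "partial i (f + g) = partial i f + partial i g"
proof -
  let ?A = "Poly_Mapping.keys f \<union> Poly_Mapping.keys g"
  have "Poly_Mapping.keys (f + g) \<subseteq> ?A" by (rule keys_add)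
  then show ?thesis
    by (simp add: partial_superset[where A = ?A] lookup_add distrib_left single_add sum.distrib)
qed

lemma partial_mult: "partial i (f * g) = f * partial i g + g * partial i f"
proof (induction f rule: poly_mapping_single_induct)
  case zero
  then show ?case by (simp add: partial_def)
next
  case (add f g)
  then show ?case by (simp add: partial_add algebra_simps)
next
  case (single m c)
  show ?case
  proof (induction g rule: poly_mapping_single_induct)
    case zero
    then show ?case by (simp add: partial_def)
  next
    case (add f g)
    then show ?case by (simp add: partial_add algebra_simps)
  next
    case (single n d)
    let ?e = "Poly_Mapping.single i (1::nat)"
    have *: "Poly_Mapping.single (a + (b - ?e)) (of_nat (Poly_Mapping.lookup b i) * x) =
        Poly_Mapping.single (a + b - ?e) (of_nat (Poly_Mapping.lookup b i) * (x::complex))" for a b :: "3 \<Rightarrow>\<^sub>0 nat" and x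
    proof (cases "Poly_Mapping.lookup b i = 0")
      case False
      then have "a + (b - ?e) = a + b - ?e"
        by (intro poly_mapping_eqI) (auto simp: lookup_add lookup_minus lookup_single when_def)
      then show ?thesis by simp
    qed simp
    show ?case
      using *[of m n "c * d"] *[of n m "c * d"]
      by (simp add: partial_single mult_single lookup_add distrib_right single_add[symmetric] ac_simps)
        (simp add: single_add distrib_left ac_simps)
  qed
qed

lemma partial_derivation: "partial i \<in> derivations"
proof -
  have "partial i (const c) = 0" for c
    by (simp add: const_def partial_single)
  then show ?thesis by (auto simp: derivations_def partial_add partial_mult)
qed

lemma partial_var: "partial i (var j) = (if i = j then 1 else 0)"
  by (auto simp: var_def partial_single lookup_single when_def)

definition vector_field :: "(3 \<Rightarrow> complex poly3) \<Rightarrow> complex poly3 \<Rightarrow> complex poly3" where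
  "vector_field f g = (\<Sum>i\<in>UNIV. f i * partial i g)"

lemma vector_field_derivation: "vector_field f \<in> derivations"
  using derivations_const_mult[OF partial_derivation] derivations_const[OF partial_derivation]
  by (simp add: derivations_def vector_field_def partial_add partial_mult distrib_left sum.distrib sum_distrib_left mult.left_commute)

lemma vector_field_var [simp]: "vector_field f (var i) = f i"
  by (simp add: vector_field_def partial_var if_distrib cong: if_cong)

lemma euler_conv_vector_field: "euler_derivation = vector_field var"
  by (simp add: fun_eq_iff euler_derivation_def vector_field_def)

lemma derivations_lin: "\<theta> \<in> derivations \<Longrightarrow> \<theta> (lin c) = (\<Sum>i\<in>UNIV. const (c $ i) * \<theta> (var i))"
  by (simp add: lin_def derivations_sum derivations_const_mult)

lemma derivations_scale: "\<theta> \<in> derivations \<Longrightarrow> (\<lambda>f. g * \<theta> f) \<in> derivations"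
  by (auto simp: derivations_def algebra_simps)

text \<open>The ideal of a line is generated by \<open>lin c\<close>, so by the product rule only
  \<open>\<theta> (lin c)\<close> has to be tested.\<close>

lemma D_module_iff:
  assumes "\<theta> \<in> derivations"
  shows "\<theta> \<in> D_module (arrangement Z) \<longleftrightarrow> (\<forall>p\<in>Z. \<forall>c\<in>coords p. lin c dvd \<theta> (lin c))"
proof
  assume *: "\<theta> \<in> D_module (arrangement Z)"
  show "\<forall>p\<in>Z. \<forall>c\<in>coords p. lin c dvd \<theta> (lin c)"
  proof safe
    fix p c assume "p \<in> Z" "c \<in> coords p"
    moreover have "lin c \<in> vanishing_ideal (dual_line p)"
      using vanishing_ideal_dual_line[OF \<open>c \<in> coords p\<close>] by simp
    ultimately show "lin c dvd \<theta> (lin c)"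
      using * vanishing_ideal_dual_line[OF \<open>c \<in> coords p\<close>]
      unfolding D_module_def arrangement_def by blast
  qed
next
  assume *: "\<forall>p\<in>Z. \<forall>c\<in>coords p. lin c dvd \<theta> (lin c)"
  have "\<theta> f \<in> vanishing_ideal (dual_line p)" if "p \<in> Z" "f \<in> vanishing_ideal (dual_line p)" for p f
  proof -
    define c where "c = rep_proj2 p"
    have c: "c \<in> coords p" by (simp add: c_def rep_proj2_in_coords)
    obtain g where "f = lin c * g" using \<open>f \<in> vanishing_ideal (dual_line p)\<close> vanishing_ideal_dual_line[OF c] by (auto elim: dvdE)
    then have "\<theta> f = lin c * \<theta> g + g * \<theta> (lin c)"
      using assms by (simp add: derivations_mult)
    moreover have "lin c dvd \<theta> (lin c)" using * that c by blast
    ultimately show ?thesis using vanishing_ideal_dual_line[OF c] by simp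
  qed
  then show "\<theta> \<in> D_module (arrangement Z)"
    using assms by (auto simp: D_module_def arrangement_def)
qed

lemma D_module_scale: "\<theta> \<in> D_module (arrangement Z) \<Longrightarrow> (\<lambda>f. g * \<theta> f) \<in> D_module (arrangement Z)"
  by (auto simp: D_module_iff D_module_def[of "arrangement Z"] derivations_scale)
   (simp_all add: vanishing_ideal_def image_subset_iff eval3.mult)

lemma linear_forms_iff:
  assumes "\<theta> \<in> derivations"
  shows "(\<forall>l\<in>forms 1. \<theta> l \<in> forms d) \<longleftrightarrow> (\<forall>i. \<theta> (var i) \<in> forms d)"
proof
  assume *: "\<forall>i. \<theta> (var i) \<in> forms d"
  show "\<forall>l\<in>forms 1. \<theta> l \<in> forms d"
  proof
    fix l assume "l \<in> forms 1"
    then obtain a where "l = lin a" using forms_1_conv_lin by blast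
    then show "\<theta> l \<in> forms d"
      using * by (auto simp: derivations_lin assms intro!: forms_sum forms_const_mult)
  qed
qed (simp add: forms_var)

section \<open>The comparison of \<open>D\<^sub>0\<close> with \<open>I\<^sup>\<ggreater>(Z)\<close>\<close>

lemma module_times: "module ((*) :: 'a::comm_ring_1 \<Rightarrow> 'a \<Rightarrow> 'a)"
  by unfold_locales (simp_all add: algebra_simps)

lemma module_derivations: "module (\<lambda>g (\<theta> :: 'c \<Rightarrow> 'a::comm_ring_1) f. g * \<theta> f)"
  by unfold_locales (simp_all add: fun_eq_iff algebra_simps)

lemma ring_homomorphism_const_const: "ring_homomorphism (\<lambda>c. const (const c) :: complex poly3 poly3)"
  by (rule ring_homomorphism_comp) (rule ring_homomorphism_const)+

interpretation subst_M: ring_homomorphism subst_M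
  unfolding subst_M_def by (rule ring_homomorphism_subst3[OF ring_homomorphism_const_const])

interpretation subst_X: ring_homomorphism subst_X
  unfolding subst_X_def by (rule ring_homomorphism_subst3[OF ring_homomorphism_const_const])

lemma module_M_scale: "module M_scale"
  by unfold_locales (simp_all add: M_scale_def subst_M.hom algebra_simps)

text \<open>The values of the minors \<open>M_minor i\<close> when X and A take the values
  \<open>x\<close> and \<open>a\<close>.\<close>

definition cross :: "complex ^ 3 \<Rightarrow> complex ^ 3 \<Rightarrow> complex ^ 3" where
  "cross x a = (\<chi> i. if i = 0 then x $ 1 * a $ 2 - x $ 2 * a $ 1
     else if i = 1 then x $ 2 * a $ 0 - x $ 0 * a $ 2 else x $ 0 * a $ 1 - x $ 1 * a $ 0)"

lemma dot_cross: "dot x (cross x a) = 0"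
  by (simp add: dot_3 cross_def algebra_simps)

text \<open>For \<open>x \<noteq> 0\<close> the linear map sending \<open>a\<close> to
  \<open>cross x a\<close> has rank two and fills the plane orthogonal to \<open>x\<close>.
  Identities at all pairs \<open>(x, cross x a)\<close> thus become identities at all incident pairs
  of a point and a line.\<close>

lemma ex_cross:
  assumes "x \<noteq> 0" "dot x y = 0"
  shows "\<exists>a. cross x a = y"
proof -
  have eq: "x $ 0 * y $ 0 + x $ 1 * y $ 1 + x $ 2 * y $ 2 = 0"
    using assms(2) by (simp add: dot_3)
  from assms(1) consider "x $ 0 \<noteq> 0" | "x $ 1 \<noteq> 0" | "x $ 2 \<noteq> 0"
    using all_3[of "\<lambda>i. x $ i = 0"] by (auto simp: vec_eq_iff)
  then show ?thesis
  proof cases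
    case 1
    have "x $ 0 * y $ 0 = - (x $ 1 * y $ 1 + x $ 2 * y $ 2)"
      using eq by (simp add: eq_neg_iff_add_eq_0 algebra_simps)
    then have "y $ 0 = - (x $ 1 * y $ 1 + x $ 2 * y $ 2) / x $ 0"
      using 1 by (simp add: eq_divide_eq mult.commute)
    then show ?thesis using 1
      by (intro exI[of _ "\<chi> i. if i = 0 then 0 else if i = 1 then y $ 2 / x $ 0 else - y $ 1 / x $ 0"])
        (auto simp: vec_eq_iff all_3 cross_def field_simps)
  next
    case 2
    have "x $ 1 * y $ 1 = - (x $ 0 * y $ 0 + x $ 2 * y $ 2)"
      using eq by (simp add: eq_neg_iff_add_eq_0 algebra_simps)
    then have "y $ 1 = - (x $ 0 * y $ 0 + x $ 2 * y $ 2) / x $ 1"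
      using 2 by (simp add: eq_divide_eq mult.commute)
    then show ?thesis using 2
      by (intro exI[of _ "\<chi> i. if i = 0 then - y $ 2 / x $ 1 else if i = 1 then 0 else y $ 0 / x $ 1"])
        (auto simp: vec_eq_iff all_3 cross_def field_simps, use eq in \<open>simp add: neg_eq_iff_add_eq_0 algebra_simps\<close>)
  next
    case 3
    have "x $ 2 * y $ 2 = - (x $ 0 * y $ 0 + x $ 1 * y $ 1)"
      using eq by (simp add: eq_neg_iff_add_eq_0 algebra_simps)
    then have "y $ 2 = - (x $ 0 * y $ 0 + x $ 1 * y $ 1) / x $ 2"
      using 3 by (simp add: eq_divide_eq mult.commute)
    then show ?thesis using 3
      by (intro exI[of _ "\<chi> i. if i = 0 then y $ 1 / x $ 2 else if i = 1 then - y $ 0 / x $ 2 else 0"])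
        (auto simp: vec_eq_iff all_3 cross_def field_simps, use eq in \<open>simp add: neg_eq_iff_add_eq_0 algebra_simps\<close>)
  qed
qed

definition eval_XA :: "complex ^ 3 \<Rightarrow> complex ^ 3 \<Rightarrow> complex poly3 poly3 \<Rightarrow> complex" where
  "eval_XA x a = subst3 (\<lambda>g. eval3 g a) (($) x)"

interpretation eval_XA: ring_homomorphism "eval_XA x a" for x a
  unfolding eval_XA_def by (rule ring_homomorphism_subst3[OF ring_homomorphism_eval3])

lemma eval_XA_X_var [simp]: "eval_XA x a (X_var i) = x $ i"
  by (simp add: eval_XA_def X_var_def subst3_var ring_homomorphism_eval3)

lemma eval_XA_const [simp]: "eval_XA x a (const g) = eval3 g a"
  by (simp add: eval_XA_def subst3_const ring_homomorphism_eval3)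

lemma M_minor_conv:
  "M_minor 0 = X_var 1 * A_var 2 - X_var 2 * A_var 1"
  "M_minor 1 = X_var 2 * A_var 0 - X_var 0 * A_var 2"
  "M_minor 2 = X_var 0 * A_var 1 - X_var 1 * A_var 0"
proof -
  have "(3 :: 3) = 0" by simp
  then show
    "M_minor 0 = X_var 1 * A_var 2 - X_var 2 * A_var 1"
    "M_minor 1 = X_var 2 * A_var 0 - X_var 0 * A_var 2"
    "M_minor 2 = X_var 0 * A_var 1 - X_var 1 * A_var 0"
    by (simp_all only: M_minor_def det_3) (simp_all add: axis_def)
qed

lemma eval_XA_subst_M: "eval_XA x a (subst_M g) = eval3 g (cross x a)"
proof (rule ring_homomorphism_ext)
  show "ring_homomorphism (\<lambda>g. eval_XA x a (subst_M g))"
    by (rule ring_homomorphism_comp) unfold_locales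
  fix i
  have "eval_XA x a (M_minor i) = cross x a $ i"
    by (rule_tac i=i in cases_3) (simp_all add: M_minor_conv eval_XA.hom A_var_def cross_def)
  then show "eval_XA x a (subst_M (var i)) = eval3 (var i) (cross x a)"
    by (simp add: subst_M_def subst3_var ring_homomorphism_const_const)
qed (simp_all add: ring_homomorphism_eval3 subst_M_def subst3_const ring_homomorphism_const_const)

definition to_m_gg :: "(complex poly3 \<Rightarrow> complex poly3) \<Rightarrow> complex poly3 poly3" where
  "to_m_gg \<theta> = (\<Sum>i\<in>UNIV. M_scale (\<theta> (var i)) (X_var i))"

lemma module_hom_to_m_gg: "module_hom (\<lambda>g \<theta> f. g * \<theta> f) M_scale to_m_gg"
proof (intro module_hom.intro module_hom_axioms.intro module_derivations module_M_scale)
  show "to_m_gg (\<theta> + \<eta>) = to_m_gg \<theta> + to_m_gg \<eta>" for \<theta> \<eta>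
    by (simp add: to_m_gg_def M_scale_def subst_M.add distrib_right sum.distrib)
  show "to_m_gg (\<lambda>f. g * \<theta> f) = M_scale g (to_m_gg \<theta>)" for g \<theta>
    by (simp add: to_m_gg_def M_scale_def subst_M.mult sum_distrib_left mult.assoc)
qed

interpretation to_m_gg: module_hom "\<lambda>g (\<theta> :: complex poly3 \<Rightarrow> complex poly3) f. g * \<theta> f" M_scale to_m_gg
  by (rule module_hom_to_m_gg)

text \<open>The bridge of the comparison: the kernel of \<open>to_m_gg\<close> and membership in the
  ideal become statements on \<open>\<theta> (lin x)\<close> at the points \<open>y\<close> with
  \<open>dot x y = 0\<close>.\<close>

lemma eval_XA_to_m_gg:
  assumes "\<theta> \<in> derivations"
  shows "eval_XA x a (to_m_gg \<theta>) = eval3 (\<theta> (lin x)) (cross x a)"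
  by (simp add: to_m_gg_def M_scale_def eval_XA.sum eval_XA.mult eval_XA_subst_M derivations_lin[OF assms]
      eval3.sum eval3.mult mult.commute)

lemma var_not_dvd_var: "i \<noteq> j \<Longrightarrow> \<not> (var i :: complex poly3) dvd var j"
proof
  assume "i \<noteq> j" "(var i :: complex poly3) dvd var j"
  then obtain g where "var j = var i * (g :: complex poly3)" by (auto elim: dvdE)
  then have "eval3 (var j) (axis j 1) = eval3 (var i * g) (axis j 1)" by simp
  then show False using \<open>i \<noteq> j\<close> by (simp add: eval3.mult axis_def)
qed

lemma lin_axis: "lin (axis i 1) = var i"
  by (rule poly3_eqI) (simp add: dot_axis_left)

text \<open>\<open>var 0\<close> is prime and does not divide \<open>var 1\<close>, so it divides
  \<open>f 0\<close>; the quotient is the common factor.\<close>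

lemma koszul:
  assumes 1: "var 0 * f 1 = var 1 * (f 0 :: complex poly3)" and 2: "var 0 * f 2 = var 2 * f 0"
  shows "\<exists>g. \<forall>i. f i = g * var i"
proof -
  have "axis 0 1 \<noteq> (0 :: complex ^ 3)" by (simp add: axis_eq_0_iff)
  moreover have "var 0 dvd var 1 * f 0" using 1 by (metis dvd_triv_left)
  ultimately have "var 0 dvd f 0"
    using lin_dvd_mult_iff[of "axis 0 1" "var 1" "f 0"] var_not_dvd_var[of 0 1] by (simp add: lin_axis)
  then obtain g where g: "f 0 = var 0 * g" by (rule dvdE)
  have "var 0 * f 1 = var 0 * (g * var 1)" "var 0 * f 2 = var 0 * (g * var 2)"
    using 1 2 g by (simp_all add: mult_ac)
  then have "f 1 = g * var 1" "f 2 = g * var 2" by (simp_all add: var_neq_0)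
  then have "\<forall>i. f i = g * var i" using g by (simp add: all_3 mult.commute)
  then show ?thesis ..
qed

lemma euler_multiple_if:
  assumes "\<theta> \<in> derivations" and *: "\<And>i j. i \<noteq> j \<Longrightarrow> var i * \<theta> (var j) = var j * \<theta> (var i)"
  shows "\<exists>g. \<theta> = (\<lambda>f. g * euler_derivation f)"
proof -
  obtain g where "\<forall>i. \<theta> (var i) = g * var i"
    using koszul[of "\<lambda>i. \<theta> (var i)", OF *[of 0 1] *[of 0 2]] by auto
  then have "\<theta> = (\<lambda>f. g * euler_derivation f)"
    by (intro derivations_ext assms derivations_scale)
      (simp_all add: euler_conv_vector_field vector_field_derivation)
  then show ?thesis by blast
qed

lemma lin_swap: "lin (y $ i *s axis j 1 - y $ j *s axis i 1) = const (y $ i) * var j - const (y $ j) * var i"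
  by (rule poly3_eqI) (simp add: eval3.diff eval3.mult dot_simps)

text \<open>The linear form on the left vanishes at \<open>y\<close>. The values of \<theta> on
  linear forms at their own zeros therefore contain the Koszul relations, which characterise the
  multiples of the Euler derivation.\<close>

lemma derivations_swap:
  assumes "\<theta> \<in> derivations"
  shows "eval3 (\<theta> (lin (y $ i *s axis j 1 - y $ j *s axis i 1))) y = eval3 (var i * \<theta> (var j) - var j * \<theta> (var i)) y"
proof -
  have "lin (y $ i *s axis j 1 - y $ j *s axis i 1) = const (y $ i) * var j + const (- (y $ j)) * var i"
    by (simp add: lin_swap const.uminus)
  then show ?thesis
    by (simp only: derivations_add[OF assms] derivations_const_mult[OF assms]) (simp add: eval3.hom)
qed

lemma euler_multiple_iff:
  assumes "\<theta> \<in> derivations"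
  shows "(\<exists>g. \<theta> = (\<lambda>f. g * euler_derivation f)) \<longleftrightarrow> (\<forall>x y. dot x y = 0 \<longrightarrow> eval3 (\<theta> (lin x)) y = 0)"
    (is "?L \<longleftrightarrow> ?R")
proof
  assume ?L
  then obtain g where g: "\<theta> = (\<lambda>f. g * euler_derivation f)" ..
  have "\<theta> (lin x) = g * lin x" for x
    using derivations_lin[OF vector_field_derivation, of var x]
    by (simp add: g euler_conv_vector_field lin_def)
  then show ?R by (simp add: eval3.mult)
next
  assume R: ?R
  have "var i * \<theta> (var j) = var j * \<theta> (var i)" for i j
  proof (rule poly3_eqI)
    fix y :: "complex ^ 3"
    have "dot (y $ i *s axis j 1 - y $ j *s axis i 1) y = 0" by (simp add: dot_simps)
    then show "eval3 (var i * \<theta> (var j)) y = eval3 (var j * \<theta> (var i)) y"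
      using R derivations_swap[OF assms, of y i j] by (simp add: eval3.diff)
  qed
  then show ?L by (rule euler_multiple_if[OF assms])
qed

lemma to_m_gg_eq_0_iff:
  assumes "\<theta> \<in> derivations"
  shows "to_m_gg \<theta> = 0 \<longleftrightarrow> (\<exists>g. \<theta> = (\<lambda>f. g * euler_derivation f))"
proof
  assume 0: "to_m_gg \<theta> = 0"
  have "eval3 (\<theta> (lin x)) y = 0" if "dot x y = 0" for x y
  proof (cases "x = 0")
    case True
    then have "\<theta> (lin x) = 0" by (simp add: derivations_lin[OF assms] const.zero)
    then show ?thesis by (simp add: eval3.zero)
  next
    case False
    then obtain a where "cross x a = y" using ex_cross[OF False \<open>dot x y = 0\<close>] by blast
    then show ?thesis using eval_XA_to_m_gg[OF assms, of x a] by (simp add: 0 eval_XA.zero)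
  qed
  then show "\<exists>g. \<theta> = (\<lambda>f. g * euler_derivation f)" using euler_multiple_iff[OF assms] by blast
next
  assume "\<exists>g. \<theta> = (\<lambda>f. g * euler_derivation f)"
  then obtain g where g: "\<theta> = (\<lambda>f. g * euler_derivation f)" ..
  have "to_m_gg euler_derivation = (\<Sum>i\<in>UNIV. M_minor i * X_var i)"
    by (simp add: to_m_gg_def M_scale_def euler_conv_vector_field subst_M_def subst3_var ring_homomorphism_const_const)
  also have "\<dots> = 0" by (simp add: sum_UNIV_3 M_minor_conv algebra_simps)
  finally show "to_m_gg \<theta> = 0" using to_m_gg.scale[of g euler_derivation] by (simp add: g M_scale_def)
qed

section \<open>Membership in the extension of I(Z) to the larger ring\<close>

definition eval_X :: "complex ^ 3 \<Rightarrow> complex poly3 poly3 \<Rightarrow> complex poly3" where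
  "eval_X c = subst3 id (\<lambda>i. const (c $ i))"

interpretation eval_X: ring_homomorphism "eval_X c" for c
  unfolding eval_X_def by (rule ring_homomorphism_subst3[OF ring_homomorphism_id])

lemma eval3_eval_X: "eval3 (eval_X c F) a = eval_XA c a F"
proof (rule ring_homomorphism_ext)
  show "ring_homomorphism (\<lambda>F. eval3 (eval_X c F) a)"
    by (rule ring_homomorphism_comp) unfold_locales
  show "ring_homomorphism (eval_XA c a)" ..
qed (simp_all add: eval_X_def eval_XA_def subst3_const subst3_var ring_homomorphism_id ring_homomorphism_eval3)

text \<open>The coefficient in C[X] of the A-monomial \<open>a\<close>. The type nests the ring the
  other way, with A innermost, whereas I(Z) constrains the X.\<close>

definition A_coeff :: "(3 \<Rightarrow>\<^sub>0 nat) \<Rightarrow> complex poly3 poly3 \<Rightarrow> complex poly3" where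
  "A_coeff a F = Poly_Mapping.map (\<lambda>G. Poly_Mapping.lookup G a) F"

lemma lookup_A_coeff: "Poly_Mapping.lookup (A_coeff a F) m = Poly_Mapping.lookup (Poly_Mapping.lookup F m) a"
  by (simp add: A_coeff_def Poly_Mapping.map.rep_eq when_def)

lemma A_coeff_add: "A_coeff a (F + G) = A_coeff a F + A_coeff a G"
  by (rule poly_mapping_eqI) (simp add: lookup_A_coeff lookup_add)

lemma A_coeff_single: "A_coeff a (Poly_Mapping.single m G) = Poly_Mapping.single m (Poly_Mapping.lookup G a)"
  by (rule poly_mapping_eqI) (simp add: lookup_A_coeff lookup_single when_def)

lemma lookup_mult_const: "Poly_Mapping.lookup (G * const (k::complex)) a = Poly_Mapping.lookup G a * k"
proof -
  have "Poly_Mapping.lookup (const k * G) a = k * Poly_Mapping.lookup G a"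
    by (simp add: const_def mult_map_scale_conv_mult[symmetric] Poly_Mapping.map.rep_eq when_def)
  then show ?thesis by (simp add: mult.commute)
qed

lemma eval3_single: "eval3 (Poly_Mapping.single m x) c = x * (\<Prod>i\<in>UNIV. c $ i ^ Poly_Mapping.lookup m i)"
  by (simp add: eval3_def subst3_single)

lemma eval3_A_coeff: "eval3 (A_coeff a F) c = Poly_Mapping.lookup (eval_X c F) a"
proof (induction F rule: poly_mapping_single_induct)
  case zero
  have "A_coeff a 0 = 0" by (rule poly_mapping_eqI) (simp add: lookup_A_coeff)
  then show ?case by (simp add: eval_X.zero eval3.zero)
next
  case (add F G)
  then show ?case by (simp add: A_coeff_add eval3.add eval_X.add lookup_add)
next
  case (single m G)
  have "eval_X c (Poly_Mapping.single m G) = G * const (\<Prod>i\<in>UNIV. c $ i ^ Poly_Mapping.lookup m i)"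
    by (simp add: eval_X_def subst3_single const.prod const.power)
  then show ?case by (simp add: A_coeff_single eval3_single lookup_mult_const)
qed

lemma subst_X_single: "subst_X (Poly_Mapping.single m d) = Poly_Mapping.single m (const d)"
  by (simp add: subst_X_def subst3_single const.zero X_var_def single_conv_vars[of m "const d"])

lemma A_coeff_sum:
  "F = (\<Sum>a\<in>(\<Union>m\<in>Poly_Mapping.keys F. Poly_Mapping.keys (Poly_Mapping.lookup F m)).
      const (Poly_Mapping.single a 1) * subst_X (A_coeff a F))" (is "F = (\<Sum>a\<in>?A. _)")
proof -
  have fin: "finite ?A" by simp
  have "const (Poly_Mapping.single a 1) * subst_X (A_coeff a F)
      = (\<Sum>m\<in>Poly_Mapping.keys F. Poly_Mapping.single m (Poly_Mapping.single a (Poly_Mapping.lookup (Poly_Mapping.lookup F m) a)))" for a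
  proof -
    have "A_coeff a F = (\<Sum>m\<in>Poly_Mapping.keys F. Poly_Mapping.single m (Poly_Mapping.lookup (Poly_Mapping.lookup F m) a))"
      by (rule poly_mapping_eqI)
        (auto simp: lookup_A_coeff lookup_sum lookup_single when_def in_keys_iff)
    then show ?thesis
      by (simp add: subst_X.sum subst_X_single sum_distrib_left)
        (simp add: const_def mult_single)
  qed
  then have "(\<Sum>a\<in>?A. const (Poly_Mapping.single a 1) * subst_X (A_coeff a F)) =
      (\<Sum>m\<in>Poly_Mapping.keys F. \<Sum>a\<in>?A. Poly_Mapping.single m (Poly_Mapping.single a (Poly_Mapping.lookup (Poly_Mapping.lookup F m) a)))"
    by (simp only:) (rule sum.swap)
  also have "\<dots> = (\<Sum>m\<in>Poly_Mapping.keys F. Poly_Mapping.single m (Poly_Mapping.lookup F m))"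
  proof (rule sum.cong[OF refl])
    fix m assume m: "m \<in> Poly_Mapping.keys F"
    have "(\<Sum>a\<in>?A. Poly_Mapping.single a (Poly_Mapping.lookup (Poly_Mapping.lookup F m) a)) = Poly_Mapping.lookup F m"
      by (rule poly_mapping_eqI) (use m fin in \<open>auto simp: lookup_sum lookup_single when_def in_keys_iff\<close>)
    moreover have "Poly_Mapping.single m (\<Sum>a\<in>B. h a) = (\<Sum>a\<in>B. Poly_Mapping.single m (h a))" for B and h :: "_ \<Rightarrow> complex poly3"
      by (induction B rule: infinite_finite_induct) (simp_all add: single_add)
    ultimately show "(\<Sum>a\<in>?A. Poly_Mapping.single m (Poly_Mapping.single a (Poly_Mapping.lookup (Poly_Mapping.lookup F m) a))) = Poly_Mapping.single m (Poly_Mapping.lookup F m)"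
      by metis
  qed
  also have "\<dots> = F" by (rule poly_mapping_sum_single[symmetric])
  finally show ?thesis ..
qed

text \<open>Extension of an ideal to a polynomial ring is coefficientwise: \<open>F\<close> belongs
  to it exactly if its A-coefficients all lie in I(Z), and they vanish at \<open>c\<close> together
  if and only if the polynomial in A left after substituting \<open>c\<close> for X is zero.\<close>

lemma in_ideal_gen_vanishing_iff:
  "F \<in> ideal_gen (subst_X ` vanishing_ideal Z) \<longleftrightarrow> (\<forall>p\<in>Z. \<forall>c\<in>coords p. eval_X c F = 0)"
proof
  interpret module "(*) :: complex poly3 poly3 \<Rightarrow> _" by (rule module_times)
  assume F: "F \<in> span (subst_X ` vanishing_ideal Z)"
  show "\<forall>p\<in>Z. \<forall>c\<in>coords p. eval_X c F = 0"
  proof safe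
    fix p c assume "p \<in> Z" "c \<in> coords p"
    have "subspace {F. eval_X c F = 0}"
      by (rule subspaceI) (simp_all add: eval_X.hom)
    moreover have "subst_X ` vanishing_ideal Z \<subseteq> {F. eval_X c F = 0}"
    proof safe
      fix f assume f: "f \<in> vanishing_ideal Z"
      have "eval_X c (subst_X f) = const (eval3 f c)"
      proof (rule ring_homomorphism_ext[where g = "\<lambda>f. eval_X c (subst_X f)" and h = "\<lambda>f. const (eval3 f c)"])
        show "ring_homomorphism (\<lambda>f. eval_X c (subst_X f))"
          by (rule ring_homomorphism_comp) unfold_locales
        show "ring_homomorphism (\<lambda>f. const (eval3 f c))"
          by (rule ring_homomorphism_comp) unfold_locales
      qed (simp_all add: eval_X_def subst_X_def subst3_const subst3_var ring_homomorphism_const_const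
            ring_homomorphism_id X_var_def)
      then show "eval_X c (subst_X f) = 0"
        using f \<open>p \<in> Z\<close> \<open>c \<in> coords p\<close> by (auto simp: vanishing_ideal_def const.zero)
    qed
    ultimately show "eval_X c F = 0" using F span_minimal by blast
  qed
next
  interpret module "(*) :: complex poly3 poly3 \<Rightarrow> _" by (rule module_times)
  assume *: "\<forall>p\<in>Z. \<forall>c\<in>coords p. eval_X c F = 0"
  then have "A_coeff a F \<in> vanishing_ideal Z" for a
    by (simp add: vanishing_ideal_def eval3_A_coeff)
  then have "(\<Sum>a\<in>(\<Union>m\<in>Poly_Mapping.keys F. Poly_Mapping.keys (Poly_Mapping.lookup F m)).
      const (Poly_Mapping.single a 1) * subst_X (A_coeff a F)) \<in> span (subst_X ` vanishing_ideal Z)"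
    by (intro span_sum span_scale span_base imageI) simp
  then show "F \<in> span (subst_X ` vanishing_ideal Z)"
    by (simp only: A_coeff_sum[of F, symmetric])
qed

text \<open>Substituting \<open>c\<close> for X leaves \<open>\<theta> (lin c)\<close> at the points
  \<open>cross c a\<close>, and these are all points of the line dual to \<open>c\<close>.\<close>

lemma to_m_gg_in_ideal_iff:
  assumes "\<theta> \<in> derivations"
  shows "to_m_gg \<theta> \<in> ideal_gen (subst_X ` vanishing_ideal Z) \<longleftrightarrow> \<theta> \<in> D_module (arrangement Z)"
proof -
  have "eval_X c (to_m_gg \<theta>) = 0 \<longleftrightarrow> lin c dvd \<theta> (lin c)" if "c \<noteq> 0" for c
  proof
    assume 0: "eval_X c (to_m_gg \<theta>) = 0"
    show "lin c dvd \<theta> (lin c)"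
    proof (rule dvd_if_vanishes_on_plane[OF that])
      fix y assume "dot c y = 0"
      then obtain a where "cross c a = y" using ex_cross[OF \<open>c \<noteq> 0\<close> \<open>dot c y = 0\<close>] by blast
      then show "eval3 (\<theta> (lin c)) y = 0"
        using eval_XA_to_m_gg[OF assms, of c a] eval3_eval_X[of c "to_m_gg \<theta>" a] by (simp add: 0 eval3.zero)
    qed
  next
    assume "lin c dvd \<theta> (lin c)"
    then show "eval_X c (to_m_gg \<theta>) = 0"
      by (intro poly3_eq_0I) (simp add: eval3_eval_X eval_XA_to_m_gg[OF assms] eval3_dvd_lin dot_cross)
  qed
  then show ?thesis
    unfolding in_ideal_gen_vanishing_iff D_module_iff[OF assms] using coords_nonzero by blast
qed

lemma to_m_gg_piece: "to_m_gg ` piece (D0_module (arrangement Z)) e = piece (I_gg_module Z) (e + 1)"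
proof (intro equalityI subsetI)
  fix x assume "x \<in> to_m_gg ` piece (D0_module (arrangement Z)) e"
  then obtain \<theta> where x: "x = to_m_gg \<theta>" and \<theta>: "\<theta> \<in> D_module (arrangement Z)" "\<forall>l\<in>forms 1. \<theta> l \<in> forms e"
    by (auto simp: D0_module_def)
  have der: "\<theta> \<in> derivations" using \<theta> by (simp add: D_module_def)
  have "x \<in> m_gg"
    unfolding m_gg_def x to_m_gg_def by (intro to_m_gg.m2.span_sum to_m_gg.m2.span_scale to_m_gg.m2.span_base) simp
  moreover have "x \<in> m_gg_piece (e + 1)"
    using \<theta>(2) unfolding m_gg_piece_def x to_m_gg_def
    by (auto simp: linear_forms_iff[OF der] intro!: exI[of _ "\<lambda>i. \<theta> (var i)"])
  ultimately show "x \<in> piece (I_gg_module Z) (e + 1)"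
    using to_m_gg_in_ideal_iff[OF der, of Z] \<theta>(1) by (simp add: I_gg_module_def I_gg_def x)
next
  fix x assume x: "x \<in> piece (I_gg_module Z) (e + 1)"
  then obtain f where f: "x = (\<Sum>i\<in>UNIV. M_scale (f i) (X_var i))" "\<forall>i. f i \<in> forms e"
    by (auto simp: I_gg_module_def m_gg_piece_def)
  define \<theta> where "\<theta> = vector_field f"
  have der: "\<theta> \<in> derivations" by (simp add: \<theta>_def vector_field_derivation)
  have x': "x = to_m_gg \<theta>" by (simp add: to_m_gg_def \<theta>_def f)
  have "\<theta> \<in> D_module (arrangement Z)"
    using x to_m_gg_in_ideal_iff[OF der, of Z] by (simp add: I_gg_module_def I_gg_def x')
  moreover have "\<forall>l\<in>forms 1. \<theta> l \<in> forms e"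
    unfolding linear_forms_iff[OF der] using f(2) by (simp add: \<theta>_def)
  ultimately show "x \<in> to_m_gg ` piece (D0_module (arrangement Z)) e"
    using x' by (auto simp: D0_module_def)
qed

text \<open>\<open>to_m_gg\<close> sees only the values at the variables, so its kernel is described
  for derivations; the span has to stay among them.\<close>

lemma D0_span_derivations:
  "module.span (\<lambda>g \<theta> f. g * \<theta> f) (rels (D0_module A) \<union> (\<Union>e\<in>E. piece (D0_module A) e)) \<subseteq> derivations"
proof -
  have "to_m_gg.m1.subspace derivations"
    by (rule to_m_gg.m1.subspaceI) (auto simp: derivations_def algebra_simps)
  moreover have "euler_derivation \<in> derivations"
    by (simp add: euler_conv_vector_field vector_field_derivation)
  then have "rels (D0_module A) \<union> (\<Union>e\<in>E. piece (D0_module A) e) \<subseteq> derivations"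
    by (auto simp: D0_module_def D_module_def intro: derivations_scale)
  ultimately show ?thesis by (rule to_m_gg.m1.span_minimal[rotated])
qed

text \<open>The homomorphism \<open>to_m_gg\<close> matches the pieces of smaller degree, hence
  their spans. Membership in the span is also reflected, because derivations with equal images
  differ by a relation.\<close>

theorem has_generator_D0_iff_I_gg:
  "has_generator_in_degree (D0_module (arrangement Z)) a \<longleftrightarrow> has_generator_in_degree (I_gg_module Z) (a + 1)"
proof -
  let ?D = "D0_module (arrangement Z)" and ?I = "I_gg_module Z"
  let ?spanD = "module.span (\<lambda>g (\<theta> :: complex poly3 \<Rightarrow> complex poly3) f. g * \<theta> f) (rels ?D \<union> (\<Union>e\<in>{..<a}. piece ?D e))"
  let ?spanI = "module.span M_scale ({0} \<union> (\<Union>e\<in>{..<a+1}. piece ?I e))"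
  have rels: "to_m_gg ` rels ?D = {0}"
  proof -
    have "to_m_gg (\<lambda>f. g * euler_derivation f) = 0" for g
      using to_m_gg_eq_0_iff[OF derivations_scale, of euler_derivation g]
      by (auto simp: euler_conv_vector_field vector_field_derivation)
    moreover have "rels ?D = range (\<lambda>g f. g * euler_derivation f)" by (auto simp: D0_module_def)
    ultimately show ?thesis by (simp add: image_image)
  qed
  have pieces: "to_m_gg ` (\<Union>e\<in>{..<a}. piece ?D e) = (\<Union>e\<in>{..<a+1}. piece ?I e)"
  proof -
    have "(\<Union>e\<in>{..<a+1}. piece ?I e) = (\<Union>e\<in>{..<a}. piece ?I (e + 1))"
    proof safe
      fix x e assume "x \<in> piece ?I e" "e < a + 1"
      then show "x \<in> (\<Union>e\<in>{..<a}. piece ?I (e + 1))" by (intro UN_I[of "e - 1"]) auto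
    next
      fix x e assume "x \<in> piece ?I (e + 1)" "e < a"
      then show "x \<in> (\<Union>e\<in>{..<a+1}. piece ?I e)" by (intro UN_I[of "e + 1"]) auto
    qed
    then show ?thesis by (simp add: image_UN to_m_gg_piece)
  qed
  have span: "to_m_gg ` ?spanD = ?spanI"
    by (simp only: to_m_gg.span_image[symmetric] image_Un rels pieces)
  have "piece ?D a \<subseteq> ?spanD \<longleftrightarrow> piece ?I (a + 1) \<subseteq> ?spanI"
  proof
    assume "piece ?D a \<subseteq> ?spanD"
    then show "piece ?I (a + 1) \<subseteq> ?spanI"
      unfolding span[symmetric] to_m_gg_piece[symmetric] by (rule image_mono)
  next
    assume *: "piece ?I (a + 1) \<subseteq> ?spanI"
    show "piece ?D a \<subseteq> ?spanD"
    proof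
      fix \<theta> assume \<theta>: "\<theta> \<in> piece ?D a"
      then obtain \<eta> where \<eta>: "\<eta> \<in> ?spanD" "to_m_gg \<theta> = to_m_gg \<eta>"
        using * unfolding span[symmetric] to_m_gg_piece[symmetric] by blast
      have "\<eta> \<in> derivations" using \<eta>(1) D0_span_derivations by blast
      moreover have "\<theta> \<in> derivations" using \<theta> by (simp add: D0_module_def D_module_def)
      ultimately have der: "\<theta> - \<eta> \<in> derivations"
        by (auto simp: derivations_def algebra_simps)
      have "to_m_gg (\<theta> - \<eta>) = 0" using \<eta>(2) by (simp add: to_m_gg.diff)
      then have "\<theta> - \<eta> \<in> rels ?D" using to_m_gg_eq_0_iff[OF der] by (auto simp: D0_module_def)
      then have "\<theta> - \<eta> \<in> ?spanD" by (intro to_m_gg.m1.span_base) blast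
      from to_m_gg.m1.span_add[OF this \<eta>(1)] show "\<theta> \<in> ?spanD" by simp
    qed
  qed
  moreover have "scale ?D = (\<lambda>g \<theta> f. g * \<theta> f)" "scale ?I = M_scale" "rels ?I = {0}"
    by (simp_all add: D0_module_def I_gg_module_def)
  ultimately show ?thesis unfolding has_generator_in_degree_def by simp
qed

section \<open>Restriction to a line\<close>

definition vec3 :: "complex \<Rightarrow> complex \<Rightarrow> complex \<Rightarrow> complex ^ 3" where
  "vec3 a b c = (\<chi> i. if i = 0 then a else if i = 1 then b else c)"

lemma vec3_nth [simp]: "vec3 a b c $ 0 = a" "vec3 a b c $ 1 = b" "vec3 a b c $ 2 = c"
  by (simp_all add: vec3_def)

definition dehom :: "complex ^ 3 \<Rightarrow> complex ^ 3 \<Rightarrow> complex poly3 \<Rightarrow> complex poly" where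
  "dehom u v = subst3 (\<lambda>c. [:c:]) (\<lambda>i. [:u $ i, v $ i:])"

lemma ring_homomorphism_pCons: "ring_homomorphism (\<lambda>c :: complex. [:c:])"
  by unfold_locales (simp_all add: one_pCons)

interpretation dehom: ring_homomorphism "dehom u v" for u v
  unfolding dehom_def by (rule ring_homomorphism_subst3[OF ring_homomorphism_pCons])

lemma dehom_const [simp]: "dehom u v (const c) = [:c:]"
  by (simp add: dehom_def subst3_const ring_homomorphism_pCons)

lemma dehom_var [simp]: "dehom u v (var i) = [:u $ i, v $ i:]"
  by (simp add: dehom_def subst3_var ring_homomorphism_pCons)

lemma poly_eqI: "(\<And>t. poly p t = poly q t) \<Longrightarrow> p = (q :: complex poly)"
  by (metis ext poly_eq_poly_eq_iff)

lemma poly_dehom: "poly (dehom u v f) t = eval3 f (u + t *s v)"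
proof (rule ring_homomorphism_ext[where g = "\<lambda>f. poly (dehom u v f) t" and h = "\<lambda>f. eval3 f (u + t *s v)"])
  show "ring_homomorphism (\<lambda>f. poly (dehom u v f) t)"
    by (intro ring_homomorphism.intro) (simp_all add: dehom.hom)
qed (simp_all add: ring_homomorphism_eval3)

lemma dehom_lin [simp]: "dehom u v (lin a) = [:dot a u, dot a v:]"
  by (rule poly_eqI) (simp add: poly_dehom dot_simps)

lemma coeff_mult_top:
  fixes p q :: "'a::comm_semiring_0 poly"
  assumes "degree p \<le> n" "degree q \<le> m"
  shows "coeff (p * q) (n + m) = coeff p n * coeff q m"
proof -
  have "coeff (p * q) (n + m) = (\<Sum>i\<le>n + m. if i = n then coeff p n * coeff q m else 0)"
    unfolding coeff_mult
  proof (intro sum.cong refl)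
    fix i assume i: "i \<in> {..n + m}"
    consider "i < n" | "i = n" | "i > n" by linarith
    then show "coeff p i * coeff q (n + m - i) = (if i = n then coeff p n * coeff q m else 0)"
    proof cases
      case 1
      then have "coeff q (n + m - i) = 0" using assms by (intro coeff_eq_0) auto
      then show ?thesis using 1 by simp
    next
      case 3
      then have "coeff p i = 0" using assms by (intro coeff_eq_0) auto
      then show ?thesis using 3 by simp
    qed simp
  qed
  also have "\<dots> = coeff p n * coeff q m" by simp
  finally show ?thesis .
qed

lemma degree_power_linear:
  "degree ([:a, b:] ^ n :: complex poly) \<le> n \<and> coeff ([:a, b:] ^ n) n = b ^ n"
proof (induction n)
  case (Suc n)
  have "degree [:a, b:] \<le> 1" by simp
  then show ?case
    using degree_mult_le[of "[:a, b:]" "[:a, b:] ^ n"] coeff_mult_top[of "[:a, b:]" 1 "[:a, b:] ^ n" n] Suc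
    by (simp del: mult_pCons_left)
qed simp

text \<open>The coefficient in degree \<open>d\<close> is the value at the direction
  \<open>v\<close>, the point at infinity of the parametrised line. Vanishing there is read off as a
  drop of the degree.\<close>

lemma dehom_forms:
  assumes "f \<in> forms (int d)"
  shows "degree (dehom u v f) \<le> d \<and> coeff (dehom u v f) d = eval3 f v"
proof -
  let ?m = "\<lambda>m. [:Poly_Mapping.lookup f m:] * (\<Prod>i\<in>UNIV. [:u $ i, v $ i:] ^ Poly_Mapping.lookup m i)"
  have *: "degree (?m m) \<le> d \<and> coeff (?m m) d = Poly_Mapping.lookup f m * (\<Prod>i\<in>UNIV. v $ i ^ Poly_Mapping.lookup m i)"
    if "m \<in> Poly_Mapping.keys f" for m
  proof -
    have "int (\<Sum>i\<in>UNIV. Poly_Mapping.lookup m i) = int d"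
      using assms that by (auto simp: forms_def simp del: of_nat_sum)
    then have d: "d = Poly_Mapping.lookup m 0 + Poly_Mapping.lookup m 1 + Poly_Mapping.lookup m 2"
      by (simp add: sum_UNIV_3)
    let ?p = "\<lambda>i. [:u $ i, v $ i:] ^ Poly_Mapping.lookup m i"
    have 1: "degree (?p 0 * ?p 1) \<le> Poly_Mapping.lookup m 0 + Poly_Mapping.lookup m 1"
      using degree_mult_le[of "?p 0" "?p 1"] degree_power_linear by (meson add_mono le_trans)
    have 2: "degree (?p 0 * ?p 1 * ?p 2) \<le> d"
      using degree_mult_le[of "?p 0 * ?p 1" "?p 2"] 1 degree_power_linear unfolding d by (meson add_mono le_trans)
    have "coeff (?p 0 * ?p 1 * ?p 2) d = (\<Prod>i\<in>UNIV. v $ i ^ Poly_Mapping.lookup m i)"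
      unfolding d using 1 degree_power_linear by (simp add: coeff_mult_top prod_UNIV_3)
    then show ?thesis using 2 by (simp add: prod_UNIV_3 degree_smult_le order_trans[OF degree_smult_le])
  qed
  have "dehom u v f = (\<Sum>m\<in>Poly_Mapping.keys f. ?m m)" by (simp add: dehom_def subst3_def)
  then show ?thesis
    using * by (simp only: coeff_sum eval3_def subst3_def id_apply) (auto intro!: degree_sum_le sum.cong)
qed

text \<open>The lift involves \<open>lin a\<close> and \<open>lin b\<close> only: \<open>p\<close>
  is spread over the plane along the lines through their common zero, which is the centre of
  projection in \<open>evD_lift\<close>.\<close>

definition homog :: "complex ^ 3 \<Rightarrow> complex ^ 3 \<Rightarrow> nat \<Rightarrow> complex poly \<Rightarrow> complex poly3" where
  "homog a b k p = (\<Sum>j\<le>k. const (coeff p j) * (lin a ^ (k - j) * lin b ^ j))"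

lemma homog_forms: "homog a b k p \<in> forms (int k)"
  unfolding homog_def
proof (intro forms_sum forms_const_mult)
  fix j assume "j \<in> {..k}"
  then show "lin a ^ (k - j) * lin b ^ j \<in> forms (int k)"
    using forms_mult[OF forms_power_linear[OF lin_forms] forms_power_linear[OF lin_forms], of a "k - j" b j]
    by (simp add: of_nat_diff)
qed

lemma eval3_homog: "eval3 (homog a b k p) y = (\<Sum>j\<le>k. coeff p j * (dot a y ^ (k - j) * dot b y ^ j))"
  by (simp add: homog_def eval3.hom)

lemma poly_conv_sum_atMost: "degree (p :: complex poly) \<le> k \<Longrightarrow> poly p t = (\<Sum>j\<le>k. coeff p j * t ^ j)"
  unfolding poly_altdef by (rule sum.mono_neutral_left) (auto simp: coeff_eq_0)

lemma dehom_homog: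
  assumes "degree p \<le> k" "dot a u = 1" "dot a v = 0" "dot b u = 0" "dot b v = 1"
  shows "dehom u v (homog a b k p) = p"
  by (rule poly_eqI) (simp add: poly_dehom eval3_homog dot_simps assms poly_conv_sum_atMost[OF assms(1)])

text \<open>The line \<open>q \<sqdot> y = 0\<close> of the dual plane, parametrised by \<open>u + t v\<close>. The vectors \<open>u, v, w\<close> form a basis
  with dual basis \<open>l\<^sub>0, l\<^sub>1, q\<close>. The parameter \<open>lam\<close> fixes the line at infinity \<open>l\<^sub>0 \<sqdot> y = 0\<close>; \<open>\<alpha>\<close> and \<open>\<beta>\<close> are
  the slope and the intercept in the remaining affine plane.\<close>

locale line_chart =
  fixes lam \<alpha> \<beta> :: complex
begin

definition "u = vec3 1 0 \<beta>"
definition "v = vec3 (- lam) 1 \<alpha>"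
definition "w = vec3 0 0 1"
definition "l0 = vec3 1 lam 0"
definition "l1 = vec3 0 1 0"
definition "q = vec3 (- \<beta>) (- (\<beta> * lam) - \<alpha>) 1"

lemma dual_basis [simp]:
  "dot l0 u = 1" "dot l0 v = 0" "dot l0 w = 0"
  "dot l1 u = 0" "dot l1 v = 1" "dot l1 w = 0"
  "dot q u = 0" "dot q v = 0" "dot q w = 1"
  by (simp_all add: dot_3 u_def v_def w_def l0_def l1_def q_def algebra_simps)

lemma decompose: "y = dot l0 y *s u + dot l1 y *s v + dot q y *s w"
  by (simp add: vec_eq_iff all_3 dot_3 u_def v_def w_def l0_def l1_def q_def algebra_simps)

lemma decompose_dual: "y = dot u y *s l0 + dot v y *s l1 + dot w y *s q"
  by (simp add: vec_eq_iff all_3 dot_3 u_def v_def w_def l0_def l1_def q_def algebra_simps)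

lemma nonzero [simp]: "q \<noteq> 0" "v \<noteq> 0" "w \<noteq> 0" "u + t *s v \<noteq> 0" "l0 \<noteq> 0" "l1 \<noteq> 0"
proof -
  show "u + t *s v \<noteq> 0"
  proof
    assume "u + t *s v = 0"
    moreover have "dot l0 (u + t *s v) = 1" by (simp only: dot_simps dual_basis) simp
    ultimately show False by (simp add: dot_def)
  qed
qed (simp_all add: vec_eq_iff all_3 q_def v_def w_def l0_def l1_def)

abbreviation "D \<equiv> dehom u v"

definition "L = dual_line (abs_proj2 q)"
definition "pt t = abs_proj2 (u + t *s v)"
definition "inf_pt = abs_proj2 v"
definition "U0 = nonvanishing (lin l0) \<inter> L"
definition "U1 = nonvanishing (lin l1) \<inter> L"

lemma q_coords: "q \<in> coords (abs_proj2 q)" by (simp add: in_coords_abs)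
lemma pt_coords: "u + t *s v \<in> coords (pt t)" by (simp add: in_coords_abs pt_def)
lemma inf_coords: "v \<in> coords inf_pt" by (simp add: in_coords_abs inf_pt_def)

lemma pt_L [simp]: "pt t \<in> L" and inf_L [simp]: "inf_pt \<in> L"
  by (simp_all add: L_def in_dual_line_iff[OF q_coords pt_coords] in_dual_line_iff[OF q_coords inf_coords] dot_simps)

lemma L_cases:
  assumes "p \<in> L"
  obtains t where "p = pt t" | "p = inf_pt"
proof -
  define y where "y = rep_proj2 p"
  have y: "y \<in> coords p" by (simp add: y_def rep_proj2_in_coords)
  have "dot q y = 0" using assms in_dual_line_iff[OF q_coords y] by (simp add: L_def)
  then have eq: "y = dot l0 y *s u + dot l1 y *s v" using decompose[of y] by simp
  show ?thesis
  proof (cases "dot l0 y = 0")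
    case True
    then have "y = dot l1 y *s v" using eq by simp
    moreover have "dot l1 y \<noteq> 0" using calculation coords_nonzero[OF y] by auto
    ultimately have "y \<in> coords inf_pt" unfolding coords_conv[OF inf_coords] by blast
    then show ?thesis using y that(2) coords_eqD by blast
  next
    case False
    then have "y = dot l0 y *s (u + (dot l1 y / dot l0 y) *s v)"
      by (subst eq) (simp add: vector_add_ldistrib)
    then have "y \<in> coords (pt (dot l1 y / dot l0 y))"
      unfolding coords_conv[OF pt_coords] using False by blast
    then show ?thesis using y that(1) coords_eqD by blast
  qed
qed

lemma pt_nonvanishing: "f \<in> forms d \<Longrightarrow> pt t \<in> nonvanishing f \<longleftrightarrow> poly (D f) t \<noteq> 0"
  by (simp add: nonvanishing_iff[OF _ pt_coords] poly_dehom)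

lemma inf_nonvanishing: "f \<in> forms d \<Longrightarrow> inf_pt \<in> nonvanishing f \<longleftrightarrow> eval3 f v \<noteq> 0"
  by (simp add: nonvanishing_iff[OF _ inf_coords])

lemma nonvanishing_dehom:
  assumes "f \<in> forms d" "p \<in> L" "p \<in> nonvanishing f"
  shows "D f \<noteq> 0"
proof (rule L_cases[OF assms(2)])
  fix t assume "p = pt t"
  then show ?thesis using assms pt_nonvanishing[OF assms(1)] by auto
next
  assume p: "p = inf_pt"
  then have f: "eval3 f v \<noteq> 0" using assms inf_nonvanishing[OF assms(1)] by auto
  then have "d \<ge> 0" using forms_neg[of d f] assms(1) by (force simp: eval3.zero)
  then have "f \<in> forms (int (nat d))" using assms(1) by simp
  from dehom_forms[OF this, of u v] show ?thesis using f by auto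
qed

lemma U0_iff: "p \<in> U0 \<longleftrightarrow> (\<exists>t. p = pt t)"
proof
  assume p: "p \<in> U0"
  then have "p \<in> L" "p \<noteq> inf_pt" using inf_nonvanishing[OF lin_forms, of l0] by (auto simp: U0_def)
  then show "\<exists>t. p = pt t" by (elim L_cases) auto
next
  assume "\<exists>t. p = pt t"
  then show "p \<in> U0" using pt_nonvanishing[OF lin_forms] by (auto simp: U0_def)
qed

lemma pt_U1: "pt t \<in> U1 \<longleftrightarrow> t \<noteq> 0"
  using pt_nonvanishing[OF lin_forms, of t l1] by (simp add: U1_def)

lemma inf_U1: "inf_pt \<in> U1"
  using inf_nonvanishing[OF lin_forms, of l1] by (simp add: U1_def)

abbreviation "opn \<equiv> openin (subtopology zariski L)"

lemma open_nonvanishing: "f \<in> forms d \<Longrightarrow> opn (nonvanishing f \<inter> L)"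
  using openin_zariski_nonvanishing by (auto simp: openin_subtopology)

lemma open_U: "opn U0" "opn U1" "opn (U0 \<inter> U1)"
  unfolding U0_def U1_def by (auto intro!: open_nonvanishing[OF lin_forms] openin_Int)

lemma open_cofinite:
  assumes "opn V" "p \<in> V"
  shows "finite {t. pt t \<notin> V}"
proof -
  obtain T where T: "openin zariski T" "V = T \<inter> L"
    using assms(1) by (auto simp: openin_subtopology)
  then obtain f d where f: "f \<in> forms d" "p \<in> nonvanishing f" "nonvanishing f \<subseteq> T"
    using zariski_basis[OF T(1)] assms(2) by blast
  have "D f \<noteq> 0" using nonvanishing_dehom[OF f(1) _ f(2)] assms(2) T by blast
  then have "finite {t. poly (D f) t = 0}" by (rule poly_roots_finite)
  moreover have "{t. pt t \<notin> V} \<subseteq> {t. poly (D f) t = 0}"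
    using f T pt_nonvanishing[OF f(1)] by auto
  ultimately show ?thesis by (rule finite_subset[rotated])
qed

text \<open>Irreducibility of the line: by \<open>open_cofinite\<close> a nonempty open set misses
  only finitely many affine points. Two local representations of a section are compared at such a
  common point.\<close>

lemma open_common_point:
  assumes "opn V" "p \<in> V" "opn W" "r \<in> W" "finite E"
  obtains t where "pt t \<in> V" "pt t \<in> W" "t \<notin> E"
proof -
  have "finite ({t. pt t \<notin> V} \<union> {t. pt t \<notin> W} \<union> E)"
    using open_cofinite assms by simp
  then obtain t where "t \<notin> {t. pt t \<notin> V} \<union> {t. pt t \<notin> W} \<union> E"
    using infinite_UNIV_char_0[where 'a=complex] by (meson ex_new_if_finite)
  then show ?thesis using that by blast
qed

text \<open>\<open>OL\<close> represents the structure sheaf of the line.\<close>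

abbreviation "OL \<equiv> restrict_to L polynomial_module"

lemma vanishing_ideal_L: "f \<in> vanishing_ideal L \<longleftrightarrow> lin q dvd f"
  unfolding L_def by (rule vanishing_ideal_dual_line[OF q_coords])

lemma dehom_vanishing_ideal: "f \<in> vanishing_ideal L \<Longrightarrow> D f = 0"
  unfolding vanishing_ideal_L by (auto simp: dehom.mult elim!: dvdE)

lemma dehom_eq_0_imp:
  assumes "f \<in> forms d" "D f = 0"
  shows "lin q dvd f"
proof (rule dvd_if_vanishes_on_plane)
  fix y assume "dot q y = 0" "y \<noteq> 0"
  then have "abs_proj2 y \<in> L" unfolding L_def by (simp add: in_dual_line_iff[OF q_coords in_coords_abs])
  then have "abs_proj2 y \<notin> nonvanishing f" using nonvanishing_dehom[OF assms(1)] assms(2) by blast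
  then show "eval3 f y = 0" using nonvanishing_iff[OF assms(1) in_coords_abs] \<open>y \<noteq> 0\<close> by blast
qed simp

lemma dehom_rels_O: 
  assumes "x \<in> rels OL"
  shows "D x = 0"
proof -
  interpret module "(*) :: complex poly3 \<Rightarrow> _" by (rule module_times)
  have "subspace {x. D x = 0}" by (rule subspaceI) (simp_all add: dehom.hom)
  moreover have "rels OL = span ({0} \<union> {g * x | g x d. g \<in> vanishing_ideal L \<and> x \<in> forms d})"
    by (simp add: restrict_to_def polynomial_module_def)
  moreover have "{0} \<union> {g * x | g x d. g \<in> vanishing_ideal L \<and> x \<in> forms d} \<subseteq> {x. D x = 0}"
    by (auto simp: dehom.hom dehom_vanishing_ideal)
  ultimately show ?thesis using assms span_minimal by blast
qed

lemma fraction_O_self: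
  "a \<in> forms d \<Longrightarrow> f \<in> forms d \<Longrightarrow> p \<in> nonvanishing f \<Longrightarrow> (a, f) \<in> fraction OL p a f"
proof -
  interpret module "(*) :: complex poly3 \<Rightarrow> _" by (rule module_times)
  assume *: "a \<in> forms d" "f \<in> forms d" "p \<in> nonvanishing f"
  have "0 \<in> rels OL" by (simp add: restrict_to_def polynomial_module_def span_zero)
  moreover have "p \<in> nonvanishing 1" by (auto simp: nonvanishing_def eval3.one)
  moreover have "\<exists>d. a \<in> piece OL d \<and> f \<in> forms d" using * by (auto simp: restrict_to_def polynomial_module_def)
  moreover have "scale OL 1 (scale OL f a - scale OL f a) = 0" by (simp add: restrict_to_def polynomial_module_def)
  ultimately show ?thesis using * forms_1 unfolding fraction_def by (metis (mono_tags, lifting) case_prodI mem_Collect_eq)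
qed

lemma fraction_O_D:
  assumes "(a', f') \<in> fraction OL p a f" "p \<in> L"
  shows "D f' * D a = D f * D a'" "\<exists>d. a' \<in> forms d \<and> f' \<in> forms d" "p \<in> nonvanishing f'"
proof -
  obtain h e where h: "h \<in> forms e" "p \<in> nonvanishing h" "h * (f' * a - f * a') \<in> rels OL"
    using assms(1) by (auto simp: fraction_def restrict_to_def polynomial_module_def)
  have "D h * (D f' * D a - D f * D a') = 0"
    using dehom_rels_O[OF h(3)] by (simp add: dehom.hom)
  then show "D f' * D a = D f * D a'" using nonvanishing_dehom[OF h(1) assms(2) h(2)] by simp
qed (use assms in \<open>auto simp: fraction_def restrict_to_def polynomial_module_def\<close>)

definition unit_section :: "complex poly3 \<Rightarrow> complex poly3 \<Rightarrow> proj2 set \<Rightarrow> complex poly3 sect" where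
  "unit_section a f U = (\<lambda>p. if p \<in> U then fraction OL p a f else {})"

lemma unit_section_in:
  assumes "a \<in> forms d" "f \<in> forms d" "opn U" "U \<subseteq> nonvanishing f"
  shows "unit_section a f U \<in> sections L OL U"
proof -
  have "a \<in> piece OL d" using assms by (simp add: restrict_to_def polynomial_module_def)
  moreover have "\<forall>r\<in>U. r \<in> nonvanishing f \<and> unit_section a f U r = fraction OL r a f"
    using assms by (auto simp only: unit_section_def if_True)
  ultimately have "\<forall>p\<in>U. \<exists>V x f' d. opn V \<and> p \<in> V \<and> V \<subseteq> U \<and> x \<in> piece OL d \<and> f' \<in> forms d \<and>
        (\<forall>r\<in>V. r \<in> nonvanishing f' \<and> unit_section a f U r = fraction OL r x f')"
    using assms by blast
  then show ?thesis unfolding sections_def by (simp add: unit_section_def)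
qed

lemma restr_sections:
  assumes "s \<in> sections L M U" "opn V" "V \<subseteq> U"
  shows "restr V s \<in> sections L M V"
  unfolding sections_def
proof (intro CollectI conjI allI impI ballI)
  fix p assume "p \<in> V"
  then obtain W x f d where W: "opn W" "p \<in> W" "x \<in> piece M d" "f \<in> forms d"
      "\<forall>r\<in>W. r \<in> nonvanishing f \<and> s r = fraction M r x f"
    using assms(1,3) unfolding sections_def by blast
  then show "\<exists>W x f d. opn W \<and> p \<in> W \<and> W \<subseteq> V \<and> x \<in> piece M d \<and> f \<in> forms d \<and>
        (\<forall>r\<in>W. r \<in> nonvanishing f \<and> restr V s r = fraction M r x f)"
    using \<open>p \<in> V\<close> by (intro exI[of _ "W \<inter> V"] exI[of _ x] exI[of _ f] exI[of _ d])
      (auto simp: restr_def openin_Int assms)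
qed (simp add: restr_def)

end

text \<open>The bound may be negative, and then only 0 satisfies it; \<open>degree 0 = 0\<close>
  alone would not give a vector space of the expected dimension.\<close>

definition bd :: "int \<Rightarrow> complex poly \<Rightarrow> bool" where
  "bd m p \<longleftrightarrow> p = 0 \<or> int (degree p) \<le> m"

abbreviation psc :: "complex poly \<Rightarrow> complex poly \<times> complex poly \<Rightarrow> complex poly \<times> complex poly" where
  "psc F X \<equiv> (F * fst X, F * snd X)"

text \<open>\<open>P0 / F0\<close> is a rational function that near each point has a representation
  without a pole there. After cancelling the gcd, a root of the denominator would be a root of every
  such \<open>F\<close>, so the denominator is constant.\<close>

lemma dvd_if_no_poles:
  fixes F0 P0 :: "complex poly"
  assumes "F0 \<noteq> 0" "\<And>t. \<exists>F P. poly F t \<noteq> 0 \<and> F0 * P = F * P0"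
  shows "F0 dvd P0"
proof -
  define g where "g = gcd F0 P0"
  have "g \<noteq> 0" using assms(1) by (simp add: g_def)
  then obtain F1 P1 where F1: "F0 = F1 * g" and P1: "P0 = P1 * g" and cop: "coprime F1 P1"
    unfolding g_def using gcd_coprime_exists[of F0 P0] by blast
  have "\<not> poly F1 t = 0" for t
  proof
    assume 0: "poly F1 t = 0"
    obtain F P where F: "poly F t \<noteq> 0" "F0 * P = F * P0" using assms(2) by blast
    then have "g * (F1 * P) = g * (F * P1)" by (simp add: F1 P1 mult_ac)
    then have "F1 * P = F * P1" using \<open>g \<noteq> 0\<close> by simp
    then have "F1 dvd F" using coprime_dvd_mult_left_iff[OF cop, of F] by (metis dvd_triv_left)
    then show False using 0 F(1) by (auto elim!: dvdE)
  qed
  then have "constant (poly F1)" using fundamental_theorem_of_algebra by blast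
  then have "degree F1 = 0" by (simp add: constant_degree)
  moreover have "F1 \<noteq> 0" using assms(1) F1 by auto
  ultimately have "F1 dvd 1" by (metis is_unit_iff_degree)
  then have "F1 dvd P1" using one_dvd dvd_trans by blast
  then show ?thesis unfolding F1 P1 by (rule mult_dvd_mono) simp
qed

section \<open>Sections of a sheaf on a line\<close>

text \<open>A module whose associated sheaf on the line has rank two and no torsion: \<open>ev\<close> sends elements to
  pairs of univariate polynomials with kernel \<open>rels M\<close>, the sheaf away from the point at infinity
  corresponds to the lattice \<open>Lat\<close>, and \<open>n\<^sub>1\<close>, \<open>n\<^sub>2\<close> measure the pole orders at infinity.\<close>

locale line_sheaf = line_chart lam \<alpha> \<beta> for lam \<alpha> \<beta> :: complex +
  fixes M :: "'b::ab_group_add gmodule"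
    and ev :: "'b \<Rightarrow> complex poly \<times> complex poly"
    and n1 n2 :: int
    and Lat :: "(complex poly \<times> complex poly) set"
  assumes piece_scale: "f \<in> forms d \<Longrightarrow> x \<in> piece M e \<Longrightarrow> scale M f x \<in> piece M (d + e)"
    and piece_add: "x \<in> piece M d \<Longrightarrow> y \<in> piece M d \<Longrightarrow> x + y \<in> piece M d"
    and piece_diff: "x \<in> piece M d \<Longrightarrow> y \<in> piece M d \<Longrightarrow> x - y \<in> piece M d"
    and ev_scale: "x \<in> piece M d \<Longrightarrow> ev (scale M f x) = psc (D f) (ev x)"
    and ev_add: "ev (x + y) = ev x + ev y"
    and ev_diff: "ev (x - y) = ev x - ev y"
    and rels_iff: "x \<in> piece M d \<Longrightarrow> x \<in> rels M \<longleftrightarrow> ev x = 0"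
    and ev_Lat: "x \<in> piece M d \<Longrightarrow> ev x \<in> Lat"
    and ev_bd: "x \<in> piece M d \<Longrightarrow> bd (d + n1) (fst (ev x)) \<and> bd (d + n2) (snd (ev x))"
    and Lat_local: "(\<And>t. \<exists>F. poly F t \<noteq> 0 \<and> psc F X \<in> Lat) \<Longrightarrow> X \<in> Lat"
    and lift: "X \<in> Lat \<Longrightarrow> bd (int k + n1) (fst X) \<Longrightarrow> bd (int k + n2) (snd X) \<Longrightarrow> p \<in> L \<Longrightarrow>
      \<exists>e g x. g \<in> forms e \<and> p \<in> nonvanishing g \<and> x \<in> piece M (e + int k) \<and> ev x = psc (D g) X"
begin

text \<open>All fractions whose value along the line is the pair of rational functions X / F.
  Computations with \<open>fraction\<close> become computations with these values.\<close>

definition cls :: "complex poly \<Rightarrow> complex poly \<times> complex poly \<Rightarrow> proj2 \<Rightarrow> ('b \<times> complex poly3) set" where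
  "cls F X p = {(y, g). (\<exists>d. y \<in> piece M d \<and> g \<in> forms d) \<and> p \<in> nonvanishing g \<and> psc F (ev y) = psc (D g) X}"

lemma clsE:
  assumes "(y, g) \<in> cls F X p"
  obtains d where "y \<in> piece M d" "g \<in> forms d" "p \<in> nonvanishing g"
    "F * fst (ev y) = D g * fst X" "F * snd (ev y) = D g * snd X"
  using assms by (auto simp: cls_def)

lemma cls_eqI:
  assumes "F \<noteq> 0" "F' \<noteq> 0" "psc F' X = psc F X'"
  shows "cls F X p = cls F' X' p"
proof -
  have 1: "F' * fst X = F * fst X'" "F' * snd X = F * snd X'" using assms(3) by auto
  have "F * a = g * x \<longleftrightarrow> F' * a = g * x'" if "F' * x = F * x'" for a g x x'
  proof -
    have "F' * (F * a) = F * (F' * a)" by (rule mult.left_commute)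
    moreover have "F' * (g * x) = F * (g * x')" using that by (metis mult.left_commute)
    ultimately show ?thesis
      using mult_left_cancel[OF assms(2), of "F * a" "g * x"] mult_left_cancel[OF assms(1), of "F' * a" "g * x'"] by metis
  qed
  from this[OF 1(1)] this[OF 1(2)] show ?thesis by (simp add: cls_def)
qed

lemma cls_eqD:
  assumes "cls F X p = cls F' X' p" "cls F X p \<noteq> {}" "p \<in> L"
  shows "psc F' X = psc F X'"
proof -
  obtain y g where "(y, g) \<in> cls F X p" using assms(2) by auto
  moreover from this have "(y, g) \<in> cls F' X' p" using assms(1) by simp
  ultimately obtain d where *: "g \<in> forms d" "p \<in> nonvanishing g"
    "F * fst (ev y) = D g * fst X" "F * snd (ev y) = D g * snd X"
    "F' * fst (ev y) = D g * fst X'" "F' * snd (ev y) = D g * snd X'"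
    by (auto elim!: clsE)
  have g: "D g \<noteq> 0" using nonvanishing_dehom[OF *(1) assms(3) *(2)] .
  have "F' * x = F * x'" if "F * a = D g * x" "F' * a = D g * x'" for a x x'
  proof -
    have "D g * (F' * x) = F' * (F * a)" by (simp add: that(1) mult.left_commute)
    also have "\<dots> = F * (F' * a)" by (rule mult.left_commute)
    also have "\<dots> = D g * (F * x')" by (simp add: that(2) mult.left_commute)
    finally show ?thesis using g by simp
  qed
  from this[OF *(3,5)] this[OF *(4,6)] show ?thesis by simp
qed

text \<open>The auxiliary multiplier \<open>h\<close> in \<open>fraction\<close> restricts to a
  nonzero polynomial, and \<open>ev\<close> has kernel \<open>rels M\<close>; hence \<open>h\<close>
  cancels and equality of fractions is equality of values.\<close>

lemma fraction_conv_cls: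
  assumes "x \<in> piece M d" "f \<in> forms d" "p \<in> nonvanishing f" "p \<in> L"
  shows "fraction M p x f = cls (D f) (ev x) p"
proof -
  have f: "D f \<noteq> 0" using nonvanishing_dehom[OF assms(2,4,3)] .
  have "(\<exists>h e. h \<in> forms e \<and> p \<in> nonvanishing h \<and> scale M h (scale M g x - scale M f y) \<in> rels M)
     \<longleftrightarrow> psc (D f) (ev y) = psc (D g) (ev x)" (is "?A \<longleftrightarrow> ?B")
    if y: "y \<in> piece M d'" "g \<in> forms d'" for y g d'
  proof -
    have "scale M g x \<in> piece M (d' + d)" using piece_scale y assms by blast
    moreover have "scale M f y \<in> piece M (d' + d)" using piece_scale[OF assms(2) y(1)] by (simp add: add.commute)
    ultimately have z: "scale M g x - scale M f y \<in> piece M (d' + d)" by (rule piece_diff)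
    have evz: "ev (scale M g x - scale M f y) = psc (D g) (ev x) - psc (D f) (ev y)"
      by (simp add: ev_diff ev_scale[OF assms(1)] ev_scale[OF y(1)])
    have *: "scale M h (scale M g x - scale M f y) \<in> rels M \<longleftrightarrow>
        psc (D h) (psc (D g) (ev x) - psc (D f) (ev y)) = 0" if "h \<in> forms e" for h e
      using rels_iff[OF piece_scale[OF that z]] by (simp add: ev_scale[OF z] evz)
    show ?thesis
    proof
      assume ?A
      then obtain h e where h: "h \<in> forms e" "p \<in> nonvanishing h"
        "psc (D h) (psc (D g) (ev x) - psc (D f) (ev y)) = 0" using * by blast
      have "D h \<noteq> 0" using nonvanishing_dehom[OF h(1) assms(4) h(2)] .
      then show ?B using h(3) by (simp add: zero_prod_def)
    next
      assume B: ?B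
      have "p \<in> nonvanishing 1" by (auto simp: nonvanishing_def eval3.one)
      moreover have "scale M 1 (scale M g x - scale M f y) \<in> rels M"
        using B by (subst *[OF forms_1]) (simp add: zero_prod_def)
      ultimately show ?A using forms_1 by blast
    qed
  qed
  then show ?thesis unfolding fraction_def cls_def by blast
qed

lemma fraction_self:
  assumes "x \<in> piece M d" "f \<in> forms d" "p \<in> nonvanishing f" "p \<in> L"
  shows "(x, f) \<in> fraction M p x f"
  unfolding fraction_conv_cls[OF assms] using assms by (auto simp: cls_def)

text \<open>\<open>fraction_add\<close> and \<open>fraction_scale\<close> are unions over all
  representatives; well-definedness means that all sets in the union agree.\<close>

lemma UN_const: "C \<noteq> {} \<Longrightarrow> (\<And>c. c \<in> C \<Longrightarrow> B c = K) \<Longrightarrow> (\<Union>c\<in>C. B c) = K"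
  by auto

lemma fraction_add_cls:
  assumes "p \<in> L" "cls F X p \<noteq> {}" "cls F' X' p \<noteq> {}" "F \<noteq> 0" "F' \<noteq> 0"
  shows "fraction_add M p (cls F X p) (cls F' X' p) = cls (F * F') (psc F' X + psc F X') p"
  unfolding fraction_add_def
proof (intro UN_const assms(2))
  fix c assume "c \<in> cls F X p"
  then obtain x f where c: "c = (x, f)" "(x, f) \<in> cls F X p" by (cases c) auto
  then obtain d where x: "x \<in> piece M d" "f \<in> forms d" "p \<in> nonvanishing f"
    "F * fst (ev x) = D f * fst X" "F * snd (ev x) = D f * snd X" by (elim clsE)
  have "(\<Union>(y, g)\<in>cls F' X' p. fraction M p (scale M g x + scale M f y) (f * g)) = cls (F * F') (psc F' X + psc F X') p"
  proof (intro UN_const assms(3))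
    fix c' assume "c' \<in> cls F' X' p"
    then obtain y g where c': "c' = (y, g)" "(y, g) \<in> cls F' X' p" by (cases c') auto
    then obtain e where y: "y \<in> piece M e" "g \<in> forms e" "p \<in> nonvanishing g"
      "F' * fst (ev y) = D g * fst X'" "F' * snd (ev y) = D g * snd X'" by (elim clsE)
    have "scale M g x \<in> piece M (d + e)" using piece_scale[OF y(2) x(1)] by (simp add: add.commute)
    then have z: "scale M g x + scale M f y \<in> piece M (d + e)" using piece_scale[OF x(2) y(1)] by (rule piece_add)
    have fg: "f * g \<in> forms (d + e)" "p \<in> nonvanishing (f * g)"
      using x y by (auto intro: forms_mult simp: nonvanishing_mult[symmetric])
    have ev: "ev (scale M g x + scale M f y) = psc (D g) (ev x) + psc (D f) (ev y)"
      by (simp add: ev_add ev_scale[OF x(1)] ev_scale[OF y(1)])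
    have *: "F * F' * (D g * a + D f * b) = D f * D g * (F' * s + F * t)"
      if "F * a = D f * s" "F' * b = D g * t" for a b s t
    proof -
      have "F * F' * (D g * a + D f * b) = F' * D g * (F * a) + F * D f * (F' * b)" by (simp add: algebra_simps)
      also have "\<dots> = D f * D g * (F' * s + F * t)" unfolding that by (simp add: algebra_simps)
      finally show ?thesis .
    qed
    have "cls (D (f * g)) (ev (scale M g x + scale M f y)) p = cls (F * F') (psc F' X + psc F X') p"
    proof (rule cls_eqI)
      show "D (f * g) \<noteq> 0" using nonvanishing_dehom[OF fg(1) assms(1) fg(2)] .
      show "F * F' \<noteq> 0" using assms by simp
      show "psc (F * F') (ev (scale M g x + scale M f y)) = psc (D (f * g)) (psc F' X + psc F X')"
        using *[OF x(4) y(4)] *[OF x(5) y(5)] by (simp add: ev dehom.mult)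
    qed
    then show "(case c' of (y, g) \<Rightarrow> fraction M p (scale M g x + scale M f y) (f * g)) = cls (F * F') (psc F' X + psc F X') p"
      by (simp add: c' fraction_conv_cls[OF z fg assms(1)])
  qed
  then show "(case c of (x, f) \<Rightarrow> \<Union>(y, g)\<in>cls F' X' p. fraction M p (scale M g x + scale M f y) (f * g))
      = cls (F * F') (psc F' X + psc F X') p" by (simp add: c)
qed

lemma fraction_scale_cls:
  assumes "p \<in> L" "cls F X p \<noteq> {}" "F \<noteq> 0" "a \<in> forms d0" "f0 \<in> forms d0" "p \<in> nonvanishing f0"
  shows "fraction_scale M p (fraction OL p a f0) (cls F X p) = cls (D f0 * F) (psc (D a) X) p"
  unfolding fraction_scale_def
proof (intro UN_const)
  show "fraction OL p a f0 \<noteq> {}" using fraction_O_self[OF assms(4,5,6)] by blast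
  have f0: "D f0 \<noteq> 0" using nonvanishing_dehom[OF assms(5,1,6)] .
  fix c assume "c \<in> fraction OL p a f0"
  then obtain a' f where c: "c = (a', f)" "(a', f) \<in> fraction OL p a f0" by (cases c) auto
  obtain d where a': "a' \<in> forms d" "f \<in> forms d" "p \<in> nonvanishing f" "D f * D a = D f0 * D a'"
    using fraction_O_D[OF c(2) assms(1)] by blast
  have "(\<Union>(x, g)\<in>cls F X p. fraction M p (scale M a' x) (f * g)) = cls (D f0 * F) (psc (D a) X) p"
  proof (intro UN_const assms(2))
    fix c' assume "c' \<in> cls F X p"
    then obtain y g where c': "c' = (y, g)" "(y, g) \<in> cls F X p" by (cases c') auto
    then obtain e where y: "y \<in> piece M e" "g \<in> forms e" "p \<in> nonvanishing g"
      "F * fst (ev y) = D g * fst X" "F * snd (ev y) = D g * snd X" by (elim clsE)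
    have z: "scale M a' y \<in> piece M (d + e)" using piece_scale[OF a'(1) y(1)] .
    have fg: "f * g \<in> forms (d + e)" "p \<in> nonvanishing (f * g)"
      using a' y by (auto intro: forms_mult simp: nonvanishing_mult[symmetric])
    have *: "D f0 * F * (D a' * b) = D f * D g * (D a * t)" if "F * b = D g * t" for b t
    proof -
      have "D f0 * F * (D a' * b) = (D f0 * D a') * (F * b)" by (simp add: algebra_simps)
      also have "\<dots> = D f * D g * (D a * t)" unfolding that a'(4)[symmetric] by (simp add: algebra_simps)
      finally show ?thesis .
    qed
    have "cls (D (f * g)) (ev (scale M a' y)) p = cls (D f0 * F) (psc (D a) X) p"
    proof (rule cls_eqI)
      show "D (f * g) \<noteq> 0" using nonvanishing_dehom[OF fg(1) assms(1) fg(2)] .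
      show "D f0 * F \<noteq> 0" using assms f0 by simp
      show "psc (D f0 * F) (ev (scale M a' y)) = psc (D (f * g)) (psc (D a) X)"
        using *[OF y(4)] *[OF y(5)] by (simp add: ev_scale[OF y(1)] dehom.mult)
    qed
    then show "(case c' of (x, g) \<Rightarrow> fraction M p (scale M a' x) (f * g)) = cls (D f0 * F) (psc (D a) X) p"
      by (simp add: c' fraction_conv_cls[OF z fg assms(1)])
  qed
  then show "(case c of (a, f) \<Rightarrow> \<Union>(x, g)\<in>cls F X p. fraction M p (scale M a x) (f * g))
      = cls (D f0 * F) (psc (D a) X) p" by (simp add: c)
qed

section \<open>Global sections of the twists\<close>

definition global :: "nat \<Rightarrow> (complex poly \<times> complex poly) set" where
  "global k = {X \<in> Lat. bd (int k + n1) (fst X) \<and> bd (int k + n2) (snd X)}"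

definition sec0 :: "complex poly \<times> complex poly \<Rightarrow> 'b sect" where
  "sec0 X = (\<lambda>p. if p \<in> U0 then cls 1 X p else {})"

definition sec1 :: "nat \<Rightarrow> complex poly \<times> complex poly \<Rightarrow> 'b sect" where
  "sec1 k X = (\<lambda>p. if p \<in> U1 then cls ([:0, 1:] ^ k) X p else {})"

text \<open>The transition function of the \<open>k\<close>-th twist: it takes the coordinate with
  respect to the k-th power of l0 to that with respect to the k-th power of l1.\<close>

definition trans :: "nat \<Rightarrow> complex poly3 sect" where
  "trans k = unit_section (lin l0 ^ k) (lin l1 ^ k) (U0 \<inter> U1)"

text \<open>A global section of the \<open>k\<close>-th twist, given by its restriction to \<open>U0\<close>.\<close>

definition twisted :: "nat \<Rightarrow> 'b sect set" where
  "twisted k = {s \<in> sections L M U0. \<exists>t\<in>sections L M U1.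
     (\<lambda>p. fraction_scale M p (trans k p) (restr (U0 \<inter> U1) s p)) = restr (U0 \<inter> U1) t}"

lemma dehom_l0 [simp]: "D (lin l0) = 1" and dehom_l1 [simp]: "D (lin l1) = [:0, 1:]"
  by (simp_all add: one_pCons)

lemma lin_power_forms: "lin a ^ k \<in> forms (int k)"
  by (rule forms_power_linear) (rule lin_forms)

lemma nonvanishing_power: "p \<in> nonvanishing f \<Longrightarrow> p \<in> nonvanishing (f ^ k)"
  by (auto simp: nonvanishing_def eval3.power)

lemma global_lift:
  assumes "X \<in> global k" "p \<in> L" "p \<in> nonvanishing (lin l)"
  obtains x g d where "x \<in> piece M d" "g * lin l ^ k \<in> forms d" "p \<in> nonvanishing (g * lin l ^ k)" "ev x = psc (D g) X"
proof -
  obtain e g x where *: "g \<in> forms e" "p \<in> nonvanishing g" "x \<in> piece M (e + int k)" "ev x = psc (D g) X"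
    using lift[of X k p] assms by (auto simp: global_def)
  moreover have "p \<in> nonvanishing (g * lin l ^ k)"
    unfolding nonvanishing_mult[symmetric] using *(2) nonvanishing_power[OF assms(3)] by blast
  ultimately show ?thesis using that forms_mult[OF *(1) lin_power_forms] by blast
qed

lemma X_power_neq_0: "[:0, 1 :: complex:] ^ k \<noteq> 0" by simp

lemma sec_in_sections:
  assumes X: "X \<in> global k" and U: "opn U" "U \<subseteq> L" "U \<subseteq> nonvanishing (lin l)"
    and l: "D (lin l) ^ k \<noteq> 0"
  shows "(\<lambda>p. if p \<in> U then cls (D (lin l) ^ k) X p else {}) \<in> sections L M U" (is "?s \<in> _")
    and "p \<in> U \<Longrightarrow> cls (D (lin l) ^ k) X p \<noteq> {}"
proof -
  have *: "\<exists>x f d. x \<in> piece M d \<and> f \<in> forms d \<and> p \<in> nonvanishing f \<and> psc (D (lin l) ^ k) (ev x) = psc (D f) X"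
    if p: "p \<in> U" for p
  proof -
    obtain x g d where g: "x \<in> piece M d" "g * lin l ^ k \<in> forms d" "p \<in> nonvanishing (g * lin l ^ k)" "ev x = psc (D g) X"
      by (rule global_lift[OF X, of p l]) (use p U in auto)
    moreover have "psc (D (lin l) ^ k) (ev x) = psc (D (g * lin l ^ k)) X"
      by (simp only: g(4) dehom.mult dehom.power fst_conv snd_conv mult_ac)
    ultimately show ?thesis by blast
  qed
  show "p \<in> U \<Longrightarrow> cls (D (lin l) ^ k) X p \<noteq> {}"
    using *[of p] unfolding cls_def by blast
  have "\<exists>V x f d. opn V \<and> p \<in> V \<and> V \<subseteq> U \<and> x \<in> piece M d \<and> f \<in> forms d \<and>
      (\<forall>r\<in>V. r \<in> nonvanishing f \<and> ?s r = fraction M r x f)" if p: "p \<in> U" for p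
  proof -
    obtain x f d where f: "x \<in> piece M d" "f \<in> forms d" "p \<in> nonvanishing f" "psc (D (lin l) ^ k) (ev x) = psc (D f) X"
      using *[OF p] by blast
    have "opn (U \<inter> (nonvanishing f \<inter> L))" using U(1) open_nonvanishing[OF f(2)] by (rule openin_Int)
    moreover have "?s r = fraction M r x f" if "r \<in> U \<inter> (nonvanishing f \<inter> L)" for r
    proof -
      have "D f \<noteq> 0" using nonvanishing_dehom[OF f(2)] that by blast
      then have "cls (D f) (ev x) r = cls (D (lin l) ^ k) X r" using f(4) l by (intro cls_eqI) auto
      then show ?thesis using that fraction_conv_cls[OF f(1,2), of r] by simp
    qed
    ultimately show ?thesis using f p U(2)
      by (intro exI[of _ "U \<inter> (nonvanishing f \<inter> L)"] exI[of _ x] exI[of _ f] exI[of _ d]) auto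
  qed
  then show "?s \<in> sections L M U" unfolding sections_def by simp
qed

lemma U_subset: "U0 \<subseteq> L" "U0 \<subseteq> nonvanishing (lin l0)" "U1 \<subseteq> L" "U1 \<subseteq> nonvanishing (lin l1)"
  by (auto simp: U0_def U1_def)

lemma sec0_in: "X \<in> global k \<Longrightarrow> sec0 X \<in> sections L M U0"
  using sec_in_sections(1)[of X k U0 l0, unfolded dehom_l0 power_one] open_U U_subset by (simp add: sec0_def)

lemma sec0_nonempty: "X \<in> global k \<Longrightarrow> p \<in> U0 \<Longrightarrow> cls 1 X p \<noteq> {}"
  using sec_in_sections(2)[of X k U0 l0 p, unfolded dehom_l0 power_one] open_U U_subset by simp

lemma sec1_in: "X \<in> global k \<Longrightarrow> sec1 k X \<in> sections L M U1"
  using sec_in_sections(1)[of X k U1 l1, unfolded dehom_l1] open_U U_subset X_power_neq_0 by (simp add: sec1_def)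

lemma trans_cls:
  assumes "p \<in> U0 \<inter> U1" "cls F X p \<noteq> {}" "F \<noteq> 0"
  shows "fraction_scale M p (trans k p) (cls F X p) = cls ([:0, 1:] ^ k * F) X p"
proof -
  have "p \<in> L" "p \<in> nonvanishing (lin l1 ^ k)" using assms(1) U_subset nonvanishing_power by blast+
  from fraction_scale_cls[OF this(1) assms(2,3) lin_power_forms lin_power_forms this(2), of l0] show ?thesis
    using assms(1) by (simp add: trans_def unit_section_def dehom.power del: dehom_lin)
qed

lemma fraction_scale_empty: "fraction_scale M p {} Y = {}"
  by (simp add: fraction_scale_def)

lemma sec0_twisted:
  assumes "X \<in> global k"
  shows "sec0 X \<in> twisted k"
proof -
  have "(\<lambda>p. fraction_scale M p (trans k p) (restr (U0 \<inter> U1) (sec0 X) p)) = restr (U0 \<inter> U1) (sec1 k X)"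
  proof
    fix p show "fraction_scale M p (trans k p) (restr (U0 \<inter> U1) (sec0 X) p) = restr (U0 \<inter> U1) (sec1 k X) p"
    proof (cases "p \<in> U0 \<inter> U1")
      case True
      then show ?thesis using trans_cls[OF True, of 1 X k] sec0_nonempty[OF assms, of p]
        by (simp add: restr_def sec0_def sec1_def)
    next
      case False
      then have "trans k p = {}" "restr (U0 \<inter> U1) (sec1 k X) p = {}"
        by (auto simp: trans_def unit_section_def restr_def)
      then show ?thesis by (simp add: fraction_scale_empty)
    qed
  qed
  then show ?thesis using sec0_in[OF assms] sec1_in[OF assms] by (auto simp: twisted_def)
qed

lemma sec0_inj:
  assumes "X \<in> global k" "sec0 X = sec0 Y"
  shows "X = Y"
proof -
  have "pt 0 \<in> U0" "pt 0 \<in> L" by (auto simp: U0_iff)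
  moreover have "cls 1 X (pt 0) = cls 1 Y (pt 0)"
    using fun_cong[OF assms(2), of "pt 0"] calculation by (simp add: sec0_def)
  ultimately have "psc 1 X = psc 1 Y" using cls_eqD sec0_nonempty[OF assms(1)] by blast
  then show ?thesis by (simp add: prod_eq_iff)
qed

lemma section_local:
  assumes "s \<in> sections L M U" "U \<subseteq> L" "p \<in> U"
  obtains V x f d where "opn V" "p \<in> V" "V \<subseteq> U" "x \<in> piece M d" "f \<in> forms d" "p \<in> nonvanishing f" "D f \<noteq> 0"
    "\<And>r. r \<in> V \<Longrightarrow> s r = cls (D f) (ev x) r" "\<And>r. r \<in> V \<Longrightarrow> s r \<noteq> {}"
proof -
  obtain V x f d where V: "opn V" "p \<in> V" "V \<subseteq> U" "x \<in> piece M d" "f \<in> forms d"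
    "\<forall>r\<in>V. r \<in> nonvanishing f \<and> s r = fraction M r x f"
    using assms(1,3) unfolding sections_def by blast
  have 1: "s r = cls (D f) (ev x) r" "s r \<noteq> {}" if "r \<in> V" for r
    using V that assms(2) fraction_conv_cls[OF V(4,5), of r] fraction_self[OF V(4,5), of r] by auto
  have "D f \<noteq> 0" using nonvanishing_dehom[OF V(5), of p] V assms(2) by blast
  then show ?thesis using that[OF V(1-5)] V(2,6) 1 by blast
qed

text \<open>By irreducibility all local fractions of \<open>s\<close> over \<open>U0\<close> have
  one common value, a pair of rational functions. It has no pole at an affine point, so it is a pair
  of polynomials, and membership in \<open>Lat\<close> is local. The degree bounds come from the
  other chart, at the point at infinity.\<close>

lemma twisted_conv_sec0:
  assumes "s \<in> twisted k"
  shows "\<exists>X\<in>global k. s = sec0 X"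
proof -
  obtain t where s: "s \<in> sections L M U0" and t: "t \<in> sections L M U1"
    and st: "\<And>p. fraction_scale M p (trans k p) (restr (U0 \<inter> U1) s p) = restr (U0 \<inter> U1) t p"
    using assms unfolding twisted_def by (auto dest: fun_cong)
  have pt0: "pt z \<in> U0" for z by (auto simp: U0_iff)
  obtain V0 x0 f0 d0 where V0: "opn V0" "pt 0 \<in> V0" "V0 \<subseteq> U0" "x0 \<in> piece M d0" "f0 \<in> forms d0" "D f0 \<noteq> 0"
    "\<And>r. r \<in> V0 \<Longrightarrow> s r = cls (D f0) (ev x0) r" "\<And>r. r \<in> V0 \<Longrightarrow> s r \<noteq> {}"
    by (rule section_local[OF s U_subset(1) pt0]) blast
  have eq: "psc (D f0) (ev x) = psc (D f) (ev x0)"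
    if V: "opn V" "p \<in> V" "V \<subseteq> U0" "\<And>r. r \<in> V \<Longrightarrow> s r = cls (D f) (ev x) r" for V p x f
  proof -
    obtain z where z: "pt z \<in> V0" "pt z \<in> V"
      by (rule open_common_point[OF V0(1,2) V(1,2) finite.emptyI]) blast
    have "cls (D f0) (ev x0) (pt z) = cls (D f) (ev x) (pt z)" using V0(7)[OF z(1)] V(4)[OF z(2)] by simp
    moreover have "cls (D f0) (ev x0) (pt z) \<noteq> {}" using V0(7,8)[OF z(1)] by simp
    ultimately show ?thesis using cls_eqD[of "D f0" "ev x0" "pt z"] by simp
  qed
  have ex: "\<exists>x f d. x \<in> piece M d \<and> poly (D f) z \<noteq> 0 \<and> D f \<noteq> 0 \<and> s (pt z) = cls (D f) (ev x) (pt z)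
      \<and> D f0 * fst (ev x) = D f * fst (ev x0) \<and> D f0 * snd (ev x) = D f * snd (ev x0)" for z
  proof -
    obtain V x f d where V: "opn V" "pt z \<in> V" "V \<subseteq> U0" "x \<in> piece M d" "f \<in> forms d" "pt z \<in> nonvanishing f" "D f \<noteq> 0"
      "\<And>r. r \<in> V \<Longrightarrow> s r = cls (D f) (ev x) r"
      by (rule section_local[OF s U_subset(1) pt0[of z]]) blast
    show ?thesis
      using eq[OF V(1,2,3) V(8)] V pt_nonvanishing[OF V(5)] by (intro exI[of _ x] exI[of _ f] exI[of _ d]) auto
  qed
  have "D f0 dvd fst (ev x0)"
    by (rule dvd_if_no_poles[OF V0(6)]) (use ex in blast)
  moreover have "D f0 dvd snd (ev x0)"
    by (rule dvd_if_no_poles[OF V0(6)]) (use ex in blast)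
  ultimately obtain P G where PG: "fst (ev x0) = D f0 * P" "snd (ev x0) = D f0 * G" by (auto elim!: dvdE)
  define X where "X = (P, G)"
  have ex': "\<exists>x f d. x \<in> piece M d \<and> poly (D f) z \<noteq> 0 \<and> D f \<noteq> 0 \<and> s (pt z) = cls (D f) (ev x) (pt z)
      \<and> ev x = psc (D f) X" for z
  proof -
    obtain x f d where x: "x \<in> piece M d" "poly (D f) z \<noteq> 0" "D f \<noteq> 0" "s (pt z) = cls (D f) (ev x) (pt z)"
      "D f0 * fst (ev x) = D f * fst (ev x0)" "D f0 * snd (ev x) = D f * snd (ev x0)" using ex[of z] by blast
    then have "D f0 * fst (ev x) = D f0 * (D f * P)" "D f0 * snd (ev x) = D f0 * (D f * G)"
      by (simp_all add: PG mult_ac)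
    then have "ev x = psc (D f) X" using V0(6) by (simp add: X_def prod_eq_iff)
    then show ?thesis using x by blast
  qed
  have sX: "s = sec0 X"
  proof
    fix p show "s p = sec0 X p"
    proof (cases "p \<in> U0")
      case True
      then obtain z where p: "p = pt z" by (auto simp: U0_iff)
      obtain x f where x: "D f \<noteq> 0" "s (pt z) = cls (D f) (ev x) (pt z)" "ev x = psc (D f) X" using ex'[of z] by blast
      have "cls (D f) (ev x) (pt z) = cls 1 X (pt z)" using x by (intro cls_eqI) auto
      then show ?thesis using x True by (simp add: sec0_def p)
    next
      case False
      then show ?thesis using s by (simp add: sections_def sec0_def)
    qed
  qed
  have Lat: "X \<in> Lat"
  proof (rule Lat_local)
    fix z obtain x f d where "x \<in> piece M d" "poly (D f) z \<noteq> 0" "ev x = psc (D f) X" using ex'[of z] by blast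
    then show "\<exists>F. poly F z \<noteq> 0 \<and> psc F X \<in> Lat" using ev_Lat[of x d] by (intro exI[of _ "D f"]) simp
  qed
  obtain V x f d where V: "opn V" "inf_pt \<in> V" "V \<subseteq> U1" "x \<in> piece M d" "f \<in> forms d" "inf_pt \<in> nonvanishing f" "D f \<noteq> 0"
    "\<And>r. r \<in> V \<Longrightarrow> t r = cls (D f) (ev x) r" "\<And>r. r \<in> V \<Longrightarrow> t r \<noteq> {}"
    by (rule section_local[OF t U_subset(3) inf_U1]) blast
  obtain z where z: "pt z \<in> V0" "pt z \<in> V" "z \<notin> {0}"
    by (rule open_common_point[OF V0(1,2) V(1,2), of "{0}"]) auto
  have zU: "pt z \<in> U0 \<inter> U1" using z pt_U1 pt0 by simp
  have ne: "cls 1 X (pt z) \<noteq> {}" using V0(8)[OF z(1)] zU by (simp add: sX sec0_def)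
  have "cls ([:0, 1:] ^ k * 1) X (pt z) = fraction_scale M (pt z) (trans k (pt z)) (restr (U0 \<inter> U1) s (pt z))"
    using trans_cls[OF zU ne, of k] zU by (simp add: restr_def sX sec0_def)
  also have "\<dots> = cls (D f) (ev x) (pt z)" using st[of "pt z"] zU V(8)[OF z(2)] by (simp add: restr_def)
  finally have 1: "cls (D f) (ev x) (pt z) = cls ([:0, 1:] ^ k) X (pt z)" by simp
  moreover have "cls (D f) (ev x) (pt z) \<noteq> {}" using V(8,9)[OF z(2)] by simp
  ultimately have 2: "psc ([:0, 1:] ^ k) (ev x) = psc (D f) X" using cls_eqD[of "D f" "ev x" "pt z"] by simp
  \<comment> \<open>\<open>f\<close> does not vanish at infinity, so \<open>D f\<close> has degree
    exactly \<open>d\<close>. Comparing degrees on the overlap turns \<open>ev_bd\<close> for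
    \<open>x\<close> into bounds for \<open>X\<close>.\<close>
  have fv: "eval3 f v \<noteq> 0" using V(6) inf_nonvanishing[OF V(5)] by simp
  have d: "d \<ge> 0" using fv forms_neg[of d f] V(5) by (force simp: eval3.zero)
  then have "f \<in> forms (int (nat d))" using V(5) by simp
  from dehom_forms[OF this, of u v] fv have deg: "degree (D f) = nat d"
    by (metis le_antisym le_degree)
  have bd: "bd (int k + n) b" if "[:0, 1:] ^ k * a = D f * b" "bd (d + n) a" for a b n
  proof (cases "b = 0")
    case False
    then have a: "a \<noteq> 0" using that(1) V(7) by auto
    have "degree ([:0, 1 :: complex:] ^ k * a) = k + degree a"
      using a by (simp add: degree_mult_eq degree_power_eq)
    moreover have "degree (D f * b) = nat d + degree b"
      using V(7) False deg by (simp add: degree_mult_eq)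
    ultimately have "k + degree a = nat d + degree b" using that(1) by simp
    then show ?thesis using that(2) a d by (auto simp: bd_def)
  qed (simp add: bd_def)
  have "X \<in> global k"
    using bd[of "fst (ev x)" "fst X" n1] bd[of "snd (ev x)" "snd X" n2] 2 ev_bd[OF V(4)] Lat
    by (auto simp: global_def)
  then show ?thesis using sX by blast
qed

lemma bij_sec0: "bij_betw sec0 (global k) (twisted k)"
  unfolding bij_betw_def
proof (intro conjI inj_onI)
  show "sec0 ` global k = twisted k" using sec0_twisted twisted_conv_sec0 by blast
qed (rule sec0_inj)

lemma sec0_add:
  assumes "X \<in> global k" "Y \<in> global k"
  shows "(\<lambda>p. fraction_add M p (sec0 X p) (sec0 Y p)) = sec0 (X + Y)"
proof
  fix p show "fraction_add M p (sec0 X p) (sec0 Y p) = sec0 (X + Y) p"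
  proof (cases "p \<in> U0")
    case True
    then have "p \<in> L" using U_subset by blast
    from fraction_add_cls[OF this sec0_nonempty[OF assms(1) True] sec0_nonempty[OF assms(2) True]] show ?thesis
      using True by (simp add: sec0_def)
  qed (simp add: sec0_def fraction_add_def)
qed

lemma sec0_scale:
  assumes "X \<in> global k"
  shows "(\<lambda>p. fraction_scale M p (unit_section (const c) 1 U0 p) (sec0 X p)) = sec0 (psc [:c:] X)"
proof
  fix p show "fraction_scale M p (unit_section (const c) 1 U0 p) (sec0 X p) = sec0 (psc [:c:] X) p"
  proof (cases "p \<in> U0")
    case True
    then have p: "p \<in> L" "p \<in> nonvanishing 1" using U_subset by (auto simp: nonvanishing_def eval3.one)
    from fraction_scale_cls[OF p(1) sec0_nonempty[OF assms True] _ forms_const forms_1 p(2)] show ?thesis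
      using True by (simp add: sec0_def unit_section_def dehom.one)
  qed (simp add: sec0_def unit_section_def fraction_scale_empty)
qed

lemma trans_section:
  assumes "s \<in> sections L M (U0 \<inter> U1)"
  shows "(\<lambda>p. fraction_scale M p (trans k p) (s p)) \<in> sections L M (U0 \<inter> U1)"
proof -
  have "\<exists>V x f d. opn V \<and> p \<in> V \<and> V \<subseteq> U0 \<inter> U1 \<and> x \<in> piece M d \<and> f \<in> forms d \<and>
      (\<forall>r\<in>V. r \<in> nonvanishing f \<and> fraction_scale M r (trans k r) (s r) = fraction M r x f)" if p: "p \<in> U0 \<inter> U1" for p
  proof -
    have sub: "U0 \<inter> U1 \<subseteq> L" using U_subset by blast
    obtain V x f d where V: "opn V" "p \<in> V" "V \<subseteq> U0 \<inter> U1" "x \<in> piece M d" "f \<in> forms d"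
      "\<forall>r\<in>V. r \<in> nonvanishing f \<and> s r = fraction M r x f"
      using assms p unfolding sections_def by blast
    let ?x = "scale M (lin l0 ^ k) x" and ?f = "lin l1 ^ k * f"
    have x: "?x \<in> piece M (int k + d)" "?f \<in> forms (int k + d)"
      using piece_scale[OF lin_power_forms V(4)] forms_mult[OF lin_power_forms V(5)] by auto
    have "r \<in> nonvanishing ?f \<and> fraction_scale M r (trans k r) (s r) = fraction M r ?x ?f" if "r \<in> V" for r
    proof -
      have r: "r \<in> nonvanishing f" "r \<in> L" "r \<in> U0 \<inter> U1" "s r = cls (D f) (ev x) r" "cls (D f) (ev x) r \<noteq> {}"
        using V that sub fraction_conv_cls[OF V(4,5), of r] fraction_self[OF V(4,5), of r] by auto
      have Df: "D f \<noteq> 0" using nonvanishing_dehom[OF V(5) r(2,1)] .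
      have nv: "r \<in> nonvanishing ?f"
        unfolding nonvanishing_mult[symmetric] using r nonvanishing_power U_subset by blast
      have "fraction_scale M r (trans k r) (s r) = cls ([:0, 1:] ^ k * D f) (ev x) r"
        using trans_cls[OF r(3,5) Df] r(4) by simp
      also have "\<dots> = cls (D ?f) (ev ?x) r"
        by (simp add: ev_scale[OF V(4)] dehom.mult dehom.power del: dehom_lin)
      also have "\<dots> = fraction M r ?x ?f" using fraction_conv_cls[OF x nv r(2)] by simp
      finally show ?thesis using nv by blast
    qed
    then show ?thesis using V x by blast
  qed
  moreover have "fraction_scale M p (trans k p) (s p) = {}" if "p \<notin> U0 \<inter> U1" for p
  proof -
    have "trans k p = {}" using that by (auto simp: trans_def unit_section_def)
    then show ?thesis by (simp add: fraction_scale_empty)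
  qed
  ultimately show ?thesis unfolding sections_def by simp
qed

end

lemma (in line_chart) trans_O: "unit_section (lin l0 ^ k) (lin l1 ^ k) (U0 \<inter> U1) \<in> sections L OL (U0 \<inter> U1)"
proof (rule unit_section_in)
  show "lin l0 ^ k \<in> forms (int k)" "lin l1 ^ k \<in> forms (int k)"
    by (rule forms_power_linear, rule lin_forms)+
  show "U0 \<inter> U1 \<subseteq> nonvanishing (lin l1 ^ k)"
    by (auto simp: U1_def nonvanishing_def eval3.power)
qed (rule open_U)

text \<open>Linearity over the structure sheaf and compatibility with restriction make the
  isomorphism commute with multiplication by the transition function on
  \<open>U0 \<inter> U1\<close>. It therefore preserves gluing data, and \<open>sec0\<close> on both
  sides turns it into a map between polynomial pairs.\<close>

lemma sheaf_isomorphism_global: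
  assumes A: "line_sheaf lam \<alpha> \<beta> M ev n1 n2 Lat" and B: "line_sheaf lam \<alpha> \<beta> M' ev' n1' n2' Lat'"
    and iso: "sheaves_isomorphic (line_chart.L lam \<alpha> \<beta>) M M'"
  shows "\<exists>\<Psi>. bij_betw \<Psi> (line_sheaf.global n1 n2 Lat k) (line_sheaf.global n1' n2' Lat' k) \<and>
    (\<forall>X\<in>line_sheaf.global n1 n2 Lat k. \<forall>Y\<in>line_sheaf.global n1 n2 Lat k.
       X + Y \<in> line_sheaf.global n1 n2 Lat k \<longrightarrow> \<Psi> (X + Y) = \<Psi> X + \<Psi> Y) \<and>
    (\<forall>X\<in>line_sheaf.global n1 n2 Lat k. \<forall>c.
       psc [:c:] X \<in> line_sheaf.global n1 n2 Lat k \<longrightarrow> \<Psi> (psc [:c:] X) = psc [:c:] (\<Psi> X))"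
proof -
  interpret A: line_sheaf lam \<alpha> \<beta> M ev n1 n2 Lat by (rule A)
  interpret B: line_sheaf lam \<alpha> \<beta> M' ev' n1' n2' Lat' by (rule B)
  obtain \<phi> where \<phi>: "\<forall>U. A.opn U \<longrightarrow>
           bij_betw (\<phi> U) (sections A.L M U) (sections A.L M' U) \<and>
           (\<forall>s\<in>sections A.L M U. \<forall>t\<in>sections A.L M U.
              \<phi> U (\<lambda>p. fraction_add M p (s p) (t p)) = (\<lambda>p. fraction_add M' p (\<phi> U s p) (\<phi> U t p))) \<and>
           (\<forall>r\<in>sections A.L A.OL U. \<forall>s\<in>sections A.L M U.
              \<phi> U (\<lambda>p. fraction_scale M p (r p) (s p)) = (\<lambda>p. fraction_scale M' p (r p) (\<phi> U s p)))"
    and \<phi>': "\<forall>U V. A.opn U \<and> A.opn V \<and> V \<subseteq> U \<longrightarrow>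
           (\<forall>s\<in>sections A.L M U. \<phi> V (restr V s) = restr V (\<phi> U s))"
    using iso unfolding sheaves_isomorphic_def by (elim exE conjE) (rule that)
  have bij: "bij_betw (\<phi> U) (sections A.L M U) (sections A.L M' U)" if "A.opn U" for U
    using \<phi> that by blast
  have add: "\<phi> U (\<lambda>p. fraction_add M p (s p) (t p)) = (\<lambda>p. fraction_add M' p (\<phi> U s p) (\<phi> U t p))"
    if "A.opn U" "s \<in> sections A.L M U" "t \<in> sections A.L M U" for U s t
    using \<phi> that by blast
  have scl: "\<phi> U (\<lambda>p. fraction_scale M p (r p) (s p)) = (\<lambda>p. fraction_scale M' p (r p) (\<phi> U s p))"
    if "A.opn U" "r \<in> sections A.L A.OL U" "s \<in> sections A.L M U" for U r s
    using \<phi> that by blast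
  have res: "\<phi> V (restr V s) = restr V (\<phi> U s)"
    if "A.opn U" "A.opn V" "V \<subseteq> U" "s \<in> sections A.L M U" for U V s
    using \<phi>' that by blast
  let ?U01 = "A.U0 \<inter> A.U1"
  have trO: "A.trans k \<in> sections A.L A.OL ?U01" unfolding A.trans_def by (rule A.trans_O)
  have key: "\<phi> ?U01 (\<lambda>p. fraction_scale M p (A.trans k p) (restr ?U01 s p))
      = (\<lambda>p. fraction_scale M' p (A.trans k p) (restr ?U01 (\<phi> A.U0 s) p))" if s: "s \<in> sections A.L M A.U0" for s
    using scl[OF A.open_U(3) trO A.restr_sections[OF s A.open_U(3)]] res[OF A.open_U(1,3) _ s] by simp
  have img: "\<phi> A.U0 ` A.twisted k = B.twisted k"
  proof (intro equalityI subsetI)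
    fix s' assume "s' \<in> \<phi> A.U0 ` A.twisted k"
    then obtain s t where s: "s' = \<phi> A.U0 s" "s \<in> sections A.L M A.U0" "t \<in> sections A.L M A.U1"
      "(\<lambda>p. fraction_scale M p (A.trans k p) (restr ?U01 s p)) = restr ?U01 t"
      by (auto simp: A.twisted_def)
    have "(\<lambda>p. fraction_scale M' p (A.trans k p) (restr ?U01 s' p)) = restr ?U01 (\<phi> A.U1 t)"
      using key[OF s(2)] res[OF A.open_U(2,3) _ s(3)] by (simp add: s(1,4))
    moreover have "s' \<in> sections A.L M' A.U0" "\<phi> A.U1 t \<in> sections A.L M' A.U1"
      using bij_betwE[OF bij[OF A.open_U(1)]] bij_betwE[OF bij[OF A.open_U(2)]] s by auto
    ultimately show "s' \<in> B.twisted k" unfolding B.twisted_def by blast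
  next
    fix s' assume "s' \<in> B.twisted k"
    then obtain t' where s': "s' \<in> sections A.L M' A.U0" "t' \<in> sections A.L M' A.U1"
      "(\<lambda>p. fraction_scale M' p (A.trans k p) (restr ?U01 s' p)) = restr ?U01 t'"
      by (auto simp: B.twisted_def)
    obtain s where s: "s \<in> sections A.L M A.U0" "s' = \<phi> A.U0 s"
      using bij_betw_imp_surj_on[OF bij[OF A.open_U(1)]] s'(1) by blast
    obtain t where t: "t \<in> sections A.L M A.U1" "t' = \<phi> A.U1 t"
      using bij_betw_imp_surj_on[OF bij[OF A.open_U(2)]] s'(2) by blast
    have "\<phi> ?U01 (\<lambda>p. fraction_scale M p (A.trans k p) (restr ?U01 s p)) = \<phi> ?U01 (restr ?U01 t)"
      using key[OF s(1)] s'(3) res[OF A.open_U(2,3) _ t(1)] by (simp add: s t)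
    moreover have "(\<lambda>p. fraction_scale M p (A.trans k p) (restr ?U01 s p)) \<in> sections A.L M ?U01"
      by (rule A.trans_section[OF A.restr_sections[OF s(1) A.open_U(3)]]) simp
    moreover have "restr ?U01 t \<in> sections A.L M ?U01"
      by (rule A.restr_sections[OF t(1) A.open_U(3)]) simp
    ultimately have "(\<lambda>p. fraction_scale M p (A.trans k p) (restr ?U01 s p)) = restr ?U01 t"
      using bij_betw_imp_inj_on[OF bij[OF A.open_U(3)]] by (auto dest: inj_onD)
    then have "s \<in> A.twisted k" using s t unfolding A.twisted_def by blast
    then show "s' \<in> \<phi> A.U0 ` A.twisted k" using s by blast
  qed
  have "A.twisted k \<subseteq> sections A.L M A.U0" by (auto simp: A.twisted_def)
  then have "bij_betw (\<phi> A.U0) (A.twisted k) (B.twisted k)"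
    using bij_betw_subset[OF bij[OF A.open_U(1)] _ img] by blast
  then have bij': "bij_betw (\<phi> A.U0 \<circ> A.sec0) (A.global k) (B.twisted k)"
    by (rule bij_betw_trans[OF A.bij_sec0])
  define \<Psi> where "\<Psi> = the_inv_into (B.global k) B.sec0 \<circ> (\<phi> A.U0 \<circ> A.sec0)"
  have bij\<Psi>: "bij_betw \<Psi> (A.global k) (B.global k)"
    unfolding \<Psi>_def by (rule bij_betw_trans[OF bij' bij_betw_the_inv_into[OF B.bij_sec0]])
  have \<Psi>: "B.sec0 (\<Psi> X) = \<phi> A.U0 (A.sec0 X)" if "X \<in> A.global k" for X
  proof -
    have "\<phi> A.U0 (A.sec0 X) \<in> B.twisted k" using bij_betwE[OF bij'] that by auto
    then show ?thesis using f_the_inv_into_f_bij_betw[OF B.bij_sec0] by (simp add: \<Psi>_def)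
  qed
  have \<Psi>g: "\<Psi> X \<in> B.global k" if "X \<in> A.global k" for X using bij_betwE[OF bij\<Psi>] that by blast
  have "\<Psi> (X + Y) = \<Psi> X + \<Psi> Y" if X: "X \<in> A.global k" "Y \<in> A.global k" "X + Y \<in> A.global k" for X Y
  proof (rule B.sec0_inj[OF \<Psi>g[OF X(3)]])
    have "B.sec0 (\<Psi> (X + Y)) = \<phi> A.U0 (\<lambda>p. fraction_add M p (A.sec0 X p) (A.sec0 Y p))"
      using \<Psi>[OF X(3)] A.sec0_add[OF X(1,2)] by simp
    also have "\<dots> = (\<lambda>p. fraction_add M' p (B.sec0 (\<Psi> X) p) (B.sec0 (\<Psi> Y) p))"
      using add[OF A.open_U(1) A.sec0_in[OF X(1)] A.sec0_in[OF X(2)]] by (simp add: \<Psi>[OF X(1)] \<Psi>[OF X(2)])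
    also have "\<dots> = B.sec0 (\<Psi> X + \<Psi> Y)" by (rule B.sec0_add[OF \<Psi>g[OF X(1)] \<Psi>g[OF X(2)]])
    finally show "B.sec0 (\<Psi> (X + Y)) = B.sec0 (\<Psi> X + \<Psi> Y)" .
  qed
  moreover have "\<Psi> (psc [:c:] X) = psc [:c:] (\<Psi> X)" if X: "X \<in> A.global k" "psc [:c:] X \<in> A.global k" for X c
  proof (rule B.sec0_inj[OF \<Psi>g[OF X(2)]])
    have one: "A.U0 \<subseteq> nonvanishing 1" by (auto simp: nonvanishing_def eval3.one)
    have "B.sec0 (\<Psi> (psc [:c:] X)) = \<phi> A.U0 (\<lambda>p. fraction_scale M p (A.unit_section (const c) 1 A.U0 p) (A.sec0 X p))"
      using \<Psi>[OF X(2)] A.sec0_scale[OF X(1)] by simp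
    also have "\<dots> = (\<lambda>p. fraction_scale M' p (A.unit_section (const c) 1 A.U0 p) (B.sec0 (\<Psi> X) p))"
      using scl[OF A.open_U(1) A.unit_section_in[OF forms_const forms_1 A.open_U(1) one] A.sec0_in[OF X(1)]]
      by (simp add: \<Psi>[OF X(1)])
    also have "\<dots> = B.sec0 (psc [:c:] (\<Psi> X))" by (rule B.sec0_scale[OF \<Psi>g[OF X(1)]])
    finally show "B.sec0 (\<Psi> (psc [:c:] X)) = B.sec0 (psc [:c:] (\<Psi> X))" .
  qed
  ultimately show ?thesis using bij\<Psi> by blast
qed

section \<open>The split sheaf and the restricted sheaf as lattices of polynomial pairs\<close>

lemma bd_0 [simp]: "bd m 0"
  by (simp add: bd_def)

lemma bd_conv: "bd m p \<longleftrightarrow> (\<forall>i. int i > m \<longrightarrow> coeff p i = 0)"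
proof
  assume "bd m p"
  then show "\<forall>i. int i > m \<longrightarrow> coeff p i = 0"
    by (auto simp: bd_def intro: coeff_eq_0)
next
  assume *: "\<forall>i. int i > m \<longrightarrow> coeff p i = 0"
  show "bd m p"
  proof (cases "p = 0")
    case False
    then have "coeff p (degree p) \<noteq> 0" by simp
    then have "\<not> m < int (degree p)" using * by blast
    then show ?thesis by (simp add: bd_def)
  qed simp
qed

lemma bd_add: "bd m p \<Longrightarrow> bd m r \<Longrightarrow> bd m (p + r)"
  and bd_diff: "bd m p \<Longrightarrow> bd m r \<Longrightarrow> bd m (p - r)"
  and bd_const_mult: "bd m p \<Longrightarrow> bd m ([:c:] * p)"
  by (simp_all add: bd_conv)

lemma bd_T_mult: "bd m p \<Longrightarrow> bd (m + 1) ([:0, 1:] * p)"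
  by (auto simp: bd_conv coeff_pCons split: nat.splits)

lemma bd_mono: "bd m p \<Longrightarrow> m \<le> n \<Longrightarrow> bd n p"
  by (auto simp: bd_def)

lemma bd_int: "bd (int k) p \<longleftrightarrow> degree p \<le> k"
  by (auto simp: bd_def)

lemma dehom_bd: "f \<in> forms d \<Longrightarrow> bd d (dehom u v f)"
proof (cases "d < 0")
  case True
  assume "f \<in> forms d"
  then have "f = 0" using True forms_neg by blast
  then show ?thesis by (simp add: dehom.zero)
next
  case False
  assume "f \<in> forms d"
  then show ?thesis using dehom_forms[of f "nat d" u v] False by (simp add: bd_def le_nat_iff)
qed

lemma lin_scale: "lin (k *s c) = const k * lin c"
  by (rule poly3_eqI) (simp add: eval3.mult dot_scale_left)

lemma lin_add: "lin (a + b) = lin a + lin b"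
  by (rule poly3_eqI) (simp add: eval3.add dot_add_left)

lemma lin_scale_dvd_iff:
  assumes "k \<noteq> 0"
  shows "lin (k *s c) dvd f \<longleftrightarrow> lin c dvd f"
proof
  assume "lin c dvd f"
  then obtain g where g: "f = lin c * g" by (rule dvdE)
  have "const k * const (1 / k) = (1 :: complex poly3)"
    using assms by (simp add: const_mult[symmetric] const_1)
  then have "f = (const k * const (1 / k)) * (lin c * g)" by (simp add: g)
  then have "f = lin (k *s c) * (const (1 / k) * g)" by (simp only: lin_scale mult_ac)
  then show "lin (k *s c) dvd f" by (rule dvdI)
qed (metis lin_scale dvd_mult_right)

lemma D_module_iff_rep:
  assumes "\<theta> \<in> derivations"
  shows "\<theta> \<in> D_module (arrangement Z) \<longleftrightarrow> (\<forall>p\<in>Z. lin (rep_proj2 p) dvd \<theta> (lin (rep_proj2 p)))"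
proof -
  have "lin (k *s c) dvd \<theta> (lin (k *s c))" if "lin c dvd \<theta> (lin c)" "k \<noteq> 0" for k c
  proof -
    have "\<theta> (lin (k *s c)) = const k * \<theta> (lin c)" by (simp add: lin_scale derivations_const_mult[OF assms])
    then show ?thesis using that lin_scale_dvd_iff[of k c] by simp
  qed
  then show ?thesis
    unfolding D_module_iff[OF assms] using coords_conv[OF rep_proj2_in_coords] rep_proj2_in_coords by auto
qed

lemma derivations_closed:
  assumes "\<theta> \<in> derivations" "\<eta> \<in> derivations"
  shows "\<theta> + \<eta> \<in> derivations" "\<theta> - \<eta> \<in> derivations"
  using assms derivations_const[OF assms(1)] derivations_const[OF assms(2)]
  by (simp_all add: derivations_def distrib_left right_diff_distrib add_diff_add add_ac)

lemma derivations_lin_combination: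
  assumes "\<theta> \<in> derivations"
  shows "\<theta> (lin (a *s x + b *s y + c *s z)) = const a * \<theta> (lin x) + const b * \<theta> (lin y) + const c * \<theta> (lin z)"
  by (simp add: lin_add lin_scale derivations_add[OF assms] derivations_const_mult[OF assms])

lemma euler_lin: "euler_derivation (lin x) = lin x"
  using derivations_lin[OF vector_field_derivation, of var x]
  by (simp add: euler_conv_vector_field lin_def)

lemma euler_in_derivations: "euler_derivation \<in> derivations"
  by (simp add: euler_conv_vector_field vector_field_derivation)

context line_chart begin

lemma ex_dehom:
  assumes "bd m p"
  obtains f where "f \<in> forms m" "D f = p"
proof (cases "m < 0")
  case True
  then have "p = 0" using assms by (auto simp: bd_def)
  then show ?thesis using that[of 0] by (simp add: dehom.zero)
next
  case False
  then have "degree p \<le> nat m" using assms bd_int[of "nat m" p] by simp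
  then have "D (homog l0 l1 (nat m) p) = p" by (rule dehom_homog) simp_all
  then show ?thesis using that[of "homog l0 l1 (nat m) p"] homog_forms[of l0 l1 "nat m" p] False by simp
qed

lemma forms_factor_q:
  assumes "f \<in> forms d" "D f = 0"
  obtains g where "f = lin q * g" "g \<in> forms (d - 1)"
  using forms_factor[OF dehom_eq_0_imp[OF assms] assms(1)] by blast

definition split_module :: "int \<Rightarrow> int \<Rightarrow> (complex poly3 \<times> complex poly3) gmodule" where
  "split_module a1 a2 = restrict_to L (direct_sum (twist (- a1) polynomial_module) (twist (- a2) polynomial_module))"

lemma split_module_simps:
  "scale (split_module a1 a2) g x = (g * fst x, g * snd x)"
  "piece (split_module a1 a2) d = forms (d - a1) \<times> forms (d - a2)"
  by (simp_all add: split_module_def restrict_to_def direct_sum_def twist_def polynomial_module_def split_beta)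

lemma split_module_rels:
  "rels (split_module a1 a2) = module.span (\<lambda>g x. (g * fst x, g * snd x))
     ({(0, 0)} \<union> {(g * fst x, g * snd x) | g x d. g \<in> vanishing_ideal L \<and> x \<in> forms (d - a1) \<times> forms (d - a2)})"
  by (simp add: split_module_def restrict_to_def direct_sum_def twist_def polynomial_module_def split_def)

lemma module_pair: "module (\<lambda>(g :: complex poly3) (x :: complex poly3 \<times> complex poly3). (g * fst x, g * snd x))"
  by unfold_locales (simp_all add: algebra_simps prod_eq_iff)

lemma line_sheaf_split:
  "line_sheaf lam \<alpha> \<beta> (split_module a1 a2) (\<lambda>x. (D (fst x), D (snd x))) (- a1) (- a2) UNIV"
proof
  interpret module "\<lambda>(g :: complex poly3) (x :: complex poly3 \<times> complex poly3). (g * fst x, g * snd x)"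
    by (rule module_pair)
  fix x d assume x: "x \<in> piece (split_module a1 a2) d"
  show "x \<in> rels (split_module a1 a2) \<longleftrightarrow> (D (fst x), D (snd x)) = 0"
  proof
    have "subspace {x. (D (fst x), D (snd x)) = 0}"
      by (rule subspaceI) (simp_all add: dehom.hom zero_prod_def)
    moreover have "{(0, 0)} \<union> {(g * fst x, g * snd x) | g x d. g \<in> vanishing_ideal L \<and> x \<in> forms (d - a1) \<times> forms (d - a2)}
        \<subseteq> {x. (D (fst x), D (snd x)) = 0}"
      by (auto simp: dehom.hom dehom_vanishing_ideal zero_prod_def)
    moreover assume "x \<in> rels (split_module a1 a2)"
    ultimately show "(D (fst x), D (snd x)) = 0" unfolding split_module_rels using span_minimal by blast
  next
    assume "(D (fst x), D (snd x)) = 0"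
    then have 0: "D (fst x) = 0" "D (snd x) = 0" by (simp_all add: zero_prod_def)
    have f: "fst x \<in> forms (d - a1)" "snd x \<in> forms (d - a2)" using x by (auto simp: split_module_simps)
    obtain y z where "fst x = lin q * y" "y \<in> forms (d - a1 - 1)" "snd x = lin q * z" "z \<in> forms (d - a2 - 1)"
      using forms_factor_q[OF f(1) 0(1)] forms_factor_q[OF f(2) 0(2)] by metis
    then have "x = (lin q * fst (y, z), lin q * snd (y, z))" "(y, z) \<in> forms (d - 1 - a1) \<times> forms (d - 1 - a2)"
      by (simp_all add: prod_eq_iff algebra_simps)
    moreover have "lin q \<in> vanishing_ideal L" by (simp add: vanishing_ideal_L)
    ultimately show "x \<in> rels (split_module a1 a2)"
      unfolding split_module_rels by (intro span_base UnI2) blast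
  qed
next
  fix X k p
  assume X: "bd (int k + - a1) (fst X)" "bd (int k + - a2) (snd X)"
  obtain x y where xy: "x \<in> forms (int k + - a1)" "D x = fst X" "y \<in> forms (int k + - a2)" "D y = snd X"
    using ex_dehom[OF X(1)] ex_dehom[OF X(2)] by metis
  have "p \<in> nonvanishing 1" by (auto simp: nonvanishing_def eval3.one)
  then show "\<exists>e g x. g \<in> forms e \<and> p \<in> nonvanishing g \<and> x \<in> piece (split_module a1 a2) (e + int k) \<and>
      (D (fst x), D (snd x)) = psc (D g) X"
    using xy by (intro exI[of _ 0] exI[of _ 1] exI[of _ "(x, y)"]) (simp add: forms_1 split_module_simps dehom.one)
next
  fix f d x e assume *: "f \<in> forms d" "x \<in> piece (split_module a1 a2) e"
  show "scale (split_module a1 a2) f x \<in> piece (split_module a1 a2) (d + e)"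
    using * forms_mult[OF *(1), of _ "e - a1"] forms_mult[OF *(1), of _ "e - a2"]
    by (auto simp: split_module_simps add_diff_eq)
next
  fix x d assume "x \<in> piece (split_module a1 a2) d"
  then show "bd (d + - a1) (fst (D (fst x), D (snd x))) \<and> bd (d + - a2) (snd (D (fst x), D (snd x)))"
    using dehom_bd[of "fst x" "d - a1" u v] dehom_bd[of "snd x" "d - a2" u v] by (auto simp: split_module_simps)
qed (auto simp: split_module_simps dehom.mult dehom.add dehom.diff intro: forms_add forms_diff)

end

text \<open>A line meeting the lines of the arrangement in distinct points, none of them at infinity.\<close>

locale good_line = line_chart lam \<alpha> \<beta> for lam \<alpha> \<beta> :: complex +
  fixes Z :: "proj2 set"
  assumes finite_Z: "finite Z"
    and dot_v: "p \<in> Z \<Longrightarrow> dot (rep_proj2 p) v \<noteq> 0"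
    and distinct: "p \<in> Z \<Longrightarrow> r \<in> Z \<Longrightarrow> p \<noteq> r \<Longrightarrow>
      dot (rep_proj2 p) u * dot (rep_proj2 r) v \<noteq> dot (rep_proj2 r) u * dot (rep_proj2 p) v"
begin

definition node :: "proj2 \<Rightarrow> complex" where
  "node p = - dot (rep_proj2 p) u / dot (rep_proj2 p) v"

lemma dot_u: "p \<in> Z \<Longrightarrow> dot (rep_proj2 p) u = - (node p * dot (rep_proj2 p) v)"
  using dot_v by (simp add: node_def)

lemma node_inj: "p \<in> Z \<Longrightarrow> r \<in> Z \<Longrightarrow> node p = node r \<Longrightarrow> p = r"
  using dot_u[of p] dot_u[of r] distinct[of p r] by auto

text \<open>For a vector field P v + G w along \<open>L\<close> this is tangency to the line of
  \<open>p\<close> at the point, with parameter \<open>node p\<close>, where the two lines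
  meet.\<close>

definition Lat :: "(complex poly \<times> complex poly) set" where
  "Lat = {X. \<forall>p\<in>Z. dot (rep_proj2 p) v * poly (fst X) (node p) + dot (rep_proj2 p) w * poly (snd X) (node p) = 0}"

definition D0L :: "(complex poly3 \<Rightarrow> complex poly3) gmodule" where
  "D0L = restrict_to L (D0_module (arrangement Z))"

text \<open>At u + t v the Euler derivation has the values 1, t, 0 on \<open>lin l0\<close>,
  \<open>lin l1\<close>, \<open>lin q\<close>, so this combination kills it. The two entries are the
  components along \<open>v\<close> and \<open>w\<close> modulo the Euler field.\<close>

definition evD :: "(complex poly3 \<Rightarrow> complex poly3) \<Rightarrow> complex poly \<times> complex poly" where
  "evD \<theta> = (D (\<theta> (lin l1)) - [:0, 1:] * D (\<theta> (lin l0)), D (\<theta> (lin q)))"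

lemma D0L_simps:
  "scale D0L g \<theta> = (\<lambda>f. g * \<theta> f)"
  "piece D0L d = {\<theta> \<in> D_module (arrangement Z). \<forall>l\<in>forms 1. \<theta> l \<in> forms d}"
  by (simp_all add: D0L_def restrict_to_def D0_module_def)

lemma D0L_rels:
  "rels D0L = module.span (\<lambda>g \<theta> f. g * \<theta> f) ({(\<lambda>f. g * euler_derivation f) | g. True}
     \<union> {(\<lambda>f. g * \<theta> f) | g \<theta> d. g \<in> vanishing_ideal L \<and> \<theta> \<in> piece D0L d})"
  by (simp add: D0L_def restrict_to_def D0_module_def)

lemma evD_scale: "evD (\<lambda>f. g * \<theta> f) = psc (D g) (evD \<theta>)"
  by (simp add: evD_def dehom.mult algebra_simps)

lemma evD_add: "evD (\<theta> + \<eta>) = evD \<theta> + evD \<eta>"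
  by (simp add: evD_def dehom.add algebra_simps)

lemma evD_diff: "evD (\<theta> - \<eta>) = evD \<theta> - evD \<eta>"
  by (simp add: evD_def dehom.diff algebra_simps)

lemma evD_euler: "evD euler_derivation = 0"
  by (simp add: evD_def euler_lin zero_prod_def)

lemma D_theta_lin:
  assumes "\<theta> \<in> derivations"
  shows "D (\<theta> (lin c)) = [:dot c u:] * D (\<theta> (lin l0)) + [:dot c v:] * D (\<theta> (lin l1)) + [:dot c w:] * D (\<theta> (lin q))"
proof -
  have "c = dot c u *s l0 + dot c v *s l1 + dot c w *s q"
    using decompose_dual[of c] by (simp add: dot_commute)
  then have "\<theta> (lin c) = \<theta> (lin (dot c u *s l0 + dot c v *s l1 + dot c w *s q))" by simp
  also have "\<dots> = const (dot c u) * \<theta> (lin l0) + const (dot c v) * \<theta> (lin l1) + const (dot c w) * \<theta> (lin q)"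
    by (rule derivations_lin_combination[OF assms])
  finally show ?thesis by (simp add: dehom.hom)
qed

lemma evD_Lat:
  assumes "\<theta> \<in> D_module (arrangement Z)"
  shows "evD \<theta> \<in> Lat"
proof -
  have der: "\<theta> \<in> derivations" using assms by (simp add: D_module_def)
  have "dot (rep_proj2 p) v * poly (fst (evD \<theta>)) (node p) + dot (rep_proj2 p) w * poly (snd (evD \<theta>)) (node p) = 0"
    if p: "p \<in> Z" for p
  proof -
    let ?c = "rep_proj2 p"
    obtain g where "\<theta> (lin ?c) = lin ?c * g" using assms D_module_iff_rep[OF der] p by (meson dvdE)
    then have "poly (D (\<theta> (lin ?c))) (node p) = 0"
      using dot_u[OF p] by (simp add: dehom.mult)
    then show ?thesis
      unfolding D_theta_lin[OF der, of ?c] using dot_u[OF p] by (simp add: evD_def algebra_simps)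
  qed
  then show ?thesis by (simp add: Lat_def)
qed

lemma not_dvd_q:
  assumes "p \<in> Z"
  shows "\<not> lin (rep_proj2 p) dvd lin q"
proof
  let ?c = "rep_proj2 p"
  let ?y = "w - (dot ?c w / dot ?c v) *s v"
  assume "lin ?c dvd lin q"
  moreover have "dot ?c ?y = 0" using dot_v[OF assms] by (simp add: dot_simps)
  ultimately have "dot q ?y = 0" using eval3_dvd_lin[of ?c "lin q" ?y] by simp
  moreover have "dot q ?y = 1" by (simp add: dot_simps)
  ultimately show False by simp
qed

text \<open>A multiple of the Euler derivation with the same restriction to \<open>L\<close> is
  subtracted. The remainder vanishes on \<open>L\<close> and is divisible by \<open>lin q\<close>,
  and the quotient is still tangent to the arrangement because \<open>L\<close> is not one of its
  lines.\<close>

lemma evD_eq_0_imp: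
  assumes \<theta>: "\<theta> \<in> piece D0L d" and 0: "evD \<theta> = 0"
  obtains g \<zeta> where "\<theta> = (\<lambda>f. g * euler_derivation f) + (\<lambda>f. lin q * \<zeta> f)" "\<zeta> \<in> piece D0L (d - 1)"
proof -
  have D: "\<theta> \<in> D_module (arrangement Z)" and fd: "\<And>l. l \<in> forms 1 \<Longrightarrow> \<theta> l \<in> forms d"
    using \<theta> by (auto simp: D0L_simps)
  have der: "\<theta> \<in> derivations" using D by (simp add: D_module_def)
  let ?A = "D (\<theta> (lin l0))"
  have ev: "D (\<theta> (lin l1)) = [:0, 1:] * ?A" "D (\<theta> (lin q)) = 0"
    using 0 by (simp_all add: evD_def zero_prod_def)
  \<comment> \<open>By \<open>ev\<close>, multiplying \<open>?A\<close> by the parameter gives the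
    restriction of a form of degree \<open>d\<close>. Hence \<open>g\<close> gets degree d - 1, as a
    coefficient of the Euler derivation must.\<close>
  have "bd (d - 1) ?A"
    unfolding bd_conv
  proof (intro allI impI)
    fix i assume i: "d - 1 < int i"
    have "bd d ([:0, 1:] * ?A)" using dehom_bd[OF fd[OF lin_forms], of u v l1] ev by simp
    then have "coeff ([:0, 1:] * ?A) (Suc i) = 0"
      by (rule bd_conv[THEN iffD1, rule_format]) (use i in linarith)
    then show "coeff ?A i = 0" by simp
  qed
  then obtain g where g: "g \<in> forms (d - 1)" "D g = ?A" by (rule ex_dehom)
  define \<eta> where "\<eta> = \<theta> - (\<lambda>f. g * euler_derivation f)"
  have \<eta>der: "\<eta> \<in> derivations"
    unfolding \<eta>_def by (intro derivations_closed der derivations_scale euler_in_derivations)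
  have "D (\<eta> (lin l0)) = 0" "D (\<eta> (lin l1)) = 0" "D (\<eta> (lin q)) = 0"
    by (simp_all add: \<eta>_def euler_lin dehom.diff dehom.mult g(2) ev)
  then have D\<eta>: "D (\<eta> (lin c)) = 0" for c using D_theta_lin[OF \<eta>der, of c] by simp
  have \<eta>forms: "\<eta> (lin c) \<in> forms d" for c
    using fd[OF lin_forms, of c] forms_mult[OF g(1) lin_forms, of c] by (simp add: \<eta>_def euler_lin forms_diff)
  have "\<exists>h. \<eta> (var i) = lin q * h \<and> h \<in> forms (d - 1)" for i
    using forms_factor_q[OF \<eta>forms D\<eta>, of "axis i 1"] by (metis lin_axis)
  then obtain h where h: "\<And>i. \<eta> (var i) = lin q * h i" "\<And>i. h i \<in> forms (d - 1)" by metis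
  define \<zeta> where "\<zeta> = vector_field h"
  have \<zeta>der: "\<zeta> \<in> derivations" by (simp add: \<zeta>_def vector_field_derivation)
  have \<eta>\<zeta>: "\<eta> = (\<lambda>f. lin q * \<zeta> f)"
    by (rule derivations_ext[OF \<eta>der derivations_scale[OF \<zeta>der]]) (simp add: \<zeta>_def h)
  have "\<zeta> \<in> D_module (arrangement Z)"
    unfolding D_module_iff_rep[OF \<zeta>der]
  proof
    fix p assume p: "p \<in> Z"
    let ?c = "rep_proj2 p"
    have "lin ?c dvd \<theta> (lin ?c)" using D D_module_iff_rep[OF der] p by blast
    then have "lin ?c dvd \<eta> (lin ?c)" by (simp add: \<eta>_def euler_lin)
    then have "lin ?c dvd lin q \<or> lin ?c dvd \<zeta> (lin ?c)"
      using lin_dvd_mult_iff[of ?c "lin q" "\<zeta> (lin ?c)"] coords_nonzero[OF rep_proj2_in_coords] by (simp add: \<eta>\<zeta>)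
    then show "lin ?c dvd \<zeta> (lin ?c)" using not_dvd_q[OF p] by blast
  qed
  moreover have "\<forall>l\<in>forms 1. \<zeta> l \<in> forms (d - 1)"
    unfolding linear_forms_iff[OF \<zeta>der] using h(2) by (simp add: \<zeta>_def)
  ultimately have "\<zeta> \<in> piece D0L (d - 1)" by (simp add: D0L_simps)
  moreover have "\<theta> = (\<lambda>f. g * euler_derivation f) + (\<lambda>f. lin q * \<zeta> f)"
    unfolding \<eta>\<zeta>[symmetric] by (simp add: \<eta>_def)
  ultimately show ?thesis by (rule that[rotated])
qed

lemma D0L_rels_iff:
  assumes \<theta>: "\<theta> \<in> piece D0L d"
  shows "\<theta> \<in> rels D0L \<longleftrightarrow> evD \<theta> = 0"
proof
  let ?G = "{(\<lambda>f. g * euler_derivation f) | g. True} \<union> {(\<lambda>f. g * \<theta> f) | g \<theta> d. g \<in> vanishing_ideal L \<and> \<theta> \<in> piece D0L d}"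
  have "to_m_gg.m1.subspace {\<theta>. evD \<theta> = 0}"
    by (rule to_m_gg.m1.subspaceI) (simp_all add: evD_add evD_scale, simp_all add: evD_def dehom.zero prod_eq_iff)
  moreover have "?G \<subseteq> {\<theta>. evD \<theta> = 0}"
    by (auto simp: evD_scale evD_euler dehom_vanishing_ideal) (simp_all add: prod_eq_iff)
  moreover assume "\<theta> \<in> rels D0L"
  ultimately show "evD \<theta> = 0" unfolding D0L_rels using to_m_gg.m1.span_minimal by blast
next
  assume "evD \<theta> = 0"
  then obtain g \<zeta> where *: "\<theta> = (\<lambda>f. g * euler_derivation f) + (\<lambda>f. lin q * \<zeta> f)" "\<zeta> \<in> piece D0L (d - 1)"
    by (rule evD_eq_0_imp[OF \<theta>])
  have "lin q \<in> vanishing_ideal L" by (simp add: vanishing_ideal_L)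
  then show "\<theta> \<in> rels D0L"
    unfolding D0L_rels *(1) using *(2)
    by (intro to_m_gg.m1.span_add[OF to_m_gg.m1.span_base[OF UnI1] to_m_gg.m1.span_base[OF UnI2]]) auto
qed

text \<open>A pair is lifted to the plane along the lines through a point; if the given point lies on a line
  of the arrangement, that centre of projection is taken on the same line.\<close>

lemma evD_lift:
  assumes X: "X \<in> Lat" "bd (int k + 1) (fst X)" "bd (int k) (snd X)" and r: "r \<in> L"
  shows "\<exists>e g \<theta>. g \<in> forms e \<and> r \<in> nonvanishing g \<and> \<theta> \<in> piece D0L (e + int k) \<and> evD \<theta> = psc (D g) X"
proof -
  define Z0 where "Z0 = {p \<in> Z. r = pt (node p)}"
  \<comment> \<open>Chosen so that for \<open>p\<close> in \<open>Z0\<close> the vector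
    \<open>m1 - node p *s l0\<close> is proportional to \<open>rep_proj2 p\<close>. The common zero
    of \<open>l0\<close> and \<open>m1\<close>, the centre of projection, then lies on the line of
    \<open>p\<close>.\<close>
  define s where "s = (if Z0 = {} then 0 else dot (rep_proj2 (SOME p. p \<in> Z0)) w / dot (rep_proj2 (SOME p. p \<in> Z0)) v)"
  have pt_inj: "x = y" if "pt x = pt y" for x y
  proof -
    have "pt y \<in> nonvanishing (lin (l1 - x *s l0)) \<longleftrightarrow> y \<noteq> x" for x y
      by (subst pt_nonvanishing[OF lin_forms]) (simp add: dot_simps)
    then show ?thesis using that by metis
  qed
  have s: "s = dot (rep_proj2 p) w / dot (rep_proj2 p) v" if "p \<in> Z0" for p
  proof -
    have "(SOME p. p \<in> Z0) \<in> Z0" using that by (rule someI)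
    then have "(SOME p. p \<in> Z0) = p" using that pt_inj node_inj unfolding Z0_def by blast
    then show ?thesis using that by (auto simp: s_def)
  qed
  define m1 where "m1 = l1 + s *s q"
  have m1: "dot m1 u = 0" "dot m1 v = 1" by (simp_all add: m1_def dot_simps)
  \<comment> \<open>The first component may have degree k + 1. Writing it as b - t a with both
    degrees at most \<open>k\<close> matches the shape of \<open>evD\<close>; \<open>a\<close> takes
    up the top coefficient.\<close>
  define a where "a = monom (- coeff (fst X) (Suc k)) k"
  define b where "b = fst X + [:0, 1:] * a"
  have deg: "degree a \<le> k" "degree b \<le> k" "degree (snd X) \<le> k"
  proof -
    show "degree a \<le> k" by (simp add: a_def degree_monom_le)
    show "degree (snd X) \<le> k" using X(3) by (simp add: bd_int)
    have "coeff b i = 0" if "i > k" for i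
    proof (cases "i = Suc k")
      case True
      then show ?thesis by (simp add: b_def a_def)
    next
      case False
      then show ?thesis using that X(2) by (cases i) (auto simp: b_def a_def bd_conv)
    qed
    then show "degree b \<le> k" by (simp add: degree_le)
  qed
  define h where "h = homog l0 m1 k"
  have Dh: "D (h a) = a" "D (h b) = b" "D (h (snd X)) = snd X"
    using deg by (simp_all add: h_def dehom_homog m1)
  define \<theta> where "\<theta> = vector_field (\<lambda>i. const (u $ i) * h a + const (v $ i) * h b + const (w $ i) * h (snd X))"
  have der: "\<theta> \<in> derivations" by (simp add: \<theta>_def vector_field_derivation)
  have \<theta>lin: "\<theta> (lin c) = const (dot c u) * h a + const (dot c v) * h b + const (dot c w) * h (snd X)" for c
    by (simp add: derivations_lin[OF der]) (simp add: \<theta>_def sum_UNIV_3 dot_3 const.hom algebra_simps)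
  \<comment> \<open>Multiplication by \<open>g\<close> enforces tangency to the lines that do not
    pass through \<open>r\<close>, and \<open>g\<close> does not vanish at \<open>r\<close>.\<close>
  define g where "g = (\<Prod>p\<in>Z - Z0. lin (rep_proj2 p))"
  have g: "g \<in> forms (int (card (Z - Z0)))"
    unfolding g_def using finite_Z by (intro forms_prod_linear lin_forms) auto
  have rg: "r \<in> nonvanishing g"
  proof (rule L_cases[OF r])
    fix t assume t: "r = pt t"
    have "dot (rep_proj2 p) (u + t *s v) \<noteq> 0" if "p \<in> Z - Z0" for p
    proof
      assume "dot (rep_proj2 p) (u + t *s v) = 0"
      then have "dot (rep_proj2 p) v * (t - node p) = 0"
        using dot_u[of p] that by (simp add: dot_simps algebra_simps)
      then show False using dot_v[of p] that t by (auto simp: Z0_def)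
    qed
    then show ?thesis unfolding t pt_nonvanishing[OF g] poly_dehom using finite_Z by (simp add: g_def eval3.prod)
  next
    assume t: "r = inf_pt"
    then show ?thesis unfolding t inf_nonvanishing[OF g] using finite_Z dot_v by (simp add: g_def eval3.prod)
  qed
  have "lin (rep_proj2 p) dvd g * \<theta> (lin (rep_proj2 p))" if p: "p \<in> Z" for p
  proof (cases "p \<in> Z0")
    case False
    then have "lin (rep_proj2 p) dvd g" unfolding g_def using p finite_Z by (intro dvd_prodI) auto
    then show ?thesis by (rule dvd_mult2)
  next
    case True
    let ?c = "rep_proj2 p"
    have "lin ?c dvd \<theta> (lin ?c)"
    proof (rule dvd_if_vanishes_on_plane)
      show "?c \<noteq> 0" using coords_nonzero[OF rep_proj2_in_coords] .
      fix y assume y: "dot ?c y = 0"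
      have "dot ?c (dot l0 y *s u + dot l1 y *s v + dot q y *s w) = 0" using y decompose[of y] by simp
      then have "dot ?c v * (dot l1 y - node p * dot l0 y) + dot ?c w * dot q y = 0"
        by (simp add: dot_simps dot_u[OF p] algebra_simps)
      moreover have "dot ?c w = s * dot ?c v" using s[OF True] dot_v[OF p] by simp
      ultimately have "dot ?c v * (dot m1 y - node p * dot l0 y) = 0"
        by (simp add: m1_def dot_simps algebra_simps)
      then have m1y: "dot m1 y = node p * dot l0 y" using dot_v[OF p] by simp
      have eval: "eval3 (h P) y = dot l0 y ^ k * poly P (node p)" if "degree P \<le> k" for P
      proof -
        have "eval3 (h P) y = (\<Sum>j\<le>k. dot l0 y ^ k * (coeff P j * node p ^ j))"
          unfolding h_def eval3_homog m1y
        proof (rule sum.cong[OF refl])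
          fix j assume "j \<in> {..k}"
          then have "dot l0 y ^ k = dot l0 y ^ (k - j) * dot l0 y ^ j" by (simp add: power_add[symmetric])
          then show "coeff P j * (dot l0 y ^ (k - j) * (node p * dot l0 y) ^ j) = dot l0 y ^ k * (coeff P j * node p ^ j)"
            by (simp add: power_mult_distrib)
        qed
        then show ?thesis by (simp add: poly_conv_sum_atMost[OF that] sum_distrib_left)
      qed
      have "eval3 (\<theta> (lin ?c)) y = dot l0 y ^ k * (dot ?c v * poly (fst X) (node p) + dot ?c w * poly (snd X) (node p))"
        by (simp add: \<theta>lin eval3.hom eval deg dot_u[OF p]) (simp add: b_def algebra_simps)
      then show "eval3 (\<theta> (lin ?c)) y = 0" using X(1) p by (simp add: Lat_def)
    qed
    then show ?thesis by (rule dvd_mult)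
  qed
  then have "(\<lambda>f. g * \<theta> f) \<in> D_module (arrangement Z)"
    using D_module_iff_rep[OF derivations_scale[OF der]] by blast
  moreover have "g * \<theta> l \<in> forms (int (card (Z - Z0)) + int k)" if l: "l \<in> forms 1" for l
  proof -
    obtain c where "l = lin c" using forms_1_conv_lin[OF l] by blast
    then have "\<theta> l \<in> forms (int k)" unfolding \<theta>lin h_def by (auto simp: \<theta>lin h_def intro!: forms_add forms_const_mult homog_forms)
    then show ?thesis using forms_mult[OF g] by blast
  qed
  ultimately have "(\<lambda>f. g * \<theta> f) \<in> piece D0L (int (card (Z - Z0)) + int k)" by (simp add: D0L_simps)
  moreover have "evD (\<lambda>f. g * \<theta> f) = psc (D g) X"
    unfolding evD_scale by (simp add: evD_def \<theta>lin dehom.hom Dh const.hom) (simp add: b_def)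
  ultimately show ?thesis using g rg by blast
qed

lemma line_sheaf_D0L: "line_sheaf lam \<alpha> \<beta> D0L evD 1 0 Lat"
proof
  fix \<theta> d assume \<theta>: "\<theta> \<in> piece D0L d"
  show "bd (d + 1) (fst (evD \<theta>)) \<and> bd (d + 0) (snd (evD \<theta>))"
  proof -
    have 1: "bd d (D (\<theta> (lin c)))" for c using \<theta> lin_forms by (auto simp: D0L_simps intro: dehom_bd)
    have "bd (d + 1) (D (\<theta> (lin l1)))" by (rule bd_mono[OF 1]) simp
    from bd_diff[OF this bd_T_mult[OF 1]] show ?thesis using 1[of q] by (simp add: evD_def)
  qed
next
  fix X assume *: "\<And>t. \<exists>F. poly F t \<noteq> 0 \<and> psc F X \<in> Lat"
  have "dot (rep_proj2 p) v * poly (fst X) (node p) + dot (rep_proj2 p) w * poly (snd X) (node p) = 0" if p: "p \<in> Z" for p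
  proof -
    obtain F where F: "poly F (node p) \<noteq> 0" "psc F X \<in> Lat" using *[of "node p"] by blast
    then have "poly F (node p) * (dot (rep_proj2 p) v * poly (fst X) (node p) + dot (rep_proj2 p) w * poly (snd X) (node p)) = 0"
    proof -
      have "dot (rep_proj2 p) v * (poly F (node p) * poly (fst X) (node p))
          + dot (rep_proj2 p) w * (poly F (node p) * poly (snd X) (node p)) = 0"
        using F(2) p by (simp add: Lat_def)
      then show ?thesis by (simp add: distrib_left mult.left_commute)
    qed
    then show ?thesis using F(1) by simp
  qed
  then show "X \<in> Lat" by (simp add: Lat_def)
next
  fix f d \<theta> e assume "f \<in> forms d" "\<theta> \<in> piece D0L e"
  then show "scale D0L f \<theta> \<in> piece D0L (d + e)"
    by (auto simp: D0L_simps D_module_scale intro: forms_mult)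
next
  fix \<theta> \<eta> d assume *: "\<theta> \<in> piece D0L d" "\<eta> \<in> piece D0L d"
  have der: "\<theta> \<in> derivations" "\<eta> \<in> derivations" "\<theta> + \<eta> \<in> derivations" "\<theta> - \<eta> \<in> derivations"
    using * derivations_closed by (auto simp: D0L_simps D_module_def)
  show "\<theta> + \<eta> \<in> piece D0L d" "\<theta> - \<eta> \<in> piece D0L d"
    using * by (auto simp: D0L_simps D_module_iff_rep der forms_add forms_diff)
next
  fix X k p assume "X \<in> Lat" "bd (int k + 1) (fst X)" "bd (int k + 0) (snd X)" "p \<in> L"
  then show "\<exists>e g x. g \<in> forms e \<and> p \<in> nonvanishing g \<and> x \<in> piece D0L (e + int k) \<and> evD x = psc (D g) X"
    using evD_lift[of X k p] by simp
qed (auto simp: D0L_simps evD_scale evD_add evD_diff evD_Lat D0L_rels_iff[unfolded D0L_simps])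

end

section \<open>Dimension counts\<close>

text \<open>\<open>f\<close> has to be linear only as far as sums and multiples stay in
  \<open>V\<close>, as for the bijections between spaces of sections. It is injective on the span of
  \<open>S\<close>, so independence is carried over.\<close>

lemma independent_card_le_image:
  fixes s1 :: "'k::field \<Rightarrow> 'a::ab_group_add \<Rightarrow> 'a" and s2 :: "'k \<Rightarrow> 'b::ab_group_add \<Rightarrow> 'b"
  assumes "vector_space s1" "vector_space s2"
    and S: "finite S" "\<not> module.dependent s1 S" "module.span s1 S \<subseteq> V"
    and add: "\<And>x y. x \<in> V \<Longrightarrow> y \<in> V \<Longrightarrow> x + y \<in> V \<Longrightarrow> f (x + y) = f x + f y"
    and scl: "\<And>c x. x \<in> V \<Longrightarrow> s1 c x \<in> V \<Longrightarrow> f (s1 c x) = s2 c (f x)"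
    and ker: "\<And>x. x \<in> V \<Longrightarrow> f x = 0 \<Longrightarrow> x = 0"
    and B: "finite B" "f ` S \<subseteq> module.span s2 B"
  shows "card S \<le> card B"
proof -
  interpret v1: vector_space s1 by fact
  interpret v2: vector_space s2 by fact
  have comb: "(\<Sum>x\<in>A. s1 (g x) x) \<in> v1.span S" if "A \<subseteq> S" for A g
    using that by (intro v1.span_sum v1.span_scale) (auto intro: v1.span_base)
  have sum: "f (\<Sum>x\<in>A. s1 (g x) x) = (\<Sum>x\<in>A. s2 (g x) (f x))" if "A \<subseteq> S" for A g
    using finite_subset[OF that S(1)] that
  proof (induction A rule: finite_induct)
    case empty
    have "0 \<in> V" using v1.span_zero S(3) by blast
    then have "f 0 = f 0 + f 0" using add[of 0 0] by simp
    then show ?case by simp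
  next
    case (insert x A)
    have 1: "s1 (g x) x \<in> v1.span S" "(\<Sum>x\<in>A. s1 (g x) x) \<in> v1.span S" "x \<in> v1.span S"
      using insert comb v1.span_base v1.span_scale by auto
    then have 2: "s1 (g x) x + (\<Sum>x\<in>A. s1 (g x) x) \<in> v1.span S" by (intro v1.span_add)
    have "f (s1 (g x) x + (\<Sum>x\<in>A. s1 (g x) x)) = f (s1 (g x) x) + f (\<Sum>x\<in>A. s1 (g x) x)"
      using 1 2 S(3) by (intro add) auto
    then show ?case using insert scl[of x "g x"] 1 S(3) by auto
  qed
  have inj: "inj_on f S"
  proof (rule inj_onI)
    fix x y assume xy: "x \<in> S" "y \<in> S" "f x = f y"
    have 1: "x \<in> v1.span S" "y \<in> v1.span S" using xy v1.span_base by auto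
    then have d: "x - y \<in> v1.span S" by (rule v1.span_diff)
    then have "f (x - y + y) = f (x - y) + f y" using S(3) 1 by (intro add) auto
    then have "f (x - y) = 0" using xy by simp
    then show "x = y" using ker[of "x - y"] d S(3) by auto
  qed
  have "v2.independent (f ` S)"
  proof (rule v2.independent_if_scalars_zero)
    fix g y assume g: "(\<Sum>x\<in>f ` S. s2 (g x) x) = 0" and y: "y \<in> f ` S"
    have "f (\<Sum>x\<in>S. s1 (g (f x)) x) = (\<Sum>x\<in>S. s2 (g (f x)) (f x))" by (rule sum) simp
    also have "\<dots> = 0" using g by (simp add: sum.reindex[OF inj])
    finally have "(\<Sum>x\<in>S. s1 (g (f x)) x) = 0"
      using S(3) comb[of S] by (intro ker) auto
    then show "g y = 0" using v1.independentD[OF S(2,1) order_refl, of "\<lambda>x. g (f x)"] y by auto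
  qed (use S in simp)
  from v2.independent_span_bound[OF B(1) this B(2)] show ?thesis by (simp add: card_image[OF inj])
qed

lemma sum_fun_apply: "(\<Sum>i\<in>I. F i) x = (\<Sum>i\<in>I. F i x :: 'b::comm_monoid_add)"
  by (induction I rule: infinite_finite_induct) simp_all

lemma vector_space_fun: "vector_space (\<lambda>c (g :: 'i \<Rightarrow> complex) i. c * g i)"
  by unfold_locales (simp_all add: fun_eq_iff algebra_simps)

text \<open>Rank and nullity: a basis \<open>S\<close> of the common kernel is extended to a basis
  of the span, and the added vectors map to independent vectors in the coordinate space over
  \<open>I\<close>.\<close>

lemma independent_in_kernel:
  fixes s :: "complex \<Rightarrow> 'a::ab_group_add \<Rightarrow> 'a" and l :: "'i \<Rightarrow> 'a \<Rightarrow> complex"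
  assumes "vector_space s" and B: "finite B" "\<not> module.dependent s B" and I: "finite I"
    and add: "\<And>i x y. l i (x + y) = l i x + l i y" and scl: "\<And>i c x. l i (s c x) = c * l i x"
  obtains S where "finite S" "\<not> module.dependent s S" "card B \<le> card S + card I"
    "module.span s S \<subseteq> {x \<in> module.span s B. \<forall>i\<in>I. l i x = 0}"
proof -
  interpret vector_space s by fact
  interpret f: vector_space "\<lambda>c (g :: 'i \<Rightarrow> complex) i. c * g i" by (rule vector_space_fun)
  define K where "K = {x \<in> span B. \<forall>i\<in>I. l i x = 0}"
  have l0: "l i 0 = 0" for i using add[of i 0 0] by simp
  have K: "subspace K" unfolding K_def
    by (rule subspaceI) (auto simp: add scl l0 intro: span_zero span_add span_scale)
  obtain S where S: "S \<subseteq> K" "independent S" "K \<subseteq> span S" by (rule maximal_independent_subset)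
  have SB: "S \<subseteq> span B" using S(1) by (auto simp: K_def)
  have finS: "finite S" using independent_span_bound[OF B(1) S(2) SB] by blast
  obtain T where T: "S \<subseteq> T" "T \<subseteq> span B" "independent T" "span B \<subseteq> span T"
    by (rule maximal_independent_subset_extend[OF SB S(2)])
  have finT: "finite T" using independent_span_bound[OF B(1) T(3,2)] by blast
  have "B \<subseteq> span T" using T(4) span_superset by blast
  then have cardT: "card B \<le> card T" using independent_span_bound[OF finT B(2)] by blast
  have spanT: "span T \<subseteq> span B" using T(2) by (rule span_minimal) simp
  define e where "e i = (\<lambda>j. if j = i then 1 else 0 :: complex)" for i :: 'i
  have "card (T - S) \<le> card (e ` I)"
  proof (rule independent_card_le_image[where f = "\<lambda>x i. if i \<in> I then l i x else 0" and V = "span (T - S)"])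
    show "vector_space s" by fact
    show "vector_space (\<lambda>c (g :: 'i \<Rightarrow> complex) i. c * g i)" by (rule vector_space_fun)
    show "finite (T - S)" "finite (e ` I)" using finT I by auto
    show "independent (T - S)" using T(3) by (rule independent_mono) blast
    fix x assume x: "x \<in> span (T - S)" and 0: "(\<lambda>i. if i \<in> I then l i x else 0) = 0"
    have "l i x = 0" if "i \<in> I" for i using fun_cong[OF 0, of i] that by simp
    moreover have "x \<in> span B" using x spanT span_mono[of "T - S" T] by blast
    ultimately have "x \<in> span S" using S(3) by (auto simp: K_def)
    then obtain a where a: "x = (\<Sum>v\<in>S. s (a v) v)" using span_finite[OF finS] by auto
    obtain b where b: "x = (\<Sum>v\<in>T - S. s (b v) v)" using x span_finite[of "T - S"] finT by auto
    have "(\<Sum>v\<in>T. s (if v \<in> S then a v else - b v) v)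
        = (\<Sum>v\<in>T - S. s (if v \<in> S then a v else - b v) v) + (\<Sum>v\<in>S. s (if v \<in> S then a v else - b v) v)"
      by (rule sum.subset_diff[OF T(1) finT])
    also have "\<dots> = - (\<Sum>v\<in>T - S. s (b v) v) + (\<Sum>v\<in>S. s (a v) v)"
      by (simp add: sum_negf)
    also have "\<dots> = 0" using a b by simp
    finally have "b v = 0" if "v \<in> T - S" for v
      using independentD[OF T(3) finT order_refl, of "\<lambda>v. if v \<in> S then a v else - b v" v] that by auto
    then show "x = 0" unfolding b by simp
  next
    show "(\<lambda>x i. if i \<in> I then l i x else 0) ` (T - S) \<subseteq> f.span (e ` I)"
    proof
      fix g assume "g \<in> (\<lambda>x i. if i \<in> I then l i x else 0) ` (T - S)"
      then obtain x where g: "g = (\<lambda>i. if i \<in> I then l i x else 0)" by blast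
      have "g = (\<Sum>i\<in>I. (\<lambda>j. l i x * e i j))"
        using I by (auto simp: g fun_eq_iff e_def sum_fun_apply if_distrib cong: if_cong)
      also have "\<dots> \<in> f.span (e ` I)" by (intro f.span_sum f.span_scale f.span_base imageI)
      finally show "g \<in> f.span (e ` I)" .
    qed
  qed (auto simp: add scl fun_eq_iff)
  also have "\<dots> \<le> card I" using I by (rule card_image_le)
  finally have "card B \<le> card S + card I"
    using cardT card_Diff_subset[OF finS T(1)] card_mono[OF finT T(1)] by linarith
  moreover have "span S \<subseteq> K" using S(1) K by (rule span_minimal)
  ultimately show ?thesis using that finS S(2) unfolding K_def by blast
qed

abbreviation pair_scale :: "complex \<Rightarrow> complex poly \<times> complex poly \<Rightarrow> complex poly \<times> complex poly" where
  "pair_scale c X \<equiv> (smult c (fst X), smult c (snd X))"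

interpretation pair: vector_space pair_scale
  by unfold_locales (simp_all add: prod_eq_iff algebra_simps smult_add_left smult_add_right)

text \<open>The global sections of O(m) \<oplus> O(n) on a line.\<close>

definition bdspace :: "int \<Rightarrow> int \<Rightarrow> (complex poly \<times> complex poly) set" where
  "bdspace m n = {X. bd m (fst X) \<and> bd n (snd X)}"

definition bdbasis :: "int \<Rightarrow> int \<Rightarrow> (complex poly \<times> complex poly) set" where
  "bdbasis m n = (\<lambda>i. (monom 1 i, 0)) ` {..<nat (m + 1)} \<union> (\<lambda>i. (0, monom 1 i)) ` {..<nat (n + 1)}"

lemma bdspace_subspace: "pair.subspace (bdspace m n)"
  by (rule pair.subspaceI) (use bd_const_mult in \<open>auto simp: bdspace_def intro: bd_add\<close>)

lemma finite_bdbasis: "finite (bdbasis m n)"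
  by (simp add: bdbasis_def)

lemma sum_bdbasis:
  fixes h :: "complex poly \<times> complex poly \<Rightarrow> 'c::comm_monoid_add"
  shows "sum h (bdbasis m n) = (\<Sum>i<nat (m + 1). h (monom 1 i, 0)) + (\<Sum>i<nat (n + 1). h (0, monom 1 i))"
proof -
  have 1: "inj_on (\<lambda>i. (monom 1 i :: complex poly, 0 :: complex poly)) A" "inj_on (\<lambda>i. (0 :: complex poly, monom 1 i :: complex poly)) A" for A
    by (auto simp: inj_on_def monom_eq_iff')
  have "(\<lambda>i. (monom 1 i :: complex poly, 0 :: complex poly)) ` {..<nat (m + 1)} \<inter> (\<lambda>i. (0, monom 1 i)) ` {..<nat (n + 1)} = {}"
    by (auto simp: monom_eq_0_iff)
  then show ?thesis unfolding bdbasis_def by (subst sum.union_disjoint) (simp_all add: sum.reindex 1)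
qed

lemma card_bdbasis: "card (bdbasis m n) = nat (m + 1) + nat (n + 1)"
  unfolding card_eq_sum sum_bdbasis by simp

lemma bdbasis_independent: "pair.independent (bdbasis m n)"
proof (rule pair.independent_if_scalars_zero[OF finite_bdbasis])
  fix g x assume g: "(\<Sum>x\<in>bdbasis m n. pair_scale (g x) x) = 0" and x: "x \<in> bdbasis m n"
  have "(\<Sum>i<nat (m + 1). monom (g (monom 1 i, 0)) i) = 0" "(\<Sum>i<nat (n + 1). monom (g (0, monom 1 i)) i) = 0"
    using arg_cong[OF g, of fst] arg_cong[OF g, of snd] unfolding fst_sum snd_sum sum_bdbasis
    by (simp_all add: smult_monom fst_sum snd_sum)
  then have "coeff (\<Sum>i<nat (m + 1). monom (g (monom 1 i, 0)) i) j = 0" "coeff (\<Sum>i<nat (n + 1). monom (g (0, monom 1 i)) i) j = 0" for j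
    by simp_all
  then have "(if j < nat (m + 1) then g (monom 1 j, 0) else 0) = 0" "(if j < nat (n + 1) then g (0, monom 1 j) else 0) = 0" for j
    unfolding coeff_sum coeff_monom by (simp_all add: sum.delta)
  then have "\<forall>j<nat (m + 1). g (monom 1 j, 0) = 0" "\<forall>j<nat (n + 1). g (0, monom 1 j) = 0"
    by metis+
  then show "g x = 0" using x by (auto simp: bdbasis_def)
qed

lemma span_bdbasis: "pair.span (bdbasis m n) = bdspace m n"
proof (intro equalityI)
  show "pair.span (bdbasis m n) \<subseteq> bdspace m n"
    by (rule pair.span_minimal[OF _ bdspace_subspace])
      (auto simp: bdbasis_def bdspace_def bd_conv)
  show "bdspace m n \<subseteq> pair.span (bdbasis m n)"
  proof
    fix X assume X: "X \<in> bdspace m n"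
    have *: "p = (\<Sum>i<nat (k + 1). smult (coeff p i) (monom 1 i))" if "bd k p" for k p
      using that by (intro Polynomial.poly_eqI) (auto simp: coeff_sum smult_monom if_distrib bd_conv cong: if_cong)
    have "X = (\<Sum>i<nat (m + 1). pair_scale (coeff (fst X) i) (monom 1 i, 0)) + (\<Sum>i<nat (n + 1). pair_scale (coeff (snd X) i) (0, monom 1 i))"
      using X *[of m "fst X"] *[of n "snd X"] by (simp add: prod_eq_iff fst_sum snd_sum bdspace_def)
    also have "\<dots> \<in> pair.span (bdbasis m n)"
      by (intro pair.span_add pair.span_sum pair.span_scale pair.span_base) (auto simp: bdbasis_def)
    finally show "X \<in> pair.span (bdbasis m n)" .
  qed
qed

lemma pair_dim_le:
  assumes vs: "vector_space s1" and S: "finite S" "\<not> module.dependent s1 S" "module.span s1 S \<subseteq> V"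
    and add: "\<And>x y. x \<in> V \<Longrightarrow> y \<in> V \<Longrightarrow> x + y \<in> V \<Longrightarrow> f (x + y) = f x + f y"
    and scl: "\<And>c x. x \<in> V \<Longrightarrow> s1 c x \<in> V \<Longrightarrow> f (s1 c x) = pair_scale c (f x)"
    and ker: "\<And>x. x \<in> V \<Longrightarrow> f x = 0 \<Longrightarrow> x = 0"
    and img: "f ` V \<subseteq> bdspace m n"
  shows "card S \<le> nat (m + 1) + nat (n + 1)"
proof -
  interpret v1: vector_space s1 by fact
  have "f ` S \<subseteq> pair.span (bdbasis m n)"
    unfolding span_bdbasis using img S(3) v1.span_superset[of S] by blast
  then have "card S \<le> card (bdbasis m n)"
    by (rule independent_card_le_image[where f = f and V = V, OF vs pair.vector_space_axioms S _ _ _ finite_bdbasis, rotated 3])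
      (fact add scl ker)+
  then show ?thesis by (simp add: card_bdbasis)
qed

definition linear_iso :: "((complex poly \<times> complex poly) \<Rightarrow> (complex poly \<times> complex poly)) \<Rightarrow> _ set \<Rightarrow> _ set \<Rightarrow> bool" where
  "linear_iso \<Psi> V W \<longleftrightarrow> bij_betw \<Psi> V W \<and>
    (\<forall>X\<in>V. \<forall>Y\<in>V. X + Y \<in> V \<longrightarrow> \<Psi> (X + Y) = \<Psi> X + \<Psi> Y) \<and>
    (\<forall>X\<in>V. \<forall>c. pair_scale c X \<in> V \<longrightarrow> \<Psi> (pair_scale c X) = pair_scale c (\<Psi> X))"

lemma linear_iso_zero:
  assumes "linear_iso \<Psi> V W" "0 \<in> V" "X \<in> V"
  shows "\<Psi> X = 0 \<longleftrightarrow> X = 0"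
proof -
  have "\<forall>X\<in>V. \<forall>Y\<in>V. X + Y \<in> V \<longrightarrow> \<Psi> (X + Y) = \<Psi> X + \<Psi> Y"
    by (rule assms(1)[unfolded linear_iso_def, THEN conjunct2, THEN conjunct1])
  from bspec[OF bspec[OF this assms(2)] assms(2)] have "\<Psi> (0 + 0) = \<Psi> 0 + \<Psi> 0" using assms(2) by simp
  then have "\<Psi> 0 = 0" by simp
  moreover have "inj_on \<Psi> V" using assms(1) by (auto simp: linear_iso_def bij_betw_def)
  ultimately show ?thesis using inj_onD[of \<Psi> V X 0] assms(2,3) by auto
qed

lemma linear_iso_inv:
  assumes "linear_iso \<Psi> V W" "pair.subspace V"
  shows "linear_iso (the_inv_into V \<Psi>) W V"
proof -
  have bij: "bij_betw \<Psi> V W" using assms by (simp add: linear_iso_def)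
  let ?\<Phi> = "the_inv_into V \<Psi>"
  have bij': "bij_betw ?\<Phi> W V" by (rule bij_betw_the_inv_into[OF bij])
  have 1: "?\<Phi> Y \<in> V" if "Y \<in> W" for Y using bij_betwE[OF bij'] that by blast
  have 2: "\<Psi> (?\<Phi> Y) = Y" if "Y \<in> W" for Y using f_the_inv_into_f_bij_betw[OF bij] that by blast
  have 3: "?\<Phi> (\<Psi> X) = X" if "X \<in> V" for X
    using the_inv_into_f_f[OF bij_betw_imp_inj_on[OF bij] that] .
  have "?\<Phi> (X + Y) = ?\<Phi> X + ?\<Phi> Y" if "X \<in> W" "Y \<in> W" "X + Y \<in> W" for X Y
  proof -
    have "?\<Phi> X + ?\<Phi> Y \<in> V" using 1 that pair.subspace_add[OF assms(2)] by blast
    then have "\<Psi> (?\<Phi> X + ?\<Phi> Y) = X + Y" using assms(1) 1 2 that unfolding linear_iso_def by metis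
    then show ?thesis using 3[OF \<open>?\<Phi> X + ?\<Phi> Y \<in> V\<close>] by simp
  qed
  moreover have "?\<Phi> (pair_scale c X) = pair_scale c (?\<Phi> X)" if "X \<in> W" "pair_scale c X \<in> W" for X c
  proof -
    have V: "pair_scale c (?\<Phi> X) \<in> V" using 1 that pair.subspace_scale[OF assms(2)] by blast
    then have "\<Psi> (pair_scale c (?\<Phi> X)) = pair_scale c (\<Psi> (?\<Phi> X))" using assms(1) 1[OF that(1)] unfolding linear_iso_def by blast
    then have "\<Psi> (pair_scale c (?\<Phi> X)) = pair_scale c X" using 2[OF that(1)] by simp
    then show ?thesis using 3[OF V] by simp
  qed
  ultimately show ?thesis using bij' by (simp add: linear_iso_def)
qed

context good_line begin

text \<open>The global sections of the \<open>k\<close>-th twist of the restricted sheaf. The two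
  bounds differ by one because \<open>evD\<close> multiplies one value by the parameter.\<close>

definition E :: "nat \<Rightarrow> (complex poly \<times> complex poly) set" where
  "E k = Lat \<inter> bdspace (int k + 1) (int k)"

lemma Lat_subspace: "pair.subspace Lat"
proof (rule pair.subspaceI)
  fix X Y assume XY: "X \<in> Lat" "Y \<in> Lat"
  have *: "a * (x + y) + b * (z + t) = (a * x + b * z) + (a * y + b * t)" for a b x y z t :: complex
    by (simp add: algebra_simps)
  show "X + Y \<in> Lat" using XY by (simp add: Lat_def *)
next
  fix X c assume X: "X \<in> Lat"
  have "dot (rep_proj2 p) v * (c * poly (fst X) (node p)) + dot (rep_proj2 p) w * (c * poly (snd X) (node p)) = 0" if "p \<in> Z" for p
  proof -
    have "c * (dot (rep_proj2 p) v * poly (fst X) (node p) + dot (rep_proj2 p) w * poly (snd X) (node p)) = 0"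
      using X that by (simp add: Lat_def)
    then show ?thesis by (simp add: distrib_left mult.left_commute)
  qed
  then show "pair_scale c X \<in> Lat" by (simp add: Lat_def)
qed (simp add: Lat_def)

lemma E_subspace: "pair.subspace (E k)"
  unfolding E_def by (rule pair.subspace_inter[OF Lat_subspace bdspace_subspace])

lemma ex_linear_iso:
  assumes "sheaves_isomorphic L (restrict_to L (D0_module (arrangement Z)))
     (restrict_to L (direct_sum (twist (- a1) polynomial_module) (twist (- a2) polynomial_module)))"
  shows "\<exists>\<Psi>. linear_iso \<Psi> (E k) (bdspace (int k - a1) (int k - a2))"
proof -
  interpret A: line_sheaf lam \<alpha> \<beta> D0L evD 1 0 Lat by (rule line_sheaf_D0L)
  interpret B: line_sheaf lam \<alpha> \<beta> "split_module a1 a2" "\<lambda>x. (D (fst x), D (snd x))" "- a1" "- a2" UNIV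
    by (rule line_sheaf_split)
  have "A.global k = E k" "B.global k = bdspace (int k - a1) (int k - a2)"
    by (auto simp: A.global_def B.global_def E_def bdspace_def)
  then show ?thesis
    using sheaf_isomorphism_global[OF line_sheaf_D0L line_sheaf_split assms[folded D0L_def split_module_def], of k]
    by (simp add: linear_iso_def)
qed

text \<open>Comparing dimensions for large \<open>k\<close>, where the conditions at the nodes are independent.\<close>

lemma card_Z:
  assumes iso: "\<And>k. \<exists>\<Psi>. linear_iso \<Psi> (E k) (bdspace (int k - a1) (int k - a2))" and a: "0 \<le> a1" "a1 \<le> a2"
  shows "int (card Z) = a1 + a2 + 1"
proof -
  define n where "n = card Z"
  \<comment> \<open>Large enough that none of the dimensions below is truncated at zero.\<close>
  define k where "k = n + nat a2"
  have k: "int k \<ge> a2" "k \<ge> n" using a by (auto simp: k_def)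
  obtain \<Psi> where \<Psi>: "linear_iso \<Psi> (E k) (bdspace (int k - a1) (int k - a2))" using iso by blast
  let ?l = "\<lambda>p X. dot (rep_proj2 p) v * poly (fst X) (node p) + dot (rep_proj2 p) w * poly (snd X) (node p)"
  \<comment> \<open>Lower bound for the dimension of \<open>E k\<close>: at most
    \<open>card Z\<close> linear conditions on a space of dimension 2 k + 3.\<close>
  obtain S where S: "finite S" "pair.independent S" "card (bdbasis (int k + 1) (int k)) \<le> card S + card Z"
    "pair.span S \<subseteq> {X \<in> pair.span (bdbasis (int k + 1) (int k)). \<forall>p\<in>Z. ?l p X = 0}"
    by (rule independent_in_kernel[OF pair.vector_space_axioms finite_bdbasis bdbasis_independent finite_Z, of ?l])
      (auto simp: algebra_simps)
  have "pair.span S \<subseteq> E k" using S(4) unfolding span_bdbasis E_def Lat_def by blast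
  then have "card S \<le> nat (int k - a1 + 1) + nat (int k - a2 + 1)"
  proof (rule pair_dim_le[OF pair.vector_space_axioms S(1,2), where f = \<Psi>])
    show "\<Psi> ` E k \<subseteq> bdspace (int k - a1) (int k - a2)"
      using \<Psi> by (auto simp: linear_iso_def bij_betw_def)
  qed (use \<Psi> linear_iso_zero[OF \<Psi> pair.subspace_0[OF E_subspace]] in \<open>auto simp: linear_iso_def\<close>)
  then have 1: "a1 + a2 + 1 \<le> int n" using S(3) k a by (simp add: card_bdbasis n_def)
  define \<Phi> where "\<Phi> = the_inv_into (E k) \<Psi>"
  have \<Phi>: "linear_iso \<Phi> (bdspace (int k - a1) (int k - a2)) (E k)"
    unfolding \<Phi>_def by (rule linear_iso_inv[OF \<Psi> E_subspace])
  define N where "N = (\<Prod>p\<in>Z. [:- node p, 1:])"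
  have N: "degree N = n" "N \<noteq> 0"
    using finite_Z by (simp_all add: N_def degree_prod_eq_sum_degree n_def)
  \<comment> \<open>Upper bound 2 k + 3 - n for the dimension of \<open>E k\<close>. If
    \<open>f X = 0\<close>, the second component is zero, so the first one vanishes at all
    \<open>n\<close> nodes, but it has degree less than \<open>n\<close>.\<close>
  define f where "f X = (snd X, fst X div N)" for X :: "complex poly \<times> complex poly"
  have f_img: "f X \<in> bdspace (int k) (int k + 1 - int n)" if "X \<in> E k" for X
  proof -
    have "degree (fst X) \<le> k + 1" "bd (int k) (snd X)"
      using that bd_int[of "k + 1" "fst X"] by (auto simp: E_def bdspace_def add.commute)
    moreover have "fst X div N = 0 \<or> degree (fst X div N) + n \<le> degree (fst X)"
    proof (cases "fst X div N = 0")
      case False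
      then have "degree (fst X div N * N) = degree (fst X div N) + n" using N by (simp add: degree_mult_eq)
      moreover have "degree (fst X div N * N) \<le> degree (fst X)"
      proof (cases "fst X mod N = 0")
        case True
        then show ?thesis by (metis div_mult_mod_eq add.right_neutral order_refl)
      next
        case mod: False
        then have "degree (fst X mod N) < degree (fst X div N * N)"
          using degree_mod_less[OF N(2), of "fst X"] calculation N(1) by simp
        from degree_add_eq_left[OF this] show ?thesis by (simp only: div_mult_mod_eq)
      qed
      ultimately show ?thesis by simp
    qed simp
    ultimately show ?thesis using k by (auto simp: f_def bdspace_def bd_def)
  qed
  have f_ker: "X = 0" if "X \<in> E k" "f X = 0" for X
  proof -
    have X: "snd X = 0" "fst X div N = 0" using that(2) by (auto simp: f_def prod_eq_iff)
    have "poly (fst X) (node p) = 0" if "p \<in> Z" for p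
      using \<open>X \<in> E k\<close> X(1) that dot_v by (auto simp: E_def Lat_def)
    then have "node ` Z \<subseteq> {t. poly (fst X) t = 0}" by auto
    have "fst X = 0"
    proof (rule ccontr)
      assume ne: "fst X \<noteq> 0"
      have "degree (fst X) < n" using X(2) ne N by (metis div_poly_eq_0_iff)
      moreover have "card (node ` Z) = n" using node_inj by (simp add: n_def card_image inj_on_def)
      moreover have "card (node ` Z) \<le> card {t. poly (fst X) t = 0}"
        using \<open>node ` Z \<subseteq> _\<close> poly_roots_finite[OF ne] card_mono by blast
      ultimately show False using card_poly_roots_bound[OF ne] by linarith
    qed
    then show ?thesis using X(1) by (simp add: prod_eq_iff)
  qed
  let ?W = "bdspace (int k - a1) (int k - a2)"
  have \<Phi>E: "\<Phi> X \<in> E k" if "X \<in> ?W" for X using \<Phi> that bij_betwE unfolding linear_iso_def by blast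
  have "card (bdbasis (int k - a1) (int k - a2)) \<le> nat (int k + 1) + nat (int k + 1 - int n + 1)"
  proof (rule pair_dim_le[OF pair.vector_space_axioms finite_bdbasis bdbasis_independent, where V = ?W and f = "\<lambda>X. f (\<Phi> X)"])
    show "pair.span (bdbasis (int k - a1) (int k - a2)) \<subseteq> ?W" by (simp add: span_bdbasis)
    show "(\<lambda>X. f (\<Phi> X)) ` ?W \<subseteq> bdspace (int k) (int k + 1 - int n)" using f_img \<Phi>E by blast
    show "f (\<Phi> (X + Y)) = f (\<Phi> X) + f (\<Phi> Y)" if "X \<in> ?W" "Y \<in> ?W" "X + Y \<in> ?W" for X Y
      using \<Phi> that by (simp add: linear_iso_def f_def poly_div_add_left)
    show "f (\<Phi> (pair_scale c X)) = pair_scale c (f (\<Phi> X))" if "X \<in> ?W" "pair_scale c X \<in> ?W" for X c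
    proof -
      have "\<Phi> (pair_scale c X) = pair_scale c (\<Phi> X)" using \<Phi> that unfolding linear_iso_def by blast
      then show ?thesis by (simp add: f_def div_smult_left)
    qed
    show "X = 0" if "X \<in> ?W" "f (\<Phi> X) = 0" for X
      using f_ker[OF \<Phi>E[OF that(1)] that(2)] linear_iso_zero[OF \<Phi> pair.subspace_0[OF bdspace_subspace] that(1)] by blast
  qed
  then have 2: "int n \<le> a1 + a2 + 1" using k a by (simp add: card_bdbasis)
  show ?thesis using 1 2 by (simp add: n_def)
qed

end

section \<open>General lines\<close>

lemma for_general_conj:
  assumes "for_general P" "for_general Q"
  shows "for_general (\<lambda>p. P p \<and> Q p)"
proof -
  obtain f d where f: "f \<in> forms d" "f \<noteq> 0" "\<And>p. p \<in> nonvanishing f \<Longrightarrow> P p"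
    by (rule for_general_nonvanishing[OF assms(1)]) blast
  obtain g e where g: "g \<in> forms e" "g \<noteq> 0" "\<And>p. p \<in> nonvanishing g \<Longrightarrow> Q p"
    by (rule for_general_nonvanishing[OF assms(2)]) blast
  have fg: "f * g \<in> forms (d + e)" "f * g \<noteq> 0" using f g by (auto intro: forms_mult)
  show ?thesis unfolding for_general_def
    using openin_zariski_nonvanishing[OF fg(1)] nonvanishing_nonempty_iff[OF fg(1)] fg(2) f(3) g(3)
    by (intro exI[of _ "nonvanishing (f * g)"]) (auto simp: nonvanishing_mult[symmetric])
qed

lemma cross_eq_0_imp:
  assumes "cross c d = 0" "c \<noteq> 0"
  shows "\<exists>k. d = k *s c"
proof -
  have eq: "c $ 1 * d $ 2 = c $ 2 * d $ 1" "c $ 2 * d $ 0 = c $ 0 * d $ 2" "c $ 0 * d $ 1 = c $ 1 * d $ 0"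
    using assms(1) by (simp_all add: vec_eq_iff all_3 cross_def)
  from assms(2) consider "c $ 0 \<noteq> 0" | "c $ 1 \<noteq> 0" | "c $ 2 \<noteq> 0"
    using all_3[of "\<lambda>i. c $ i = 0"] by (auto simp: vec_eq_iff)
  then show ?thesis
  proof cases
    case 1
    then show ?thesis using eq by (intro exI[of _ "d $ 0 / c $ 0"]) (simp add: vec_eq_iff all_3 field_simps)
  next
    case 2
    then show ?thesis using eq by (intro exI[of _ "d $ 1 / c $ 1"]) (simp add: vec_eq_iff all_3 field_simps)
  next
    case 3
    then show ?thesis using eq by (intro exI[of _ "d $ 2 / c $ 2"]) (simp add: vec_eq_iff all_3 field_simps)
  qed
qed

lemma cross_rep_neq_0:
  assumes "p \<noteq> r"
  shows "cross (rep_proj2 p) (rep_proj2 r) \<noteq> 0"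
proof
  assume "cross (rep_proj2 p) (rep_proj2 r) = 0"
  then obtain k where k: "rep_proj2 r = k *s rep_proj2 p"
    using cross_eq_0_imp coords_nonzero[OF rep_proj2_in_coords] by blast
  then have "k \<noteq> 0" using coords_nonzero[OF rep_proj2_in_coords[of r]] by auto
  then have "rep_proj2 r \<in> coords p" unfolding coords_conv[OF rep_proj2_in_coords[of p]] using k by blast
  then show False using assms coords_eqD rep_proj2_in_coords by blast
qed

lemma forms_prod_ex: "finite A \<Longrightarrow> (\<And>a. a \<in> A \<Longrightarrow> \<exists>d. f a \<in> forms d) \<Longrightarrow> \<exists>d. prod f A \<in> forms d"
proof (induction A rule: finite_induct)
  case (insert a A)
  then obtain d e where "f a \<in> forms d" "prod f A \<in> forms e" by blast
  then have "f a * prod f A \<in> forms (d + e)" by (rule forms_mult)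
  then show ?case using insert.hyps by auto
qed (use forms_1 in auto)

text \<open>In terms of \<open>q\<close>, the conditions for a good line are the nonvanishing of linear forms.\<close>

lemma general_good_line:
  assumes "finite Z" "for_general P"
  obtains lam F D where "F \<in> forms D" "F \<noteq> 0" "var 2 dvd F"
    "\<And>\<alpha> \<beta>. eval3 F (line_chart.q lam \<alpha> \<beta>) \<noteq> 0 \<Longrightarrow> good_line lam \<alpha> \<beta> Z \<and> P (abs_proj2 (line_chart.q lam \<alpha> \<beta>))"
    "\<And>p. p \<in> Z \<Longrightarrow> rep_proj2 p $ 1 - lam * rep_proj2 p $ 0 \<noteq> 0 \<or> rep_proj2 p $ 2 \<noteq> 0"
proof -
  obtain f d where f: "f \<in> forms d" "f \<noteq> 0" "\<And>p. p \<in> nonvanishing f \<Longrightarrow> P p"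
    by (rule for_general_nonvanishing[OF assms(2)]) blast
  \<comment> \<open>The line at infinity has coordinates \<open>(1, lam, 0)\<close>; avoiding these
    ratios keeps it out of the arrangement.\<close>
  have "finite ((\<lambda>p. rep_proj2 p $ 1 / rep_proj2 p $ 0) ` Z)" using assms by simp
  then obtain lam where lam: "lam \<notin> (\<lambda>p. rep_proj2 p $ 1 / rep_proj2 p $ 0) ` Z"
    using ex_new_if_finite[OF infinite_UNIV_char_0] by blast
  have ne: "rep_proj2 p $ 1 - lam * rep_proj2 p $ 0 \<noteq> 0 \<or> rep_proj2 p $ 2 \<noteq> 0" if p: "p \<in> Z" for p
  proof (rule ccontr)
    let ?c = "rep_proj2 p"
    assume "\<not> ?thesis"
    then have *: "?c $ 1 = lam * ?c $ 0" "?c $ 2 = 0" by auto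
    have "?c $ 0 \<noteq> 0"
    proof
      assume "?c $ 0 = 0"
      then have "?c = 0" using * by (simp add: vec_eq_iff all_3)
      then show False using coords_nonzero[OF rep_proj2_in_coords] by blast
    qed
    then have "lam = ?c $ 1 / ?c $ 0" using * by simp
    then show False using lam p by blast
  qed
  \<comment> \<open>Turns \<open>dot (rep_proj2 p) v\<close> into a linear form in
    \<open>q\<close>.\<close>
  define a where "a p = vec3 (lam * rep_proj2 p $ 2) (- rep_proj2 p $ 2) (rep_proj2 p $ 1 - lam * rep_proj2 p $ 0)" for p
  define A where "A = (\<Prod>p\<in>Z. lin (a p))"
  \<comment> \<open>Nonvanishing at \<open>q\<close> says that the intersection points of the lines
    of the arrangement do not lie on \<open>L\<close>.\<close>
  define C where "C = (\<Prod>(p, r)\<in>{(p, r) \<in> Z \<times> Z. p \<noteq> r}. lin (cross (rep_proj2 p) (rep_proj2 r)))"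
  have fin: "finite {(p, r) \<in> Z \<times> Z. p \<noteq> r}" using assms(1) by (auto intro: finite_subset[of _ "Z \<times> Z"])
  have A: "A \<noteq> 0"
    unfolding A_def prod_zero_iff[OF assms(1)] lin_eq_0_iff using ne by (force simp: a_def vec_eq_iff all_3)
  have C: "C \<noteq> 0"
    unfolding C_def prod_zero_iff[OF fin] using cross_rep_neq_0 by (auto simp: lin_eq_0_iff)
  obtain dA dC where "A \<in> forms dA" "C \<in> forms dC"
    using forms_prod_ex[OF assms(1), of "\<lambda>p. lin (a p)"] forms_prod_ex[OF fin, of "\<lambda>(p, r). lin (cross (rep_proj2 p) (rep_proj2 r))"]
      lin_forms unfolding A_def C_def by (metis (mono_tags, lifting) case_prod_conv surj_pair)
  \<comment> \<open>The factor \<open>var 2\<close> restricts to lines that have a slope and an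
    intercept: their coordinate vectors can be scaled to last coordinate 1, as in
    \<open>q\<close>.\<close>
  then have F: "var 2 * (f * (A * C)) \<in> forms (1 + (d + (dA + dC)))" by (intro forms_mult forms_var f)
  show ?thesis
  proof (rule that[OF F])
    show "var 2 * (f * (A * C)) \<noteq> 0" using A C f by (simp add: var_neq_0)
    fix \<alpha> \<beta>
    interpret line_chart lam \<alpha> \<beta> .
    assume "eval3 (var 2 * (f * (A * C))) q \<noteq> 0"
    then have nz: "eval3 f q \<noteq> 0" "eval3 A q \<noteq> 0" "eval3 C q \<noteq> 0" by (auto simp: eval3.mult)
    have "good_line lam \<alpha> \<beta> Z"
    proof
      fix p assume p: "p \<in> Z"
      then have "dot (a p) q \<noteq> 0" using nz(2) assms(1) by (auto simp: A_def eval3.prod)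
      moreover have "dot (rep_proj2 p) v = dot (a p) q"
        by (simp add: dot_3 v_def q_def a_def algebra_simps)
      ultimately show "dot (rep_proj2 p) v \<noteq> 0" by simp
      fix r assume "r \<in> Z" "p \<noteq> r"
      then have "dot (cross (rep_proj2 p) (rep_proj2 r)) q \<noteq> 0"
        using nz(3) p fin by (auto simp: C_def eval3.prod split_beta)
      moreover have "dot (cross (rep_proj2 p) (rep_proj2 r)) q
          = dot (rep_proj2 p) u * dot (rep_proj2 r) v - dot (rep_proj2 r) u * dot (rep_proj2 p) v"
        by (simp add: dot_3 v_def u_def q_def cross_def algebra_simps)
      ultimately show "dot (rep_proj2 p) u * dot (rep_proj2 r) v \<noteq> dot (rep_proj2 r) u * dot (rep_proj2 p) v" by simp
    qed (rule assms)
    moreover have "abs_proj2 q \<in> nonvanishing f" using nonvanishing_iff[OF f(1) q_coords] nz(1) by simp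
    ultimately show "good_line lam \<alpha> \<beta> Z \<and> P (abs_proj2 q)" using f(3) by blast
  qed (use ne in auto)
qed

lemma chart_point:
  assumes "F \<in> forms D" "eval3 F y \<noteq> 0" "var 2 dvd F"
  obtains \<alpha> \<beta> where "eval3 F (line_chart.q lam \<alpha> \<beta>) \<noteq> 0" "y = y $ 2 *s line_chart.q lam \<alpha> \<beta>" "y $ 2 \<noteq> 0"
proof -
  have y2: "y $ 2 \<noteq> 0" using assms(2,3) by (auto simp: eval3.mult elim!: dvdE)
  have "D \<ge> 0" using forms_neg[of D F] assms by (force simp: eval3.zero)
  then have F: "F \<in> forms (int (nat D))" using assms(1) by simp
  define \<beta> where "\<beta> = - y $ 0 / y $ 2"
  define \<alpha> where "\<alpha> = - y $ 1 / y $ 2 - \<beta> * lam"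
  have y: "y = y $ 2 *s line_chart.q lam \<alpha> \<beta>"
    using y2 by (simp add: vec_eq_iff all_3 line_chart.q_def \<alpha>_def \<beta>_def)
  then have "eval3 F (line_chart.q lam \<alpha> \<beta>) \<noteq> 0" using eval3_forms_scale[OF F] assms(2) by (metis mult_zero_right)
  then show ?thesis using y y2 by (rule that)
qed

lemma ex_chart_point:
  assumes "F \<in> forms D" "F \<noteq> 0" "var 2 dvd F"
  obtains \<alpha> \<beta> where "eval3 F (line_chart.q lam \<alpha> \<beta>) \<noteq> 0"
proof -
  obtain y where "eval3 F y \<noteq> 0" using assms(2) poly3_eq_0I by blast
  from chart_point[OF assms(1) this assms(3)] that show ?thesis by blast
qed

section \<open>Unexpected curves\<close>

interpretation poly3: vector_space poly_scale
  by unfold_locales (simp_all add: algebra_simps const.hom)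

text \<open>The exponents of the monomials of degree less than \<open>n\<close> in two variables.
  \<open>tri (d + 1)\<close> counts the monomials of degree d in three variables, and
  \<open>tri (d - 1)\<close> those left modulo the power d - 1 of the ideal of a point.\<close>

definition tri :: "nat \<Rightarrow> (nat \<times> nat) set" where
  "tri n = (SIGMA a:{..<n}. {..<n - a})"

lemma tri_iff: "(a, b) \<in> tri n \<longleftrightarrow> a + b < n"
  by (auto simp: tri_def)

lemma finite_tri: "finite (tri n)"
  by (simp add: tri_def)

lemma card_tri: "2 * card (tri n) = n * (n + 1)"
proof -
  have "card (tri n) = (\<Sum>a<n. n - a)" by (simp add: tri_def)
  also have "\<dots> = (\<Sum>a<n. Suc a)" using sum.nat_diff_reindex[of Suc n] by (simp add: Suc_diff_Suc)
  also have "2 * (\<Sum>a<n. Suc a) = n * (n + 1)" by (induction n) auto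
  finally show ?thesis by simp
qed

definition monomials :: "nat \<Rightarrow> complex poly3 set" where
  "monomials d = (\<lambda>(a, b). Poly_Mapping.single (Poly_Mapping.single 0 a + Poly_Mapping.single 1 b + Poly_Mapping.single 2 (d - a - b)) 1) ` tri (d + 1)"

lemma finite_monomials: "finite (monomials d)"
  by (simp add: monomials_def finite_tri)

lemma card_monomials: "card (monomials d) = card (tri (d + 1))"
  unfolding monomials_def
proof (rule card_image, rule inj_onI)
  fix x y :: "nat \<times> nat"
  assume *: "(case x of (a, b) \<Rightarrow> Poly_Mapping.single (Poly_Mapping.single 0 a + Poly_Mapping.single 1 b + Poly_Mapping.single (2::3) (d - a - b)) (1::complex))
    = (case y of (a, b) \<Rightarrow> Poly_Mapping.single (Poly_Mapping.single 0 a + Poly_Mapping.single 1 b + Poly_Mapping.single 2 (d - a - b)) 1)"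
  obtain a b a' b' where xy: "x = (a, b)" "y = (a', b')" by (cases x, cases y) auto
  have "Poly_Mapping.keys (Poly_Mapping.single (Poly_Mapping.single 0 a + Poly_Mapping.single 1 b + Poly_Mapping.single (2::3) (d - a - b)) (1::complex))
     = Poly_Mapping.keys (Poly_Mapping.single (Poly_Mapping.single 0 a' + Poly_Mapping.single 1 b' + Poly_Mapping.single (2::3) (d - a' - b')) (1::complex))"
    using * by (simp add: xy)
  then have eq: "Poly_Mapping.single 0 a + Poly_Mapping.single 1 b + Poly_Mapping.single (2::3) (d - a - b)
     = Poly_Mapping.single 0 a' + Poly_Mapping.single 1 b' + Poly_Mapping.single 2 (d - a' - b')"
    by simp
  show "x = y"
    using arg_cong[OF eq, of "\<lambda>m. Poly_Mapping.lookup m 0"] arg_cong[OF eq, of "\<lambda>m. Poly_Mapping.lookup m 1"]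
    by (simp add: xy lookup_add lookup_single)
qed

lemma monomials_conv: "monomials d = {Poly_Mapping.single m 1 | m. int (\<Sum>i\<in>UNIV. Poly_Mapping.lookup m i) = int d}"
proof (intro equalityI subsetI)
  fix f assume "f \<in> monomials d"
  then show "f \<in> {Poly_Mapping.single m 1 | m. int (\<Sum>i\<in>UNIV. Poly_Mapping.lookup m i) = int d}"
    by (fastforce simp: monomials_def tri_iff sum_UNIV_3 lookup_add lookup_single)
next
  fix f :: "complex poly3" assume "f \<in> {Poly_Mapping.single m 1 | m. int (\<Sum>i\<in>UNIV. Poly_Mapping.lookup m i) = int d}"
  then obtain m where f: "f = Poly_Mapping.single m 1" and "int (\<Sum>i\<in>UNIV. Poly_Mapping.lookup m i) = int d" by blast
  then have m: "Poly_Mapping.lookup m 0 + Poly_Mapping.lookup m 1 + Poly_Mapping.lookup m 2 = d"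
    by (simp add: sum_UNIV_3 del: of_nat_sum)
  have "Poly_Mapping.single 0 (Poly_Mapping.lookup m 0) + Poly_Mapping.single 1 (Poly_Mapping.lookup m 1)
      + Poly_Mapping.single 2 (d - Poly_Mapping.lookup m 0 - Poly_Mapping.lookup m 1) = m"
    using m by (intro poly_mapping_eqI, rule_tac i=k in cases_3) (auto simp: lookup_add lookup_single)
  then show "f \<in> monomials d"
    unfolding monomials_def f using m by (intro image_eqI[of _ _ "(Poly_Mapping.lookup m 0, Poly_Mapping.lookup m 1)"]) (auto simp: tri_iff)
qed

lemma monomials_independent: "poly3.independent (monomials d)"
proof (rule poly3.independent_if_scalars_zero[OF finite_monomials])
  fix g x assume g: "(\<Sum>x\<in>monomials d. const (g x) * x) = 0" and x: "x \<in> monomials d"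
  then obtain m where m: "x = Poly_Mapping.single m 1" by (auto simp: monomials_conv)
  have "0 = Poly_Mapping.lookup (\<Sum>x\<in>monomials d. const (g x) * x) m" using g by simp
  also have "\<dots> = (\<Sum>y\<in>monomials d. if y = x then g x else 0)"
    unfolding lookup_sum
  proof (rule sum.cong[OF refl])
    fix y assume "y \<in> monomials d"
    then obtain n where n: "y = Poly_Mapping.single n 1" by (auto simp: monomials_conv)
    show "Poly_Mapping.lookup (const (g y) * y) m = (if y = x then g x else 0)"
    proof (cases "n = m")
      case False
      then have "Poly_Mapping.single n (1::complex) \<noteq> Poly_Mapping.single m 1"
        by (metis keys_single one_neq_zero the_elem_eq)
      then show ?thesis using False by (simp add: n m const_def mult_single lookup_single)
    qed (simp add: n m const_def mult_single)
  qed
  also have "\<dots> = g x" using x finite_monomials by simp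
  finally show "g x = 0" by simp
qed

lemma span_monomials: "poly3.span (monomials d) = forms (int d)"
proof (intro equalityI)
  show "poly3.span (monomials d) \<subseteq> forms (int d)"
  proof (rule poly3.span_minimal)
    show "poly3.subspace (forms (int d))"
      by (rule poly3.subspaceI) (auto intro: forms_add forms_const_mult)
  qed (auto simp: monomials_conv simp del: of_nat_sum intro: forms_single)
  show "forms (int d) \<subseteq> poly3.span (monomials d)"
  proof
    fix f assume f: "f \<in> forms (int d)"
    have "f = (\<Sum>m\<in>Poly_Mapping.keys f. const (Poly_Mapping.lookup f m) * Poly_Mapping.single m 1)"
      by (subst poly_mapping_sum_single[of f]) (simp add: const_def mult_single)
    also have "\<dots> \<in> poly3.span (monomials d)"
      using f by (intro poly3.span_sum poly3.span_scale poly3.span_base) (auto simp: monomials_conv forms_def simp del: of_nat_sum)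
    finally show "f \<in> poly3.span (monomials d)" .
  qed
qed

text \<open>Each point imposes at most one linear condition on the forms of degree
  \<open>d\<close>.\<close>

lemma dim_vanishing_ideal_ge:
  assumes "finite Z"
  shows "card (tri (d + 1)) \<le> dim_degree (vanishing_ideal Z) d + card Z"
proof -
  obtain S where S: "finite S" "poly3.independent S" "card (monomials d) \<le> card S + card Z"
    "poly3.span S \<subseteq> {f \<in> poly3.span (monomials d). \<forall>p\<in>Z. eval3 f (rep_proj2 p) = 0}"
    by (rule independent_in_kernel[OF poly3.vector_space_axioms finite_monomials monomials_independent assms, of "\<lambda>p f. eval3 f (rep_proj2 p)"])
      (auto simp: eval3.hom)
  let ?V = "vanishing_ideal Z \<inter> forms (int d)"
  have "poly3.span S \<subseteq> ?V"
  proof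
    fix f assume "f \<in> poly3.span S"
    then have f: "f \<in> forms (int d)" "\<forall>p\<in>Z. eval3 f (rep_proj2 p) = 0" using S(4) by (auto simp: span_monomials)
    then have "f \<in> vanishing_ideal Z"
      using eval3_forms_scale[OF f(1)] by (auto simp: vanishing_ideal_def coords_conv[OF rep_proj2_in_coords])
    then show "f \<in> ?V" using f by blast
  qed
  then have SV: "S \<subseteq> ?V" using poly3.span_superset by blast
  obtain B where B: "B \<subseteq> ?V" "poly3.independent B" "?V \<subseteq> poly3.span B" "card B = poly3.dim ?V"
    by (rule poly3.basis_exists)
  have "B \<subseteq> poly3.span (monomials d)" using B(1) by (auto simp: span_monomials)
  then have "finite B" using poly3.independent_span_bound[OF finite_monomials B(2)] by blast
  then have "card S \<le> card B" using poly3.independent_span_bound[OF _ S(2)] SV B(3) by blast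
  then show ?thesis using S(3) B(4) by (simp add: dim_degree_def card_monomials)
qed

section \<open>Curves of degree d with a point of multiplicity d - 1\<close>

context good_line begin

text \<open>\<open>f\<close> at q + e (l1 - t l0), with outer variable e and inner variable t. The
  line joining \<open>q\<close> to l1 - t l0 is dual to the point u + t v of
  \<open>L\<close>.\<close>

definition expansion :: "complex poly3 \<Rightarrow> complex poly poly" where
  "expansion = subst3 (\<lambda>c. [:[:c:]:]) (\<lambda>i. [: [:q $ i:], [:l1 $ i, - l0 $ i:] :])"

lemma ring_homomorphism_pCons2: "ring_homomorphism (\<lambda>c :: complex. [:[:c:]:])"
  by unfold_locales (simp_all add: one_pCons)

sublocale expansion: ring_homomorphism expansion
  unfolding expansion_def by (rule ring_homomorphism_subst3[OF ring_homomorphism_pCons2])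

lemma expansion_const: "expansion (const c) = [:[:c:]:]"
  by (simp add: expansion_def subst3_const ring_homomorphism_pCons2)

lemma expansion_var: "expansion (var i) = [: [:q $ i:], [:l1 $ i, - l0 $ i:] :]"
  by (simp add: expansion_def subst3_var ring_homomorphism_pCons2)

lemma poly_expansion: "poly (poly (expansion f) [:e:]) t = eval3 f (q + e *s (l1 - t *s l0))"
proof (rule ring_homomorphism_ext[where g = "\<lambda>f. poly (poly (expansion f) [:e:]) t" and h = "\<lambda>f. eval3 f (q + e *s (l1 - t *s l0))"])
  show "ring_homomorphism (\<lambda>f. poly (poly (expansion f) [:e:]) t)"
    by (intro ring_homomorphism.intro) (simp_all add: expansion.hom)
qed (simp_all add: ring_homomorphism_eval3 expansion_const expansion_var algebra_simps)

lemma degree_coeff_expansion: "degree (coeff (expansion f) j) \<le> j"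
proof (induction f arbitrary: j rule: poly3_induct)
  case (add f g)
  then show ?case by (simp add: expansion.add degree_add_le)
next
  case (mult f g)
  have "degree (coeff (expansion f) i * coeff (expansion g) (j - i)) \<le> j" if "i \<le> j" for i
    using degree_mult_le[of "coeff (expansion f) i" "coeff (expansion g) (j - i)"] mult.IH(1)[of i] mult.IH(2)[of "j - i"] that
    by linarith
  then show ?case unfolding expansion.mult coeff_mult by (intro degree_sum_le) auto
qed (simp_all add: expansion_const expansion_var coeff_pCons split: nat.splits)

lemma degree_expansion:
  assumes "f \<in> forms (int d)"
  shows "degree (expansion f) \<le> d"
proof -
  have "expansion f = expansion (\<Sum>m\<in>Poly_Mapping.keys f. Poly_Mapping.single m (Poly_Mapping.lookup f m))"
    by (subst poly_mapping_sum_single[of f]) simp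
  then have "expansion f = (\<Sum>m\<in>Poly_Mapping.keys f. expansion (Poly_Mapping.single m (Poly_Mapping.lookup f m)))"
    by (simp add: expansion.sum)
  moreover have mon: "degree (expansion (Poly_Mapping.single m c)) \<le> d" if "m \<in> Poly_Mapping.keys f" for m c
  proof -
    have "int (\<Sum>i\<in>UNIV. Poly_Mapping.lookup m i) = int d"
      using assms that by (auto simp: forms_def simp del: of_nat_sum)
    then have d: "d = Poly_Mapping.lookup m 0 + Poly_Mapping.lookup m 1 + Poly_Mapping.lookup m 2"
      by (simp add: sum_UNIV_3)
    let ?p = "\<lambda>i. expansion (var i) ^ Poly_Mapping.lookup m i"
    have "degree (?p i) \<le> Poly_Mapping.lookup m i" for i
    proof -
      have "degree (expansion (var i)) \<le> 1" by (simp add: expansion_var)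
      then show ?thesis using degree_power_le[of "expansion (var i)" "Poly_Mapping.lookup m i"]
          mult_le_mono1[of "degree (expansion (var i))" 1 "Poly_Mapping.lookup m i"] by linarith
    qed
    then have "degree (?p 0 * ?p 1 * ?p 2) \<le> d"
      unfolding d by (meson add_mono degree_mult_le le_trans)
    moreover have "expansion (Poly_Mapping.single m c) = smult [:c:] (?p 0 * ?p 1 * ?p 2)"
      by (simp add: single_conv_vars[of m c] expansion.hom expansion_const prod_UNIV_3)
    ultimately show ?thesis by (simp only: order_trans[OF degree_smult_le])
  qed
  moreover have "degree (\<Sum>m\<in>Poly_Mapping.keys f. expansion (Poly_Mapping.single m (Poly_Mapping.lookup f m))) \<le> d"
    by (intro degree_sum_le mon) simp_all
  ultimately show ?thesis by simp
qed

text \<open>The expansion of a polynomial that vanishes at \<open>q\<close> has no constant term in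
  the outer variable; products of \<open>n\<close> such factors are divisible by its n-th
  power.\<close>

lemma expansion_ideal_power:
  "f \<in> ideal_power (vanishing_ideal {abs_proj2 q}) n \<Longrightarrow> [:0, 1:] ^ n dvd expansion f"
proof (induction n arbitrary: f)
  case (Suc n)
  let ?J = "vanishing_ideal {abs_proj2 q}"
  interpret module "(*) :: complex poly3 \<Rightarrow> _" by (rule module_times)
  have 1: "[:0, 1:] dvd expansion g" if "g \<in> ?J" for g
  proof -
    have "poly (poly (expansion g) 0) t = 0" for t
      using poly_expansion[of g 0 t] that q_coords by (auto simp: vanishing_ideal_def)
    then have "poly (expansion g) 0 = 0" by (intro poly_eqI) simp
    then show ?thesis using poly_eq_0_iff_dvd[of "expansion g" 0] by simp
  qed
  have "subspace {f. [:0, 1:] ^ Suc n dvd expansion f}"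
    by (rule subspaceI) (auto simp only: mem_Collect_eq expansion.hom intro: dvd_add dvd_mult dvd_0_right)
  moreover have "{g * h | g h. g \<in> ?J \<and> h \<in> ideal_power ?J n} \<subseteq> {f. [:0, 1:] ^ Suc n dvd expansion f}"
    using 1 Suc.IH by (auto simp only: mem_Collect_eq expansion.mult power_Suc intro!: mult_dvd_mono)
  ultimately show ?case using Suc.prems span_minimal by (simp only: ideal_power.simps) blast
qed simp

text \<open>A curve of degree \<open>d\<close> with a point of multiplicity \<open>d - 1\<close> at \<open>q\<close>, in coordinates around \<open>q\<close>.\<close>

definition curve_pair :: "nat \<Rightarrow> complex poly3 \<Rightarrow> complex poly \<times> complex poly" where
  "curve_pair d f = (coeff (expansion f) d, coeff (expansion f) (d - 1))"

text \<open>The multiplicity removes the powers of the outer variable below d - 1 and the degree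
  removes those above d, so only two coefficients remain.\<close>

lemma eval3_curve:
  assumes f: "f \<in> forms (int d)" "f \<in> ideal_power (vanishing_ideal {abs_proj2 q}) (d - 1)" and d: "d \<ge> 1"
  shows "eval3 f (\<sigma> *s q + e *s (l1 - t *s l0)) = e ^ (d - 1) * (\<sigma> * poly (snd (curve_pair d f)) t + e * poly (fst (curve_pair d f)) t)"
proof -
  define P where "P = fst (curve_pair d f)"
  define G where "G = snd (curve_pair d f)"
  have exp: "expansion f = [:0, 1:] ^ (d - 1) * [:G, P:]"
  proof (rule Polynomial.poly_eqI)
    fix j
    obtain h where h: "expansion f = [:0, 1:] ^ (d - 1) * h" using expansion_ideal_power[OF f(2)] by (rule dvdE)
    have mon: "[:0, 1:] ^ (d - 1) * h = monom 1 (d - 1) * h" for h :: "complex poly poly" by (simp add: monom_altdef)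
    have "coeff (expansion f) j = 0" if "j > d" using degree_expansion[OF f(1)] that by (intro coeff_eq_0) simp
    moreover have "coeff (expansion f) j = 0" if "j < d - 1" unfolding h mon using that by (simp add: coeff_monom_mult)
    moreover have "coeff ([:0, 1:] ^ (d - 1) * [:G, P:]) j = (if j = d then P else if j = d - 1 then G else 0)"
    proof -
      consider "j < d - 1" | "j = d - 1" | "j = d" | "j > d" by linarith
      then show ?thesis unfolding mon coeff_monom_mult
        using d by cases (auto simp: coeff_pCons split: nat.splits)
    qed
    ultimately show "coeff (expansion f) j = coeff ([:0, 1:] ^ (d - 1) * [:G, P:]) j"
      by (cases "j > d"; cases "j < d - 1") (auto simp: P_def G_def curve_pair_def)
  qed
  have 1: "eval3 f (q + e *s (l1 - t *s l0)) = e ^ (d - 1) * (poly G t + e * poly P t)" for e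
    unfolding poly_expansion[symmetric] exp by (simp add: algebra_simps)
  have dd: "x ^ d = x ^ (d - 1) * x" for x :: complex using d by (metis power_minus_mult less_le_trans zero_less_one)
  have 2: "eval3 f (\<sigma> *s q + e *s (l1 - t *s l0)) = e ^ (d - 1) * (\<sigma> * poly G t + e * poly P t)" if "\<sigma> \<noteq> 0" for \<sigma>
  proof -
    have "\<sigma> *s q + e *s (l1 - t *s l0) = \<sigma> *s (q + (e / \<sigma>) *s (l1 - t *s l0))"
      using that by (simp add: vector_add_ldistrib)
    then have "eval3 f (\<sigma> *s q + e *s (l1 - t *s l0)) = \<sigma> ^ d * ((e / \<sigma>) ^ (d - 1) * (poly G t + e / \<sigma> * poly P t))"
      by (simp only: eval3_forms_scale[OF f(1)] 1)
    also have "\<dots> = (\<sigma> ^ d * (e / \<sigma>) ^ (d - 1)) * (poly G t + e / \<sigma> * poly P t)" by (simp only: mult.assoc)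
    also have "\<sigma> ^ d * (e / \<sigma>) ^ (d - 1) = e ^ (d - 1) * \<sigma>"
      using that by (simp add: dd[of \<sigma>] power_divide)
    also have "e ^ (d - 1) * \<sigma> * (poly G t + e / \<sigma> * poly P t) = e ^ (d - 1) * (\<sigma> * poly G t + e * poly P t)"
      using that by (simp add: algebra_simps)
    finally show ?thesis .
  qed
  \<comment> \<open>Both sides are polynomials in \<open>\<sigma>\<close>, so the identity for
    \<open>\<sigma> \<noteq> 0\<close> extends to \<open>\<sigma> = 0\<close>.\<close>
  have "poly (dehom (e *s (l1 - t *s l0)) q f - [:e ^ (d - 1) * (e * poly P t), e ^ (d - 1) * poly G t:]) \<sigma> = 0" if "\<sigma> \<in> - {0}" for \<sigma>
    using 2[of \<sigma>] that by (simp add: poly_dehom add.commute algebra_simps)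
  then have "- {0} \<subseteq> {\<sigma>. poly (dehom (e *s (l1 - t *s l0)) q f - [:e ^ (d - 1) * (e * poly P t), e ^ (d - 1) * poly G t:]) \<sigma> = 0}"
    by blast
  moreover have "infinite (- {0 :: complex})" by (simp add: infinite_UNIV_char_0 Compl_eq_Diff_UNIV)
  ultimately have "dehom (e *s (l1 - t *s l0)) q f - [:e ^ (d - 1) * (e * poly P t), e ^ (d - 1) * poly G t:] = 0"
    using poly_roots_finite finite_subset by blast
  then have "poly (dehom (e *s (l1 - t *s l0)) q f) \<sigma> = poly [:e ^ (d - 1) * (e * poly P t), e ^ (d - 1) * poly G t:] \<sigma>"
    by simp
  then show ?thesis by (simp add: poly_dehom add.commute algebra_simps P_def G_def)
qed

text \<open>Vanishing of \<open>f\<close> at a point of \<open>Z\<close> is the lattice condition at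
  its node. Hence \<open>curve_pair\<close> embeds these curves into \<open>E (d - 1)\<close>, whose
  dimension is known through \<open>\<Psi>\<close>.\<close>

lemma dim_curves_le:
  assumes \<Psi>: "linear_iso \<Psi> (E (d - 1)) (bdspace (int (d - 1) - a1) (int (d - 1) - a2))" and d: "d \<ge> 1"
  shows "dim_degree (vanishing_ideal Z \<inter> ideal_power (vanishing_ideal {abs_proj2 q}) (d - 1)) d
     \<le> nat (int d - a1) + nat (int d - a2)"
proof -
  let ?J = "ideal_power (vanishing_ideal {abs_proj2 q}) (d - 1)"
  let ?V = "vanishing_ideal Z \<inter> ?J \<inter> forms (int d)"
  interpret m: module "(*) :: complex poly3 \<Rightarrow> _" by (rule module_times)
  have J: "m.subspace ?J" by (cases "d - 1") simp_all
  have Vsub: "poly3.subspace ?V"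
    using m.subspace_0[OF J] m.subspace_add[OF J] m.subspace_scale[OF J]
    by (intro poly3.subspaceI) (auto simp: vanishing_ideal_def eval3.hom intro: forms_add forms_const_mult)
  obtain B where B: "B \<subseteq> ?V" "poly3.independent B" "?V \<subseteq> poly3.span B" "card B = poly3.dim ?V"
    by (rule poly3.basis_exists)
  have "B \<subseteq> poly3.span (monomials d)" using B(1) by (auto simp: span_monomials)
  then have finB: "finite B" using poly3.independent_span_bound[OF finite_monomials B(2)] by blast
  have E: "curve_pair d f \<in> E (d - 1)" if f: "f \<in> ?V" for f
  proof -
    have ev: "eval3 f (\<sigma> *s q + e *s (l1 - t *s l0)) = e ^ (d - 1) * (\<sigma> * poly (snd (curve_pair d f)) t + e * poly (fst (curve_pair d f)) t)" for \<sigma> e t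
      using eval3_curve[of f d] f d by blast
    have "dot (rep_proj2 p) v * poly (fst (curve_pair d f)) (node p) + dot (rep_proj2 p) w * poly (snd (curve_pair d f)) (node p) = 0"
      if p: "p \<in> Z" for p
    proof -
      let ?c = "rep_proj2 p"
      \<comment> \<open>The expansion of \<open>?c\<close> in the dual basis, with
        \<open>dot ?c u\<close> expressed by the node. It puts the point into the form required by
        \<open>ev\<close>, with the nonzero number \<open>dot ?c v\<close> in the place of
        \<open>e\<close>.\<close>
      have "?c = dot ?c w *s q + dot ?c v *s (l1 - node p *s l0)"
        by (subst decompose_dual) (simp add: dot_commute[of _ ?c] dot_u[OF p] vec_eq_iff algebra_simps)
      moreover have "eval3 f ?c = 0" using f p rep_proj2_in_coords by (auto simp: vanishing_ideal_def)
      ultimately show ?thesis using ev[of "dot ?c w" "dot ?c v" "node p"] dot_v[OF p] by (simp add: add.commute)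
    qed
    moreover have "bd (int (d - 1) + 1) (fst (curve_pair d f))" "bd (int (d - 1)) (snd (curve_pair d f))"
      using degree_coeff_expansion[of f d] degree_coeff_expansion[of f "d - 1"] d by (auto simp: curve_pair_def bd_def)
    ultimately show ?thesis by (simp add: E_def Lat_def bdspace_def)
  qed
  have "card B \<le> nat (int (d - 1) - a1 + 1) + nat (int (d - 1) - a2 + 1)"
  proof (rule pair_dim_le[OF poly3.vector_space_axioms finB B(2), where V = ?V and f = "\<lambda>f. \<Psi> (curve_pair d f)"])
    show "poly3.span B \<subseteq> ?V" by (rule poly3.span_minimal[OF B(1) Vsub])
    show "(\<lambda>f. \<Psi> (curve_pair d f)) ` ?V \<subseteq> bdspace (int (d - 1) - a1) (int (d - 1) - a2)"
    proof
      fix X assume "X \<in> (\<lambda>f. \<Psi> (curve_pair d f)) ` ?V"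
      then show "X \<in> bdspace (int (d - 1) - a1) (int (d - 1) - a2)"
        using E \<Psi> bij_betwE unfolding linear_iso_def by blast
    qed
    show "\<Psi> (curve_pair d (f + g)) = \<Psi> (curve_pair d f) + \<Psi> (curve_pair d g)" if "f \<in> ?V" "g \<in> ?V" "f + g \<in> ?V" for f g
    proof -
      have eq: "curve_pair d (f + g) = curve_pair d f + curve_pair d g" by (simp add: curve_pair_def expansion.add)
      have "curve_pair d f + curve_pair d g \<in> E (d - 1)" using E[OF that(3)] by (simp add: eq)
      then show ?thesis unfolding eq using \<Psi> E[OF that(1)] E[OF that(2)] unfolding linear_iso_def by blast
    qed
    show "\<Psi> (curve_pair d (const c * f)) = pair_scale c (\<Psi> (curve_pair d f))" if "f \<in> ?V" "const c * f \<in> ?V" for c f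
    proof -
      have eq: "curve_pair d (const c * f) = pair_scale c (curve_pair d f)"
        by (simp add: curve_pair_def expansion.mult expansion_const)
      have "pair_scale c (curve_pair d f) \<in> E (d - 1)" using E[OF that(2)] by (simp only: eq)
      then show ?thesis unfolding eq using \<Psi> E[OF that(1)] unfolding linear_iso_def by blast
    qed
    show "f = 0" if f: "f \<in> ?V" "\<Psi> (curve_pair d f) = 0" for f
    proof -
      have 0: "curve_pair d f = 0"
        using linear_iso_zero[OF \<Psi> pair.subspace_0[OF E_subspace] E[OF f(1)]] f(2) by blast
      have "eval3 f (\<sigma> *s q + e *s (l1 - t *s l0)) = 0" for \<sigma> e t
        using eval3_curve[of f d \<sigma> e t] f(1) d by (simp add: 0)
      moreover have "y = dot w y *s q + dot v y *s (l1 - (- dot u y / dot v y) *s l0)" if "dot v y \<noteq> 0" for y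
        using that by (subst decompose_dual) (simp add: vec_eq_iff field_simps)
      ultimately have "eval3 f y = 0" if "dot v y \<noteq> 0" for y using that by metis
      then have "f * lin v = 0" by (intro poly3_eq_0I) (auto simp: eval3.mult)
      then show "f = 0" by (simp add: lin_eq_0_iff)
    qed
  qed
  moreover have "int (d - 1) - a1 + 1 = int d - a1" "int (d - 1) - a2 + 1 = int d - a2" using d by auto
  ultimately show ?thesis using B(4) by (simp add: dim_degree_def)
qed

lemma lin_u_v_ideal_power: "n \<le> a + b \<Longrightarrow> lin u ^ a * lin v ^ b * g \<in> ideal_power (vanishing_ideal {abs_proj2 q}) n"
proof (induction n arbitrary: a b)
  case (Suc n)
  interpret module "(*) :: complex poly3 \<Rightarrow> _" by (rule module_times)
  let ?J = "vanishing_ideal {abs_proj2 q}"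
  have J: "lin u \<in> ?J" "lin v \<in> ?J"
    using dual_basis(7,8) by (auto simp: vanishing_ideal_def coords_conv[OF q_coords] dot_scale dot_commute[of _ q])
  have "\<exists>f h. lin u ^ a * lin v ^ b * g = f * h \<and> f \<in> ?J \<and> h \<in> ideal_power ?J n"
  proof (cases a)
    case 0
    then obtain b' where b: "b = Suc b'" using Suc.prems by (cases b) auto
    have "lin u ^ 0 * lin v ^ b' * g \<in> ideal_power ?J n"
      by (rule Suc.IH) (use Suc.prems 0 b in linarith)
    moreover have "lin u ^ a * lin v ^ b * g = lin v * (lin u ^ 0 * lin v ^ b' * g)" by (simp only: 0 b power_Suc power_0 mult_1_left mult.assoc)
    ultimately show ?thesis using J(2)
      by (intro exI[of _ "lin v"] exI[of _ "lin u ^ 0 * lin v ^ b' * g"] conjI)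
  next
    case a: (Suc a')
    have "lin u ^ a' * lin v ^ b * g \<in> ideal_power ?J n"
      by (rule Suc.IH) (use Suc.prems a in linarith)
    moreover have "lin u ^ a * lin v ^ b * g = lin u * (lin u ^ a' * lin v ^ b * g)" by (simp only: a power_Suc mult.assoc)
    ultimately show ?thesis using J(1)
      by (intro exI[of _ "lin u"] exI[of _ "lin u ^ a' * lin v ^ b * g"] conjI)
  qed
  then show ?case unfolding ideal_power.simps by (intro span_base) blast
qed simp

lemma forms_span_uvw:
  "forms (int d) \<subseteq> poly3.span {lin u ^ a * lin v ^ b * lin w ^ c | a b c. a + b + c = d}"
proof -
  let ?S = "\<lambda>d. {lin u ^ a * lin v ^ b * lin w ^ c | a b c. a + b + c = (d::nat)}"
  have step: "var i * f \<in> poly3.span (?S (Suc d))" if f: "f \<in> poly3.span (?S d)" for i f d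
    using f
  proof (induction f rule: poly3.span_induct)
    case base
    then show ?case
      by (intro poly3.subspaceI) (auto simp: distrib_left mult.left_commute intro: poly3.span_zero poly3.span_add poly3.span_scale)
  next
    case (step f)
    then obtain a b c where f: "f = lin u ^ a * lin v ^ b * lin w ^ c" "a + b + c = d" by blast
    let ?y = "axis i 1 :: complex ^ 3"
    have "var i = lin (dot l0 ?y *s u + dot l1 ?y *s v + dot q ?y *s w)" by (subst decompose[symmetric]) (simp add: lin_axis)
    then have "var i * f = const (dot l0 ?y) * (lin u ^ Suc a * lin v ^ b * lin w ^ c)
       + const (dot l1 ?y) * (lin u ^ a * lin v ^ Suc b * lin w ^ c) + const (dot q ?y) * (lin u ^ a * lin v ^ b * lin w ^ Suc c)"
      by (simp add: f lin_add lin_scale algebra_simps)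
    also have "\<dots> \<in> poly3.span (?S (Suc d))"
    proof (intro poly3.span_add poly3.span_scale poly3.span_base)
      show "lin u ^ Suc a * lin v ^ b * lin w ^ c \<in> ?S (Suc d)"
        by (intro CollectI exI[of _ "Suc a"] exI[of _ b] exI[of _ c]) (simp add: f(2))
      show "lin u ^ a * lin v ^ Suc b * lin w ^ c \<in> ?S (Suc d)"
        by (intro CollectI exI[of _ a] exI[of _ "Suc b"] exI[of _ c]) (use f(2) in simp)
      show "lin u ^ a * lin v ^ b * lin w ^ Suc c \<in> ?S (Suc d)"
        by (intro CollectI exI[of _ a] exI[of _ b] exI[of _ "Suc c"]) (use f(2) in simp)
    qed
    finally show ?case .
  qed
  have power: "var i ^ n * f \<in> poly3.span (?S (n + d))" if "f \<in> poly3.span (?S d)" for i n f d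
  proof (induction n)
    case (Suc n)
    then show ?case using step[of "var i ^ n * f" "n + d" i] by (simp add: mult.assoc)
  qed (use that in simp)
  have one: "1 \<in> poly3.span (?S 0)" by (rule poly3.span_base) auto
  have "f \<in> poly3.span (?S d)" if fm: "f \<in> monomials d" for f
  proof -
    obtain m where m: "f = Poly_Mapping.single m 1" "int (\<Sum>i\<in>UNIV. Poly_Mapping.lookup m i) = int d"
      using fm unfolding monomials_conv by blast
    then have d: "d = Poly_Mapping.lookup m 0 + (Poly_Mapping.lookup m 1 + (Poly_Mapping.lookup m 2 + 0))"
      by (simp add: sum_UNIV_3)
    have fe: "f = var 0 ^ Poly_Mapping.lookup m 0 * (var 1 ^ Poly_Mapping.lookup m 1 * (var 2 ^ Poly_Mapping.lookup m 2 * 1))"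
      by (simp add: m(1) single_conv_vars[of m 1] const_1 prod_UNIV_3 mult.assoc)
    show ?thesis by (subst fe, subst d) (intro power one)
  qed
  then have "poly3.span (monomials d) \<subseteq> poly3.span (?S d)" by (intro poly3.span_minimal) auto
  then show ?thesis by (simp add: span_monomials)
qed

text \<open>\<open>lin u\<close> and \<open>lin v\<close> vanish at \<open>q\<close>, so a monomial
  in \<open>lin u\<close>, \<open>lin v\<close>, \<open>lin w\<close> whose degree in the first two
  is at least d - 1 lies in the power of the ideal. The other monomials span the quotient.\<close>

lemma dim_quotient_le:
  assumes "d \<ge> 1"
  shows "dim_degree_quotient (ideal_power (vanishing_ideal {abs_proj2 q}) (d - 1)) d \<le> card (tri (d - 1))"
proof -
  let ?J = "ideal_power (vanishing_ideal {abs_proj2 q}) (d - 1)"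
  define B where "B = (\<lambda>(a, b). lin u ^ a * lin v ^ b * lin w ^ (d - a - b)) ` tri (d - 1)"
  have form: "lin u ^ a * lin v ^ b * lin w ^ c \<in> forms (int d)" if "a + b + c = d" for a b c
    using forms_mult[OF forms_mult[OF forms_power_linear[OF lin_forms] forms_power_linear[OF lin_forms]] forms_power_linear[OF lin_forms], of u a v b w c]
      that by (metis of_nat_add)
  have B: "B \<subseteq> forms (int d)" unfolding B_def
  proof safe
    fix a b assume "(a, b) \<in> tri (d - 1)"
    then show "lin u ^ a * lin v ^ b * lin w ^ (d - a - b) \<in> forms (int d)" by (intro form) (auto simp: tri_iff)
  qed
  have "{lin u ^ a * lin v ^ b * lin w ^ c | a b c. a + b + c = d} \<subseteq> B \<union> (?J \<inter> forms (int d))"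
  proof
    fix x assume "x \<in> {lin u ^ a * lin v ^ b * lin w ^ c | a b c. a + b + c = d}"
    then obtain a b c where x: "x = lin u ^ a * lin v ^ b * lin w ^ c" "a + b + c = d" by blast
    show "x \<in> B \<union> (?J \<inter> forms (int d))"
    proof (cases "a + b < d - 1")
      case True
      then have "(a, b) \<in> tri (d - 1)" "c = d - a - b" using x by (auto simp: tri_iff)
      then have "x \<in> B" unfolding B_def x by (intro image_eqI[of _ _ "(a, b)"]) auto
      then show ?thesis by blast
    next
      case False
      then have "x \<in> ?J" unfolding x by (intro lin_u_v_ideal_power) simp
      then show ?thesis using form[OF x(2)] by (simp add: x)
    qed
  qed
  then have "forms (int d) \<subseteq> poly3.span (B \<union> (?J \<inter> forms (int d)))"
    using forms_span_uvw[of d] poly3.span_mono by blast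
  moreover have "finite B" by (simp add: B_def finite_tri)
  ultimately have "dim_degree_quotient ?J d \<le> card B"
    unfolding dim_degree_quotient_def using B by (intro Least_le) blast
  also have "\<dots> \<le> card (tri (d - 1))" unfolding B_def by (rule card_image_le[OF finite_tri])
  finally show ?thesis .
qed

text \<open>The expected dimension is at least 2 d + 1 - |Z| = 2 d - a1 - a2, while
  \<open>dim_curves_le\<close> bounds the actual one by max(0, d - a1) + max(0, d - a2). These leave
  no room for excess if d \<ge> a2 or d \<le> a1, and an integer d strictly between a1 and a2 needs
  a gap of two.\<close>

lemma gap_if_unexpected:
  assumes iso: "\<And>k. \<exists>\<Psi>. linear_iso \<Psi> (E k) (bdspace (int k - a1) (int k - a2))" and a: "0 \<le> a1" "a1 \<le> a2"
    and d: "d \<ge> 1"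
    and un: "int (dim_degree (vanishing_ideal Z \<inter> ideal_power (vanishing_ideal {abs_proj2 q}) (d - 1)) d)
      > max 0 (int (dim_degree (vanishing_ideal Z) d) - int (dim_degree_quotient (ideal_power (vanishing_ideal {abs_proj2 q}) (d - 1)) d))"
  shows "a2 - a1 \<ge> 2"
proof -
  obtain \<Psi> where "linear_iso \<Psi> (E (d - 1)) (bdspace (int (d - 1) - a1) (int (d - 1) - a2))" using iso by blast
  from dim_curves_le[OF this d] have 1: "max 0 (int (dim_degree (vanishing_ideal Z) d)
      - int (dim_degree_quotient (ideal_power (vanishing_ideal {abs_proj2 q}) (d - 1)) d)) < int (nat (int d - a1) + nat (int d - a2))"
    using un by linarith
  have 2: "int (card Z) = a1 + a2 + 1" by (rule card_Z[OF iso a])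
  have "int (card (tri (d + 1))) - int (card (tri (d - 1))) = 2 * int d + 1"
  proof -
    obtain e where e: "d = Suc e" using d by (cases d) auto
    have "2 * int (card (tri (d + 1))) = int ((d + 1) * (d + 2))" "2 * int (card (tri (d - 1))) = int (e * (e + 1))"
      using card_tri[of "d + 1"] card_tri[of "d - 1"] by (simp_all add: e flip: of_nat_mult)
    then show ?thesis by (simp add: e algebra_simps)
  qed
  then have 3: "2 * int d - a1 - a2 \<le> int (dim_degree (vanishing_ideal Z) d)
      - int (dim_degree_quotient (ideal_power (vanishing_ideal {abs_proj2 q}) (d - 1)) d)"
    using dim_vanishing_ideal_ge[OF finite_Z, of d] dim_quotient_le[OF d] 2 by linarith
  show ?thesis using 1 3 a by linarith
qed

end

section \<open>The Grauert--Muelich argument\<close>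

text \<open>Gauss elimination over a domain without division. The second alternative is a left
  inverse up to the factor \<open>d\<close>. Such a certificate can be specialised: wherever
  \<open>d\<close> does not vanish, it excludes nonzero solutions.\<close>

lemma fraction_free_elimination:
  fixes r :: "'i \<Rightarrow> nat \<Rightarrow> 'r::idom"
  assumes "finite I"
  shows "(\<exists>x. (\<exists>j<n. x j \<noteq> 0) \<and> (\<forall>i\<in>I. (\<Sum>j<n. r i j * x j) = 0)) \<or>
    (\<exists>d \<mu>. d \<noteq> 0 \<and> (\<forall>j<n. \<forall>l<n. (\<Sum>i\<in>I. \<mu> j i * r i l) = (if l = j then d else 0)))"
proof (induction n arbitrary: r)
  case 0
  show ?case by (rule disjI2) (auto intro: exI[of _ 1])
next
  case (Suc n)
  show ?case
  proof (cases "\<forall>i\<in>I. r i n = 0")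
    case True
    then have "(\<Sum>j<Suc n. r i j * (if j = n then 1 else 0)) = 0" if "i \<in> I" for i
      using that by (intro sum.neutral) auto
    then show ?thesis by (intro disjI1 exI[of _ "\<lambda>j. if j = n then 1 else 0"]) auto
  next
    case False
    then obtain i0 where i0: "i0 \<in> I" "r i0 n \<noteq> 0" by blast
    define a where "a = r i0 n"
    define r' where "r' i j = a * r i j - r i n * r i0 j" for i j
    from Suc.IH[of r'] show ?thesis
    proof (elim disjE exE conjE)
      fix x j assume j: "j < n" "x j \<noteq> 0" and x: "\<forall>i\<in>I. (\<Sum>j<n. r' i j * x j) = 0"
      define y where "y l = (if l = n then - (\<Sum>j<n. r i0 j * x j) else a * x l)" for l
      have "(\<Sum>l<Suc n. r i l * y l) = 0" if i: "i \<in> I" for i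
      proof -
        have "(\<Sum>l<Suc n. r i l * y l) = (\<Sum>l<n. r i l * (a * x l)) - r i n * (\<Sum>j<n. r i0 j * x j)"
          by (simp add: y_def)
        also have "\<dots> = (\<Sum>l<n. r' i l * x l)"
          by (simp add: r'_def sum_distrib_left sum_subtractf[symmetric] algebra_simps)
        finally show ?thesis using x i by simp
      qed
      moreover have "y j \<noteq> 0" using j i0 by (simp add: y_def a_def)
      ultimately show ?thesis using j(1) by (intro disjI1 exI[of _ y] conjI exI[of _ j]) auto
    next
      fix d \<mu> assume d: "d \<noteq> 0" and \<mu>: "\<forall>j<n. \<forall>l<n. (\<Sum>i\<in>I. \<mu> j i * r' i l) = (if l = j then d else 0)"
      \<comment> \<open>The multipliers for the reduced rows \<open>r'\<close>, rewritten for the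
        rows \<open>r\<close>: all contributions of the pivot row are collected at
        \<open>i0\<close>. Column \<open>n\<close> of the result is zero.\<close>
      define \<nu> where "\<nu> j i = a * \<mu> j i - (if i = i0 then \<Sum>k\<in>I. \<mu> j k * r k n else 0)" for j i
      have \<nu>: "(\<Sum>i\<in>I. \<nu> j i * r i l) = (if l = j then d else 0)" if "j < n" "l < Suc n" for j l
      proof -
        have "(\<Sum>i\<in>I. \<nu> j i * r i l) = (\<Sum>i\<in>I. a * \<mu> j i * r i l) - (\<Sum>i\<in>I. if i = i0 then (\<Sum>k\<in>I. \<mu> j k * r k n) * r i l else 0)"
          unfolding sum_subtractf[symmetric] by (intro sum.cong) (auto simp: \<nu>_def algebra_simps)
        also have "\<dots> = (\<Sum>i\<in>I. a * \<mu> j i * r i l) - (\<Sum>k\<in>I. \<mu> j k * r k n) * r i0 l"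
          using assms i0 by simp
        also have "\<dots> = (\<Sum>i\<in>I. \<mu> j i * r' i l)"
          by (simp add: r'_def sum_distrib_right sum_distrib_left right_diff_distrib sum_subtractf mult_ac)
        also have "\<dots> = (if l = j then d else 0)"
        proof (cases "l = n")
          case True
          then show ?thesis using that by (simp add: r'_def a_def)
        qed (use \<mu> that in auto)
        finally show ?thesis .
      qed
      \<comment> \<open>Unknown \<open>n\<close> is isolated by clearing the other columns from
        \<open>d\<close> times the pivot row. The remaining combinations are scaled by
        \<open>a\<close> so that the diagonal entry is \<open>d * a\<close> everywhere.\<close>
      define \<xi> where "\<xi> j i = (if j = n then (if i = i0 then d else 0) - (\<Sum>k<n. r i0 k * \<nu> k i) else a * \<nu> j i)" for j i
      have "(\<Sum>i\<in>I. \<xi> j i * r i l) = (if l = j then d * a else 0)" if jl: "j < Suc n" "l < Suc n" for j l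
      proof (cases "j = n")
        case False
        then have "(\<Sum>i\<in>I. \<xi> j i * r i l) = a * (\<Sum>i\<in>I. \<nu> j i * r i l)"
          by (simp add: \<xi>_def sum_distrib_left mult.assoc)
        then show ?thesis using \<nu>[of j l] jl False by simp
      next
        case True
        have "(\<Sum>i\<in>I. \<xi> j i * r i l) = (\<Sum>i\<in>I. if i = i0 then d * r i l else 0) - (\<Sum>i\<in>I. \<Sum>k<n. r i0 k * \<nu> k i * r i l)"
          unfolding sum_subtractf[symmetric]
          by (intro sum.cong) (auto simp: \<xi>_def True left_diff_distrib sum_distrib_right)
        also have "(\<Sum>i\<in>I. \<Sum>k<n. r i0 k * \<nu> k i * r i l) = (\<Sum>k<n. r i0 k * (\<Sum>i\<in>I. \<nu> k i * r i l))"
          by (subst sum.swap) (simp add: sum_distrib_left mult.assoc)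
        also have "\<dots> = (\<Sum>k<n. if k = l then r i0 l * d else 0)"
          using \<nu> jl(2) by (intro sum.cong) auto
        also have "(\<Sum>i\<in>I. if i = i0 then d * r i l else 0) = d * r i0 l" using assms i0 by simp
        also have "d * r i0 l - (\<Sum>k<n. if k = l then r i0 l * d else 0) = (if l = j then d * a else 0)"
          using jl True by (auto simp: a_def)
        finally show ?thesis .
      qed
      then show ?thesis using d i0 by (intro disjI2 exI[of _ "d * a"] exI[of _ \<xi>]) (auto simp: a_def)
    qed
  qed
qed

text \<open>After division by the gcd, each of the two polynomials divides its own derivative and is
  therefore constant. So \<open>p\<close> and \<open>q\<close> are constant multiples of one
  polynomial.\<close>

lemma wronskian_zero_imp_proportional:
  fixes p q :: "complex poly"
  assumes "p * pderiv q = q * pderiv p"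
  shows "poly p x * poly q y = poly q x * poly p y"
proof (cases "p = 0 \<or> q = 0")
  case False
  define g where "g = gcd p q"
  have "g \<noteq> 0" using False by (simp add: g_def)
  then obtain p1 q1 where p1: "p = p1 * g" and q1: "q = q1 * g" and cop: "coprime p1 q1"
    unfolding g_def using gcd_coprime_exists[of p q] by blast
  have "g * g * (p1 * pderiv q1) = g * g * (q1 * pderiv p1)"
    using assms by (simp add: p1 q1 pderiv_mult algebra_simps)
  then have eq: "p1 * pderiv q1 = q1 * pderiv p1" using \<open>g \<noteq> 0\<close> by simp
  have "p1 dvd pderiv p1"
    using coprime_dvd_mult_right_iff[OF cop, of "pderiv p1"] by (metis eq dvd_triv_left)
  then have "degree p1 = 0" using not_dvd_pderiv by blast
  moreover have "coprime q1 p1" using cop by (simp add: coprime_commute)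
  then have "q1 dvd pderiv q1"
    using coprime_dvd_mult_right_iff[of q1 p1 "pderiv q1"] by (metis eq dvd_triv_left)
  then have "degree q1 = 0" using not_dvd_pderiv by blast
  ultimately obtain a b where "p1 = [:a:]" "q1 = [:b:]" by (metis degree_eq_zeroE)
  then show ?thesis by (simp add: p1 q1)
qed auto

text \<open>Polynomials in two variables: \<open>poly2 p \<alpha> \<beta>\<close> evaluates the outer variable at \<open>\<beta>\<close>, the inner one at \<open>\<alpha>\<close>.\<close>

definition poly2 :: "complex poly poly \<Rightarrow> complex \<Rightarrow> complex \<Rightarrow> complex" where
  "poly2 p \<alpha> \<beta> = poly (poly p [:\<beta>:]) \<alpha>"

interpretation poly2: ring_homomorphism "\<lambda>p. poly2 p \<alpha> \<beta>" for \<alpha> \<beta>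
  by unfold_locales (simp_all add: poly2_def)

lemma poly2_pCons [simp]: "poly2 (pCons a p) \<alpha> \<beta> = poly a \<alpha> + \<beta> * poly2 p \<alpha> \<beta>"
  by (simp add: poly2_def)

lemma poly2_0 [simp]: "poly2 0 \<alpha> \<beta> = 0"
  by (simp add: poly2_def)

text \<open>\<open>[:z, - x:]\<close> is the intercept of the line of slope \<alpha> through (x, z),
  as a polynomial in the slope.\<close>

lemma poly_poly_line: "poly (poly p [:z, - x:]) \<alpha> = poly2 p \<alpha> (z - \<alpha> * x)"
  by (induction p) (simp_all add: algebra_simps)

lemma pderiv_poly: "pderiv (poly p Q) = poly (map_poly pderiv p) Q + poly (pderiv p) Q * pderiv Q"
  for p :: "complex poly poly"
proof (induction p)
  case (pCons a p)
  then show ?case by (simp add: map_poly_pCons pderiv_add pderiv_mult pderiv_pCons algebra_simps)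
qed simp

lemma poly2_eq_0_iff: "p = 0 \<longleftrightarrow> (\<forall>\<alpha> \<beta>. poly2 p \<alpha> \<beta> = 0)"
proof
  assume *: "\<forall>\<alpha> \<beta>. poly2 p \<alpha> \<beta> = 0"
  then have "poly p [:\<beta>:] = 0" for \<beta> by (intro poly_eqI) (simp add: poly2_def)
  then have "range (\<lambda>\<beta>. [:\<beta>:]) \<subseteq> {a. poly p a = 0}" by auto
  moreover have "infinite (range (\<lambda>\<beta> :: complex. [:\<beta>:]))"
    by (auto dest!: finite_imageD simp: inj_on_def infinite_UNIV_char_0)
  ultimately show "p = 0" using poly_roots_finite[of p] finite_subset by blast
qed simp

lemma ex_poly2_neq_0: "p \<noteq> 0 \<Longrightarrow> \<exists>\<alpha> \<beta>. poly2 p \<alpha> \<beta> \<noteq> 0"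
  using poly2_eq_0_iff by blast

text \<open>A family of sections on all lines: \<open>p j\<close> and \<open>g j\<close>,
  polynomials in slope and intercept, are the coefficients of the j-th power of the parameter in the
  two components. \<open>relation\<close> is the lattice condition at the node of \<open>r\<close>,
  \<open>affine\<close> keeps the line at infinity out of the arrangement, and \<open>many\<close>
  is what the gap provides for k = a1.\<close>

locale pencil =
  fixes lam :: complex and Z :: "proj2 set" and k :: nat and p g :: "nat \<Rightarrow> complex poly poly"
  assumes finite_Z: "finite Z"
    and affine: "r \<in> Z \<Longrightarrow> rep_proj2 r $ 1 - lam * rep_proj2 r $ 0 \<noteq> 0 \<or> rep_proj2 r $ 2 \<noteq> 0"
    and many: "card Z > 2 * k + 2"
    and relation: "\<And>\<alpha> \<beta> r. r \<in> Z \<Longrightarrow> dot (rep_proj2 r) (line_chart.v lam \<alpha>) \<noteq> 0 \<Longrightarrow>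
      dot (rep_proj2 r) (line_chart.v lam \<alpha>)
        * (\<Sum>j\<le>k + 1. poly2 (p j) \<alpha> \<beta> * (- dot (rep_proj2 r) (line_chart.u \<beta>) / dot (rep_proj2 r) (line_chart.v lam \<alpha>)) ^ j)
      + rep_proj2 r $ 2 * (\<Sum>j\<le>k. poly2 (g j) \<alpha> \<beta> * (- dot (rep_proj2 r) (line_chart.u \<beta>) / dot (rep_proj2 r) (line_chart.v lam \<alpha>)) ^ j) = 0"
begin

definition k0 :: "proj2 \<Rightarrow> complex" where "k0 r = rep_proj2 r $ 0"
definition k1 :: "proj2 \<Rightarrow> complex" where "k1 r = rep_proj2 r $ 1 - lam * rep_proj2 r $ 0"
definition k2 :: "proj2 \<Rightarrow> complex" where "k2 r = rep_proj2 r $ 2"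

lemma dot_conv:
  "dot (rep_proj2 r) (line_chart.u \<beta>) = k0 r + k2 r * \<beta>"
  "dot (rep_proj2 r) (line_chart.v lam \<alpha>) = k1 r + k2 r * \<alpha>"
  by (simp_all add: dot_3 line_chart.u_def line_chart.v_def k0_def k1_def k2_def)

text \<open>\<open>Pt x z\<close> and \<open>Qt x z\<close> are the components of the vector field at \<open>(x, z)\<close> that belongs to the line of
  slope \<open>\<alpha>\<close> through that point, as polynomials in \<open>\<alpha>\<close>.\<close>

definition "Pt x z = (\<Sum>j\<le>k + 1. smult (x ^ j) (poly (p j) [:z, - x:]))"
definition "Gt x z = (\<Sum>j\<le>k. smult (x ^ j) (poly (g j) [:z, - x:]))"
definition "Qt x z = Gt x z + [:0, 1:] * Pt x z"
definition "PL \<alpha> \<beta> = (\<Sum>j\<le>k + 1. monom (poly2 (p j) \<alpha> \<beta>) j)"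
definition "GL \<alpha> \<beta> = (\<Sum>j\<le>k. monom (poly2 (g j) \<alpha> \<beta>) j)"
definition "W x z = Pt x z * pderiv (Qt x z) - Qt x z * pderiv (Pt x z)"

lemma poly_Pt: "poly (Pt x z) \<alpha> = poly (PL \<alpha> (z - \<alpha> * x)) x"
  by (simp add: Pt_def PL_def poly_sum poly_monom poly_poly_line mult.commute)

lemma poly_Gt: "poly (Gt x z) \<alpha> = poly (GL \<alpha> (z - \<alpha> * x)) x"
  by (simp add: Gt_def GL_def poly_sum poly_monom poly_poly_line mult.commute)

lemma poly_Qt: "poly (Qt x z) \<alpha> = poly (GL \<alpha> (z - \<alpha> * x)) x + \<alpha> * poly (PL \<alpha> (z - \<alpha> * x)) x"
  by (simp add: Qt_def poly_Gt poly_Pt)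

lemma degree_PL: "degree (PL \<alpha> \<beta>) \<le> k + 1"
  unfolding PL_def by (intro degree_sum_le) (auto intro: order_trans[OF degree_monom_le])

lemma degree_GL: "degree (GL \<alpha> \<beta>) \<le> k"
  unfolding GL_def by (intro degree_sum_le) (auto intro: order_trans[OF degree_monom_le])

text \<open>The derivative of \<open>PL\<close> when the line turns about the point over x. Since
  \<beta> = z - \<alpha> x, it is the \<alpha>-derivative minus x times the \<beta>-derivative; the
  factor x accounts for \<open>Suc j\<close> and raises the degree by one.\<close>

definition "PL' \<alpha> \<beta> = (\<Sum>j\<le>k + 1. monom (poly2 (map_poly pderiv (p j)) \<alpha> \<beta>) j - monom (poly2 (pderiv (p j)) \<alpha> \<beta>) (Suc j))"
definition "GL' \<alpha> \<beta> = (\<Sum>j\<le>k. monom (poly2 (map_poly pderiv (g j)) \<alpha> \<beta>) j - monom (poly2 (pderiv (g j)) \<alpha> \<beta>) (Suc j))"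

lemma degree_PL': "degree (PL' \<alpha> \<beta>) \<le> k + 2"
  unfolding PL'_def by (intro degree_sum_le degree_diff_le) (auto intro: order_trans[OF degree_monom_le])

lemma degree_GL': "degree (GL' \<alpha> \<beta>) \<le> k + 1"
  unfolding GL'_def by (intro degree_sum_le degree_diff_le) (auto intro: order_trans[OF degree_monom_le])

lemma pderiv_sum: "pderiv (sum f A) = (\<Sum>a\<in>A. pderiv (f a :: complex poly))"
  by (induction A rule: infinite_finite_induct) (simp_all add: pderiv_add)

lemma poly_pderiv_family:
  "poly (pderiv (\<Sum>j\<le>N. smult (x ^ j) (poly (h j) [:z, - x:]))) \<alpha>
    = poly (\<Sum>j\<le>N. monom (poly2 (map_poly pderiv (h j)) \<alpha> (z - \<alpha> * x)) j - monom (poly2 (pderiv (h j)) \<alpha> (z - \<alpha> * x)) (Suc j)) x"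
  unfolding pderiv_sum poly_sum
  by (intro sum.cong)
    (simp_all add: pderiv_smult pderiv_poly poly_monom poly_poly_line pderiv_pCons algebra_simps)

lemma poly_pderiv_Pt: "poly (pderiv (Pt x z)) \<alpha> = poly (PL' \<alpha> (z - \<alpha> * x)) x"
  unfolding Pt_def PL'_def by (rule poly_pderiv_family)

lemma poly_pderiv_Gt: "poly (pderiv (Gt x z)) \<alpha> = poly (GL' \<alpha> (z - \<alpha> * x)) x"
  unfolding Gt_def GL'_def by (rule poly_pderiv_family)

lemma cofinite_poly_eq_0:
  fixes f :: "complex poly"
  assumes "b \<noteq> 0" "\<And>x. poly b x \<noteq> 0 \<Longrightarrow> poly f x = 0"
  shows "f = 0"
proof -
  have "b * f = 0" by (rule poly_eqI) (use assms(2) in auto)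
  then show ?thesis using assms(1) by simp
qed

text \<open>For slopes of lines that meet the line of \<open>r\<close> at a finite point, this is
  the lattice condition at that point; as a polynomial identity in the slope it then holds
  always.\<close>

lemma relation_Pt:
  assumes r: "r \<in> Z" and xz: "k0 r + k1 r * x + k2 r * z = 0"
  shows "smult (k1 r) (Pt x z) + smult (k2 r) (Qt x z) = 0"
proof (rule cofinite_poly_eq_0)
  show "[:k1 r, k2 r:] \<noteq> 0" using affine[OF r] by (auto simp: k1_def k2_def)
  fix \<alpha> assume "poly [:k1 r, k2 r:] \<alpha> \<noteq> 0"
  then have nz: "k1 r + k2 r * \<alpha> \<noteq> 0" by (simp add: mult.commute)
  define \<beta> where "\<beta> = z - \<alpha> * x"
  have "k0 r + k2 r * \<beta> = - x * (k1 r + k2 r * \<alpha>)" using xz by (simp add: \<beta>_def algebra_simps eq_neg_iff_add_eq_0)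
  then have x: "- (k0 r + k2 r * \<beta>) / (k1 r + k2 r * \<alpha>) = x" using nz by simp
  have "(k1 r + k2 r * \<alpha>) * poly (PL \<alpha> \<beta>) x + k2 r * poly (GL \<alpha> \<beta>) x = 0"
    using relation[OF r, of \<alpha> \<beta>] nz unfolding dot_conv x k2_def[symmetric]
    by (simp add: PL_def GL_def poly_sum poly_monom)
  then show "poly (smult (k1 r) (Pt x z) + smult (k2 r) (Qt x z)) \<alpha> = 0"
    by (simp add: poly_Pt poly_Qt \<beta>_def[symmetric] algebra_simps)
qed

text \<open>On the line of \<open>r\<close> the two components satisfy a linear relation with
  constant coefficients, not both zero, which forces their Wronskian to vanish.\<close>

lemma W_on_arrangement:
  assumes r: "r \<in> Z" and xz: "k0 r + k1 r * x + k2 r * z = 0"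
  shows "W x z = 0"
proof -
  note 1 = relation_Pt[OF assms]
  have 2: "smult (k1 r) (pderiv (Pt x z)) + smult (k2 r) (pderiv (Qt x z)) = 0"
    using arg_cong[OF 1, of pderiv] by (simp add: pderiv_add pderiv_smult)
  have "smult (k1 r) (W x z) = (smult (k1 r) (Pt x z) + smult (k2 r) (Qt x z)) * pderiv (Qt x z)
      - Qt x z * (smult (k1 r) (pderiv (Pt x z)) + smult (k2 r) (pderiv (Qt x z)))"
    by (simp add: W_def algebra_simps smult_diff_right smult_add_right)
  moreover have "smult (k2 r) (W x z) = Pt x z * (smult (k1 r) (pderiv (Pt x z)) + smult (k2 r) (pderiv (Qt x z)))
      - (smult (k1 r) (Pt x z) + smult (k2 r) (Qt x z)) * pderiv (Pt x z)"
    by (simp add: W_def algebra_simps smult_diff_right smult_add_right)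
  ultimately have "smult (k1 r) (W x z) = 0" "smult (k2 r) (W x z) = 0" using 1 2 by simp_all
  then show ?thesis using affine[OF r] by (auto simp: k1_def k2_def)
qed

text \<open>On a good line the Wronskian has degree at most \<open>2 k + 2\<close>, but it vanishes at all nodes.\<close>

lemma W_on_good_line:
  assumes "good_line lam \<alpha> \<beta> Z"
  shows "poly (W x (\<beta> + \<alpha> * x)) \<alpha> = 0"
proof -
  interpret good_line lam \<alpha> \<beta> Z by fact
  \<comment> \<open>Since Q is G + \<alpha> P, the two terms \<alpha> P P' of the Wronskian cancel.
    They alone would have reached degree 2 k + 3.\<close>
  define Wp where "Wp = PL \<alpha> \<beta> * GL' \<alpha> \<beta> + PL \<alpha> \<beta> * PL \<alpha> \<beta> - GL \<alpha> \<beta> * PL' \<alpha> \<beta>"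
  have W: "poly (W x (\<beta> + \<alpha> * x)) \<alpha> = poly Wp x" for x
    by (simp add: W_def Qt_def pderiv_add pderiv_mult pderiv_pCons poly_Pt poly_Gt poly_pderiv_Pt poly_pderiv_Gt Wp_def algebra_simps)
  have deg: "degree Wp \<le> 2 * k + 2"
  proof -
    have "degree (PL \<alpha> \<beta> * GL' \<alpha> \<beta>) \<le> 2 * k + 2" "degree (PL \<alpha> \<beta> * PL \<alpha> \<beta>) \<le> 2 * k + 2" "degree (GL \<alpha> \<beta> * PL' \<alpha> \<beta>) \<le> 2 * k + 2"
      using degree_mult_le[of "PL \<alpha> \<beta>" "GL' \<alpha> \<beta>"] degree_mult_le[of "PL \<alpha> \<beta>" "PL \<alpha> \<beta>"] degree_mult_le[of "GL \<alpha> \<beta>" "PL' \<alpha> \<beta>"]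
        degree_PL[of \<alpha> \<beta>] degree_GL[of \<alpha> \<beta>] degree_PL'[of \<alpha> \<beta>] degree_GL'[of \<alpha> \<beta>] by linarith+
    then show ?thesis unfolding Wp_def by (intro degree_diff_le degree_add_le)
  qed
  have "poly Wp (node r) = 0" if r: "r \<in> Z" for r
  proof -
    have "k0 r + k2 r * \<beta> = - (node r * (k1 r + k2 r * \<alpha>))" using dot_u[OF r] by (simp add: dot_conv)
    moreover have "k0 r + k1 r * node r + k2 r * (\<beta> + \<alpha> * node r) = (k0 r + k2 r * \<beta>) + node r * (k1 r + k2 r * \<alpha>)"
      by (simp add: algebra_simps)
    ultimately have "k0 r + k1 r * node r + k2 r * (\<beta> + \<alpha> * node r) = 0" by simp
    from W_on_arrangement[OF r this] W[of "node r"] show ?thesis by simp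
  qed
  then have sub: "node ` Z \<subseteq> {x. poly Wp x = 0}" by auto
  have "Wp = 0"
  proof (rule ccontr)
    assume ne: "Wp \<noteq> 0"
    have "card (node ` Z) = card Z" using node_inj by (simp add: card_image inj_on_def)
    moreover have "card (node ` Z) \<le> card {x. poly Wp x = 0}"
      using sub poly_roots_finite[OF ne] card_mono by blast
    ultimately show False using card_poly_roots_bound[OF ne] deg many by linarith
  qed
  then show ?thesis using W by simp
qed

text \<open>Through a point of one good line all but finitely many lines with a slope are good.
  Hence the Wronskian vanishes for almost all slopes, so identically, and the ratio of the two
  components is constant.\<close>

lemma direction_independent:
  assumes good: "good_line lam \<alpha> \<beta> Z" and z: "z = \<beta> + \<alpha> * x"
  shows "poly (Pt x z) \<alpha>1 * poly (Qt x z) \<alpha>2 = poly (Qt x z) \<alpha>1 * poly (Pt x z) \<alpha>2"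
proof -
  interpret good_line lam \<alpha> \<beta> Z by fact
  let ?I = "{(r, s) \<in> Z \<times> Z. r \<noteq> s}"
  \<comment> \<open>As a polynomial in the slope of a line through (x, z), this is nonzero where the
    line meets the lines of \<open>r\<close> and \<open>s\<close> in distinct points, as a good line
    must.\<close>
  define c where "c r s = [:k0 r + k2 r * z, - k2 r * x:] * [:k1 s, k2 s:] - [:k0 s + k2 s * z, - k2 s * x:] * [:k1 r, k2 r:]" for r s
  define b where "b = (\<Prod>r\<in>Z. [:k1 r, k2 r:]) * (\<Prod>(r, s)\<in>?I. c r s)"
  have fin: "finite ?I" using finite_Z by (auto intro: finite_subset[of _ "Z \<times> Z"])
  have b: "poly b \<alpha>' \<noteq> 0 \<longleftrightarrow> good_line lam \<alpha>' (z - \<alpha>' * x) Z" for \<alpha>'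
  proof -
    have 1: "poly [:k1 r, k2 r:] \<alpha>' = dot (rep_proj2 r) (line_chart.v lam \<alpha>')" for r
      by (simp add: dot_conv mult.commute)
    have 2: "poly (c r s) \<alpha>' = dot (rep_proj2 r) (line_chart.u (z - \<alpha>' * x)) * dot (rep_proj2 s) (line_chart.v lam \<alpha>')
        - dot (rep_proj2 s) (line_chart.u (z - \<alpha>' * x)) * dot (rep_proj2 r) (line_chart.v lam \<alpha>')" for r s
      by (simp add: c_def dot_conv algebra_simps)
    have "poly b \<alpha>' \<noteq> 0 \<longleftrightarrow> (\<forall>r\<in>Z. poly [:k1 r, k2 r:] \<alpha>' \<noteq> 0) \<and> (\<forall>(r, s)\<in>?I. poly (c r s) \<alpha>' \<noteq> 0)"
      unfolding b_def poly_mult poly_prod using finite_Z fin by (simp add: split_beta) blast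
    also have "\<dots> \<longleftrightarrow> good_line lam \<alpha>' (z - \<alpha>' * x) Z"
      unfolding 1 2 good_line_def using finite_Z by auto
    finally show ?thesis .
  qed
  have "poly b \<alpha> \<noteq> 0" unfolding b using good z by simp
  then have "b \<noteq> 0" by auto
  moreover have "poly (W x z) \<alpha>' = 0" if "poly b \<alpha>' \<noteq> 0" for \<alpha>'
    using W_on_good_line[of \<alpha>' "z - \<alpha>' * x" x] that b by (simp add: algebra_simps)
  ultimately have "W x z = 0" by (rule cofinite_poly_eq_0)
  then show ?thesis by (intro wronskian_zero_imp_proportional) (simp add: W_def)
qed

end

section \<open>Existence of a polynomial family of sections\<close>

lemma sum_lessThan_add: "(\<Sum>j<a + b. f j) = (\<Sum>j<a. f j) + (\<Sum>j<b. f (a + j :: nat) :: 'a::comm_monoid_add)"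
  by (induction b) (simp_all add: add.assoc)

text \<open>Multiplying the condition at a node by the power k + 1 of \<open>V\<close> clears the
  denominators, so that its coefficients become polynomials in slope and intercept.\<close>

lemma homogenized_relation:
  fixes U V c :: complex and y :: "nat \<Rightarrow> complex"
  assumes "V \<noteq> 0"
  shows "(\<Sum>j<(k + 2) + (k + 1). (if j < k + 2 then (- U) ^ j * V ^ (k + 2 - j) else (- U) ^ (j - (k + 2)) * V ^ (k + 1 - (j - (k + 2))) * c) * y j)
    = V ^ (k + 1) * (V * (\<Sum>j\<le>k + 1. y j * (- U / V) ^ j) + c * (\<Sum>j\<le>k. y (k + 2 + j) * (- U / V) ^ j))"
proof -
  have pow: "(- U) ^ j * V ^ (n - j) = V ^ n * (- U / V) ^ j" if "j \<le> n" for j n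
  proof -
    have "V ^ n = V ^ (n - j) * V ^ j" using that by (simp add: power_add[symmetric])
    moreover have "(- U) ^ j = (- U / V) ^ j * V ^ j"
      by (simp only: power_mult_distrib[symmetric]) (simp add: assms)
    ultimately show ?thesis by (simp only: mult_ac)
  qed
  have 1: "(\<Sum>j<k + 2. (- U) ^ j * V ^ (k + 2 - j) * y j) = V ^ (k + 1) * (V * (\<Sum>j\<le>k + 1. y j * (- U / V) ^ j))"
  proof -
    have "{..<k + 2} = {..k + 1}" by auto
    then show ?thesis by (simp only: sum_distrib_left) (intro sum.cong refl, simp add: pow)
  qed
  have 2: "(\<Sum>j<k + 1. (- U) ^ j * V ^ (k + 1 - j) * c * y (k + 2 + j)) = V ^ (k + 1) * (c * (\<Sum>j\<le>k. y (k + 2 + j) * (- U / V) ^ j))"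
  proof -
    have "{..<k + 1} = {..k}" by auto
    then show ?thesis by (simp only: sum_distrib_left) (intro sum.cong refl, simp add: pow)
  qed
  show ?thesis unfolding sum_lessThan_add distrib_left 1[symmetric] 2[symmetric]
    by (intro arg_cong2[of _ _ _ _ "(+)"] sum.cong) auto
qed

definition chart_poly :: "complex \<Rightarrow> complex poly3 \<Rightarrow> complex poly poly" where
  "chart_poly lam = subst3 (\<lambda>c. [:[:c:]:]) (\<lambda>i. if i = 0 then [:0, [:-1:]:] else if i = 1 then [:[:0, -1:], [:- lam:]:] else 1)"

lemma poly2_chart_poly: "poly2 (chart_poly lam F) \<alpha> \<beta> = eval3 F (line_chart.q lam \<alpha> \<beta>)"
proof (rule ring_homomorphism_ext[where g = "\<lambda>F. poly2 (chart_poly lam F) \<alpha> \<beta>" and h = "\<lambda>F. eval3 F (line_chart.q lam \<alpha> \<beta>)"])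
  have hom: "ring_homomorphism (\<lambda>c :: complex. [:[:c:]:])" by unfold_locales (simp_all add: one_pCons)
  show "ring_homomorphism (\<lambda>F. poly2 (chart_poly lam F) \<alpha> \<beta>)"
    unfolding chart_poly_def by (rule ring_homomorphism_comp[OF _ ring_homomorphism_subst3[OF hom]]) unfold_locales
  show "poly2 (chart_poly lam (const c)) \<alpha> \<beta> = eval3 (const c) (line_chart.q lam \<alpha> \<beta>)" for c
    by (simp add: chart_poly_def subst3_const hom)
  show "poly2 (chart_poly lam (var i)) \<alpha> \<beta> = eval3 (var i) (line_chart.q lam \<alpha> \<beta>)" for i
    by (rule_tac i=i in cases_3) (simp_all add: chart_poly_def subst3_var hom line_chart.q_def poly2.one algebra_simps)
qed (rule ring_homomorphism_eval3)

lemma bdspace_coeffs: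
  assumes "X \<in> bdspace (int k + 1) (int k)" "\<And>j. j \<le> k + 1 \<Longrightarrow> coeff (fst X) j = 0" "\<And>j. j \<le> k \<Longrightarrow> coeff (snd X) j = 0"
  shows "X = 0"
proof -
  have "coeff (fst X) j = 0" for j
    using assms(1,2) by (cases "j \<le> k + 1") (auto simp: bdspace_def bd_conv)
  moreover have "coeff (snd X) j = 0" for j
    using assms(1,3) by (cases "j \<le> k") (auto simp: bdspace_def bd_conv)
  ultimately show ?thesis by (auto simp: prod_eq_iff intro: Polynomial.poly_eqI)
qed

text \<open>A polynomial family of sections over all lines exists, as the conditions form a linear system over
  \<open>\<complex>[\<alpha>, \<beta>]\<close> that has a nontrivial solution at every general point.\<close>

lemma ex_pencil:
  assumes fin: "finite Z" and affine: "\<And>r. r \<in> Z \<Longrightarrow> rep_proj2 r $ 1 - lam * rep_proj2 r $ 0 \<noteq> 0 \<or> rep_proj2 r $ 2 \<noteq> 0"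
    and many: "card Z > 2 * k + 2" and \<Phi>: "\<Phi> \<noteq> 0"
    and good: "\<And>\<alpha> \<beta>. poly2 \<Phi> \<alpha> \<beta> \<noteq> 0 \<Longrightarrow> good_line lam \<alpha> \<beta> Z \<and> (\<exists>X\<in>good_line.E lam \<alpha> \<beta> Z k. X \<noteq> 0)"
  obtains p g where "pencil lam Z k p g" "(\<exists>j\<le>k + 1. p j \<noteq> 0) \<or> (\<exists>j\<le>k. g j \<noteq> 0)"
proof -
  define U where "U r = [: [:rep_proj2 r $ 0:], [:rep_proj2 r $ 2:] :]" for r
  define V where "V r = [: [:rep_proj2 r $ 1 - lam * rep_proj2 r $ 0, rep_proj2 r $ 2:] :]" for r
  define row where "row r j = (if j < k + 2 then (- U r) ^ j * V r ^ (k + 2 - j)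
    else (- U r) ^ (j - (k + 2)) * V r ^ (k + 1 - (j - (k + 2))) * [:[:rep_proj2 r $ 2:]:])" for r j
  have U: "poly2 (U r) \<alpha> \<beta> = dot (rep_proj2 r) (line_chart.u \<beta>)" for r \<alpha> \<beta>
    by (simp add: U_def dot_3 line_chart.u_def)
  have V: "poly2 (V r) \<alpha> \<beta> = dot (rep_proj2 r) (line_chart.v lam \<alpha>)" for r \<alpha> \<beta>
    by (simp add: V_def dot_3 line_chart.v_def algebra_simps)
  have row: "(\<Sum>j<(k + 2) + (k + 1). poly2 (row r j) \<alpha> \<beta> * y j) = dot (rep_proj2 r) (line_chart.v lam \<alpha>) ^ (k + 1) *
      (dot (rep_proj2 r) (line_chart.v lam \<alpha>) * (\<Sum>j\<le>k + 1. y j * (- dot (rep_proj2 r) (line_chart.u \<beta>) / dot (rep_proj2 r) (line_chart.v lam \<alpha>)) ^ j)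
      + rep_proj2 r $ 2 * (\<Sum>j\<le>k. y (k + 2 + j) * (- dot (rep_proj2 r) (line_chart.u \<beta>) / dot (rep_proj2 r) (line_chart.v lam \<alpha>)) ^ j))"
    if "dot (rep_proj2 r) (line_chart.v lam \<alpha>) \<noteq> 0" for r \<alpha> \<beta> y
  proof -
    have "poly2 (row r j) \<alpha> \<beta> = (if j < k + 2 then (- dot (rep_proj2 r) (line_chart.u \<beta>)) ^ j * dot (rep_proj2 r) (line_chart.v lam \<alpha>) ^ (k + 2 - j)
      else (- dot (rep_proj2 r) (line_chart.u \<beta>)) ^ (j - (k + 2)) * dot (rep_proj2 r) (line_chart.v lam \<alpha>) ^ (k + 1 - (j - (k + 2))) * rep_proj2 r $ 2)" for j
    proof -
      have c: "poly2 [:[:c:]:] \<alpha> \<beta> = c" for c by simp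
      show ?thesis by (simp only: row_def if_distrib[of "\<lambda>x. poly2 x \<alpha> \<beta>"] c poly2.mult poly2.power poly2.uminus U V)
    qed
    then show ?thesis using homogenized_relation[OF that, of k "dot (rep_proj2 r) (line_chart.u \<beta>)" "rep_proj2 r $ 2" y] by simp
  qed
  let ?n = "(k + 2) + (k + 1)"
  from fraction_free_elimination[OF fin, of ?n row] show ?thesis
  proof (elim disjE exE conjE)
    fix x j assume j: "j < ?n" "x j \<noteq> 0" and x: "\<forall>r\<in>Z. (\<Sum>j<?n. row r j * x j) = 0"
    have "pencil lam Z k x (\<lambda>j. x (k + 2 + j))"
    proof
      fix \<alpha> \<beta> r assume r: "r \<in> Z" and nz: "dot (rep_proj2 r) (line_chart.v lam \<alpha>) \<noteq> 0"
      have "poly2 (\<Sum>j<?n. row r j * x j) \<alpha> \<beta> = 0" using x r by (simp only: poly2_0)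
      then have "(\<Sum>j<?n. poly2 (row r j) \<alpha> \<beta> * poly2 (x j) \<alpha> \<beta>) = 0"
        by (simp only: poly2.sum poly2.mult)
      then show "dot (rep_proj2 r) (line_chart.v lam \<alpha>)
        * (\<Sum>j\<le>k + 1. poly2 (x j) \<alpha> \<beta> * (- dot (rep_proj2 r) (line_chart.u \<beta>) / dot (rep_proj2 r) (line_chart.v lam \<alpha>)) ^ j)
      + rep_proj2 r $ 2 * (\<Sum>j\<le>k. poly2 (x (k + 2 + j)) \<alpha> \<beta> * (- dot (rep_proj2 r) (line_chart.u \<beta>) / dot (rep_proj2 r) (line_chart.v lam \<alpha>)) ^ j) = 0"
        unfolding row[OF nz] using nz by simp
    qed (use assms in auto)
    moreover have "(\<exists>j\<le>k + 1. x j \<noteq> 0) \<or> (\<exists>j\<le>k. x (k + 2 + j) \<noteq> 0)"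
    proof (cases "j \<le> k + 1")
      case False
      then have "j = k + 2 + (j - (k + 2))" "j - (k + 2) \<le> k" using j(1) by auto
      then show ?thesis using j(2) by metis
    qed (use j in blast)
    ultimately show ?thesis by (rule that)
  next
    \<comment> \<open>The certificate would survive specialisation at a point where
      \<open>\<Phi> * d\<close> does not vanish, but a nonzero section exists there.\<close>
    fix d \<mu> assume d: "d \<noteq> 0" and \<mu>: "\<forall>j<?n. \<forall>l<?n. (\<Sum>r\<in>Z. \<mu> j r * row r l) = (if l = j then d else 0)"
    obtain \<alpha> \<beta> where nz: "poly2 (\<Phi> * d) \<alpha> \<beta> \<noteq> 0" using ex_poly2_neq_0 \<Phi> d by (metis mult_eq_0_iff)
    then have 1: "poly2 \<Phi> \<alpha> \<beta> \<noteq> 0" "poly2 d \<alpha> \<beta> \<noteq> 0" by (auto simp: poly2.mult)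
    then interpret good_line lam \<alpha> \<beta> Z using good by blast
    obtain X where X: "X \<in> E k" "X \<noteq> 0" using good[OF 1(1)] by blast
    define y where "y j = (if j < k + 2 then coeff (fst X) j else coeff (snd X) (j - (k + 2)))" for j
    have bd: "degree (fst X) \<le> k + 1" "degree (snd X) \<le> k"
      using X(1) bd_int[of "k + 1" "fst X"] bd_int[of k "snd X"] by (auto simp: E_def bdspace_def add.commute)
    have rel: "(\<Sum>j<?n. poly2 (row r j) \<alpha> \<beta> * y j) = 0" if r: "r \<in> Z" for r
    proof -
      have A: "(\<Sum>j\<le>k + 1. y j * node r ^ j) = poly (fst X) (node r)"
        unfolding poly_conv_sum_atMost[OF bd(1)] by (intro sum.cong) (auto simp: y_def)
      have B: "(\<Sum>j\<le>k. y (k + 2 + j) * node r ^ j) = poly (snd X) (node r)"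
        unfolding poly_conv_sum_atMost[OF bd(2)] by (intro sum.cong) (auto simp: y_def)
      have w: "rep_proj2 r $ 2 = dot (rep_proj2 r) w" by (simp add: dot_3 w_def)
      show ?thesis
        unfolding row[OF dot_v[OF r]] node_def[symmetric] A B w using X(1) r by (simp add: E_def Lat_def)
    qed
    have y0: "y j = 0" if j: "j < ?n" for j
    proof -
      have "0 = (\<Sum>r\<in>Z. poly2 (\<mu> j r) \<alpha> \<beta> * (\<Sum>l<?n. poly2 (row r l) \<alpha> \<beta> * y l))" using rel by simp
      also have "\<dots> = (\<Sum>l<?n. (\<Sum>r\<in>Z. poly2 (\<mu> j r) \<alpha> \<beta> * poly2 (row r l) \<alpha> \<beta>) * y l)"
        by (simp only: sum_distrib_left sum_distrib_right mult.assoc) (rule sum.swap)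
      also have "\<dots> = (\<Sum>l<?n. poly2 (\<Sum>r\<in>Z. \<mu> j r * row r l) \<alpha> \<beta> * y l)" by (simp only: poly2.sum poly2.mult)
      also have "\<dots> = (\<Sum>l<?n. if l = j then poly2 d \<alpha> \<beta> * y j else 0)"
        using \<mu> j by (intro sum.cong) auto
      also have "\<dots> = poly2 d \<alpha> \<beta> * y j" using j by simp
      finally show ?thesis using 1(2) by simp
    qed
    have "X = 0"
    proof (rule bdspace_coeffs)
      show "X \<in> bdspace (int k + 1) (int k)" using X(1) by (simp add: E_def)
      show "coeff (fst X) j = 0" if "j \<le> k + 1" for j using y0[of j] that by (simp add: y_def)
      show "coeff (snd X) j = 0" if "j \<le> k" for j using y0[of "k + 2 + j"] that by (simp add: y_def)
    qed
    then show ?thesis using X(2) by simp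
  qed
qed

section \<open>Polynomials on the affine plane\<close>

definition on_line :: "complex \<Rightarrow> complex \<Rightarrow> complex poly poly \<Rightarrow> complex poly" where
  "on_line \<alpha> \<beta> F = poly F [:\<beta>, \<alpha>:]"

interpretation on_line: ring_homomorphism "on_line \<alpha> \<beta>" for \<alpha> \<beta>
  by unfold_locales (simp_all add: on_line_def)

lemma poly_on_line: "poly (on_line \<alpha> \<beta> F) x = poly2 F x (\<beta> + \<alpha> * x)"
  using poly_poly_line[of F \<beta> "- \<alpha>" x] by (simp add: on_line_def mult.commute)

text \<open>By pseudo-division a nonzero combination \<open>f\<close> of least degree divides
  constant multiples of \<open>P\<close> and \<open>Q\<close>. Its primitive part divides both and
  is a unit, so \<open>f\<close> lies in the coefficient ring; it plays the part of a
  resultant.\<close>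

lemma coprime_poly_bezout:
  fixes P Q :: "'a::{factorial_ring_gcd,semiring_gcd_mult_normalize} poly"
  assumes "coprime P Q"
  obtains U V r where "U * P + V * Q = [:r:]" "r \<noteq> 0"
proof -
  define I where "I = {U * P + V * Q | U V. U * P + V * Q \<noteq> 0}"
  have PI: "P \<in> I" if "P \<noteq> 0" using that unfolding I_def by (intro CollectI exI[of _ 1] exI[of _ 0]) simp
  have QI: "Q \<in> I" if "Q \<noteq> 0" using that unfolding I_def by (intro CollectI exI[of _ 0] exI[of _ 1]) simp
  have "P \<noteq> 0 \<or> Q \<noteq> 0" using assms by auto
  then have "\<exists>f. f \<in> I" using PI QI by blast
  then obtain f where f: "f \<in> I" "\<And>h. h \<in> I \<Longrightarrow> degree f \<le> degree h"
    using ex_has_least_nat[of "\<lambda>f. f \<in> I" _ degree] by blast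
  then obtain U V where UV: "f = U * P + V * Q" and f0: "f \<noteq> 0" by (auto simp: I_def)
  have dvd: "\<exists>c. c \<noteq> 0 \<and> f dvd smult c h" if h: "\<exists>A B. h = A * P + B * Q" for h
  proof -
    obtain A B where AB: "h = A * P + B * Q" using h by blast
    obtain q r where qr: "pseudo_divmod h f = (q, r)" by force
    let ?c = "coeff f (degree f) ^ (Suc (degree h) - degree f)"
    have 1: "smult ?c h = f * q + r" and 2: "r = 0 \<or> degree r < degree f"
      using pseudo_divmod[OF f0 qr] by auto
    have "r = (smult ?c A - q * U) * P + (smult ?c B - q * V) * Q"
    proof -
      have "r = smult ?c h - f * q" using 1 by simp
      also have "\<dots> = (smult ?c A - q * U) * P + (smult ?c B - q * V) * Q"
        by (simp add: AB UV algebra_simps smult_add_right)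
      finally show ?thesis .
    qed
    then have "r = 0 \<or> r \<in> I" unfolding I_def by blast
    then have "r = 0" using f(2)[of r] 2 by auto
    then have "f dvd smult ?c h" using 1 by simp
    moreover have "?c \<noteq> 0" using f0 by simp
    ultimately show ?thesis by blast
  qed
  have prim: "primitive_part f dvd h" if "c \<noteq> 0" "f dvd smult c h" for c h
  proof -
    have "primitive_part f dvd smult c h"
      using that(2) by (metis content_times_primitive_part dvd_trans dvd_smult dvd_refl smult_dvd_cancel)
    then have "primitive_part (primitive_part f) dvd primitive_part (smult c h)"
      by (rule primitive_part_dvd_primitive_partI)
    then have "primitive_part f dvd primitive_part (smult c h)" 
      by (simp add: primitive_part_prim content_primitive_part[OF f0])
    also have "primitive_part (smult c h) = smult (unit_factor c) (primitive_part h)" by (rule primitive_part_smult)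
    finally have 1: "primitive_part f dvd smult (unit_factor c) (primitive_part h)" .
    have "unit_factor c dvd 1" using that(1) by (rule unit_factor_is_unit)
    then obtain s where s: "1 = unit_factor c * s" by (rule dvdE)
    have "primitive_part f dvd smult s (smult (unit_factor c) (primitive_part h))" using 1 by (rule dvd_smult)
    then have "primitive_part f dvd primitive_part h" by (simp add: mult.commute[of s] s[symmetric])
    then show ?thesis using content_times_primitive_part[of h] by (metis dvd_smult)
  qed
  have "primitive_part f dvd P" "primitive_part f dvd Q"
    using dvd[of P] dvd[of Q] prim by (metis add.right_neutral mult_1 mult_zero_left, metis add.left_neutral mult_1 mult_zero_left)
  then have "primitive_part f dvd 1" using assms by (metis coprime_common_divisor)
  then have "degree (primitive_part f) = 0" unfolding is_unit_poly_iff by (metis degree_pCons_0)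
  then have "degree f = 0" by simp
  then obtain r where "f = [:r:]" by (rule degree_eq_zeroE)
  then show ?thesis using that[of U V r] UV f0 by simp
qed

text \<open>The first coordinate of a common zero is a root of \<open>r\<close>. The zeros over one
  such value are finite in number, since otherwise a linear polynomial in the inner variable would
  divide both \<open>P\<close> and \<open>Q\<close>.\<close>

lemma finite_common_zeros:
  fixes P Q :: "complex poly poly"
  assumes "coprime P Q"
  shows "finite {(x, z). poly2 P x z = 0 \<and> poly2 Q x z = 0}"
proof -
  obtain U V r where r: "U * P + V * Q = [:r:]" "r \<noteq> 0" by (rule coprime_poly_bezout[OF assms])
  define sp where "sp x F = map_poly (\<lambda>c. poly c x) F" for x and F :: "complex poly poly"
  have sp: "poly (sp x F) z = poly2 F x z" for x z F
    unfolding sp_def by (induction F) (simp_all add: map_poly_pCons)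
  have zero: "x \<in> {x. poly r x = 0}" if "poly2 P x z = 0" "poly2 Q x z = 0" for x z
  proof -
    have "poly2 (U * P + V * Q) x z = 0" using that by (simp add: poly2.hom)
    then show ?thesis by (simp add: r(1))
  qed
  have fin: "finite {z. poly2 P x z = 0 \<and> poly2 Q x z = 0}" for x
  proof -
    have "sp x P \<noteq> 0 \<or> sp x Q \<noteq> 0"
    proof (rule ccontr)
      assume "\<not> ?thesis"
      then have *: "sp x P = 0" "sp x Q = 0" by auto
      have "[:[:- x, 1:]:] dvd F" if "sp x F = 0" for F
      proof -
        have "poly (coeff F n) x = 0" for n
          using arg_cong[OF that, of "\<lambda>p. coeff p n"] by (simp add: sp_def coeff_map_poly)
        then show ?thesis by (simp add: const_poly_dvd_iff poly_eq_0_iff_dvd)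
      qed
      then have "[:[:- x, 1:]:] dvd P" "[:[:- x, 1:]:] dvd Q" using * by blast+
      then have "[:[:- x, 1:]:] dvd (1 :: complex poly poly)" using assms coprime_common_divisor by blast
      then obtain s where "1 = [:[:- x, 1:]:] * s" by (rule dvdE)
      then have "poly2 1 x 0 = poly2 ([:[:- x, 1:]:] * s) x 0" by simp
      then show False by (simp only: poly2.mult poly2.one) simp
    qed
    then have "finite {z. poly (sp x P) z = 0} \<or> finite {z. poly (sp x Q) z = 0}" using poly_roots_finite by blast
    then show ?thesis by (rule disjE) (auto simp: sp elim: finite_subset[rotated])
  qed
  have "{(x, z). poly2 P x z = 0 \<and> poly2 Q x z = 0} \<subseteq> (SIGMA x:{x. poly r x = 0}. {z. poly2 P x z = 0 \<and> poly2 Q x z = 0})"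
    using zero by auto
  moreover have "finite (SIGMA x:{x. poly r x = 0}. {z. poly2 P x z = 0 \<and> poly2 Q x z = 0})"
    using poly_roots_finite[OF r(2)] fin by (intro finite_SigmaI) auto
  ultimately show ?thesis by (rule finite_subset)
qed

lemma ex_poly_along:
  fixes F :: "complex poly poly" and X Y :: "complex poly"
  shows "\<exists>f. \<forall>t. poly f t = poly2 F (poly X t) (poly Y t)"
proof (induction F)
  case (pCons a F)
  then obtain f where "\<forall>t. poly f t = poly2 F (poly X t) (poly Y t)" by blast
  then show ?case by (intro exI[of _ "pcompose a X + Y * f"]) (simp add: poly_pcompose)
qed (auto intro: exI[of _ 0])

lemma ex_poly2_along:
  fixes F :: "complex poly poly" and X Y :: "complex poly poly"
  shows "\<exists>G. \<forall>s t. poly2 G s t = poly2 F (poly2 X s t) (poly2 Y s t)"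
proof (induction F)
  case (pCons a F)
  then obtain G where G: "\<forall>s t. poly2 G s t = poly2 F (poly2 X s t) (poly2 Y s t)" by blast
  have "\<exists>H. \<forall>s t. poly2 H s t = poly a (poly2 X s t)"
  proof (induction a)
    case (pCons b a)
    then obtain H where "\<forall>s t. poly2 H s t = poly a (poly2 X s t)" by blast
    then show ?case by (intro exI[of _ "[:[:b:]:] + X * H"]) (simp add: poly2.hom)
  qed (auto intro: exI[of _ 0])
  then obtain H where "\<forall>s t. poly2 H s t = poly a (poly2 X s t)" by blast
  then show ?case using G by (intro exI[of _ "H + Y * G"]) (simp add: poly2.hom)
qed (auto intro: exI[of _ 0])

lemma finite_zeros_on_line:
  assumes ab: "a \<noteq> 0 \<or> b \<noteq> 0" and xz: "c + a * x + b * z = 0" "poly2 F x z \<noteq> 0"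
  shows "finite {(x, z). c + a * x + b * z = 0 \<and> poly2 F x z = 0}"
proof -
  obtain f where f: "\<And>t. poly f t = poly2 F (poly [:x, b:] t) (poly [:z, - a:] t)"
    using ex_poly_along[of F "[:x, b:]" "[:z, - a:]"] by blast
  have "poly f 0 \<noteq> 0" using xz by (simp add: f)
  then have "finite {t. poly f t = 0}" by (intro poly_roots_finite) auto
  moreover have "{(x, z). c + a * x + b * z = 0 \<and> poly2 F x z = 0} \<subseteq> (\<lambda>t. (x + b * t, z - a * t)) ` {t. poly f t = 0}"
  proof safe
    fix x' z' assume 1: "c + a * x' + b * z' = 0" "poly2 F x' z' = 0"
    have eq: "a * (x' - x) + b * (z' - z) = 0" using 1 xz by (simp add: algebra_simps) (metis add.commute add_left_cancel)
    have "\<exists>t. x' = x + b * t \<and> z' = z - a * t"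
    proof (cases "b = 0")
      case True
      then show ?thesis using ab eq by (intro exI[of _ "(z - z') / a"]) auto
    next
      case False
      have "b * (z' - z) = - (a * (x' - x))" using eq by (simp only: eq_neg_iff_add_eq_0 add.commute)
      then have "z' - z = - (a * (x' - x)) / b" using False by (simp only: nonzero_eq_divide_eq mult.commute not_False_eq_True)
      then have "z' = z - a * ((x' - x) / b)" by (simp add: diff_eq_eq)
      then show ?thesis using False by (intro exI[of _ "(x' - x) / b"]) simp
    qed
    then obtain t where t: "x' = x + b * t" "z' = z - a * t" by blast
    then have "poly f t = 0" using 1 by (simp add: f mult.commute)
    then show "(x', z') \<in> (\<lambda>t. (x + b * t, z - a * t)) ` {t. poly f t = 0}" using t by blast
  qed
  ultimately show ?thesis using finite_surj by blast
qed

section \<open>Total degree and its detection on general lines\<close>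

definition total_degree_le :: "nat \<Rightarrow> complex poly poly \<Rightarrow> bool" where
  "total_degree_le n F \<longleftrightarrow> (\<forall>i j. i + j > n \<longrightarrow> coeff (coeff F j) i = 0)"

lemma total_degree_leD: "total_degree_le n F \<Longrightarrow> degree (coeff F j) \<le> n - j" "total_degree_le n F \<Longrightarrow> degree F \<le> n"
proof -
  assume *: "total_degree_le n F"
  show "degree (coeff F j) \<le> n - j" by (rule degree_le) (use * in \<open>auto simp: total_degree_le_def\<close>)
  show "degree F \<le> n"
  proof (rule degree_le, safe)
    fix j assume "n < j"
    then show "coeff F j = 0" using * by (intro Polynomial.poly_eqI) (auto simp: total_degree_le_def)
  qed
qed

lemma ex_total_degree_le: "\<exists>n. total_degree_le n F"
proof (intro exI)
  show "total_degree_le (degree F + (\<Sum>j\<le>degree F. degree (coeff F j))) F"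
    unfolding total_degree_le_def
  proof (intro allI impI)
    fix i j assume ij: "i + j > degree F + (\<Sum>j\<le>degree F. degree (coeff F j))"
    show "coeff (coeff F j) i = 0"
    proof (cases "j \<le> degree F")
      case True
      then have "degree (coeff F j) \<le> (\<Sum>j\<le>degree F. degree (coeff F j))" by (intro member_le_sum) auto
      then show ?thesis using ij True by (intro coeff_eq_0) linarith
    qed (simp add: coeff_eq_0)
  qed
qed

text \<open>The part of total degree \<open>n\<close> at (1, \<alpha>). If \<open>n\<close> bounds
  the total degree, it is the coefficient of the n-th power along any line of slope \<alpha>,
  whatever the intercept.\<close>

definition top_part :: "nat \<Rightarrow> complex poly poly \<Rightarrow> complex poly" where
  "top_part n F = (\<Sum>j\<le>n. monom (coeff (coeff F j) (n - j)) j)"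

lemma coeff_top_part: "j \<le> n \<Longrightarrow> coeff (top_part n F) j = coeff (coeff F j) (n - j)" "j > n \<Longrightarrow> coeff (top_part n F) j = 0"
  by (simp_all add: top_part_def coeff_sum)

lemma coeff_on_line:
  assumes "total_degree_le n F"
  shows "coeff (on_line \<alpha> \<beta> F) n = poly (top_part n F) \<alpha>"
proof -
  have deg: "degree (coeff F j) \<le> n - j" "degree F \<le> n" for j using total_degree_leD[OF assms] by auto
  have "on_line \<alpha> \<beta> F = (\<Sum>j\<le>n. coeff F j * [:\<beta>, \<alpha>:] ^ j)"
    unfolding on_line_def poly_altdef by (rule sum.mono_neutral_left) (use deg(2) in \<open>auto simp: coeff_eq_0\<close>)
  then have "coeff (on_line \<alpha> \<beta> F) n = (\<Sum>j\<le>n. coeff (coeff F j * [:\<beta>, \<alpha>:] ^ j) n)" by (simp add: coeff_sum)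
  also have "\<dots> = (\<Sum>j\<le>n. coeff (coeff F j) (n - j) * \<alpha> ^ j)"
  proof (rule sum.cong[OF refl])
    fix j assume "j \<in> {..n}"
    then show "coeff (coeff F j * [:\<beta>, \<alpha>:] ^ j) n = coeff (coeff F j) (n - j) * \<alpha> ^ j"
      using coeff_mult_top[of "coeff F j" "n - j" "[:\<beta>, \<alpha>:] ^ j" j] deg(1)[of j] degree_power_linear[of \<beta> \<alpha> j] by simp
  qed
  finally show ?thesis by (simp add: top_part_def poly_sum poly_monom)
qed

lemma general_slope:
  fixes f :: "complex poly"
  assumes "\<Theta> \<noteq> 0" "\<And>\<alpha> \<beta>. poly2 \<Theta> \<alpha> \<beta> \<noteq> 0 \<Longrightarrow> poly f \<alpha> = 0"
  shows "f = 0"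
proof -
  obtain \<alpha>0 \<beta>0 where "poly2 \<Theta> \<alpha>0 \<beta>0 \<noteq> 0" using ex_poly2_neq_0 assms(1) by blast
  then have "poly \<Theta> [:\<beta>0:] \<noteq> 0" by (auto simp: poly2_def)
  then have "poly \<Theta> [:\<beta>0:] * f = 0 \<longleftrightarrow> f = 0" by simp
  moreover have "poly \<Theta> [:\<beta>0:] * f = 0"
  proof (rule poly_eqI)
    fix t show "poly (poly \<Theta> [:\<beta>0:] * f) t = poly 0 t"
      using assms(2)[of t \<beta>0] by (cases "poly2 \<Theta> t \<beta>0 = 0") (simp_all add: poly2_def)
  qed
  ultimately show ?thesis by simp
qed

text \<open>If a bound above \<open>n\<close> holds, the part of that total degree vanishes for
  general slopes, hence altogether. So the bound is lowered one by one from some initial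
  \<open>N\<close>.\<close>

lemma total_degree_le_if_on_lines:
  assumes \<Theta>: "\<Theta> \<noteq> 0" and deg: "\<And>\<alpha> \<beta>. poly2 \<Theta> \<alpha> \<beta> \<noteq> 0 \<Longrightarrow> degree (on_line \<alpha> \<beta> F) \<le> n"
  shows "total_degree_le n F"
proof -
  obtain N where N: "total_degree_le N F" using ex_total_degree_le by blast
  have "total_degree_le n F \<or> total_degree_le (N - m) F" for m
  proof (induction m)
    case (Suc m)
    show ?case
    proof (cases "n \<ge> N - m")
      case True
      then show ?thesis using Suc by (auto simp: total_degree_le_def)
    next
      case False
      show ?thesis
      proof (rule disjCI)
        assume "\<not> total_degree_le (N - Suc m) F"
        show "total_degree_le n F"
        proof (rule ccontr)
          assume n: "\<not> total_degree_le n F"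
          then have td: "total_degree_le (N - m) F" using Suc by blast
          have "top_part (N - m) F = 0"
          proof (rule general_slope[OF \<Theta>])
            fix \<alpha> \<beta> assume "poly2 \<Theta> \<alpha> \<beta> \<noteq> 0"
            then have "coeff (on_line \<alpha> \<beta> F) (N - m) = 0" using deg[of \<alpha> \<beta>] False by (intro coeff_eq_0) simp
            then show "poly (top_part (N - m) F) \<alpha> = 0" using coeff_on_line[OF td] by simp
          qed
          then have "coeff (coeff F j) (N - m - j) = 0" if "j \<le> N - m" for j
            using coeff_top_part(1)[OF that, of F] by simp
          then have top: "coeff (coeff F j) i = 0" if "i + j = N - m" for i j using that by (metis add_diff_cancel_right' le_add2)
          then have "total_degree_le (N - Suc m) F"
            unfolding total_degree_le_def
          proof (intro allI impI)
            fix i j assume "N - Suc m < i + j"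
            then consider "i + j = N - m" | "N - m < i + j" using False by linarith
            then show "coeff (coeff F j) i = 0"
              by cases (use top td in \<open>auto simp: total_degree_le_def\<close>)
          qed
          then show False using \<open>\<not> total_degree_le (N - Suc m) F\<close> by blast
        qed
      qed
    qed
  qed (use N in simp)
  from this[of N] show ?thesis
  proof
    assume "total_degree_le (N - N) F"
    then show ?thesis unfolding total_degree_le_def by (metis diff_self_eq_0 gr_zeroI not_less_zero)
  qed
qed

lemma coprime_if_no_common_root:
  fixes p q :: "complex poly"
  assumes "\<And>x. \<not> (poly p x = 0 \<and> poly q x = 0)"
  shows "coprime p q"
proof -
  have "poly (gcd p q) x \<noteq> 0" for x
  proof
    assume 0: "poly (gcd p q) x = 0"
    obtain a b where a: "p = gcd p q * a" and b: "q = gcd p q * b" using gcd_dvd1 gcd_dvd2 by (meson dvdE)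
    have "poly p x = 0" using 0 by (subst a) simp
    moreover have "poly q x = 0" using 0 by (subst b) simp
    ultimately show False using assms by blast
  qed
  then have "constant (poly (gcd p q))" using fundamental_theorem_of_algebra by blast
  then have "degree (gcd p q) = 0" by (simp add: constant_degree)
  moreover have "gcd p q \<noteq> 0" using \<open>\<And>x. poly (gcd p q) x \<noteq> 0\<close>[of 0] by auto
  ultimately have "is_unit (gcd p q)" using is_unit_iff_degree by blast
  then show ?thesis by (simp only: is_unit_gcd)
qed

lemma prod_linear_dvd:
  fixes h :: "complex poly"
  assumes "finite A" "inj_on t A" "\<And>a. a \<in> A \<Longrightarrow> poly h (t a) = 0"
  shows "(\<Prod>a\<in>A. [:- t a, 1:]) dvd h"
  using assms
proof (induction A rule: finite_induct)
  case (insert a A)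
  then obtain s where s: "h = (\<Prod>b\<in>A. [:- t b, 1:]) * s" by (auto elim: dvdE)
  have "poly (\<Prod>b\<in>A. [:- t b, 1:]) (t a) \<noteq> 0"
    using insert by (auto simp: poly_prod inj_on_def)
  moreover have "poly h (t a) = 0" using insert by simp
  ultimately have "poly s (t a) = 0" by (simp add: s)
  then have "[:- t a, 1:] dvd s" by (simp add: poly_eq_0_iff_dvd)
  then have "(\<Prod>b\<in>A. [:- t b, 1:]) * [:- t a, 1:] dvd h" unfolding s by (rule mult_dvd_mono[OF dvd_refl])
  then show ?case using insert by (simp add: mult.commute)
qed simp

lemma smult_left_cancel: "s \<noteq> 0 \<Longrightarrow> smult s p = smult s q \<longleftrightarrow> p = (q :: 'a::field poly)"
  by (metis (no_types) left_inverse smult_1_left smult_smult)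

context pencil begin

lemma coeff_PL: "j \<le> k + 1 \<Longrightarrow> coeff (PL \<alpha> \<beta>) j = poly2 (p j) \<alpha> \<beta>"
  by (simp add: PL_def coeff_sum del: sum.atMost_Suc)

lemma coeff_GL: "j \<le> k \<Longrightarrow> coeff (GL \<alpha> \<beta>) j = poly2 (g j) \<alpha> \<beta>"
  by (simp add: GL_def coeff_sum)

lemma ex_specialized_family:
  "\<exists>F. \<forall>x z. poly2 F x z = poly (\<Sum>j\<le>N. smult (x ^ j) (poly (h j) [:z, - x:])) \<alpha>0"
proof -
  have "\<exists>G. \<forall>x z. poly2 G x z = poly2 (h j) \<alpha>0 (z - \<alpha>0 * x)" for j
    using ex_poly2_along[of "h j" "[:[:\<alpha>0:]:]" "[:[:0, - \<alpha>0:], 1:]"] by (simp add: poly2.one algebra_simps)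
  then obtain G where "\<And>j x z. poly2 (G j) x z = poly2 (h j) \<alpha>0 (z - \<alpha>0 * x)" by metis
  then show ?thesis
    by (intro exI[of _ "\<Sum>j\<le>N. [:[:0, 1:]:] ^ j * G j"]) (simp add: poly2.hom poly_sum poly_poly_line)
qed

text \<open>As the direction at a point does not depend on the slope, one slope \<open>\<alpha>0\<close> suffices to define the field. Once its
  components are divided by their common factor, only the lines in \<open>C\<close> fail to be invariant, and \<open>\<pi>\<close> restores
  them; on a general line the given section must be a multiple of the result, which bounds the degrees.\<close>

lemma ex_plane_field:
  assumes \<Phi>: "\<Phi> \<noteq> 0" and good: "\<And>\<alpha> \<beta>. poly2 \<Phi> \<alpha> \<beta> \<noteq> 0 \<Longrightarrow> good_line lam \<alpha> \<beta> Z"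
    and ne: "(\<exists>j\<le>k + 1. p j \<noteq> 0) \<or> (\<exists>j\<le>k. g j \<noteq> 0)"
  obtains P Q where "P \<noteq> 0 \<or> Q \<noteq> 0"
    "\<And>r x z. r \<in> Z \<Longrightarrow> k0 r + k1 r * x + k2 r * z = 0 \<Longrightarrow> k1 r * poly2 P x z + k2 r * poly2 Q x z = 0"
    "total_degree_le (k + 1) P" "total_degree_le (k + 1) Q"
    "top_part (k + 1) Q = [:0, 1:] * top_part (k + 1) P"
proof -
  obtain \<kappa> where \<kappa>: "\<kappa> \<noteq> 0" "\<And>\<alpha> \<beta>. poly2 \<kappa> \<alpha> \<beta> \<noteq> 0 \<Longrightarrow> PL \<alpha> \<beta> \<noteq> 0 \<or> GL \<alpha> \<beta> \<noteq> 0"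
  proof -
    from ne show ?thesis
    proof (elim disjE exE conjE)
      fix j assume "j \<le> k + 1" "p j \<noteq> 0"
      then show ?thesis using that[of "p j"] coeff_PL by (metis coeff_0)
    next
      fix j assume "j \<le> k" "g j \<noteq> 0"
      then show ?thesis using that[of "g j"] coeff_GL by (metis coeff_0)
    qed
  qed
  obtain \<alpha>0 \<beta>0 where "poly2 \<kappa> \<alpha>0 \<beta>0 \<noteq> 0" using ex_poly2_neq_0 \<kappa>(1) by blast
  then have ne0: "PL \<alpha>0 \<beta>0 \<noteq> 0 \<or> GL \<alpha>0 \<beta>0 \<noteq> 0" by (rule \<kappa>(2))
  obtain P0 where P0: "\<And>x z. poly2 P0 x z = poly (Pt x z) \<alpha>0"
    using ex_specialized_family[of p "k + 1" \<alpha>0] unfolding Pt_def by blast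
  obtain G0 where G0: "\<And>x z. poly2 G0 x z = poly (Gt x z) \<alpha>0"
    using ex_specialized_family[of g k \<alpha>0] unfolding Gt_def by blast
  define Q0 where "Q0 = G0 + [:[:\<alpha>0:]:] * P0"
  have Q0: "poly2 Q0 x z = poly (Qt x z) \<alpha>0" for x z
    unfolding Q0_def poly2.add poly2.mult by (simp add: P0 G0 Qt_def)
  have PQ0: "P0 \<noteq> 0 \<or> Q0 \<noteq> 0"
  proof (rule ccontr)
    assume "\<not> ?thesis"
    then have 0: "P0 = 0" "Q0 = 0" by auto
    have "poly (PL \<alpha>0 \<beta>0) x = 0" for x
      using P0[of x "\<beta>0 + \<alpha>0 * x"] by (simp add: 0 poly_Pt)
    then have PL: "PL \<alpha>0 \<beta>0 = 0" by (intro poly_eqI) simp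
    have "poly (GL \<alpha>0 \<beta>0) x = 0" for x
      using Q0[of x "\<beta>0 + \<alpha>0 * x"] by (simp add: 0 poly_Qt PL)
    then have "GL \<alpha>0 \<beta>0 = 0" by (intro poly_eqI) simp
    then show False using ne0 PL by blast
  qed
  define g0 where "g0 = gcd P0 Q0"
  have "g0 \<noteq> 0" using PQ0 by (simp add: g0_def)
  then obtain P1 Q1 where P1: "P0 = P1 * g0" and Q1: "Q0 = Q1 * g0" and cop: "coprime P1 Q1"
    unfolding g0_def using gcd_coprime_exists[of P0 Q0] by blast
  define c where "c r = [:[:k1 r:]:] * P1 + [:[:k2 r:]:] * Q1" for r
  have c: "poly2 (c r) x z = k1 r * poly2 P1 x z + k2 r * poly2 Q1 x z" for r x z
    unfolding c_def poly2.add poly2.mult by simp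
  \<comment> \<open>The lines that lose their invariance when the common factor \<open>g0\<close> is
    divided out.\<close>
  define C where "C = {r \<in> Z. \<exists>x z. k0 r + k1 r * x + k2 r * z = 0 \<and> poly2 (c r) x z \<noteq> 0}"
  have finC: "finite C" using finite_Z by (simp add: C_def)
  \<comment> \<open>Finitely many points that a general line avoids. On such a line
    \<open>P1\<close> and \<open>Q1\<close> have no common root, and at the node of a member of
    \<open>C\<close> the reduced field is not tangent to the line of that member.\<close>
  define N where "N = {(x, z). poly2 P1 x z = 0 \<and> poly2 Q1 x z = 0}
    \<union> (\<Union>r\<in>C. {(x, z). k0 r + k1 r * x + k2 r * z = 0 \<and> poly2 (c r) x z = 0})"
  have finN: "finite N"
    unfolding N_def
  proof (intro finite_UnI finite_UN_I finC finite_common_zeros[OF cop])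
    fix r assume "r \<in> C"
    then obtain x z where r: "r \<in> Z" "k0 r + k1 r * x + k2 r * z = 0" "poly2 (c r) x z \<noteq> 0" by (auto simp: C_def)
    have "k1 r \<noteq> 0 \<or> k2 r \<noteq> 0" using affine[OF r(1)] by (simp add: k1_def k2_def)
    then show "finite {(x, z). k0 r + k1 r * x + k2 r * z = 0 \<and> poly2 (c r) x z = 0}"
      using r by (rule_tac finite_zeros_on_line)
  qed
  obtain x1 z1 where xz1: "poly2 g0 x1 z1 \<noteq> 0" using ex_poly2_neq_0 \<open>g0 \<noteq> 0\<close> by blast
  \<comment> \<open>Nonvanishing of \<open>\<Gamma>\<close> ensures that \<open>g0\<close> does not
    vanish identically on the line, so that it can be cancelled there.\<close>
  obtain \<Gamma> where \<Gamma>: "\<And>\<alpha> \<beta>. poly2 \<Gamma> \<alpha> \<beta> = poly2 g0 x1 (\<beta> + \<alpha> * x1)"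
    using ex_poly2_along[of g0 "[:[:x1:]:]" "[:[:0, x1:], 1:]"] by (auto simp: poly2.one algebra_simps)
  have "poly2 \<Gamma> 0 z1 \<noteq> 0" using xz1 by (simp add: \<Gamma>)
  then have \<Gamma>0: "\<Gamma> \<noteq> 0" by auto
  define A where "A = (\<Prod>(x, z)\<in>N. [:[:z, - x:], [:-1:]:])"
  have A0: "A \<noteq> 0" using finN by (auto simp: A_def prod_zero_iff)
  have A: "poly2 A \<alpha> \<beta> \<noteq> 0 \<longleftrightarrow> (\<forall>(x, z)\<in>N. z \<noteq> \<beta> + \<alpha> * x)" for \<alpha> \<beta>
    using finN by (auto simp: A_def poly2.prod split_beta algebra_simps)
  define \<Theta> where "\<Theta> = \<Phi> * (\<kappa> * (\<Gamma> * A))"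
  have \<Theta>0: "\<Theta> \<noteq> 0" using \<Phi> \<kappa>(1) \<Gamma>0 A0 by (simp add: \<Theta>_def)
  define \<pi> where "\<pi> = (\<Prod>r\<in>C. [:[:k0 r, k1 r:], [:k2 r:]:])"
  have \<pi>0: "\<pi> \<noteq> 0"
  proof -
    have "[:[:k0 r, k1 r:], [:k2 r:]:] \<noteq> 0" if "r \<in> C" for r
      using affine[of r] that by (auto simp: C_def k1_def k2_def)
    then show ?thesis using finC by (simp add: \<pi>_def prod_zero_iff)
  qed
  define P where "P = \<pi> * P1"
  define Q where "Q = \<pi> * Q1"
  have main: "degree (on_line \<alpha> \<beta> P) \<le> k + 1 \<and> degree (on_line \<alpha> \<beta> Q - [:\<alpha>:] * on_line \<alpha> \<beta> P) \<le> k"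
    if \<Theta>: "poly2 \<Theta> \<alpha> \<beta> \<noteq> 0" for \<alpha> \<beta>
  proof -
    have gen: "poly2 \<Phi> \<alpha> \<beta> \<noteq> 0" "poly2 \<kappa> \<alpha> \<beta> \<noteq> 0" "poly2 \<Gamma> \<alpha> \<beta> \<noteq> 0" "poly2 A \<alpha> \<beta> \<noteq> 0"
      using \<Theta> by (auto simp: \<Theta>_def poly2.mult)
    interpret good_line lam \<alpha> \<beta> Z by (rule good[OF gen(1)])
    let ?R = "on_line \<alpha> \<beta>"
    let ?PL = "PL \<alpha> \<beta>"
    define QL where "QL = GL \<alpha> \<beta> + [:\<alpha>:] * ?PL"
    have avoid: "(x, \<beta> + \<alpha> * x) \<notin> N" for x using gen(4) unfolding A by blast
    have Rg0: "?R g0 \<noteq> 0"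
    proof
      assume "?R g0 = 0"
      then have "poly (?R g0) x1 = 0" by simp
      then show False using gen(3) by (simp add: poly_on_line \<Gamma>)
    qed
    \<comment> \<open>At every point of the line, the direction for its own slope \<alpha> is
      compared with the direction for the fixed slope \<alpha>0.\<close>
    have "?PL * ?R Q0 = QL * ?R P0"
    proof (rule poly_eqI)
      fix x
      show "poly (?PL * ?R Q0) x = poly (QL * ?R P0) x"
        using direction_independent[OF good[OF gen(1)] refl, of x \<alpha> \<alpha>0]
        by (simp add: poly_on_line P0[symmetric] Q0[symmetric] poly_Pt[of _ _ \<alpha>] poly_Qt[of _ _ \<alpha>] QL_def)
    qed
    then have "?R g0 * (?PL * ?R Q1) = ?R g0 * (QL * ?R P1)" by (simp add: P1 Q1 on_line.mult mult_ac)
    then have eq: "?PL * ?R Q1 = QL * ?R P1" using Rg0 by simp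
    have "coprime (?R P1) (?R Q1)"
      using avoid by (intro coprime_if_no_common_root) (auto simp: poly_on_line N_def)
    then obtain U V s where UV: "U * ?R P1 + V * ?R Q1 = [:s:]" "s \<noteq> 0" by (rule coprime_poly_bezout)
    \<comment> \<open>The section is proportional to the coprime pair \<open>?R P1\<close>,
      \<open>?R Q1\<close>; the Bezout identity gives the polynomial factor.\<close>
    define h where "h = smult (1 / s) (U * ?PL + V * QL)"
    have hP: "?PL = h * ?R P1" and hQ: "QL = h * ?R Q1"
    proof -
      have "smult s (h * ?R P1) = U * (?PL * ?R P1) + V * (QL * ?R P1)" using UV(2) by (simp add: h_def algebra_simps smult_add_right)
      also have "\<dots> = ?PL * (U * ?R P1 + V * ?R Q1)" unfolding eq[symmetric] by (simp add: algebra_simps)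
      also have "\<dots> = smult s ?PL" by (simp add: UV(1))
      finally show "?PL = h * ?R P1" using UV(2) smult_left_cancel by metis
      have "smult s (h * ?R Q1) = U * (?PL * ?R Q1) + V * (QL * ?R Q1)" using UV(2) by (simp add: h_def algebra_simps smult_add_right)
      also have "\<dots> = QL * (U * ?R P1 + V * ?R Q1)" unfolding eq by (simp add: algebra_simps)
      also have "\<dots> = smult s QL" by (simp add: UV(1))
      finally show "QL = h * ?R Q1" using UV(2) smult_left_cancel by metis
    qed
    \<comment> \<open>At this node the section is tangent to the line of \<open>r\<close> but the
      reduced field is not, so the factor vanishes. Therefore \<open>h\<close> absorbs the
      restriction of \<open>\<pi>\<close>.\<close>
    have hroot: "poly h (node r) = 0" if r: "r \<in> C" for r
    proof -
      let ?x = "node r"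
      have rZ: "r \<in> Z" using r by (simp add: C_def)
      have "k0 r + k2 r * \<beta> = - (?x * (k1 r + k2 r * \<alpha>))" using dot_u[OF rZ] by (simp add: dot_conv)
      moreover have "k0 r + k1 r * ?x + k2 r * (\<beta> + \<alpha> * ?x) = (k0 r + k2 r * \<beta>) + ?x * (k1 r + k2 r * \<alpha>)"
        by (simp add: algebra_simps)
      ultimately have on: "k0 r + k1 r * ?x + k2 r * (\<beta> + \<alpha> * ?x) = 0" by simp
      have "k1 r * poly ?PL ?x + k2 r * poly QL ?x = 0"
        using arg_cong[OF relation_Pt[OF rZ on], of "\<lambda>p. poly p \<alpha>"] by (simp add: poly_Pt poly_Qt QL_def)
      then have "poly h ?x * poly2 (c r) ?x (\<beta> + \<alpha> * ?x) = 0"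
        by (simp add: hP hQ c poly_on_line algebra_simps)
      moreover have "poly2 (c r) ?x (\<beta> + \<alpha> * ?x) \<noteq> 0" using avoid[of ?x] r on by (auto simp: N_def)
      ultimately show ?thesis by simp
    qed
    have "inj_on node C" using node_inj by (auto simp: inj_on_def C_def)
    then have "(\<Prod>r\<in>C. [:- node r, 1:]) dvd h" using hroot finC by (intro prod_linear_dvd)
    moreover have "?R \<pi> = smult (\<Prod>r\<in>C. k1 r + k2 r * \<alpha>) (\<Prod>r\<in>C. [:- node r, 1:])"
    proof -
      have "?R [:[:k0 r, k1 r:], [:k2 r:]:] = [:k1 r + k2 r * \<alpha>:] * [:- node r, 1:]" if "r \<in> C" for r
      proof -
        have "k0 r + k2 r * \<beta> = - (node r * (k1 r + k2 r * \<alpha>))" using dot_u[of r] that by (simp add: dot_conv C_def)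
        then show ?thesis by (simp add: on_line_def algebra_simps)
      qed
      then have "?R \<pi> = (\<Prod>r\<in>C. [:k1 r + k2 r * \<alpha>:] * [:- node r, 1:])" by (simp add: \<pi>_def on_line.prod)
      also have "\<dots> = (\<Prod>r\<in>C. [:k1 r + k2 r * \<alpha>:]) * (\<Prod>r\<in>C. [:- node r, 1:])" by (rule prod.distrib)
      also have "(\<Prod>r\<in>C. [:k1 r + k2 r * \<alpha>:]) = [:\<Prod>r\<in>C. k1 r + k2 r * \<alpha>:]"
        using ring_homomorphism.prod[OF ring_homomorphism_pCons, of "\<lambda>r. k1 r + k2 r * \<alpha>" C] by simp
      finally show ?thesis by simp
    qed
    moreover have "(\<Prod>r\<in>C. k1 r + k2 r * \<alpha>) \<noteq> 0"
      using dot_v finC by (auto simp: dot_conv C_def prod_zero_iff)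
    ultimately have "?R \<pi> dvd h" by (simp add: smult_dvd)
    then obtain h' where h': "h = ?R \<pi> * h'" by (rule dvdE)
    have P': "?PL = h' * ?R P" and Q': "QL = h' * ?R Q"
      by (simp_all add: hP hQ h' P_def Q_def on_line.mult mult_ac)
    have "h' \<noteq> 0"
      using \<kappa>(2)[OF gen(2)] P' Q' by (auto simp: QL_def)
    \<comment> \<open>The section is a nonzero multiple of the restricted field, so the degrees of
      \<open>PL\<close> and \<open>GL\<close> bound those of the field. The bound \<open>k\<close>
      for the component across the line is what makes the top part radial.\<close>
    have G': "GL \<alpha> \<beta> = h' * (?R Q - [:\<alpha>:] * ?R P)"
    proof -
      have "GL \<alpha> \<beta> = QL - [:\<alpha>:] * ?PL" by (simp add: QL_def)
      then show ?thesis by (simp add: P' Q' algebra_simps)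
    qed
    show ?thesis
      using degree_mult_right_le[OF \<open>h' \<noteq> 0\<close>, of "?R P"] degree_mult_right_le[OF \<open>h' \<noteq> 0\<close>, of "?R Q - [:\<alpha>:] * ?R P"]
        degree_PL[of \<alpha> \<beta>] degree_GL[of \<alpha> \<beta>] unfolding P' G' by (simp add: mult.commute)
  qed
  have tdP: "total_degree_le (k + 1) P"
    by (rule total_degree_le_if_on_lines[OF \<Theta>0]) (use main in blast)
  have tdQ: "total_degree_le (k + 1) Q"
  proof (rule total_degree_le_if_on_lines[OF \<Theta>0])
    fix \<alpha> \<beta> assume "poly2 \<Theta> \<alpha> \<beta> \<noteq> 0"
    then have m: "degree (on_line \<alpha> \<beta> P) \<le> k + 1" "degree (on_line \<alpha> \<beta> Q - [:\<alpha>:] * on_line \<alpha> \<beta> P) \<le> k" using main by auto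
    have "degree ((on_line \<alpha> \<beta> Q - [:\<alpha>:] * on_line \<alpha> \<beta> P) + [:\<alpha>:] * on_line \<alpha> \<beta> P) \<le> k + 1"
    proof (rule degree_add_le)
      show "degree (on_line \<alpha> \<beta> Q - [:\<alpha>:] * on_line \<alpha> \<beta> P) \<le> k + 1" using m(2) by simp
      show "degree ([:\<alpha>:] * on_line \<alpha> \<beta> P) \<le> k + 1" using m(1) by simp
    qed
    then show "degree (on_line \<alpha> \<beta> Q) \<le> k + 1" by simp
  qed
  have "top_part (k + 1) Q - [:0, 1:] * top_part (k + 1) P = 0"
  proof (rule general_slope[OF \<Theta>0])
    fix \<alpha> \<beta> assume "poly2 \<Theta> \<alpha> \<beta> \<noteq> 0"
    then have "coeff (on_line \<alpha> \<beta> Q - [:\<alpha>:] * on_line \<alpha> \<beta> P) (k + 1) = 0"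
      using main by (intro coeff_eq_0) fastforce
    then have "coeff (on_line \<alpha> \<beta> Q) (k + 1) - \<alpha> * coeff (on_line \<alpha> \<beta> P) (k + 1) = 0" by simp
    then show "poly (top_part (k + 1) Q - [:0, 1:] * top_part (k + 1) P) \<alpha> = 0"
      unfolding coeff_on_line[OF tdP] coeff_on_line[OF tdQ] by simp
  qed
  then have top: "top_part (k + 1) Q = [:0, 1:] * top_part (k + 1) P" by simp
  have "k1 r * poly2 P x z + k2 r * poly2 Q x z = 0" if r: "r \<in> Z" and on: "k0 r + k1 r * x + k2 r * z = 0" for r x z
  proof -
    have eq: "k1 r * poly2 P x z + k2 r * poly2 Q x z = poly2 \<pi> x z * poly2 (c r) x z"
      by (simp add: P_def Q_def poly2.mult c algebra_simps)
    show ?thesis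
    proof (cases "r \<in> C")
      case True
      have "poly2 [:[:k0 r, k1 r:], [:k2 r:]:] x z = 0" using on by (simp add: algebra_simps)
      then have "poly2 \<pi> x z = 0" using True finC unfolding \<pi>_def poly2.prod by (intro prod_zero) auto
      then show ?thesis by (simp add: eq)
    next
      case False
      then have "poly2 (c r) x z = 0" using r on by (auto simp: C_def)
      then show ?thesis by (simp add: eq)
    qed
  qed
  moreover have "P \<noteq> 0 \<or> Q \<noteq> 0" using PQ0 \<pi>0 by (auto simp: P_def Q_def P1 Q1)
  ultimately show ?thesis using that tdP tdQ top by blast
qed

end

text \<open>Splits off the part of total degree k + 1, which needs separate treatment in the
  homogenisation to degree \<open>k\<close>.\<close>

lemma poly2_total_degree:
  assumes "total_degree_le (k + 1) F"
  shows "poly2 F x z = (\<Sum>j\<le>k. \<Sum>i\<le>k - j. coeff (coeff F j) i * x ^ i * z ^ j)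
    + (\<Sum>j\<le>k + 1. coeff (top_part (k + 1) F) j * x ^ (k + 1 - j) * z ^ j)"
proof -
  have deg: "degree (coeff F j) \<le> k + 1 - j" "degree F \<le> k + 1" for j using total_degree_leD[OF assms] by auto
  have "poly2 F x z = (\<Sum>j\<le>k + 1. poly (coeff F j) x * z ^ j)"
  proof -
    have "poly F [:z:] = (\<Sum>j\<le>k + 1. coeff F j * [:z:] ^ j)"
      unfolding poly_altdef by (rule sum.mono_neutral_left) (use deg(2) in \<open>auto simp: coeff_eq_0\<close>)
    then show ?thesis by (simp add: poly2_def poly_sum)
  qed
  also have "\<dots> = (\<Sum>j\<le>k + 1. (\<Sum>i\<le>k + 1 - j. coeff (coeff F j) i * x ^ i) * z ^ j)"
    by (intro sum.cong refl) (simp only: poly_conv_sum_atMost[OF deg(1)])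
  also have "\<dots> = (\<Sum>j\<le>k + 1. ((if j \<le> k then \<Sum>i\<le>k - j. coeff (coeff F j) i * x ^ i else 0) + coeff (coeff F j) (k + 1 - j) * x ^ (k + 1 - j)) * z ^ j)"
  proof (intro sum.cong refl arg_cong2[of _ _ _ _ "(*)"])
    fix j assume j: "j \<in> {..k + 1}"
    show "(\<Sum>i\<le>k + 1 - j. coeff (coeff F j) i * x ^ i) =
      (if j \<le> k then \<Sum>i\<le>k - j. coeff (coeff F j) i * x ^ i else 0) + coeff (coeff F j) (k + 1 - j) * x ^ (k + 1 - j)"
    proof (cases "j \<le> k")
      case True
      then have "k + 1 - j = Suc (k - j)" by simp
      then show ?thesis using True by simp
    next
      case False
      then have "j = k + 1" using j by simp
      then show ?thesis by simp
    qed
  qed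
  also have "\<dots> = (\<Sum>j\<le>k + 1. (if j \<le> k then \<Sum>i\<le>k - j. coeff (coeff F j) i * x ^ i * z ^ j else 0))
      + (\<Sum>j\<le>k + 1. coeff (coeff F j) (k + 1 - j) * x ^ (k + 1 - j) * z ^ j)"
    unfolding sum.distrib[symmetric] by (intro sum.cong refl) (simp add: distrib_right sum_distrib_right)
  also have "(\<Sum>j\<le>k + 1. (if j \<le> k then \<Sum>i\<le>k - j. coeff (coeff F j) i * x ^ i * z ^ j else 0))
      = (\<Sum>j\<le>k. \<Sum>i\<le>k - j. coeff (coeff F j) i * x ^ i * z ^ j)"
    by (rule sum.mono_neutral_cong_right) auto
  also have "(\<Sum>j\<le>k + 1. coeff (coeff F j) (k + 1 - j) * x ^ (k + 1 - j) * z ^ j)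
      = (\<Sum>j\<le>k + 1. coeff (top_part (k + 1) F) j * x ^ (k + 1 - j) * z ^ j)"
    by (intro sum.cong refl) (simp add: coeff_top_part)
  finally show ?thesis .
qed

text \<open>Homogenisation: a plane vector field \<open>(P, Q)\<close> of degree \<open>k + 1\<close> whose top part is a multiple of the
  radial field comes from a homogeneous derivation of degree \<open>k\<close>.\<close>

lemma ex_derivation_of_plane_field:
  assumes affine: "\<And>r. r \<in> Z \<Longrightarrow> rep_proj2 r $ 1 - lam * rep_proj2 r $ 0 \<noteq> 0 \<or> rep_proj2 r $ 2 \<noteq> 0"
    and PQ: "P \<noteq> 0 \<or> Q \<noteq> 0"
    and rel: "\<And>r x z. r \<in> Z \<Longrightarrow> rep_proj2 r $ 0 + (rep_proj2 r $ 1 - lam * rep_proj2 r $ 0) * x + rep_proj2 r $ 2 * z = 0 \<Longrightarrow>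
      (rep_proj2 r $ 1 - lam * rep_proj2 r $ 0) * poly2 P x z + rep_proj2 r $ 2 * poly2 Q x z = 0"
    and td: "total_degree_le (k + 1) P" "total_degree_le (k + 1) Q"
    and top: "top_part (k + 1) Q = [:0, 1:] * top_part (k + 1) P"
  obtains \<theta> where "\<theta> \<in> D_module (arrangement Z)" "\<forall>l\<in>forms 1. \<theta> l \<in> forms (int k)"
    "\<not> (\<exists>g. \<theta> = (\<lambda>f. g * euler_derivation f))"
proof -
  define l0 where "l0 = vec3 1 lam 0"
  \<comment> \<open>The part of total degree at most \<open>k\<close>, made homogeneous with
    \<open>lin l0\<close>. The part of degree k + 1 is \<open>\<tau>\<close> times the radial
    field.\<close>
  define low where "low F = (\<Sum>j\<le>k. \<Sum>i\<le>k - j. const (coeff (coeff F j) i) * (lin l0 ^ (k - j - i) * var 1 ^ i * var 2 ^ j))" for F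
  define \<tau> where "\<tau> = (\<Sum>j\<le>k. const (coeff (top_part (k + 1) P) j) * (var 1 ^ (k - j) * var 2 ^ j))"
  have low: "low F \<in> forms (int k)" for F
    unfolding low_def
  proof (intro forms_sum forms_const_mult)
    fix i j assume "j \<in> {..k}" "i \<in> {..k - j}"
    then have "int (k - j - i) + int i + int j = int k" by simp
    then show "lin l0 ^ (k - j - i) * var 1 ^ i * var 2 ^ j \<in> forms (int k)"
      using forms_mult[OF forms_mult[OF forms_power_linear[OF lin_forms] forms_power_linear[OF forms_var]] forms_power_linear[OF forms_var],
        of l0 "k - j - i" 1 i 2 j] by simp
  qed
  have \<tau>: "\<tau> \<in> forms (int k)"
    unfolding \<tau>_def
  proof (intro forms_sum forms_const_mult)
    fix j assume "j \<in> {..k}"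
    then have "int (k - j) + int j = int k" by simp
    then show "var 1 ^ (k - j) * var 2 ^ j \<in> forms (int k)"
      using forms_mult[OF forms_power_linear[OF forms_var] forms_power_linear[OF forms_var], of 1 "k - j" 2 j] by simp
  qed
  \<comment> \<open>The point with affine coordinates x and z, scaled so that \<open>lin l0\<close>
    has the value 1 there.\<close>
  define y where "y x z = vec3 (1 - lam * x) x z" for x z
  have l0y: "dot l0 (y x z) = 1" for x z by (simp add: dot_3 l0_def y_def)
  define \<tau>v where "\<tau>v x z = (\<Sum>j\<le>k. coeff (top_part (k + 1) P) j * x ^ (k - j) * z ^ j)" for x z
  have ev\<tau>: "eval3 \<tau> (y x z) = \<tau>v x z" for x z
    by (simp add: \<tau>_def \<tau>v_def eval3.hom y_def mult.assoc)
  have evlow: "eval3 (low F) (y x z) = (\<Sum>j\<le>k. \<Sum>i\<le>k - j. coeff (coeff F j) i * x ^ i * z ^ j)" for F x z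
    by (simp add: low_def eval3.hom l0y) (simp add: y_def mult.assoc)
  \<comment> \<open>The top part of \<open>Q\<close> has degree at most k + 1 and is the variable
    times that of \<open>P\<close>; this is why \<open>\<tau>\<close> may stop at
    \<open>k\<close>.\<close>
  have topP: "coeff (top_part (k + 1) P) (k + 1) = 0"
  proof -
    have "coeff (top_part (k + 1) Q) (Suc (k + 1)) = 0" by (rule coeff_top_part) simp
    then show ?thesis unfolding top by simp
  qed
  have evP: "eval3 (low P) (y x z) = poly2 P x z - x * \<tau>v x z" for x z
  proof -
    have "(\<Sum>j\<le>k + 1. coeff (top_part (k + 1) P) j * x ^ (k + 1 - j) * z ^ j) = (\<Sum>j\<le>k. coeff (top_part (k + 1) P) j * x ^ (k + 1 - j) * z ^ j)"
      using topP by simp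
    also have "\<dots> = x * \<tau>v x z"
      unfolding \<tau>v_def sum_distrib_left by (intro sum.cong refl) (auto simp: Suc_diff_le)
    finally show ?thesis using poly2_total_degree[OF td(1), of x z] by (simp only: evlow) simp
  qed
  have evQ: "eval3 (low Q) (y x z) = poly2 Q x z - z * \<tau>v x z" for x z
  proof -
    have "(\<Sum>j\<le>k + 1. coeff (top_part (k + 1) Q) j * x ^ (k + 1 - j) * z ^ j) = (\<Sum>j\<le>Suc k. coeff (top_part (k + 1) Q) j * x ^ (k + 1 - j) * z ^ j)"
      by simp
    also have "\<dots> = coeff (top_part (k + 1) Q) 0 * x ^ (k + 1) + (\<Sum>j\<le>k. coeff (top_part (k + 1) Q) (Suc j) * x ^ (k + 1 - Suc j) * z ^ Suc j)"
      by (subst sum.atMost_Suc_shift) simp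
    also have "\<dots> = z * \<tau>v x z"
      unfolding top \<tau>v_def sum_distrib_left by simp (intro sum.cong refl, simp)
    finally show ?thesis using poly2_total_degree[OF td(2), of x z] by (simp only: evlow) simp
  qed
  \<comment> \<open>Chosen so that \<theta> sends \<open>lin l0\<close> to \<open>- \<tau>\<close>.
    In the affine chart the components then are low P + x \<tau> = P and low Q + z \<tau> =
    Q.\<close>
  define f where "f i = (if i = 0 then - \<tau> - const lam * low P else if i = 1 then low P else low Q)" for i :: 3
  define \<theta> where "\<theta> = vector_field f"
  have der: "\<theta> \<in> derivations" by (simp add: \<theta>_def vector_field_derivation)
  have \<theta>lin: "\<theta> (lin c) = - (const (c $ 0) * \<tau>) + const (c $ 1 - lam * c $ 0) * low P + const (c $ 2) * low Q" for c
    by (simp add: derivations_lin[OF der]) (simp add: \<theta>_def f_def sum_UNIV_3 const.hom algebra_simps)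
  have \<theta>forms: "\<theta> (lin c) \<in> forms (int k)" for c
    unfolding \<theta>lin by (intro forms_add forms_uminus forms_const_mult low \<tau>)
  have ev: "eval3 (\<theta> (lin c)) (y x z) = (c $ 1 - lam * c $ 0) * poly2 P x z + c $ 2 * poly2 Q x z
      - \<tau>v x z * (c $ 0 + (c $ 1 - lam * c $ 0) * x + c $ 2 * z)" for c x z
    by (simp add: \<theta>lin eval3.hom ev\<tau> evP evQ algebra_simps)
  have "lin (rep_proj2 r) dvd \<theta> (lin (rep_proj2 r))" if r: "r \<in> Z" for r
  proof -
    let ?c = "rep_proj2 r"
    have cne: "?c \<noteq> 0" using coords_nonzero[OF rep_proj2_in_coords] .
    \<comment> \<open>The factor \<open>lin l0\<close> disposes of the points at infinity. It is
      cancelled afterwards, as the line at infinity is not in the arrangement.\<close>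
    have "lin ?c dvd lin l0 * \<theta> (lin ?c)"
    proof (rule dvd_if_vanishes_on_plane[OF cne])
      fix t assume t: "dot ?c t = 0"
      show "eval3 (lin l0 * \<theta> (lin ?c)) t = 0"
      proof (cases "dot l0 t = 0")
        case False
        define x where "x = t $ 1 / dot l0 t"
        define z where "z = t $ 2 / dot l0 t"
        have ty: "t = dot l0 t *s y x z"
          using False by (simp add: vec_eq_iff all_3 y_def x_def z_def) (simp add: dot_3 l0_def field_simps)
        have "dot l0 t * dot ?c (y x z) = 0" using t by (subst (asm) ty) (simp add: dot_scale)
        then have "dot ?c (y x z) = 0" using False by simp
        then have "?c $ 0 + (?c $ 1 - lam * ?c $ 0) * x + ?c $ 2 * z = 0"
          by (simp add: dot_3 y_def algebra_simps)
        then have "eval3 (\<theta> (lin ?c)) (y x z) = 0" using rel[OF r] by (simp add: ev)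
        then have "eval3 (\<theta> (lin ?c)) t = 0" by (subst ty) (simp add: eval3_forms_scale[OF \<theta>forms])
        then show ?thesis by (simp add: eval3.mult)
      qed (simp add: eval3.mult)
    qed
    moreover have "\<not> lin ?c dvd lin l0"
    proof
      assume d: "lin ?c dvd lin l0"
      let ?k = "?c $ 1 - lam * ?c $ 0"
      show False
      proof (cases "?c $ 2 = 0")
        case False
        have "dot ?c (vec3 1 0 (- ?c $ 0 / ?c $ 2)) = 0" using False by (simp add: dot_3)
        from eval3_dvd_lin[OF d this] show False by (simp add: dot_3 l0_def)
      next
        case True
        then have k: "?k \<noteq> 0" using affine[OF r] by blast
        have "dot ?c (vec3 (- ?c $ 1) (?c $ 0) 0) = 0" by (simp add: dot_3)
        from eval3_dvd_lin[OF d this] show False using k by (simp add: dot_3 l0_def algebra_simps)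
      qed
    qed
    ultimately show ?thesis using lin_dvd_mult_iff[OF cne] by blast
  qed
  then have "\<theta> \<in> D_module (arrangement Z)" using D_module_iff_rep[OF der] by blast
  moreover have "\<forall>l\<in>forms 1. \<theta> l \<in> forms (int k)" using forms_1_conv_lin \<theta>forms by blast
  moreover have "\<not> (\<exists>g. \<theta> = (\<lambda>f. g * euler_derivation f))"
  proof
    assume "\<exists>g. \<theta> = (\<lambda>f. g * euler_derivation f)"
    then have 0: "eval3 (\<theta> (lin c)) t = 0" if "dot c t = 0" for c t
      using euler_multiple_iff[OF der] that by blast
    have "poly2 P x z = 0" for x z
    proof -
      have "dot (vec3 (- x) (1 - lam * x) 0) (y x z) = 0" by (simp add: dot_3 y_def algebra_simps)
      from 0[OF this] show ?thesis by (simp add: ev algebra_simps)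
    qed
    moreover have "poly2 Q x z = 0" for x z
    proof -
      have "dot (vec3 (- z) (- lam * z) 1) (y x z) = 0" by (simp add: dot_3 y_def algebra_simps)
      from 0[OF this] show ?thesis by (simp add: ev algebra_simps)
    qed
    ultimately show False using PQ poly2_eq_0_iff by blast
  qed
  ultimately show ?thesis by (rule that)
qed

section \<open>The splitting type and generators\<close>

lemma for_general_True: "for_general (\<lambda>p. True)"
  using openin_zariski_nonvanishing[OF forms_1] nonvanishing_nonempty_iff[OF forms_1]
  unfolding for_general_def by (intro exI[of _ "nonvanishing 1"]) simp

lemma general_splitting:
  assumes "finite Z" "splitting_type (D0_module (arrangement Z)) a1 a2" "for_general P"
  obtains lam F d where "F \<in> forms d" "F \<noteq> 0" "var 2 dvd F"
    "\<And>\<alpha> \<beta>. eval3 F (line_chart.q lam \<alpha> \<beta>) \<noteq> 0 \<Longrightarrow> good_line lam \<alpha> \<beta> Z \<and> P (abs_proj2 (line_chart.q lam \<alpha> \<beta>)) \<and>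
      (\<forall>k. \<exists>\<Psi>. linear_iso \<Psi> (good_line.E lam \<alpha> \<beta> Z k) (bdspace (int k - a1) (int k - a2)))"
    "\<And>p. p \<in> Z \<Longrightarrow> rep_proj2 p $ 1 - lam * rep_proj2 p $ 0 \<noteq> 0 \<or> rep_proj2 p $ 2 \<noteq> 0"
proof -
  let ?iso = "\<lambda>p. sheaves_isomorphic (dual_line p) (restrict_to (dual_line p) (D0_module (arrangement Z)))
    (restrict_to (dual_line p) (direct_sum (twist (- a1) polynomial_module) (twist (- a2) polynomial_module)))"
  have "for_general ?iso" using assms(2) by (simp add: splitting_type_def Let_def)
  then have "for_general (\<lambda>p. P p \<and> ?iso p)" by (rule for_general_conj[OF assms(3)])
  then obtain lam F d where F: "F \<in> forms d" "F \<noteq> 0" "var 2 dvd F"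
    and gd: "\<And>\<alpha> \<beta>. eval3 F (line_chart.q lam \<alpha> \<beta>) \<noteq> 0 \<Longrightarrow> good_line lam \<alpha> \<beta> Z \<and>
      P (abs_proj2 (line_chart.q lam \<alpha> \<beta>)) \<and> ?iso (abs_proj2 (line_chart.q lam \<alpha> \<beta>))"
    and affine: "\<And>p. p \<in> Z \<Longrightarrow> rep_proj2 p $ 1 - lam * rep_proj2 p $ 0 \<noteq> 0 \<or> rep_proj2 p $ 2 \<noteq> 0"
    by (rule general_good_line[OF assms(1)]) blast
  show ?thesis
  proof (rule that[OF F _ affine])
    fix \<alpha> \<beta> assume *: "eval3 F (line_chart.q lam \<alpha> \<beta>) \<noteq> 0"
    interpret good_line lam \<alpha> \<beta> Z using gd[OF *] by blast
    have "\<exists>\<Psi>. linear_iso \<Psi> (E k) (bdspace (int k - a1) (int k - a2))" for k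
      by (rule ex_linear_iso) (use gd[OF *] in \<open>simp add: L_def\<close>)
    then show "good_line lam \<alpha> \<beta> Z \<and> P (abs_proj2 q) \<and>
        (\<forall>k. \<exists>\<Psi>. linear_iso \<Psi> (E k) (bdspace (int k - a1) (int k - a2)))"
      using gd[OF *] by blast
  qed
qed

lemma gap_if_admits_unexpected_curves:
  assumes "finite Z" "splitting_type (D0_module (arrangement Z)) a1 a2" "admits_unexpected_curves Z d"
  shows "a2 - a1 \<ge> 2"
proof -
  let ?J = "\<lambda>Q. ideal_power (vanishing_ideal {Q}) (d - 1)"
  have d: "d \<ge> 1" and un: "for_general (\<lambda>Q. int (dim_degree (vanishing_ideal Z \<inter> ?J Q) d)
      > max 0 (int (dim_degree (vanishing_ideal Z) d) - int (dim_degree_quotient (?J Q) d)))"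
    using assms(3) unfolding admits_unexpected_curves_def Let_def by blast+
  have a: "0 \<le> a1" "a1 \<le> a2" using assms(2) by (simp_all add: splitting_type_def)
  obtain lam F D where F: "F \<in> forms D" "F \<noteq> 0" "var 2 dvd F"
    and gd: "\<And>\<alpha> \<beta>. eval3 F (line_chart.q lam \<alpha> \<beta>) \<noteq> 0 \<Longrightarrow> good_line lam \<alpha> \<beta> Z \<and>
      int (dim_degree (vanishing_ideal Z \<inter> ?J (abs_proj2 (line_chart.q lam \<alpha> \<beta>))) d)
        > max 0 (int (dim_degree (vanishing_ideal Z) d) - int (dim_degree_quotient (?J (abs_proj2 (line_chart.q lam \<alpha> \<beta>))) d)) \<and>
      (\<forall>k. \<exists>\<Psi>. linear_iso \<Psi> (good_line.E lam \<alpha> \<beta> Z k) (bdspace (int k - a1) (int k - a2)))"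
    by (rule general_splitting[OF assms(1,2) un]) blast
  obtain \<alpha> \<beta> where "eval3 F (line_chart.q lam \<alpha> \<beta>) \<noteq> 0" by (rule ex_chart_point[OF F])
  from gd[OF this] show ?thesis using good_line.gap_if_unexpected[OF _ _ a d] by blast
qed

text \<open>For k < a1 both degree bounds on the split side are negative, so \<open>E k\<close> is
  zero and \<theta> agrees on \<open>L\<close> with a multiple of the Euler derivation.\<close>

lemma (in good_line) vanishes_on_line_if_low_degree:
  assumes iso: "linear_iso \<Psi> (E k) (bdspace (int k - a1) (int k - a2))" and k: "int k < a1" "a1 \<le> a2"
    and \<theta>: "\<theta> \<in> piece D0L (int k)" and y: "dot q y = 0" "dot x y = 0"
  shows "eval3 (\<theta> (lin x)) y = 0"
proof -
  interpret A: line_sheaf lam \<alpha> \<beta> D0L evD 1 0 Lat by (rule line_sheaf_D0L)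
  have "evD \<theta> \<in> E k" using A.ev_bd[OF \<theta>] \<theta> evD_Lat by (simp add: E_def bdspace_def D0L_simps)
  moreover have "bdspace (int k - a1) (int k - a2) \<subseteq> {0}" using k by (auto simp: bdspace_def bd_def zero_prod_def)
  then have "\<Psi> (evD \<theta>) = 0" using iso calculation by (auto simp: linear_iso_def bij_betw_def)
  ultimately have "evD \<theta> = 0" using linear_iso_zero[OF iso pair.subspace_0[OF E_subspace]] by blast
  then obtain g \<zeta> where "\<theta> = (\<lambda>f. g * euler_derivation f) + (\<lambda>f. lin q * \<zeta> f)" by (rule evD_eq_0_imp[OF \<theta>])
  then show ?thesis using y by (simp add: euler_lin eval3.hom)
qed

text \<open>Every vector is some \<open>cross y a\<close>. For fixed \<open>a\<close>, the value of
  \<open>f\<close> there is a polynomial in \<open>y\<close>. It vanishes wherever \<open>F\<close>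
  does not, because \<open>cross y a\<close> lies on the line of \<open>y\<close>; hence it is
  zero.\<close>

lemma eq_0_if_vanishes_on_general_lines:
  assumes F: "F \<noteq> 0" "var 2 dvd F"
    and van: "\<And>\<alpha> \<beta> y. eval3 F (line_chart.q lam \<alpha> \<beta>) \<noteq> 0 \<Longrightarrow> dot (line_chart.q lam \<alpha> \<beta>) y = 0 \<Longrightarrow> eval3 f y = 0"
    and Fd: "F \<in> forms d"
  shows "f = 0"
proof (rule poly3_eq_0I)
  have cr: "eval3 f (cross y a) = 0" for y a
  proof -
    define h where "h = subst3 const (\<lambda>i. lin (cross a (axis i 1))) f"
    have h: "eval3 h y = eval3 f (cross y a)" for y
      unfolding h_def
    proof (rule ring_homomorphism_ext[where g = "\<lambda>f. eval3 (subst3 const (\<lambda>i. lin (cross a (axis i 1))) f) y"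
          and h = "\<lambda>f. eval3 f (cross y a)"])
      show "ring_homomorphism (\<lambda>f. eval3 (subst3 const (\<lambda>i. lin (cross a (axis i 1))) f) y)"
        by (rule ring_homomorphism_comp[OF _ ring_homomorphism_subst3[OF ring_homomorphism_const]]) unfold_locales
      show "eval3 (subst3 const (\<lambda>i. lin (cross a (axis i 1))) (const c)) y = eval3 (const c) (cross y a)" for c
        by (simp add: subst3_const ring_homomorphism_const)
      show "eval3 (subst3 const (\<lambda>i. lin (cross a (axis i 1))) (var i)) y = eval3 (var i) (cross y a)" for i
        by (rule_tac i=i in cases_3) (simp_all add: subst3_var ring_homomorphism_const dot_3 cross_def axis_def)
    qed unfold_locales
    have "F * h = 0"
    proof (rule poly3_eq_0I)
      fix y
      show "eval3 (F * h) y = 0"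
      proof (cases "eval3 F y = 0")
        case False
        then obtain \<alpha> \<beta> where *: "eval3 F (line_chart.q lam \<alpha> \<beta>) \<noteq> 0" "y = y $ 2 *s line_chart.q lam \<alpha> \<beta>" "y $ 2 \<noteq> 0"
          using chart_point[OF Fd _ F(2)] by blast
        have "y $ 2 * dot (line_chart.q lam \<alpha> \<beta>) (cross y a) = 0"
          using dot_cross[of y a] *(2) by (metis dot_scale_left)
        then have "dot (line_chart.q lam \<alpha> \<beta>) (cross y a) = 0" using *(3) by simp
        then have "eval3 f (cross y a) = 0" using van *(1) by blast
        then show ?thesis by (simp add: eval3.mult h)
      qed (simp add: eval3.mult)
    qed
    then have "h = 0" using F by simp
    then show ?thesis using h[of y] by (simp add: eval3.zero)
  qed
  fix t :: "complex ^ 3"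
  obtain x where x: "x \<noteq> 0" "dot t x = 0" using ex_plane_vector by blast
  then obtain a where "cross x a = t" using ex_cross[of x t] by (auto simp: dot_commute)
  then show "eval3 f t = 0" using cr by blast
qed

text \<open>In nonnegative degree the Koszul relations of \<theta> vanish on every general line,
  hence identically; in negative degree \<theta> kills all variables.\<close>

lemma low_degree_in_rels:
  assumes "finite Z" "splitting_type (D0_module (arrangement Z)) a1 a2"
    and \<theta>: "\<theta> \<in> piece (D0_module (arrangement Z)) d" and d: "d < a1"
  shows "\<theta> \<in> rels (D0_module (arrangement Z))"
proof -
  have a: "a1 \<le> a2" using assms(2) by (simp add: splitting_type_def)
  have der: "\<theta> \<in> derivations" using \<theta> by (simp add: D0_module_def D_module_def)
  have "for_general (\<lambda>p. True)" by (rule for_general_True)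
  then obtain lam F D where F: "F \<in> forms D" "F \<noteq> 0" "var 2 dvd F"
    and gd: "\<And>\<alpha> \<beta>. eval3 F (line_chart.q lam \<alpha> \<beta>) \<noteq> 0 \<Longrightarrow> good_line lam \<alpha> \<beta> Z \<and>
      (\<forall>k. \<exists>\<Psi>. linear_iso \<Psi> (good_line.E lam \<alpha> \<beta> Z k) (bdspace (int k - a1) (int k - a2)))"
    by (rule general_splitting[OF assms(1,2)]) blast
  have "var i * \<theta> (var j) = var j * \<theta> (var i)" for i j
  proof (cases "d < 0")
    case True
    then have "\<theta> (var i) = 0" for i using \<theta> forms_neg forms_var by (auto simp: D0_module_def)
    then show ?thesis by simp
  next
    case False
    have "var i * \<theta> (var j) - var j * \<theta> (var i) = 0"
    proof (rule eq_0_if_vanishes_on_general_lines[OF F(2,3) _ F(1)])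
      fix \<alpha> \<beta> y assume *: "eval3 F (line_chart.q lam \<alpha> \<beta>) \<noteq> 0" and y: "dot (line_chart.q lam \<alpha> \<beta>) y = 0"
      interpret good_line lam \<alpha> \<beta> Z using gd[OF *] by blast
      obtain \<Psi> where \<Psi>: "linear_iso \<Psi> (E (nat d)) (bdspace (int (nat d) - a1) (int (nat d) - a2))" using gd[OF *] by blast
      have "\<theta> \<in> piece D0L (int (nat d))" using \<theta> False by (simp add: D0L_simps D0_module_def)
      moreover have "dot (y $ i *s axis j 1 - y $ j *s axis i 1) y = 0" by (simp add: dot_simps)
      ultimately have "eval3 (\<theta> (lin (y $ i *s axis j 1 - y $ j *s axis i 1))) y = 0"
        using vanishes_on_line_if_low_degree[OF \<Psi> _ a] y d False by simp
      then show "eval3 (var i * \<theta> (var j) - var j * \<theta> (var i)) y = 0" by (simp only: derivations_swap[OF der])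
    qed
    then show ?thesis by simp
  qed
  then have "\<exists>g. \<theta> = (\<lambda>f. g * euler_derivation f)" by (rule euler_multiple_if[OF der])
  then show ?thesis by (auto simp: D0_module_def)
qed

lemma ex_minimal_derivation:
  assumes "finite Z" "splitting_type (D0_module (arrangement Z)) a1 a2" "a2 - a1 \<ge> 2"
  obtains \<theta> where "\<theta> \<in> piece (D0_module (arrangement Z)) a1" "\<theta> \<notin> rels (D0_module (arrangement Z))"
proof -
  have a: "0 \<le> a1" "a1 \<le> a2" using assms(2) by (simp_all add: splitting_type_def)
  define k where "k = nat a1"
  have k: "int k = a1" using a by (simp add: k_def)
  have "for_general (\<lambda>p. True)" by (rule for_general_True)
  then obtain lam F D where F: "F \<in> forms D" "F \<noteq> 0" "var 2 dvd F"
    and gd: "\<And>\<alpha> \<beta>. eval3 F (line_chart.q lam \<alpha> \<beta>) \<noteq> 0 \<Longrightarrow> good_line lam \<alpha> \<beta> Z \<and>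
      (\<forall>k. \<exists>\<Psi>. linear_iso \<Psi> (good_line.E lam \<alpha> \<beta> Z k) (bdspace (int k - a1) (int k - a2)))"
    and affine: "\<And>p. p \<in> Z \<Longrightarrow> rep_proj2 p $ 1 - lam * rep_proj2 p $ 0 \<noteq> 0 \<or> rep_proj2 p $ 2 \<noteq> 0"
    by (rule general_splitting[OF assms(1,2)]) blast
  obtain \<alpha> \<beta> where ab: "eval3 F (line_chart.q lam \<alpha> \<beta>) \<noteq> 0" by (rule ex_chart_point[OF F])
  have "int (card Z) = a1 + a2 + 1" by (rule good_line.card_Z[OF _ _ a]) (use gd[OF ab] in auto)
  \<comment> \<open>Here the gap enters: |Z| = a1 + a2 + 1 is at least 2 a1 + 3.\<close>
  then have many: "card Z > 2 * k + 2" using assms(3) k by linarith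
  let ?\<Phi> = "chart_poly lam F"
  have \<Phi>: "?\<Phi> \<noteq> 0" using ab poly2_chart_poly[of lam F \<alpha> \<beta>] by auto
  have good: "good_line lam \<alpha> \<beta> Z \<and> (\<exists>X\<in>good_line.E lam \<alpha> \<beta> Z k. X \<noteq> 0)" if \<Phi>: "poly2 ?\<Phi> \<alpha> \<beta> \<noteq> 0" for \<alpha> \<beta>
  proof -
    have *: "eval3 F (line_chart.q lam \<alpha> \<beta>) \<noteq> 0" using \<Phi> by (simp add: poly2_chart_poly)
    interpret good_line lam \<alpha> \<beta> Z using gd[OF *] by blast
    obtain \<Psi> where \<Psi>: "linear_iso \<Psi> (E k) (bdspace (int k - a1) (int k - a2))" using gd[OF *] by blast
    \<comment> \<open>Since \<open>int k = a1\<close>, constants are allowed in the first component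
      of the split side; the preimage is a nonzero section.\<close>
    have "([:1:], 0) \<in> bdspace (int k - a1) (int k - a2)" by (simp add: bdspace_def bd_def k)
    moreover have "\<Psi> ` E k = bdspace (int k - a1) (int k - a2)" using \<Psi> by (simp add: linear_iso_def bij_betw_def)
    ultimately obtain X where X: "X \<in> E k" "\<Psi> X = ([:1:], 0)" by (metis imageE)
    then have "X \<noteq> 0" using linear_iso_zero[OF \<Psi> pair.subspace_0[OF E_subspace] X(1)] by (simp add: zero_prod_def)
    then show ?thesis using X(1) good_line_axioms by blast
  qed
  obtain p g where pg: "pencil lam Z k p g" "(\<exists>j\<le>k + 1. p j \<noteq> 0) \<or> (\<exists>j\<le>k. g j \<noteq> 0)"
    by (rule ex_pencil[OF assms(1) affine many \<Phi> good])
  interpret pencil lam Z k p g by (rule pg)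
  obtain P Q where PQ: "P \<noteq> 0 \<or> Q \<noteq> 0"
    "\<And>r x z. r \<in> Z \<Longrightarrow> k0 r + k1 r * x + k2 r * z = 0 \<Longrightarrow> k1 r * poly2 P x z + k2 r * poly2 Q x z = 0"
    "total_degree_le (k + 1) P" "total_degree_le (k + 1) Q"
    "top_part (k + 1) Q = [:0, 1:] * top_part (k + 1) P"
    by (rule ex_plane_field[OF \<Phi> _ pg(2)]) (use good in blast)+
  obtain \<theta> where "\<theta> \<in> D_module (arrangement Z)" "\<forall>l\<in>forms 1. \<theta> l \<in> forms (int k)"
    "\<not> (\<exists>g. \<theta> = (\<lambda>f. g * euler_derivation f))"
    by (rule ex_derivation_of_plane_field[OF affine PQ(1) PQ(2)[unfolded k0_def k1_def k2_def] PQ(3-5)])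
  then show ?thesis using that[of \<theta>] k by (simp add: D0_module_def)
qed

text \<open>The relations form a submodule that contains all pieces of degree below
  \<open>a1\<close>, so an element of degree \<open>a1\<close> outside the relations is not
  generated from smaller degrees.\<close>

lemma generator_in_degree_if_gap:
  assumes "finite Z" "splitting_type (D0_module (arrangement Z)) a1 a2" "a2 - a1 \<ge> 2"
  shows "has_generator_in_degree (D0_module (arrangement Z)) a1"
proof -
  let ?M = "D0_module (arrangement Z)"
  have scale: "scale ?M = (\<lambda>g \<theta> f. g * \<theta> f)" by (simp add: D0_module_def)
  have "to_m_gg.m1.subspace (rels ?M)"
  proof (rule to_m_gg.m1.subspaceI)
    show "0 \<in> rels ?M" by (auto simp: D0_module_def fun_eq_iff intro!: exI[of _ 0])
    fix \<theta> \<eta> c assume "\<theta> \<in> rels ?M" "\<eta> \<in> rels ?M"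
    then obtain g h where gh: "\<theta> = (\<lambda>f. g * euler_derivation f)" "\<eta> = (\<lambda>f. h * euler_derivation f)"
      by (auto simp: D0_module_def)
    have "\<theta> + \<eta> = (\<lambda>f. (g + h) * euler_derivation f)" by (simp add: gh fun_eq_iff distrib_right)
    then show "\<theta> + \<eta> \<in> rels ?M" unfolding D0_module_def by auto
    have "(\<lambda>f. c * \<theta> f) = (\<lambda>f. (c * g) * euler_derivation f)" by (simp only: gh mult.assoc)
    then show "(\<lambda>f. c * \<theta> f) \<in> rels ?M" unfolding D0_module_def by auto
  qed
  then have "to_m_gg.m1.span (rels ?M \<union> (\<Union>e\<in>{..<a1}. piece ?M e)) \<subseteq> rels ?M"
    using low_degree_in_rels[OF assms(1,2)] by (intro to_m_gg.m1.span_minimal) auto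
  moreover obtain \<theta> where "\<theta> \<in> piece ?M a1" "\<theta> \<notin> rels ?M" by (rule ex_minimal_derivation[OF assms])
  ultimately show ?thesis unfolding has_generator_in_degree_def scale by blast
qed

theorem theorem6p8:
  fixes Z :: "proj2 set" and a\<^sub>1 a\<^sub>2 :: int
  assumes "finite Z" and "Z \<noteq> {}"
    and "splitting_type (D0_module (arrangement Z)) a\<^sub>1 a\<^sub>2"
  shows "((\<exists>d. admits_unexpected_curves Z d) \<longrightarrow> a\<^sub>2 - a\<^sub>1 \<ge> 2) \<and>
    (a\<^sub>2 - a\<^sub>1 \<ge> 2 \<longrightarrow> has_generator_in_degree (D0_module (arrangement Z)) a\<^sub>1) \<and>
    (has_generator_in_degree (D0_module (arrangement Z)) a\<^sub>1 \<longleftrightarrow>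
       has_generator_in_degree (I_gg_module Z) (a\<^sub>1 + 1))"
  using gap_if_admits_unexpected_curves[OF assms(1,3)] generator_in_degree_if_gap[OF assms(1,3)]
    has_generator_D0_iff_I_gg[of Z a\<^sub>1] by blast

end
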